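(* $$\lim_{n\to\infty}\frac{f^{(3)}(n;10,8)}{n^2}\ \ge\ \frac{3}{16}.$$
   Context: $f^{(3)}(n;10,8)$ denotes the maximum number of edges in an $n$-vertex $3$-uniform hypergraph (each edge a $3$-element subset of the vertex set) that contains no $8$ edges whose union has at most $10$ vertices. It is known (from prior work) that the limit $\lim_{n\to\infty}n^{-2}f^{(3)}(n;10,8)$ exists. *)

theory Defs
  imports Complex_Main "HOL-Library.Ramsey"
begin

text \<open>A hypergraph is given by its edge set; \<open>nsets V r\<close> (written \<open>[V]\<^bsup>r\<^esup>\<close>) is the complete
  \<open>r\<close>-uniform hypergraph on \<open>V\<close>.\<close>

definition contains_config :: "'a set set \<Rightarrow> nat \<Rightarrow> nat \<Rightarrow> bool" where
  "contains_config E s k \<longleftrightarrow> (\<exists>F \<subseteq> E. finite F \<and> card F = k \<and> card (\<Union>F) \<le> s)"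

text \<open>The Brown--Erdos--Sos function \<open>f\<^sup>(\<^sup>r\<^sup>)(n;s,k)\<close>. Up to isomorphism the vertex set of an
  \<open>n\<close>-vertex hypergraph is \<open>{..<n}\<close>, see \<open>card_le_bes\<close> and \<open>bes_attained\<close> below.\<close>

definition bes :: "nat \<Rightarrow> nat \<Rightarrow> nat \<Rightarrow> nat \<Rightarrow> nat" where
  "bes r n s k = Max {card E | E. E \<subseteq> nsets {..<n} r \<and> \<not> contains_config E s k}"

lemma finite_bes_set:
  fixes n :: nat
  shows "finite {card E | E. E \<subseteq> nsets {..<n} r \<and> \<not> contains_config E s k}"
proof -
  have "finite (nsets {..<n} r)" by (simp add: finite_imp_finite_nsets)
  then have "finite (Pow (nsets {..<n} r))" by simp
  then have "finite (card ` Pow (nsets {..<n} r))" by (rule finite_imageI)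
  then show ?thesis by (rule rev_finite_subset) auto
qed

lemma bes_attained:
  assumes "k > 0"
  shows "\<exists>E \<subseteq> nsets {..<n} r. \<not> contains_config E s k \<and> card E = bes r n s k"
proof -
  have "\<not> contains_config ({} :: nat set set) s k"
    using assms by (auto simp: contains_config_def)
  then have "{card E | E. E \<subseteq> nsets {..<n} r \<and> \<not> contains_config E s k} \<noteq> {}"
    by blast
  from Max_in[OF finite_bes_set this]
  obtain E where "bes r n s k = card E" "E \<subseteq> nsets {..<n} r" "\<not> contains_config E s k"
    unfolding bes_def[symmetric] mem_Collect_eq by (elim exE conjE)
  then show ?thesis by (intro exI[of _ E]) simp
qed

lemma card_le_bes:
  assumes "finite V" "card V = n" "E \<subseteq> nsets V r" "\<not> contains_config E s k"
  shows "card E \<le> bes r n s k"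
proof -
  obtain h where h: "bij_betw h V {..<n}"
    using ex_bij_betw_finite_nat[OF assms(1)] assms(2) by (auto simp: lessThan_atLeast0)
  have inj: "inj_on h V" and im: "h ` V = {..<n}" using h by (auto simp: bij_betw_def)
  have sub: "e \<subseteq> V \<and> finite e \<and> card e = r" if "e \<in> E" for e
    using that assms(3) by (auto simp: nsets_def)
  have injE: "inj_on ((`) h) E"
  proof (rule inj_onI)
    fix a b assume "a \<in> E" "b \<in> E" "h ` a = h ` b"
    then show "a = b" using sub inj_on_image_eq_iff[OF inj, of a b] by simp
  qed
  have "(`) h ` E \<subseteq> nsets {..<n} r"
  proof
    fix e' assume "e' \<in> (`) h ` E"
    then obtain e where e: "e \<in> E" "e' = h ` e" by blast
    have "inj_on h e" using inj_on_subset[OF inj] sub[OF e(1)] by simp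
    moreover have "h ` e \<subseteq> {..<n}" using sub[OF e(1)] im by blast
    ultimately show "e' \<in> nsets {..<n} r"
      using sub[OF e(1)] e(2) by (simp add: nsets_def card_image)
  qed
  moreover have "\<not> contains_config ((`) h ` E) s k"
  proof
    assume "contains_config ((`) h ` E) s k"
    then obtain F where F: "F \<subseteq> E" "finite ((`) h ` F)" "card ((`) h ` F) = k"
      "card (\<Union> ((`) h ` F)) \<le> s"
      unfolding contains_config_def by (auto simp: subset_image_iff)
    have injF: "inj_on ((`) h) F" using injE F(1) by (rule inj_on_subset)
    have "\<Union>F \<subseteq> V" using F(1) sub by blast
    then have "card (h ` \<Union>F) = card (\<Union>F)" 
      by (intro card_image inj_on_subset[OF inj])
    moreover have "h ` \<Union>F = \<Union> ((`) h ` F)" by blast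
    ultimately have "contains_config E s k"
      unfolding contains_config_def
      using F finite_imageD[OF F(2) injF] card_image[OF injF] by (intro exI[of _ F]) simp
    with assms(4) show False by blast
  qed
  ultimately have "card ((`) h ` E) \<le> bes r n s k"
    unfolding bes_def by (intro Max_ge finite_bes_set) blast
  then show ?thesis using injE by (simp add: card_image)
qed

end

theory Submission
  imports Defs
begin

text \<open>Pack edge-disjoint copies (blocks) of a gadget into \<open>{..<n}\<close>. The gadget has \<open>3 * d ^ 2\<close> triples
  on a hub \<open>z\<close> and vertices \<open>a i\<close>, \<open>b j\<close>, \<open>x i j\<close>, \<open>y i j\<close>: the triples \<open>abx\<close>, \<open>aby\<close>, \<open>xyz\<close> for all \<open>i, j < d\<close>.
  Its \<open>8 * d ^ 2 + 2 * d\<close> essential pairs lie in no other block, so about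
  \<open>n ^ 2 / (2 * (8 * d ^ 2 + 2 * d))\<close> blocks fit, which gives the density
  \<open>3 * d ^ 2 / (2 * (8 * d ^ 2 + 2 * d))\<close>, and this tends to \<open>3 / 16\<close>.

  Inside a block, \<open>k \<le> 8\<close> triples span at least \<open>k + 2\<close> vertices, and at least 11 if \<open>k = 8\<close>. If the
  blocks moreover have high girth, namely any \<open>k \<le> 8\<close> of them span at least \<open>M * k + 2\<close> vertices
  (where \<open>M + 2\<close> is the size of a block), with equality only if two of them already share two
  vertices, then 8 triples on 10 vertices would force two blocks to share a pair spanned by at
  most four triples of one of them; such a pair is essential, a contradiction.

  The packing comes from a conflict-free random nibble. Vertex pairs are first coloured randomly
  black and white, and only blocks whose black pairs are exactly the essential ones are used; thus
  no essential pair of a block is a nonessential pair of another. In each round every available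
  block is selected with a small probability, and every pair and every block survives the round
  with exactly the same conditional probability, because a coin compensates for the varying number
  of selections that would destroy it.\<close>

section \<open>Weighted random subsets\<close>

text \<open>The gadget: a single cell, three triples on five vertices, needs all its 10 pairs for
  itself, which alone would give only \<open>3 / 20\<close>; joining \<open>d ^ 2\<close> cells
  along the pairs of \<open>z\<close> with \<open>a i\<close> and with \<open>b j\<close> lowers the
  price of a cell to \<open>8 + 2 / d\<close> pairs. A block then has of order \<open>d ^ 4\<close>
  other pairs, so blocks must be allowed to share these; white gets the small probability
  \<epsilon>, so that nearly all pairs stay usable as essential ones. The obstacle: sets of several
  blocks on exactly \<open>M * k + 2\<close> vertices can occur about as often as there are blocks
  in the packing, so deleting them afterwards is too expensive and the process must avoid them. Sets
  with fewer vertices are rarer by a factor of order \<open>1 / n\<close> and can be deleted. The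
  same factor controls dependence: a block that threatens two objects of a configuration at once
  creates a set with too few vertices. Since survival probabilities are exact, the process is
  analysed by means alone: a high moment for points and a potential function for blocks replace
  concentration.\<close>

definition bern :: "'a set \<Rightarrow> ('a \<Rightarrow> real) \<Rightarrow> ('a set \<Rightarrow> real) \<Rightarrow> real" where
  "bern I r f = (\<Sum>X\<in>Pow I. (\<Prod>i\<in>X. r i) * (\<Prod>i\<in>I - X. 1 - r i) * f X)"

lemma bern_weight_nonneg:
  assumes "\<And>i. i \<in> I \<Longrightarrow> 0 \<le> r i \<and> r i \<le> 1" "X \<in> Pow I"
  shows "0 \<le> (\<Prod>i\<in>X. r i) * (\<Prod>i\<in>I - X. 1 - r i :: real)"
  by (intro mult_nonneg_nonneg prod_nonneg) (use assms in auto)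

lemma bern_mono:
  assumes "\<And>i. i \<in> I \<Longrightarrow> 0 \<le> r i \<and> r i \<le> 1" "\<And>X. X \<subseteq> I \<Longrightarrow> f X \<le> g X"
  shows "bern I r f \<le> bern I r g"
  unfolding bern_def
  by (intro sum_mono mult_left_mono bern_weight_nonneg) (use assms in auto)

lemma bern_cong:
  assumes "\<And>X. X \<subseteq> I \<Longrightarrow> f X = g X"
  shows "bern I r f = bern I r g"
  unfolding bern_def by (intro sum.cong) (use assms in auto)

lemma bern_add: "bern I r (\<lambda>X. f X + g X) = bern I r f + bern I r g"
  unfolding bern_def by (simp add: sum.distrib algebra_simps)

lemma bern_cmult: "bern I r (\<lambda>X. c * f X) = c * bern I r f"
  unfolding bern_def by (simp add: sum_distrib_left algebra_simps)

lemma bern_sum: "bern I r (\<lambda>X. \<Sum>a\<in>A. f a X) = (\<Sum>a\<in>A. bern I r (f a))"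
proof -
  have "bern I r (\<lambda>X. \<Sum>a\<in>A. f a X)
      = (\<Sum>X\<in>Pow I. \<Sum>a\<in>A. (\<Prod>i\<in>X. r i) * (\<Prod>i\<in>I - X. 1 - r i) * f a X)"
    unfolding bern_def by (simp add: sum_distrib_left)
  also have "\<dots> = (\<Sum>a\<in>A. bern I r (f a))"
    unfolding bern_def by (rule sum.swap)
  finally show ?thesis .
qed

text \<open>\<open>bern I r f\<close> is the expectation of \<open>f\<close> at a random subset of
  \<open>I\<close> that contains each \<open>i\<close> independently with probability
  \<open>r i\<close>. Independence enters here: choosing one summand for every index expands the
  product into a sum over \<open>Pow I\<close>.\<close>

lemma bern_prod:
  assumes "finite I"
  shows "bern I r (\<lambda>X. (\<Prod>i\<in>X. a i) * (\<Prod>i\<in>I - X. b i)) = (\<Prod>i\<in>I. r i * a i + (1 - r i) * b i)"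
  unfolding bern_def prod_add[OF assms] by (simp only: prod.distrib mult_ac)

lemma bern_const:
  assumes "finite I"
  shows "bern I r (\<lambda>_. c) = c"
proof -
  have "bern I r (\<lambda>X. (\<Prod>i\<in>X. 1) * (\<Prod>i\<in>I - X. 1)) = 1"
    by (subst bern_prod[OF assms]) simp
  then have "bern I r (\<lambda>_. 1) = 1" by simp
  then show ?thesis using bern_cmult[of I r c "\<lambda>_. 1"] by simp
qed

lemma bern_prob:
  assumes I: "finite I" and S: "S1 \<subseteq> I" "S0 \<subseteq> I" "S1 \<inter> S0 = {}"
  shows "bern I r (\<lambda>X. of_bool (S1 \<subseteq> X \<and> X \<inter> S0 = {})) = (\<Prod>i\<in>S1. r i) * (\<Prod>i\<in>S0. 1 - r i)"
proof -
  have "bern I r (\<lambda>X. of_bool (S1 \<subseteq> X \<and> X \<inter> S0 = {}))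
      = bern I r (\<lambda>X. (\<Prod>i\<in>X. of_bool (i \<notin> S0)) * (\<Prod>i\<in>I - X. of_bool (i \<notin> S1)))"
  proof (rule bern_cong)
    fix X assume X: "X \<subseteq> I"
    then have fin: "finite X" "finite (I - X)" using I finite_subset by auto
    have "(\<Prod>i\<in>X. of_bool (i \<notin> S0) :: real) = of_bool (X \<inter> S0 = {})"
      using fin(1) by (auto simp: of_bool_def intro!: prod_zero prod.neutral)
    moreover have "(\<Prod>i\<in>I - X. of_bool (i \<notin> S1) :: real) = of_bool (S1 \<subseteq> X)"
      using fin(2) S(1) X by (auto simp: of_bool_def intro!: prod_zero prod.neutral)
    ultimately show "of_bool (S1 \<subseteq> X \<and> X \<inter> S0 = {}) =
      (\<Prod>i\<in>X. of_bool (i \<notin> S0)) * (\<Prod>i\<in>I - X. of_bool (i \<notin> S1) :: real)"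
      by (simp only: of_bool_conj mult.commute)
  qed
  also have "\<dots> = (\<Prod>i\<in>I. r i * of_bool (i \<notin> S0) + (1 - r i) * of_bool (i \<notin> S1))"
    by (rule bern_prod[OF I])
  also have "\<dots> = (\<Prod>i\<in>I. (if i \<in> S1 then r i else 1) * (if i \<in> S0 then 1 - r i else 1))"
    using S(3) by (intro prod.cong) auto
  also have "\<dots> = (\<Prod>i\<in>I. if i \<in> S1 then r i else 1) * (\<Prod>i\<in>I. if i \<in> S0 then 1 - r i else 1)"
    by (rule prod.distrib)
  also have "(\<Prod>i\<in>I. if i \<in> S1 then r i else 1) = (\<Prod>i\<in>S1. r i)"
    using prod.inter_restrict[OF I, of r S1] S(1) by (simp add: Int_absorb1)
  also have "(\<Prod>i\<in>I. if i \<in> S0 then 1 - r i else 1) = (\<Prod>i\<in>S0. 1 - r i)"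
    using prod.inter_restrict[OF I, of "\<lambda>i. 1 - r i" S0] S(2) by (simp add: Int_absorb1)
  finally show ?thesis .
qed

lemma bern_subset:
  assumes "finite I" "S \<subseteq> I"
  shows "bern I r (\<lambda>X. of_bool (S \<subseteq> X)) = (\<Prod>i\<in>S. r i)"
  using bern_prob[OF assms(1), of S "{}" r] assms(2) by simp

section \<open>The nibble process\<close>

text \<open>For a set \<open>S\<close> of blocks the excess of the number of covered vertices over \<open>M * card S\<close> plays the
  role of an Euler characteristic: \<open>card (\<Union>(V ` S)) - M * card S = 2\<close> is the generic value for
  a configuration occurring with constant density.
  Members of \<open>J e\<close> are the essential pairs (points) of the block \<open>e\<close>; a state consists of the set of
  living objects and of the history of selections, as pairs of a round and a block.\<close>

locale block_system =
  fixes B :: "'b set" and V :: "'b \<Rightarrow> 'v set" and J :: "'b \<Rightarrow> 'v set set" and M s :: nat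
  assumes finB: "finite B"
    and finV: "e \<in> B \<Longrightarrow> finite (V e)"
    and cardV: "e \<in> B \<Longrightarrow> card (V e) = M + 2"
    and subJ: "e \<in> B \<Longrightarrow> q \<in> J e \<Longrightarrow> q \<subseteq> V e"
    and card2J: "e \<in> B \<Longrightarrow> q \<in> J e \<Longrightarrow> card q = 2"
    and cardJ: "e \<in> B \<Longrightarrow> card (J e) = s"
    and s_pos: "0 < s" and M_pos: "0 < M"
begin

definition df :: "'b set \<Rightarrow> int" where
  "df S = int (card (\<Union>(V ` S))) - int M * int (card S)"

text \<open>Minimality is what makes submodularity usable: a proper part with at least two blocks
  has excess at least 3, so gluing along it loses excess. Pairs are left out on purpose: excess 2 of
  a pair means two common vertices, which is allowed as long as they form no essential pair. The
  bound 8 is there because 8 triples meet at most 8 blocks.\<close>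

definition conf :: "'b set set" where
  "conf = {c. c \<subseteq> B \<and> 3 \<le> card c \<and> card c \<le> 8 \<and> df c = 2 \<and>
     (\<forall>d. d \<subset> c \<longrightarrow> 2 \<le> card d \<longrightarrow> 3 \<le> df d)}"

definition objs :: "'b \<Rightarrow> ('v set + 'b) set" where
  "objs e = insert (Inr e) (Inl ` J e)"

definition Obj :: "('v set + 'b) set" where
  "Obj = (\<Union>e\<in>B. objs e)"

definition Av :: "('v set + 'b) set \<Rightarrow> 'b set" where
  "Av L = {e \<in> B. objs e \<subseteq> L}"

definition Tk :: "(nat \<times> 'b) set \<Rightarrow> 'b set" where
  "Tk H = snd ` H"

text \<open>A block also kills its own points, so a selected block uses up its points and cannot be
  selected again. A block \<open>g\<close> kills \<open>e\<close> when taking \<open>g\<close>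
  leaves \<open>e\<close> as the last missing member of a conflict. Only earlier rounds count as
  taken, so conflicts with two members selected in one round escape; \<open>extraction\<close>
  removes them.\<close>

fun killers :: "('v set + 'b) set \<times> (nat \<times> 'b) set \<Rightarrow> 'v set + 'b \<Rightarrow> 'b set" where
  "killers (L, H) (Inl q) = {g \<in> Av L. q \<in> J g}"
| "killers (L, H) (Inr e) =
     {g \<in> Av L. g \<noteq> e \<and> (\<exists>c\<in>conf. e \<in> c \<and> g \<in> c \<and> c - {e, g} \<subseteq> Tk H)}"

lemma finJ: "e \<in> B \<Longrightarrow> finite (J e)"
  using cardJ s_pos by (metis card.infinite less_nat_zero_code)

lemma finite_objs: "e \<in> B \<Longrightarrow> finite (objs e)"
  by (simp add: objs_def finJ)

lemma finite_Obj: "finite Obj"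
  unfolding Obj_def using finB finite_objs by auto

lemma Av_subset: "Av L \<subseteq> B"
  by (auto simp: Av_def)

lemma killers_subset: "killers \<omega> x \<subseteq> B"
  by (cases \<omega>; cases x) (use Av_subset in auto)

lemma objs_subset_Obj: "e \<in> B \<Longrightarrow> objs e \<subseteq> Obj"
  by (auto simp: Obj_def)

lemma Av_mono: "L \<subseteq> L' \<Longrightarrow> Av L \<subseteq> Av L'"
  by (auto simp: Av_def)

lemma confD:
  assumes "c \<in> conf"
  shows "c \<subseteq> B" "3 \<le> card c" "card c \<le> 8" "df c = 2" "finite c"
    "\<And>d. d \<subset> c \<Longrightarrow> 2 \<le> card d \<Longrightarrow> 3 \<le> df d"
  using assms finite_subset[OF _ finB] by (auto simp: conf_def)

lemma finite_VU: "S \<subseteq> B \<Longrightarrow> finite (\<Union>(V ` S))"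
  using finite_subset[OF _ finB] finV by auto

end

definition coin :: "real \<Rightarrow> real \<Rightarrow> nat \<Rightarrow> real" where
  "coin p x k = (if 1 - x \<le> (1 - p) ^ k then (1 - x) / (1 - p) ^ k else 0)"

lemma coin_bounds:
  assumes "p < 1" "x \<le> 1"
  shows "0 \<le> coin p x k" "coin p x k \<le> 1" "(1 - p) ^ k * coin p x k \<le> 1 - x"
  using assms by (auto simp: coin_def divide_simps)

lemma coin_exact:
  assumes "p < 1" "1 - x \<le> (1 - p) ^ k"
  shows "(1 - p) ^ k * coin p x k = 1 - x"
  using assms by (auto simp: coin_def)

text \<open>In round \<open>i\<close> every block is selected with probability \<open>p i\<close>. An object (a point, that is a pair
  of vertices, or a block) dies if one of its killers is selected or if its coin fails. The
  coin makes the survival probability exactly \<open>1 - \<rho>\<close> for points and \<open>1 - \<kappa>\<close> for blocks; an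
  exceptional object, which already has too many killers, dies at once.\<close>

locale nibble_process = block_system B V J M s
  for B :: "'b set" and V :: "'b \<Rightarrow> 'v set" and J M s +
  fixes p :: "nat \<Rightarrow> real" and \<rho> \<kappa> :: real
  assumes p01: "0 < p i" "p i < 1"
    and \<rho>01: "0 \<le> \<rho>" "\<rho> < 1" and \<kappa>01: "0 \<le> \<kappa>" "\<kappa> < 1"
begin

definition nom :: "'v set + 'b \<Rightarrow> real" where
  "nom x = (case x of Inl _ \<Rightarrow> \<rho> | Inr _ \<Rightarrow> \<kappa>)"

lemma nom01: "0 \<le> nom x" "nom x < 1"
  using \<rho>01 \<kappa>01 by (auto simp: nom_def split: sum.splits)

definition surv :: "('v set + 'b) set \<times> (nat \<times> 'b) set \<Rightarrow> 'b set \<Rightarrow> ('v set + 'b) set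
    \<Rightarrow> ('v set + 'b) set" where
  "surv \<omega> Sel C = {x \<in> fst \<omega>. x \<in> C \<and> Sel \<inter> killers \<omega> x = {}}"

definition nxt :: "nat \<Rightarrow> ('v set + 'b) set \<times> (nat \<times> 'b) set \<Rightarrow> 'b set \<Rightarrow> ('v set + 'b) set
    \<Rightarrow> ('v set + 'b) set \<times> (nat \<times> 'b) set" where
  "nxt i \<omega> Sel C = (surv \<omega> Sel C, snd \<omega> \<union> {i} \<times> (Sel \<inter> Av (fst \<omega>)))"

definition rnd :: "nat \<Rightarrow> ('v set + 'b) set \<times> (nat \<times> 'b) set
    \<Rightarrow> ('b set \<Rightarrow> ('v set + 'b) set \<Rightarrow> real) \<Rightarrow> real" where
  "rnd i \<omega> F = bern B (\<lambda>_. p i)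
     (\<lambda>Sel. bern Obj (\<lambda>x. coin (p i) (nom x) (card (killers \<omega> x))) (\<lambda>C. F Sel C))"

text \<open>The tower property is built in: the last round is averaged first, given the state after
  \<open>i\<close> rounds. Estimates over several rounds thus become inductions over conditional
  bounds for \<open>rnd\<close>.\<close>

fun EE :: "nat \<Rightarrow> (('v set + 'b) set \<times> (nat \<times> 'b) set \<Rightarrow> real) \<Rightarrow> real" where
  "EE 0 f = f (Obj, {})"
| "EE (Suc i) f = EE i (\<lambda>\<omega>. rnd i \<omega> (\<lambda>Sel C. f (nxt i \<omega> Sel C)))"

lemma coin01: "0 \<le> coin (p i) (nom x) k \<and> coin (p i) (nom x) k \<le> 1"
  using coin_bounds[of "p i" "nom x" k] p01[of i] nom01[of x] by auto

lemma rnd_mono: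
  assumes "\<And>Sel C. Sel \<subseteq> B \<Longrightarrow> C \<subseteq> Obj \<Longrightarrow> F Sel C \<le> G Sel C"
  shows "rnd i \<omega> F \<le> rnd i \<omega> G"
  unfolding rnd_def using p01[of i] coin01 by (intro bern_mono assms) (auto simp: less_imp_le)

lemma rnd_const: "rnd i \<omega> (\<lambda>_ _. c) = c"
  unfolding rnd_def by (simp add: bern_const finB finite_Obj)

lemma rnd_add: "rnd i \<omega> (\<lambda>Sel C. F Sel C + G Sel C) = rnd i \<omega> F + rnd i \<omega> G"
  unfolding rnd_def by (simp add: bern_add)

lemma rnd_cmult: "rnd i \<omega> (\<lambda>Sel C. c * F Sel C) = c * rnd i \<omega> F"
  unfolding rnd_def by (simp add: bern_cmult)

lemma rnd_sum: "rnd i \<omega> (\<lambda>Sel C. \<Sum>a\<in>A. F a Sel C) = (\<Sum>a\<in>A. rnd i \<omega> (F a))"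
  unfolding rnd_def by (simp add: bern_sum)

lemma EE_add: "EE i (\<lambda>\<omega>. f \<omega> + g \<omega>) = EE i f + EE i g"
  by (induction i arbitrary: f g) (simp_all add: rnd_add)

lemma EE_cmult: "EE i (\<lambda>\<omega>. c * f \<omega>) = c * EE i f"
  by (induction i arbitrary: f) (simp_all add: rnd_cmult)

lemma EE_diff: "EE i (\<lambda>\<omega>. f \<omega> - g \<omega>) = EE i f - EE i g"
  using EE_add[of i f "\<lambda>\<omega>. (-1) * g \<omega>"] EE_cmult[of i "-1" g] by simp

lemma EE_sum: "EE i (\<lambda>\<omega>. \<Sum>a\<in>A. f a \<omega>) = (\<Sum>a\<in>A. EE i (f a))"
  by (induction i arbitrary: f) (simp_all add: rnd_sum)

lemma EE_const: "EE i (\<lambda>_. c) = c"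
  by (induction i) (simp_all add: rnd_const)

text \<open>The last clause records the effect of conflict killing: when \<open>g\<close> completes
  all of \<open>c\<close> except \<open>e\<close>, the block \<open>e\<close> dies in the same
  round. The strict \<open>r' < r\<close> mirrors that \<open>killers\<close> sees only the history
  before the round.\<close>

definition inv :: "nat \<Rightarrow> ('v set + 'b) set \<times> (nat \<times> 'b) set \<Rightarrow> bool" where
  "inv i \<omega> \<longleftrightarrow> fst \<omega> \<subseteq> Obj \<and> snd \<omega> \<subseteq> {..<i} \<times> B
     \<and> (\<forall>(r, e)\<in>snd \<omega>. \<forall>q\<in>J e. Inl q \<notin> fst \<omega>)
     \<and> (\<forall>(r, e)\<in>snd \<omega>. \<forall>(r', f)\<in>snd \<omega>. r \<noteq> r' \<longrightarrow> J e \<inter> J f = {})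
     \<and> (\<forall>c\<in>conf. \<forall>e\<in>c. \<forall>(r, g)\<in>snd \<omega>. g \<in> c \<longrightarrow> g \<noteq> e \<longrightarrow>
          (\<forall>f\<in>c - {e, g}. \<exists>r'<r. (r', f) \<in> snd \<omega>) \<longrightarrow>
          Inr e \<notin> fst \<omega> \<and> (\<forall>r'>r. (r', e) \<notin> snd \<omega>))"

lemma inv_init: "inv 0 (Obj, {})"
  by (simp add: inv_def)

lemma inv_step:
  assumes inv: "inv i (L, H)" and "Sel \<subseteq> B" "C \<subseteq> Obj"
  shows "inv (Suc i) (nxt i (L, H) Sel C)"
proof -
  define N where "N = Sel \<inter> Av L"
  define L' where "L' = surv (L, H) Sel C"
  define H' where "H' = H \<union> {i} \<times> N"
  have eq: "nxt i (L, H) Sel C = (L', H')"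
    by (simp add: nxt_def N_def L'_def H'_def)
  have L'L: "L' \<subseteq> L" by (auto simp: L'_def surv_def)
  have LO: "L \<subseteq> Obj"
    using inv unfolding inv_def fst_conv snd_conv by (elim conjE)
  have HB: "H \<subseteq> {..<i} \<times> B"
    using inv unfolding inv_def fst_conv snd_conv by (elim conjE)
  have NB: "N \<subseteq> B" using assms by (auto simp: N_def)
  have old: "Inl q \<notin> L" if "(r, e) \<in> H" "q \<in> J e" for r e q
  proof -
    have "\<forall>(r, e)\<in>H. \<forall>q\<in>J e. Inl q \<notin> L"
      using inv unfolding inv_def fst_conv snd_conv by (elim conjE)
    then show ?thesis using that by blast
  qed
  have new: "Inl q \<notin> L'" if "e \<in> N" "q \<in> J e" for e q
    using that by (auto simp: L'_def surv_def N_def)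
  have NL: "Inl q \<in> L" if "e \<in> N" "q \<in> J e" for e q
    using that by (auto simp: N_def Av_def objs_def)
  have NL2: "Inr e \<in> L" if "e \<in> N" for e
    using that by (auto simp: N_def Av_def objs_def)
  have 1: "\<forall>(r, e)\<in>H'. \<forall>q\<in>J e. Inl q \<notin> L'"
  proof clarify
    fix r e q assume "(r, e) \<in> H'" "q \<in> J e" "Inl q \<in> L'"
    then show False using old[of r e q] new[of e q] L'L unfolding H'_def by blast
  qed
  have disj: "J e \<inter> J f = {}" if "(r, e) \<in> H" "(r', f) \<in> H" "r \<noteq> r'" for r e r' f
  proof -
    have "\<forall>(r, e)\<in>H. \<forall>(r', f)\<in>H. r \<noteq> r' \<longrightarrow> J e \<inter> J f = {}"
      using inv unfolding inv_def fst_conv snd_conv by (elim conjE)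
    then show ?thesis using that by blast
  qed
  have disj2: "J e \<inter> J f = {}" if "(r, e) \<in> H" "f \<in> N" for r e f
    using old[OF that(1)] NL[OF that(2)] by blast
  have 2: "\<forall>(r, e)\<in>H'. \<forall>(r', f)\<in>H'. r \<noteq> r' \<longrightarrow> J e \<inter> J f = {}"
  proof clarify
    fix r e r' f assume a: "(r, e) \<in> H'" "(r', f) \<in> H'" "r \<noteq> r'"
    consider "(r, e) \<in> H" "(r', f) \<in> H" | "(r, e) \<in> H" "f \<in> N" | "e \<in> N" "(r', f) \<in> H"
      using a by (auto simp: H'_def)
    then show "J e \<inter> J f = {}" by cases (use disj[OF _ _ a(3)] disj2 in blast)+
  qed
  have 3: "Inr e \<notin> L' \<and> (\<forall>r'>r. (r', e) \<notin> H')"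
    if c: "c \<in> conf" "e \<in> c" "g \<in> c" "g \<noteq> e" and g: "(r, g) \<in> H'"
      and oth: "\<And>f. f \<in> c - {e, g} \<Longrightarrow> \<exists>r'<r. (r', f) \<in> H'" for c e g r
  proof (cases "(r, g) \<in> H")
    case True
    then have ri: "r < i" using HB by auto
    have "\<exists>r'<r. (r', f) \<in> H" if "f \<in> c - {e, g}" for f
      using oth[OF that] ri by (auto simp: H'_def)
    moreover have "\<forall>c\<in>conf. \<forall>e\<in>c. \<forall>(r, g)\<in>H. g \<in> c \<longrightarrow> g \<noteq> e \<longrightarrow>
          (\<forall>f\<in>c - {e, g}. \<exists>r'<r. (r', f) \<in> H) \<longrightarrow> Inr e \<notin> L \<and> (\<forall>r'>r. (r', e) \<notin> H)"
      using inv unfolding inv_def fst_conv snd_conv by (elim conjE)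
    note bspec[OF bspec[OF bspec[OF this c(1)] c(2)] True, unfolded prod.case, rule_format, OF c(3,4)]
    ultimately have "Inr e \<notin> L \<and> (\<forall>r'>r. (r', e) \<notin> H)"
      by blast
    then show ?thesis using L'L NL2 by (auto simp: H'_def)
  next
    case False
    then have ri: "r = i" and gN: "g \<in> N" using g by (auto simp: H'_def)
    have "\<exists>r'<r. (r', f) \<in> H" if "f \<in> c - {e, g}" for f
      using oth[OF that] ri by (auto simp: H'_def)
    then have "c - {e, g} \<subseteq> Tk H" by (force simp: Tk_def)
    then have "g \<in> killers (L, H) (Inr e)"
      using c gN by (auto simp: N_def)
    then have "Inr e \<notin> L'" using gN by (auto simp: L'_def surv_def N_def)
    moreover have "(r', e) \<notin> H'" if "r' > r" for r'
      using that ri HB by (auto simp: H'_def)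
    ultimately show ?thesis by blast
  qed
  have 4: "H' \<subseteq> {..<Suc i} \<times> B"
  proof
    fix x assume "x \<in> H'"
    then consider "x \<in> H" | "x \<in> {i} \<times> N" unfolding H'_def by blast
    then show "x \<in> {..<Suc i} \<times> B" by cases (use HB NB in force)+
  qed
  have 5: "\<forall>c\<in>conf. \<forall>e\<in>c. \<forall>(r, g)\<in>H'. g \<in> c \<longrightarrow> g \<noteq> e \<longrightarrow>
      (\<forall>f\<in>c - {e, g}. \<exists>r'<r. (r', f) \<in> H') \<longrightarrow> Inr e \<notin> L' \<and> (\<forall>r'>r. (r', e) \<notin> H')"
  proof (intro ballI)
    fix c e x assume c: "c \<in> conf" "e \<in> c" and x: "x \<in> H'"
    obtain r g where xe: "x = (r, g)" by (cases x)
    show "case x of (r, g) \<Rightarrow> g \<in> c \<longrightarrow> g \<noteq> e \<longrightarrow>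
      (\<forall>f\<in>c - {e, g}. \<exists>r'<r. (r', f) \<in> H') \<longrightarrow> Inr e \<notin> L' \<and> (\<forall>r'>r. (r', e) \<notin> H')"
      unfolding xe prod.case by (intro impI, rule 3[OF c _ _ x[unfolded xe]], assumption+, erule (1) bspec)
  qed
  have 6: "L' \<subseteq> Obj" using L'L LO by (rule subset_trans)
  show ?thesis
    unfolding eq inv_def fst_conv snd_conv by (intro conjI 6 4 1 2 5)
qed

text \<open>Comparing only on states with \<open>inv\<close> is the way in which facts about the
  history enter expectation bounds.\<close>

lemma EE_mono:
  assumes "\<And>\<omega>. inv i \<omega> \<Longrightarrow> f \<omega> \<le> g \<omega>"
  shows "EE i f \<le> EE i g"
  using assms
proof (induction i arbitrary: f g)
  case 0
  then show ?case using inv_init by simp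
next
  case (Suc i)
  have "inv (Suc i) (nxt i \<omega> Sel C)" if "inv i \<omega>" "Sel \<subseteq> B" "C \<subseteq> Obj" for \<omega> Sel C
    using inv_step that by (cases \<omega>) auto
  then show ?case
    by (simp, intro Suc.IH rnd_mono Suc.prems)
qed

lemma EE_exists:
  assumes "EE i f \<ge> c"
  shows "\<exists>\<omega>. inv i \<omega> \<and> f \<omega> \<ge> c"
proof (rule ccontr)
  assume "\<not> ?thesis"
  then have lt: "f \<omega> < c" if "inv i \<omega>" for \<omega> using that not_le by blast
  have "finite {\<omega>. inv i \<omega>}"
  proof (rule finite_subset)
    show "{\<omega>. inv i \<omega>} \<subseteq> Pow Obj \<times> Pow ({..<i} \<times> B)" by (force simp: inv_def)
    show "finite (Pow Obj \<times> Pow ({..<i} \<times> B))" using finB finite_Obj by simp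
  qed
  then have fin: "finite (f ` {\<omega>. inv i \<omega>})" by simp
  have "f ` {\<omega>. inv i \<omega>} \<noteq> {}"
  proof
    assume "f ` {\<omega>. inv i \<omega>} = {}"
    then have "\<And>\<omega>. \<not> inv i \<omega>" by blast
    then have "EE i (\<lambda>_. 1) \<le> EE i (\<lambda>_. 0)" by (intro EE_mono) blast
    then show False by (simp add: EE_const)
  qed
  then have "Max (f ` {\<omega>. inv i \<omega>}) < c" using fin lt by simp
  moreover have "EE i f \<le> EE i (\<lambda>_. Max (f ` {\<omega>. inv i \<omega>}))"
    using fin by (intro EE_mono Max_ge) auto
  ultimately show False using assms by (simp add: EE_const)
qed

end

section \<open>Overlaps\<close>

context block_system
begin

lemma df_union:
  assumes "S \<subseteq> B" "T \<subseteq> B"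
  shows "df (S \<union> T) = df S + df T + int M * int (card (S \<inter> T)) - int (card (\<Union>(V ` S) \<inter> \<Union>(V ` T)))"
proof -
  have fin: "finite S" "finite T" using assms finB finite_subset by auto
  have 1: "card (S \<union> T) + card (S \<inter> T) = card S + card T"
    using card_Un_Int[OF fin] by simp
  have 2: "card (\<Union>(V ` (S \<union> T))) + card (\<Union>(V ` S) \<inter> \<Union>(V ` T)) = card (\<Union>(V ` S)) + card (\<Union>(V ` T))"
    using card_Un_Int[OF finite_VU[OF assms(1)] finite_VU[OF assms(2)]] by (simp add: image_Un)
  have 3: "int M * int (card (S \<union> T)) + int M * int (card (S \<inter> T)) = int M * int (card S) + int M * int (card T)"
    by (simp only: distrib_left[symmetric] of_nat_add[symmetric] 1)
  show ?thesis unfolding df_def using 2 3 by linarith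
qed

text \<open>Vertices of common blocks are common vertices; this inclusion is the only loss against
  the exact formula \<open>df_union\<close>.\<close>

lemma df_submodular:
  assumes "S \<subseteq> B" "T \<subseteq> B"
  shows "df (S \<union> T) + df (S \<inter> T) \<le> df S + df T"
proof -
  have "card (\<Union>(V ` (S \<inter> T))) \<le> card (\<Union>(V ` S) \<inter> \<Union>(V ` T))"
    by (intro card_mono) (use finite_VU[OF assms(1)] in auto)
  then show ?thesis using df_union[OF assms] by (simp add: df_def)
qed

lemma df_single: "e \<in> B \<Longrightarrow> df {e} = 2"
  using cardV by (simp add: df_def)

lemma df_insert:
  assumes "S \<subseteq> B" "g \<in> B" "g \<notin> S"
  shows "df (insert g S) = df S + 2 - int (card (V g \<inter> \<Union>(V ` S)))"
  using df_union[of "{g}" S] assms df_single[of g] by simp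

lemma conf_df_ge:
  assumes "c \<in> conf" "d \<subseteq> c" "d \<noteq> {}"
  shows "2 \<le> df d"
proof (cases "d = c")
  case False
  note c = confD[OF assms(1)]
  have pr: "d \<subset> c" using assms(2) False by blast
  have fin: "finite d" using finite_subset[OF assms(2) c(5)] .
  show ?thesis
  proof (cases "card d \<ge> 2")
    case True
    then show ?thesis using c(6)[OF pr] by simp
  next
    case False
    then have "card d = 1" using assms(3) fin card_gt_0_iff[of d] by linarith
    then obtain e where "d = {e}" by (auto simp: card_1_singleton_iff)
    then show ?thesis using df_single[of e] assms(2) c(1) by auto
  qed
qed (use confD[OF assms(1)] in simp)

lemma conf_two:
  assumes "c \<in> conf" "e \<in> c" "f \<in> c" "e \<noteq> f" "d \<subseteq> c" "d \<noteq> c" "e \<in> d" "f \<in> d"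
  shows "3 \<le> df d"
proof -
  have "card {e, f} \<le> card d"
    using assms confD(5)[OF assms(1)] by (intro card_mono) (auto intro: finite_subset)
  then have "2 \<le> card d" using assms(4) by simp
  then show ?thesis using confD(6)[OF assms(1)] assms(5,6) by blast
qed

text \<open>The common frame for the sets to which the overlap analysis is applied: conflicts,
  single blocks, and pairs of blocks with exactly two common vertices.\<close>

definition tight :: "'b set \<Rightarrow> bool" where
  "tight S \<longleftrightarrow> S \<subseteq> B \<and> df S = 2 \<and> (\<forall>d\<subseteq>S. d \<noteq> {} \<longrightarrow> 2 \<le> df d)"

lemma tightD:
  assumes "tight S"
  shows "S \<subseteq> B" "df S = 2" "\<And>d. d \<subseteq> S \<Longrightarrow> d \<noteq> {} \<Longrightarrow> 2 \<le> df d" "finite S"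
  using assms finite_subset[OF _ finB] by (auto simp: tight_def)

lemma conf_tight: "c \<in> conf \<Longrightarrow> tight c"
  using confD conf_df_ge by (auto simp: tight_def)

lemma pair_tight:
  assumes "e \<in> B" "f \<in> B" "e \<noteq> f \<Longrightarrow> card (V e \<inter> V f) = 2"
  shows "tight {e, f}"
proof -
  have 2: "df {e, f} = 2"
    using df_insert[of "{f}" e] assms df_single by (cases "e = f") auto
  have "2 \<le> df d" if "d \<subseteq> {e, f}" "d \<noteq> {}" for d
  proof -
    have "d = {e} \<or> d = {f} \<or> d = {e, f}" using that by auto
    then show ?thesis using 2 df_single assms by auto
  qed
  then show ?thesis using 2 assms by (auto simp: tight_def)
qed

lemma overlap_point_point:
  assumes "tight S" "g \<in> B" "g \<notin> S" "3 \<le> card (V g \<inter> \<Union>(V ` S))"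
  shows "df (insert g S) \<le> 1"
  using df_insert[of S g] tightD[OF assms(1)] assms by simp

text \<open>Gluing \<open>c\<close> to \<open>insert g S\<close>, of excess at most 2, along a
  proper part of \<open>c\<close> that contains \<open>f\<close> and \<open>g\<close> leaves at most
  \<open>2 + 2 - 3\<close>. If instead \<open>c\<close> lies inside \<open>insert g S\<close>,
  minimality of \<open>c\<close> forces \<open>g\<close> to meet \<open>c - {g}\<close> in three
  vertices.\<close>

lemma overlap_point_block:
  assumes S: "tight S" and g: "g \<notin> S" and c: "c \<in> conf" "f \<in> S" "f \<in> c" "g \<in> c"
    and two: "2 \<le> card (V g \<inter> \<Union>(V ` S))"
  shows "df (insert g S \<union> c) \<le> 1"
proof -
  note t = tightD[OF S] and cD = confD[OF c(1)]
  have gB: "g \<in> B" using c(4) cD(1) by auto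
  have 1: "df (insert g S) \<le> 2" using df_insert[OF t(1) gB g] two t(2) by simp
  have sub: "df (insert g S \<union> c) + df (insert g S \<inter> c) \<le> df (insert g S) + 2"
    using df_submodular[of "insert g S" c] t(1) gB cD by simp
  show ?thesis
  proof (cases "insert g S \<inter> c = c")
    case False
    then have "3 \<le> df (insert g S \<inter> c)"
      using c g by (intro conf_two[OF c(1), of f g]) auto
    then show ?thesis using sub 1 by linarith
  next
    case True
    have cg: "c - {g} \<subseteq> S" "insert g (c - {g}) = c" using True c(4) by auto
    have "card (c - {g}) \<ge> 2" using cD(2,5) c(4) by simp
    then have "3 \<le> df (c - {g})" using cD(6)[of "c - {g}"] c(4) by auto
    moreover have "df c = df (c - {g}) + 2 - int (card (V g \<inter> \<Union>(V ` (c - {g}))))"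
      using df_insert[of "c - {g}" g] cg(2) gB cD(1) by auto
    ultimately have "3 \<le> card (V g \<inter> \<Union>(V ` (c - {g})))" using cD(4) by linarith
    also have "\<dots> \<le> card (V g \<inter> \<Union>(V ` S))"
      using cg(1) finV[OF gB] by (intro card_mono) auto
    finally have "df (insert g S) \<le> 1" using df_insert[OF t(1) gB g] t(2) by linarith
    moreover have "insert g S \<union> c = insert g S" using True by auto
    ultimately show ?thesis by simp
  qed
qed

text \<open>Gluing \<open>c\<close> and then \<open>c'\<close> to \<open>S\<close> never raises the
  excess above 2. It could stay at 2 only if \<open>S\<close> and \<open>c\<close> meet just in
  \<open>f\<close> and \<open>c'\<close> lies in their union; then \<open>c'\<close> is cut into two
  parts by the separator \<open>V f\<close>, and counting vertices contradicts the minimality of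
  \<open>c'\<close>.\<close>

lemma overlap_block_block:
  assumes S: "tight S" and g: "g \<notin> S" and f: "f \<in> S" "f' \<in> S" "f \<noteq> f'"
    and c: "c \<in> conf" "f \<in> c" "g \<in> c" and c': "c' \<in> conf" "f' \<in> c'" "g \<in> c'"
  shows "df (S \<union> c \<union> c') \<le> 1"
proof -
  note t = tightD[OF S] and cD = confD[OF c(1)] and cD' = confD[OF c'(1)]
  have sub1: "df (S \<union> c) + df (S \<inter> c) \<le> 4"
    using df_submodular[OF t(1) cD(1)] t(2) cD(4) by simp
  have sub2: "df (S \<union> c \<union> c') + df ((S \<union> c) \<inter> c') \<le> df (S \<union> c) + 2"
    using df_submodular[of "S \<union> c" c'] t(1) cD(1) cD'(1,4) by simp
  have ge2: "2 \<le> df ((S \<union> c) \<inter> c')"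
    using c c' by (intro conf_df_ge[OF c'(1)]) auto
  have le: "df (S \<union> c) \<le> 2"
  proof -
    have "2 \<le> df (S \<inter> c)" by (rule t(3)) (use f c in auto)
    then show ?thesis using sub1 by linarith
  qed
  show ?thesis
  proof (cases "df (S \<union> c) \<le> 1")
    case True
    then show ?thesis using sub2 ge2 by linarith
  next
    case False
    then have eq: "df (S \<union> c) = 2" using le by linarith
    have only: "S \<inter> c = {f}"
    proof (rule ccontr)
      assume "S \<inter> c \<noteq> {f}"
      then obtain h where h: "h \<in> S \<inter> c" "h \<noteq> f" using f c by auto
      have "3 \<le> df (S \<inter> c)"
        using h f c g by (intro conf_two[OF c(1), of f h]) auto
      then show False using sub1 eq by linarith
    qed
    show ?thesis
    proof (cases "(S \<union> c) \<inter> c' = c'")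
      case False
      then have "3 \<le> df ((S \<union> c) \<inter> c')"
        using c c' f g by (intro conf_two[OF c'(1), of f' g]) auto
      then show ?thesis using sub2 eq by linarith
    next
      case True
      define I1 I2 where "I1 = c' \<inter> S" and "I2 = c' \<inter> c"
      have I: "I1 \<union> I2 = c'" "I1 \<inter> I2 \<subseteq> {f}" "f' \<in> I1" "g \<in> I2" "g \<notin> I1" "f' \<notin> I2"
        using True only c' f g by (auto simp: I1_def I2_def)
      have IB: "I1 \<subseteq> B" "I2 \<subseteq> B" using cD'(1) by (auto simp: I1_def I2_def)
      have fB: "f \<in> B" using f t(1) by auto
      have fin: "finite (\<Union>(V ` I1))" "finite (\<Union>(V ` I2))" using IB finite_VU by auto
      \<comment> \<open>The submodular inequality is an equality here, so the common vertices of
        \<open>S\<close> and \<open>c\<close> are exactly those of \<open>f\<close>.\<close>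
      have "int (card (\<Union>(V ` S) \<inter> \<Union>(V ` c))) = int M + 2"
        using df_union[OF t(1) cD(1)] only eq t(2) cD(4) by simp
      moreover have "V f \<subseteq> \<Union>(V ` S) \<inter> \<Union>(V ` c)" using f c by auto
      moreover have "finite (\<Union>(V ` S) \<inter> \<Union>(V ` c))" using finite_VU[OF t(1)] by auto
      ultimately have Vf: "\<Union>(V ` S) \<inter> \<Union>(V ` c) = V f"
        using card_subset_eq[of "\<Union>(V ` S) \<inter> \<Union>(V ` c)" "V f"] cardV[OF fB] by simp
      have XV: "\<Union>(V ` I1) \<inter> \<Union>(V ` I2) \<subseteq> V f" using Vf by (auto simp: I1_def I2_def)
      define k where "k = card (\<Union>(V ` I1) \<inter> \<Union>(V ` I2))"
      have dfc': "df c' = df I1 + df I2 + int M * int (card (I1 \<inter> I2)) - int k"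
        using df_union[OF IB] I(1) by (simp add: k_def)
      have False
      proof (cases "f \<in> c'")
        \<comment> \<open>Two parts of excess at least 3 that meet in one block and in at most
          \<open>M + 2\<close> vertices would give \<open>c'\<close> excess at least
          \<open>3 + 3 + M - (M + 2) = 4\<close>.\<close>
        case True
        then have f12: "f \<in> I1" "f \<in> I2" using f c by (auto simp: I1_def I2_def)
        then have "I1 \<inter> I2 = {f}" using I(2) by auto
        moreover have "3 \<le> df I1"
          using I f12 f c' by (intro conf_two[OF c'(1), of f f']) auto
        moreover have "3 \<le> df I2"
          using I f12 f g c' by (intro conf_two[OF c'(1), of f g]) auto
        moreover have "k \<le> M + 2"
          using card_mono[OF finV[OF fB] XV] cardV[OF fB] by (simp add: k_def)
        ultimately show False using dfc' cD'(4) by simp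
      next
        \<comment> \<open>Adding \<open>f\<close> to either part keeps the excess at least 2, which
          bounds \<open>k\<close> by the excess of each part. These two excesses sum to
          \<open>2 + k\<close>, so both are at most 2, each part has at most one block, and
          \<open>c'\<close> at most two.\<close>
        case False
        then have "I1 \<inter> I2 = {}" using I by auto
        then have eq2: "df I1 + df I2 = 2 + int k" using dfc' cD'(4) by simp
        have f1: "f \<notin> I1" "f \<notin> I2" using False I by auto
        have "k \<le> card (V f \<inter> \<Union>(V ` I1))"
          unfolding k_def using XV finV[OF fB] by (intro card_mono) auto
        moreover have "2 \<le> df (insert f I1)" using f by (intro t(3)) (auto simp: I1_def)
        ultimately have k1: "int k \<le> df I1" using df_insert[OF IB(1) fB f1(1)] by linarith
        have "k \<le> card (V f \<inter> \<Union>(V ` I2))"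
          unfolding k_def using XV finV[OF fB] by (intro card_mono) auto
        moreover have "2 \<le> df (insert f I2)"
          using c by (intro conf_df_ge[OF c(1)]) (auto simp: I2_def)
        ultimately have k2: "int k \<le> df I2" using df_insert[OF IB(2) fB f1(2)] by linarith
        have small: "df I1 \<le> 2" "df I2 \<le> 2" using eq2 k1 k2 by auto
        have pr: "I1 \<subset> c'" "I2 \<subset> c'" using I c' by blast+
        have "card I1 < 2" using cD'(6)[OF pr(1)] small by linarith
        moreover have "card I2 < 2" using cD'(6)[OF pr(2)] small by linarith
        moreover have "card c' \<le> card I1 + card I2" using card_Un_le[of I1 I2] I(1) by simp
        ultimately show False using cD'(2) by linarith
      qed
      then show ?thesis ..
    qed
  qed
qed

text \<open>Apart from members of \<open>S0\<close>, only blocks in \<open>Ov H S0\<close> can kill two objects of a tight \<open>S0\<close> at once.\<close>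

definition dang :: "'b set \<Rightarrow> 'b set set" where
  "dang S0 = {S. S0 \<subset> S \<and> S \<subseteq> B \<and> card S \<le> card S0 + 14 \<and> df S \<le> 1}"

definition Ov :: "(nat \<times> 'b) set \<Rightarrow> 'b set \<Rightarrow> 'b set" where
  "Ov H S0 = {g \<in> B - S0. \<exists>S\<in>dang S0. g \<in> S \<and> S - S0 - {g} \<subseteq> Tk H}"

text \<open>A common killer outside \<open>S\<close>, together with the conflicts through which it
  kills, yields a set of excess at most 1 whose other new blocks are already taken. At most 14
  blocks are new: two conflicts, deprived of \<open>f\<close> and \<open>f'\<close>, contribute 7
  each.\<close>

lemma killers_overlap:
  assumes S: "tight S" and f: "f \<in> S" "f' \<in> S" and x: "x \<in> objs f" "y \<in> objs f'" "x \<noteq> y"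
  shows "killers (L, H) x \<inter> killers (L, H) y \<subseteq> Ov H S \<union> S"
proof
  fix g assume g: "g \<in> killers (L, H) x \<inter> killers (L, H) y"
  note t = tightD[OF S]
  have gB: "g \<in> B" using g killers_subset by auto
  have point: "q \<subseteq> V g \<inter> \<Union>(V ` S) \<and> card q = 2" if "Inl q \<in> objs h" "h \<in> S" "g \<in> killers (L, H) (Inl q)" for q h
  proof -
    have "q \<in> J h" "q \<in> J g" "h \<in> B" using that t(1) by (auto simp: objs_def)
    then show ?thesis using subJ[of h q] subJ[OF gB, of q] card2J[OF gB, of q] that(2) by auto
  qed
  have block: "\<exists>c\<in>conf. h \<in> c \<and> g \<in> c \<and> c - {h, g} \<subseteq> Tk H" if "Inr h' \<in> objs h" "g \<in> killers (L, H) (Inr h')" for h h'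
    using that by (auto simp: objs_def)
  have finVg: "finite (V g \<inter> \<Union>(V ` S))" using finV[OF gB] by simp
  have in_Ov: "g \<in> Ov H S" if "g \<notin> S" "df (S \<union> D) \<le> 1" "D \<subseteq> B" "g \<in> D" "D - S - {g} \<subseteq> Tk H" "card D \<le> 14" for D
  proof -
    have fin: "finite D" using that(3) finB finite_subset by auto
    have "S \<union> D \<in> dang S"
      unfolding dang_def using that t(1) card_Un_le[of S D] by auto
    moreover have "S \<union> D - S - {g} \<subseteq> Tk H" using that(5) by auto
    ultimately show ?thesis unfolding Ov_def using that gB by blast
  qed
  have pb: "g \<in> Ov H S" if a: "g \<notin> S" "Inl q \<in> objs h" "h \<in> S" "g \<in> killers (L, H) (Inl q)"
    "Inr h' \<in> objs k" "k \<in> S" "g \<in> killers (L, H) (Inr h')" for q h h' k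
  proof -
    obtain c where c: "c \<in> conf" "k \<in> c" "g \<in> c" "c - {k, g} \<subseteq> Tk H"
      using block[OF a(5) a(7)] by auto
    have "card q \<le> card (V g \<inter> \<Union>(V ` S))"
      using point[OF a(2,3,4)] finVg by (intro card_mono) auto
    then have "df (insert g S \<union> c) \<le> 1"
      using overlap_point_block[OF S a(1) c(1) a(6) c(2,3)] point[OF a(2,3,4)] by simp
    then show ?thesis
      using c confD[OF c(1)] a by (intro in_Ov[of c]) (auto simp: insert_absorb)
  qed
  show "g \<in> Ov H S \<union> S"
  proof (cases "g \<in> S")
    case False
    have gx: "g \<in> killers (L, H) x" "g \<in> killers (L, H) y" using g by auto
    consider q q' where "x = Inl q" "y = Inl q'" | q h where "x = Inl q" "y = Inr h"
      | h q where "x = Inr h" "y = Inl q" | h h' where "x = Inr h" "y = Inr h'"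
      by (cases x; cases y) auto
    then have "g \<in> Ov H S"
    proof cases
      case (1 q q')
      have q: "q \<subseteq> V g \<inter> \<Union>(V ` S) \<and> card q = 2" "q' \<subseteq> V g \<inter> \<Union>(V ` S) \<and> card q' = 2"
        using point[of q f] point[of q' f'] 1 x f gx by auto
      then have fin: "finite q" "finite q'" using finVg finite_subset by blast+
      have "q \<noteq> q'" using x(3) 1 by auto
      then have "q \<subset> q \<union> q'" using q fin by (metis Un_upper1 card_subset_eq psubsetI sup.cobounded2)
      then have "2 < card (q \<union> q')" using psubset_card_mono[of "q \<union> q'" q] q fin by auto
      also have "\<dots> \<le> card (V g \<inter> \<Union>(V ` S))" using q finVg by (intro card_mono) auto
      finally have "df (insert g S) \<le> 1" using overlap_point_point[OF S gB False] by simp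
      then show ?thesis using gB False by (intro in_Ov[of "{g}"]) auto
    next
      case (2 q h) then show ?thesis using pb[OF False, of q f h f'] x f gx by auto
    next
      case (3 h q) then show ?thesis using pb[OF False, of q f' h f] x f gx by auto
    next
      case (4 h h')
      then have ff: "f \<noteq> f'" "h = f" "h' = f'" using x by (auto simp: objs_def)
      obtain c where c: "c \<in> conf" "f \<in> c" "g \<in> c" "c - {f, g} \<subseteq> Tk H"
        using block[of h f] 4 x gx by auto
      obtain c' where c': "c' \<in> conf" "f' \<in> c'" "g \<in> c'" "c' - {f', g} \<subseteq> Tk H"
        using block[of h' f'] 4 x gx by auto
      have "df (S \<union> c \<union> c') \<le> 1"
        using overlap_block_block[OF S False f ff(1) c(1-3) c'(1-3)] .
      moreover have "card (c \<union> c' - S) \<le> 14"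
      proof -
        have "c \<union> c' - S \<subseteq> (c - {f}) \<union> (c' - {f'})" using f by auto
        then have "card (c \<union> c' - S) \<le> card ((c - {f}) \<union> (c' - {f'}))"
          using confD[OF c(1)] confD[OF c'(1)] by (intro card_mono) auto
        also have "\<dots> \<le> card (c - {f}) + card (c' - {f'})" by (rule card_Un_le)
        also have "\<dots> \<le> 14" using confD[OF c(1)] confD[OF c'(1)] c(2) c'(2) by simp
        finally show ?thesis .
      qed
      moreover have "S \<union> c \<union> c' = S \<union> (c \<union> c' - S)" by auto
      ultimately show ?thesis
        using c c' confD[OF c(1)] confD[OF c'(1)] False f
        by (intro in_Ov[of "c \<union> c' - S"]) auto
    qed
    then show ?thesis by simp
  qed simp
qed

end

section \<open>Survival probabilities within one round\<close>

lemma sum_Pow_binomial: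
  fixes a b :: real
  assumes "finite W"
  shows "(\<Sum>G\<in>Pow W. a ^ card G * b ^ card (W - G)) = (a + b) ^ card W"
  using prod_add[OF assms, of "\<lambda>_. a" "\<lambda>_. b"] by simp

context nibble_process
begin

lemma rnd_indep:
  assumes G: "G \<subseteq> B" and Y: "Y \<subseteq> Obj" "Y \<subseteq> fst \<omega>"
  shows "rnd i \<omega> (\<lambda>Sel C. of_bool (G \<subseteq> Sel \<and> Y \<subseteq> surv \<omega> Sel C)) =
    (if G \<inter> (\<Union>x\<in>Y. killers \<omega> x) = {} then
       p i ^ card G * (1 - p i) ^ card (\<Union>x\<in>Y. killers \<omega> x) *
       (\<Prod>x\<in>Y. coin (p i) (nom x) (card (killers \<omega> x))) else 0)"
proof -
  define KU where "KU = (\<Union>x\<in>Y. killers \<omega> x)"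
  define r where "r = (\<lambda>x. coin (p i) (nom x) (card (killers \<omega> x)))"
  have KUB: "KU \<subseteq> B" unfolding KU_def using killers_subset by blast
  have iff: "G \<subseteq> Sel \<and> Y \<subseteq> surv \<omega> Sel C \<longleftrightarrow> (G \<subseteq> Sel \<and> Sel \<inter> KU = {}) \<and> Y \<subseteq> C" for Sel C
    using Y(2) by (auto simp: surv_def KU_def)
  have inner: "bern Obj r (\<lambda>C. of_bool (G \<subseteq> Sel \<and> Y \<subseteq> surv \<omega> Sel C))
    = prod r Y * of_bool (G \<subseteq> Sel \<and> Sel \<inter> KU = {})" for Sel
    unfolding iff of_bool_conj[of "_ \<and> _"] bern_cmult bern_subset[OF finite_Obj Y(1)] by (rule mult.commute)
  have "rnd i \<omega> (\<lambda>Sel C. of_bool (G \<subseteq> Sel \<and> Y \<subseteq> surv \<omega> Sel C))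
     = prod r Y * bern B (\<lambda>_. p i) (\<lambda>Sel. of_bool (G \<subseteq> Sel \<and> Sel \<inter> KU = {}))"
    unfolding rnd_def r_def[symmetric] inner bern_cmult ..
  also have "bern B (\<lambda>_. p i) (\<lambda>Sel. of_bool (G \<subseteq> Sel \<and> Sel \<inter> KU = {}))
    = (if G \<inter> KU = {} then p i ^ card G * (1 - p i) ^ card KU else 0)"
  proof (cases "G \<inter> KU = {}")
    case True
    then show ?thesis using bern_prob[OF finB G KUB True, of "\<lambda>_. p i"] by simp
  next
    case False
    then have "\<not> (G \<subseteq> Sel \<and> Sel \<inter> KU = {})" for Sel by auto
    then have "bern B (\<lambda>_. p i) (\<lambda>Sel. of_bool (G \<subseteq> Sel \<and> Sel \<inter> KU = {})) = bern B (\<lambda>_. p i) (\<lambda>_. 0)"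
      by (intro bern_cong) auto
    then show ?thesis using False by (simp add: bern_const finB)
  qed
  finally show ?thesis unfolding KU_def r_def by simp
qed

lemma rnd_sel:
  assumes "G \<subseteq> B"
  shows "rnd i \<omega> (\<lambda>Sel C. of_bool (G \<subseteq> Sel)) = p i ^ card G"
  using rnd_indep[OF assms, of "{}" \<omega> i] by simp

text \<open>With disjoint killer sets, killers and coins would give at most the product of the
  nominal probabilities. All overlaps lie in \<open>Z\<close>, so the sum of the killer counts
  exceeds the size of their union by at most \<open>card Y * t\<close>, the exponent of the
  correction.\<close>

lemma rnd_surv_upper:
  assumes G: "G \<subseteq> B" and Y: "Y \<subseteq> Obj" "Y \<subseteq> fst \<omega>" and O: "finite Z" "card Z \<le> t"
    and disj: "\<And>x y. x \<in> Y \<Longrightarrow> y \<in> Y \<Longrightarrow> x \<noteq> y \<Longrightarrow> killers \<omega> x \<inter> killers \<omega> y \<subseteq> Z"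
  shows "rnd i \<omega> (\<lambda>Sel C. of_bool (G \<subseteq> Sel \<and> Y \<subseteq> surv \<omega> Sel C))
    \<le> p i ^ card G * (\<Prod>x\<in>Y. 1 - nom x) / (1 - p i) ^ (card Y * t)"
proof -
  define KU where "KU = (\<Union>x\<in>Y. killers \<omega> x)"
  have finY: "finite Y" using Y(1) finite_Obj finite_subset by blast
  have finK: "finite (killers \<omega> x)" for x using killers_subset finB finite_subset by blast
  have q: "0 < 1 - p i" "1 - p i \<le> 1" using p01[of i] by auto
  have "(\<Sum>x\<in>Y. card (killers \<omega> x)) \<le> (\<Sum>x\<in>Y. card (killers \<omega> x - Z) + t)"
  proof (rule sum_mono)
    fix x assume "x \<in> Y"
    have "card (killers \<omega> x) \<le> card ((killers \<omega> x - Z) \<union> Z)"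
      by (intro card_mono) (use finK O in auto)
    also have "\<dots> \<le> card (killers \<omega> x - Z) + card Z" by (rule card_Un_le)
    finally show "card (killers \<omega> x) \<le> card (killers \<omega> x - Z) + t" using O by simp
  qed
  also have "\<dots> = (\<Sum>x\<in>Y. card (killers \<omega> x - Z)) + card Y * t" by (simp add: sum.distrib)
  also have "(\<Sum>x\<in>Y. card (killers \<omega> x - Z)) = card (\<Union>x\<in>Y. killers \<omega> x - Z)"
    by (rule card_UN_disjoint[symmetric]) (use finY finK disj in blast)+
  also have "\<dots> \<le> card KU"
    unfolding KU_def using finY finK by (intro card_mono) auto
  finally have le: "(\<Sum>x\<in>Y. card (killers \<omega> x)) \<le> card KU + card Y * t" by simp
  have "(1 - p i) ^ (card KU + card Y * t) * (\<Prod>x\<in>Y. coin (p i) (nom x) (card (killers \<omega> x)))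
     \<le> (1 - p i) ^ (\<Sum>x\<in>Y. card (killers \<omega> x)) * (\<Prod>x\<in>Y. coin (p i) (nom x) (card (killers \<omega> x)))"
    using q le coin01 by (intro mult_right_mono power_decreasing prod_nonneg) auto
  also have "\<dots> = (\<Prod>x\<in>Y. (1 - p i) ^ card (killers \<omega> x) * coin (p i) (nom x) (card (killers \<omega> x)))"
    by (simp add: power_sum prod.distrib)
  also have "\<dots> \<le> (\<Prod>x\<in>Y. 1 - nom x)"
  proof (rule prod_mono, rule conjI)
    fix x
    show "0 \<le> (1 - p i) ^ card (killers \<omega> x) * coin (p i) (nom x) (card (killers \<omega> x))"
      using q coin01 by (intro mult_nonneg_nonneg) auto
    show "(1 - p i) ^ card (killers \<omega> x) * coin (p i) (nom x) (card (killers \<omega> x)) \<le> 1 - nom x"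
      using coin_bounds(3)[of "p i" "nom x"] p01[of i] nom01[of x] by auto
  qed
  finally have main: "(1 - p i) ^ card KU * (\<Prod>x\<in>Y. coin (p i) (nom x) (card (killers \<omega> x)))
     \<le> (\<Prod>x\<in>Y. 1 - nom x) / (1 - p i) ^ (card Y * t)"
    using q by (simp add: power_add field_simps)
  have nn: "0 \<le> (\<Prod>x\<in>Y. 1 - nom x) / (1 - p i) ^ (card Y * t)"
    using q nom01 by (intro divide_nonneg_nonneg prod_nonneg) (auto simp: less_imp_le)
  have pn: "0 \<le> p i ^ card G" using p01[of i] by simp
  have "0 \<le> p i ^ card G * (\<Prod>x\<in>Y. 1 - nom x) / (1 - p i) ^ (card Y * t)"
    using mult_nonneg_nonneg[OF pn nn] by simp
  then show ?thesis
    unfolding rnd_indep[OF G Y] KU_def[symmetric]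
    using mult_left_mono[OF main pn] by (simp add: mult.assoc)
qed

text \<open>Overlaps go in the favourable direction: the union of the killer sets is at most as
  large as the sum of their sizes. The third assumption excludes exceptional objects, which miss the
  nominal probability even with a certain coin.\<close>

lemma rnd_surv_lower:
  assumes Y: "Y \<subseteq> Obj" "Y \<subseteq> fst \<omega>"
    and "\<And>x. x \<in> Y \<Longrightarrow> 1 - nom x \<le> (1 - p i) ^ card (killers \<omega> x)"
  shows "(\<Prod>x\<in>Y. 1 - nom x) \<le> rnd i \<omega> (\<lambda>Sel C. of_bool (Y \<subseteq> surv \<omega> Sel C))"
proof -
  have finY: "finite Y" using Y(1) finite_Obj finite_subset by blast
  have q: "0 < 1 - p i" "1 - p i \<le> 1" using p01[of i] by auto
  have "(\<Prod>x\<in>Y. 1 - nom x) = (\<Prod>x\<in>Y. (1 - p i) ^ card (killers \<omega> x) * coin (p i) (nom x) (card (killers \<omega> x)))"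
    using assms(3) p01[of i] by (intro prod.cong) (auto simp: coin_exact)
  also have "\<dots> = (1 - p i) ^ (\<Sum>x\<in>Y. card (killers \<omega> x)) * (\<Prod>x\<in>Y. coin (p i) (nom x) (card (killers \<omega> x)))"
    by (simp add: power_sum prod.distrib)
  also have "\<dots> \<le> (1 - p i) ^ card (\<Union>x\<in>Y. killers \<omega> x) * (\<Prod>x\<in>Y. coin (p i) (nom x) (card (killers \<omega> x)))"
    using q coin01 card_UN_le[OF finY, of "killers \<omega>"]
    by (intro mult_right_mono power_decreasing prod_nonneg) auto
  also have "\<dots> = rnd i \<omega> (\<lambda>Sel C. of_bool (Y \<subseteq> surv \<omega> Sel C))"
    using rnd_indep[of "{}" Y \<omega> i] Y by simp
  finally show ?thesis .
qed

section \<open>Moments of the set of taken blocks\<close>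

lemma Tk_Un: "Tk (H \<union> {i} \<times> N) = Tk H \<union> N"
  by (force simp: Tk_def)

lemma snd_nxt: "snd (nxt i \<omega> Sel C) = snd \<omega> \<union> {i} \<times> (Sel \<inter> Av (fst \<omega>))"
  and fst_nxt: "fst (nxt i \<omega> Sel C) = surv \<omega> Sel C"
  by (simp_all add: nxt_def)

lemma p_sum_nonneg: "0 \<le> (\<Sum>r<i. p r)"
  using p01 by (intro sum_nonneg) (auto simp: less_imp_le)

text \<open>Every block of \<open>W\<close> was taken before or is selected in the current round.
  Summing over the set \<open>G\<close> of the latter produces the binomial expansion of the next
  power.\<close>

lemma taken_le:
  assumes W: "W \<subseteq> B"
  shows "EE i (\<lambda>\<omega>. of_bool (W \<subseteq> Tk (snd \<omega>))) \<le> (\<Sum>r<i. p r) ^ card W"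
  using W
proof (induction i arbitrary: W)
  case 0
  then show ?case by (auto simp: Tk_def power_0_left)
next
  case (Suc i)
  have finW: "finite W" using Suc.prems finB finite_subset by auto
  let ?f = "\<lambda>G (\<omega> :: ('v set + 'b) set \<times> (nat \<times> 'b) set). of_bool (W - G \<subseteq> Tk (snd \<omega>)) * p i ^ card G :: real"
  have "EE (Suc i) (\<lambda>\<omega>. of_bool (W \<subseteq> Tk (snd \<omega>))) \<le> EE i (\<lambda>\<omega>. \<Sum>G\<in>Pow W. p i ^ card G * of_bool (W - G \<subseteq> Tk (snd \<omega>)))"
  proof (simp, rule EE_mono)
    fix \<omega>
    have "rnd i \<omega> (\<lambda>Sel C. of_bool (W \<subseteq> Tk (snd (nxt i \<omega> Sel C))))
      \<le> rnd i \<omega> (\<lambda>Sel C. \<Sum>G\<in>Pow W. of_bool (W - G \<subseteq> Tk (snd \<omega>)) * of_bool (G \<subseteq> Sel))"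
    proof (rule rnd_mono)
      fix Sel C
      show "(of_bool (W \<subseteq> Tk (snd (nxt i \<omega> Sel C))) :: real)
        \<le> (\<Sum>G\<in>Pow W. of_bool (W - G \<subseteq> Tk (snd \<omega>)) * of_bool (G \<subseteq> Sel))"
      proof (cases "W \<subseteq> Tk (snd (nxt i \<omega> Sel C))")
        case True
        then have "W - (W - Tk (snd \<omega>)) \<subseteq> Tk (snd \<omega>)" "W - Tk (snd \<omega>) \<subseteq> Sel"
          by (auto simp: snd_nxt Tk_Un)
        then have "1 = of_bool (W - (W - Tk (snd \<omega>)) \<subseteq> Tk (snd \<omega>)) * (of_bool (W - Tk (snd \<omega>) \<subseteq> Sel) :: real)"
          by simp
        also have "\<dots> \<le> (\<Sum>G\<in>Pow W. of_bool (W - G \<subseteq> Tk (snd \<omega>)) * of_bool (G \<subseteq> Sel))"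
          using finW by (intro member_le_sum) auto
        finally show ?thesis by simp
      qed (simp add: sum_nonneg)
    qed
    also have "\<dots> = (\<Sum>G\<in>Pow W. p i ^ card G * of_bool (W - G \<subseteq> Tk (snd \<omega>)))"
      unfolding rnd_sum rnd_cmult using Suc.prems
      by (intro sum.cong refl) (subst rnd_sel, auto)
    finally show "rnd i \<omega> (\<lambda>Sel C. of_bool (W \<subseteq> Tk (snd (nxt i \<omega> Sel C))))
      \<le> (\<Sum>G\<in>Pow W. p i ^ card G * of_bool (W - G \<subseteq> Tk (snd \<omega>)))" .
  qed
  also have "\<dots> = (\<Sum>G\<in>Pow W. p i ^ card G * EE i (\<lambda>\<omega>. of_bool (W - G \<subseteq> Tk (snd \<omega>))))"
    by (simp add: EE_sum EE_cmult)
  also have "\<dots> \<le> (\<Sum>G\<in>Pow W. p i ^ card G * (\<Sum>r<i. p r) ^ card (W - G))"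
    using Suc.prems p01[of i] by (intro sum_mono mult_left_mono Suc.IH) (auto simp: less_imp_le)
  also have "\<dots> = (\<Sum>r<Suc i. p r) ^ card W"
    using sum_Pow_binomial[OF finW, of "p i" "\<Sum>r<i. p r"] by (simp add: add.commute)
  finally show ?case .
qed

definition same :: "'b \<Rightarrow> 'b \<Rightarrow> (nat \<times> 'b) set \<Rightarrow> bool" where
  "same e f H \<longleftrightarrow> (\<exists>r. (r, e) \<in> H \<and> (r, f) \<in> H)"

text \<open>As in \<open>taken_le\<close>, with the further alternative that both \<open>e\<close>
  and \<open>f\<close> are selected in the current round, at cost \<open>p i ^ 2\<close>. The sum of
  squares is what makes such coincidences rare when there are many small rounds.\<close>

lemma same_taken_le:
  assumes W: "W \<subseteq> B" and ef: "e \<notin> W" "f \<notin> W" "e \<in> B" "f \<in> B" "e \<noteq> f"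
  shows "EE i (\<lambda>\<omega>. of_bool (same e f (snd \<omega>) \<and> W \<subseteq> Tk (snd \<omega>)))
    \<le> (\<Sum>r<i. p r ^ 2) * (\<Sum>r<i. p r) ^ card W"
  using W ef(1,2)
proof (induction i arbitrary: W)
  case 0
  then show ?case by (auto simp: same_def)
next
  case (Suc i)
  have finW: "finite W" using Suc.prems finB finite_subset by auto
  let ?s = "\<lambda>(\<omega> :: ('v set + 'b) set \<times> (nat \<times> 'b) set). same e f (snd \<omega>)"
  have cardef: "card (G \<union> {e, f}) = card G + 2" if "G \<subseteq> W" for G
  proof -
    have "finite G" "G \<inter> {e, f} = {}" using that Suc.prems finW finite_subset by auto
    then show ?thesis using ef by (simp add: card_Un_disjoint)
  qed
  have "EE (Suc i) (\<lambda>\<omega>. of_bool (?s \<omega> \<and> W \<subseteq> Tk (snd \<omega>)))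
    \<le> EE i (\<lambda>\<omega>. \<Sum>G\<in>Pow W. p i ^ card G * of_bool (?s \<omega> \<and> W - G \<subseteq> Tk (snd \<omega>))
         + p i ^ (card G + 2) * of_bool (W - G \<subseteq> Tk (snd \<omega>)))"
  unfolding EE.simps
  proof (rule EE_mono)
    fix \<omega> assume inv: "inv i \<omega>"
    have "rnd i \<omega> (\<lambda>Sel C. of_bool (?s (nxt i \<omega> Sel C) \<and> W \<subseteq> Tk (snd (nxt i \<omega> Sel C))))
      \<le> rnd i \<omega> (\<lambda>Sel C. \<Sum>G\<in>Pow W. of_bool (?s \<omega> \<and> W - G \<subseteq> Tk (snd \<omega>)) * of_bool (G \<subseteq> Sel)
          + of_bool (W - G \<subseteq> Tk (snd \<omega>)) * of_bool (G \<union> {e, f} \<subseteq> Sel))"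
    proof (rule rnd_mono)
      fix Sel C
      show "(of_bool (?s (nxt i \<omega> Sel C) \<and> W \<subseteq> Tk (snd (nxt i \<omega> Sel C))) :: real)
        \<le> (\<Sum>G\<in>Pow W. of_bool (?s \<omega> \<and> W - G \<subseteq> Tk (snd \<omega>)) * of_bool (G \<subseteq> Sel)
          + of_bool (W - G \<subseteq> Tk (snd \<omega>)) * of_bool (G \<union> {e, f} \<subseteq> Sel))"
      proof (cases "?s (nxt i \<omega> Sel C) \<and> W \<subseteq> Tk (snd (nxt i \<omega> Sel C))")
        case True
        let ?G = "W - Tk (snd \<omega>)"
        have 1: "W - ?G \<subseteq> Tk (snd \<omega>)" "?G \<subseteq> Sel"
          using True by (auto simp: snd_nxt Tk_Un)
        have "snd \<omega> \<subseteq> {..<i} \<times> B" using inv unfolding inv_def by (elim conjE)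
        then have "(i, e) \<notin> snd \<omega>" "(i, f) \<notin> snd \<omega>" by auto
        then have "?s \<omega> \<or> {e, f} \<subseteq> Sel"
          using True unfolding same_def snd_nxt by blast
        then have "1 \<le> of_bool (?s \<omega> \<and> W - ?G \<subseteq> Tk (snd \<omega>)) * of_bool (?G \<subseteq> Sel)
          + of_bool (W - ?G \<subseteq> Tk (snd \<omega>)) * (of_bool (?G \<union> {e, f} \<subseteq> Sel) :: real)"
          using 1 by auto
        also have "\<dots> \<le> (\<Sum>G\<in>Pow W. of_bool (?s \<omega> \<and> W - G \<subseteq> Tk (snd \<omega>)) * of_bool (G \<subseteq> Sel)
          + of_bool (W - G \<subseteq> Tk (snd \<omega>)) * of_bool (G \<union> {e, f} \<subseteq> Sel))"
          using finW by (intro member_le_sum[of ?G]) auto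
        finally show ?thesis using True by simp
      next
        case False
        then have z: "of_bool (?s (nxt i \<omega> Sel C) \<and> W \<subseteq> Tk (snd (nxt i \<omega> Sel C))) = (0 :: real)" by simp
        show ?thesis unfolding z by (intro sum_nonneg) auto
      qed
    qed
    also have "\<dots> = (\<Sum>G\<in>Pow W. p i ^ card G * of_bool (?s \<omega> \<and> W - G \<subseteq> Tk (snd \<omega>))
         + p i ^ (card G + 2) * of_bool (W - G \<subseteq> Tk (snd \<omega>)))"
      unfolding rnd_sum rnd_add rnd_cmult
    proof (rule sum.cong[OF refl])
      fix G assume G: "G \<in> Pow W"
      have "G \<subseteq> B" "G \<union> {e, f} \<subseteq> B" using G Suc.prems ef by auto
      then show "of_bool (?s \<omega> \<and> W - G \<subseteq> Tk (snd \<omega>)) * rnd i \<omega> (\<lambda>Sel C. of_bool (G \<subseteq> Sel))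
          + of_bool (W - G \<subseteq> Tk (snd \<omega>)) * rnd i \<omega> (\<lambda>Sel C. of_bool (G \<union> {e, f} \<subseteq> Sel))
        = p i ^ card G * of_bool (?s \<omega> \<and> W - G \<subseteq> Tk (snd \<omega>))
         + p i ^ (card G + 2) * of_bool (W - G \<subseteq> Tk (snd \<omega>))"
        using G cardef[of G] by (simp only: rnd_sel mult.commute Pow_iff)
    qed
    finally show "rnd i \<omega> (\<lambda>Sel C. of_bool (?s (nxt i \<omega> Sel C) \<and> W \<subseteq> Tk (snd (nxt i \<omega> Sel C))))
      \<le> (\<Sum>G\<in>Pow W. p i ^ card G * of_bool (?s \<omega> \<and> W - G \<subseteq> Tk (snd \<omega>))
         + p i ^ (card G + 2) * of_bool (W - G \<subseteq> Tk (snd \<omega>)))" .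
  qed
  also have "\<dots> = (\<Sum>G\<in>Pow W. p i ^ card G * EE i (\<lambda>\<omega>. of_bool (?s \<omega> \<and> W - G \<subseteq> Tk (snd \<omega>)))
         + p i ^ (card G + 2) * EE i (\<lambda>\<omega>. of_bool (W - G \<subseteq> Tk (snd \<omega>))))"
    unfolding EE_sum EE_add EE_cmult ..
  also have "\<dots> \<le> (\<Sum>G\<in>Pow W. p i ^ card G * ((\<Sum>r<i. p r ^ 2) * (\<Sum>r<i. p r) ^ card (W - G))
         + p i ^ (card G + 2) * (\<Sum>r<i. p r) ^ card (W - G))"
    using Suc.prems p01[of i]
    by (intro sum_mono add_mono mult_left_mono Suc.IH taken_le) (auto simp: less_imp_le)
  also have "\<dots> = ((\<Sum>r<i. p r ^ 2) + p i ^ 2) * (\<Sum>G\<in>Pow W. p i ^ card G * (\<Sum>r<i. p r) ^ card (W - G))"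
    unfolding sum_distrib_left by (intro sum.cong refl) (simp add: power_add algebra_simps power2_eq_square)
  also have "\<dots> = (\<Sum>r<Suc i. p r ^ 2) * (\<Sum>r<Suc i. p r) ^ card W"
    using sum_Pow_binomial[OF finW, of "p i" "\<Sum>r<i. p r"] by (simp add: add.commute)
  finally show ?case .
qed

lemma finite_dang: "finite (dang S0)"
  by (rule finite_subset[of _ "Pow B"]) (use finB in \<open>auto simp: dang_def\<close>)

text \<open>For a dangerous \<open>S\<close> with free member \<open>g\<close>, the other
  \<open>card (S - S0) - 1\<close> new blocks must be taken, each at cost \<open>l\<close>; the
  factor \<open>card (S - S0)\<close> counts the choices of \<open>g\<close>. Since \<open>W\<close>
  lies in \<open>S0\<close>, it is disjoint from the new blocks and its cost multiplies.\<close>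

lemma Ov_expectation:
  assumes S0: "S0 \<subseteq> B" and W: "W \<subseteq> S0" and l: "(\<Sum>r<i. p r) \<le> l"
    and Y: "(\<Sum>S\<in>dang S0. real (card (S - S0)) * l ^ (card (S - S0) - 1)) \<le> Y"
  shows "EE i (\<lambda>\<omega>. of_bool (W \<subseteq> Tk (snd \<omega>)) * real (card (Ov (snd \<omega>) S0))) \<le> l ^ card W * Y"
proof -
  have l0: "0 \<le> l" using l p_sum_nonneg[of i] by linarith
  have fin: "finite S" if "S \<subseteq> B" for S using that finB finite_subset by auto
  have "EE i (\<lambda>\<omega>. of_bool (W \<subseteq> Tk (snd \<omega>)) * real (card (Ov (snd \<omega>) S0)))
    \<le> EE i (\<lambda>\<omega>. \<Sum>S\<in>dang S0. \<Sum>g\<in>S - S0. of_bool (W \<union> (S - S0 - {g}) \<subseteq> Tk (snd \<omega>)))"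
  proof (rule EE_mono)
    fix \<omega>
    have "Ov (snd \<omega>) S0 \<subseteq> (\<Union>S\<in>dang S0. {g\<in>S - S0. S - S0 - {g} \<subseteq> Tk (snd \<omega>)})"
      by (auto simp: Ov_def)
    then have "card (Ov (snd \<omega>) S0) \<le> card (\<Union>S\<in>dang S0. {g\<in>S - S0. S - S0 - {g} \<subseteq> Tk (snd \<omega>)})"
      by (intro card_mono finite_UN_I) (use finite_dang fin in \<open>auto simp: dang_def\<close>)
    also have "\<dots> \<le> (\<Sum>S\<in>dang S0. card {g\<in>S - S0. S - S0 - {g} \<subseteq> Tk (snd \<omega>)})"
      by (rule card_UN_le[OF finite_dang])
    finally have "real (card (Ov (snd \<omega>) S0)) \<le> (\<Sum>S\<in>dang S0. real (card {g\<in>S - S0. S - S0 - {g} \<subseteq> Tk (snd \<omega>)}))"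
      by (simp only: of_nat_sum[symmetric] of_nat_le_iff)
    also have "\<dots> = (\<Sum>S\<in>dang S0. \<Sum>g\<in>S - S0. of_bool (S - S0 - {g} \<subseteq> Tk (snd \<omega>)))"
    proof (rule sum.cong[OF refl])
      fix S assume "S \<in> dang S0"
      then have "finite (S - S0)" using fin by (auto simp: dang_def)
      moreover have "{g\<in>S - S0. S - S0 - {g} \<subseteq> Tk (snd \<omega>)} = (S - S0) \<inter> {g. S - S0 - {g} \<subseteq> Tk (snd \<omega>)}"
        by blast
      ultimately show "real (card {g\<in>S - S0. S - S0 - {g} \<subseteq> Tk (snd \<omega>)})
        = (\<Sum>g\<in>S - S0. of_bool (S - S0 - {g} \<subseteq> Tk (snd \<omega>)))"
        by (simp only: sum_of_bool_eq)
    qed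
    finally have le: "real (card (Ov (snd \<omega>) S0)) \<le> (\<Sum>S\<in>dang S0. \<Sum>g\<in>S - S0. of_bool (S - S0 - {g} \<subseteq> Tk (snd \<omega>)))" .
    have "of_bool (W \<subseteq> Tk (snd \<omega>)) * real (card (Ov (snd \<omega>) S0))
      \<le> of_bool (W \<subseteq> Tk (snd \<omega>)) * (\<Sum>S\<in>dang S0. \<Sum>g\<in>S - S0. of_bool (S - S0 - {g} \<subseteq> Tk (snd \<omega>)))"
      by (intro mult_left_mono le) auto
    also have "\<dots> = (\<Sum>S\<in>dang S0. \<Sum>g\<in>S - S0. of_bool (W \<union> (S - S0 - {g}) \<subseteq> Tk (snd \<omega>)))"
      by (simp add: sum_distrib_left)
    finally show "of_bool (W \<subseteq> Tk (snd \<omega>)) * real (card (Ov (snd \<omega>) S0)) \<le> \<dots>" .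
  qed
  also have "\<dots> = (\<Sum>S\<in>dang S0. \<Sum>g\<in>S - S0. EE i (\<lambda>\<omega>. of_bool (W \<union> (S - S0 - {g}) \<subseteq> Tk (snd \<omega>))))"
    unfolding EE_sum ..
  also have "\<dots> \<le> (\<Sum>S\<in>dang S0. \<Sum>g\<in>S - S0. l ^ card W * l ^ (card (S - S0) - 1))"
  proof (intro sum_mono)
    fix S g assume S: "S \<in> dang S0" and g: "g \<in> S - S0"
    have SB: "S \<subseteq> B" using S by (auto simp: dang_def)
    have "card (W \<union> (S - S0 - {g})) = card W + card (S - S0 - {g})"
      using W fin[OF SB] finite_subset[OF W fin[OF S0]] by (intro card_Un_disjoint) auto
    also have "card (S - S0 - {g}) = card (S - S0) - 1"
      using g fin[OF SB] by simp
    finally have c: "card (W \<union> (S - S0 - {g})) = card W + (card (S - S0) - 1)" .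
    have "EE i (\<lambda>\<omega>. of_bool (W \<union> (S - S0 - {g}) \<subseteq> Tk (snd \<omega>)))
      \<le> (\<Sum>r<i. p r) ^ card (W \<union> (S - S0 - {g}))"
      using W S0 SB by (intro taken_le) auto
    also have "\<dots> \<le> l ^ card (W \<union> (S - S0 - {g}))"
      using l p_sum_nonneg by (intro power_mono) auto
    finally show "EE i (\<lambda>\<omega>. of_bool (W \<union> (S - S0 - {g}) \<subseteq> Tk (snd \<omega>))) \<le> l ^ card W * l ^ (card (S - S0) - 1)"
      by (simp only: c power_add)
  qed
  also have "\<dots> = l ^ card W * (\<Sum>S\<in>dang S0. real (card (S - S0)) * l ^ (card (S - S0) - 1))"
    by (simp add: sum_distrib_left mult_ac)
  also have "\<dots> \<le> l ^ card W * Y"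
    using Y l0 by (intro mult_left_mono) auto
  finally show ?thesis .
qed

section \<open>Lower bound for the availability of a block\<close>

definition exc :: "nat \<Rightarrow> 'v set + 'b \<Rightarrow> ('v set + 'b) set \<times> (nat \<times> 'b) set \<Rightarrow> bool" where
  "exc i x \<omega> \<longleftrightarrow> (1 - p i) ^ card (killers \<omega> x) < 1 - nom x"

text \<open>The nominal probability that an available block stays available for one round: its
  \<open>s\<close> points and the block itself must survive.\<close>

definition \<theta> :: real where "\<theta> = (1 - \<rho>) ^ s * (1 - \<kappa>)"

lemma \<theta>_bounds: "0 < \<theta>" "\<theta> \<le> 1"
  using \<rho>01 \<kappa>01 by (auto simp: \<theta>_def intro!: mult_pos_pos mult_le_one power_le_one)

lemma prod_objs: "e \<in> B \<Longrightarrow> (\<Prod>x\<in>objs e. 1 - nom x) = \<theta>"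
proof -
  assume e: "e \<in> B"
  have "(\<Prod>x\<in>objs e. 1 - nom x) = (1 - nom (Inr e)) * (\<Prod>x\<in>Inl ` J e. 1 - nom x)"
    unfolding objs_def using finJ[OF e] by (subst prod.insert) auto
  also have "(\<Prod>x\<in>Inl ` J e. 1 - nom x) = (1 - \<rho>) ^ s"
    using cardJ[OF e] by (subst prod.reindex) (auto simp: nom_def)
  finally show ?thesis by (simp add: \<theta>_def nom_def)
qed

lemma Av_iff: "e \<in> B \<Longrightarrow> e \<in> Av L \<longleftrightarrow> objs e \<subseteq> L"
  by (simp add: Av_def)

lemma surv_subset: "surv \<omega> Sel C \<subseteq> fst \<omega>"
  by (auto simp: surv_def)

lemma Av_surv: "Av (surv \<omega> Sel C) \<subseteq> Av (fst \<omega>)"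
  by (rule Av_mono[OF surv_subset])

text \<open>Without exceptional objects the nominal probabilities multiply. If an available
  \<open>e\<close> has an exceptional object, the subtracted sum is at least 1 and the claim becomes
  trivial for that state.\<close>

lemma avail_step:
  assumes e: "e \<in> B"
  shows "\<theta> * (EE i (\<lambda>\<omega>. of_bool (e \<in> Av (fst \<omega>))) -
      (\<Sum>x\<in>objs e. EE i (\<lambda>\<omega>. of_bool (e \<in> Av (fst \<omega>) \<and> exc i x \<omega>))))
    \<le> EE (Suc i) (\<lambda>\<omega>. of_bool (e \<in> Av (fst \<omega>)))"
proof -
  have "EE i (\<lambda>\<omega>. \<theta> * (of_bool (e \<in> Av (fst \<omega>)) - (\<Sum>x\<in>objs e. of_bool (e \<in> Av (fst \<omega>) \<and> exc i x \<omega>))))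
    \<le> EE (Suc i) (\<lambda>\<omega>. of_bool (e \<in> Av (fst \<omega>)))"
    unfolding EE.simps
  proof (rule EE_mono)
    fix \<omega>
    let ?r = "rnd i \<omega> (\<lambda>Sel C. of_bool (e \<in> Av (fst (nxt i \<omega> Sel C))))"
    have r0: "0 \<le> ?r" using rnd_mono[of "\<lambda>_ _. 0"] by (simp add: rnd_const)
    show "\<theta> * (of_bool (e \<in> Av (fst \<omega>)) - (\<Sum>x\<in>objs e. of_bool (e \<in> Av (fst \<omega>) \<and> exc i x \<omega>))) \<le> ?r"
    proof (cases "e \<in> Av (fst \<omega>) \<and> (\<forall>x\<in>objs e. \<not> exc i x \<omega>)")
      case True
      then have "(\<Prod>x\<in>objs e. 1 - nom x) \<le> rnd i \<omega> (\<lambda>Sel C. of_bool (objs e \<subseteq> surv \<omega> Sel C))"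
        using objs_subset_Obj[OF e] by (intro rnd_surv_lower) (auto simp: Av_def exc_def not_less)
      then show ?thesis using True e by (simp add: prod_objs Av_iff fst_nxt)
    next
      case False
      have "(of_bool (e \<in> Av (fst \<omega>)) :: real) \<le> (\<Sum>x\<in>objs e. of_bool (e \<in> Av (fst \<omega>) \<and> exc i x \<omega>))"
      proof (cases "e \<in> Av (fst \<omega>)")
        case True
        then obtain x where x: "x \<in> objs e" "exc i x \<omega>" using False by auto
        then have "1 \<le> (of_bool (e \<in> Av (fst \<omega>) \<and> exc i x \<omega>) :: real)" using True by simp
        also have "\<dots> \<le> (\<Sum>x\<in>objs e. of_bool (e \<in> Av (fst \<omega>) \<and> exc i x \<omega>))"
          using x finite_objs[OF e] by (intro member_le_sum) auto
        finally show ?thesis by (simp only: True of_bool_eq simp_thms)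
      qed (simp add: sum_nonneg)
      then have "\<theta> * (of_bool (e \<in> Av (fst \<omega>)) - (\<Sum>x\<in>objs e. of_bool (e \<in> Av (fst \<omega>) \<and> exc i x \<omega>))) \<le> 0"
        using \<theta>_bounds by (intro mult_nonneg_nonpos) auto
      then show ?thesis using r0 by linarith
    qed
  qed
  then show ?thesis by (simp only: EE_cmult EE_diff EE_sum)
qed

lemma EE_nonneg: "(\<And>\<omega>. 0 \<le> f \<omega>) \<Longrightarrow> 0 \<le> EE i f"
  using EE_mono[of i "\<lambda>_. 0" f] by (simp add: EE_const)

text \<open>Dividing by \<open>\<theta> ^ r\<close> measures the exceptional events of round
  \<open>r\<close> against the nominal chance of being available by then, so relative losses simply
  add up.\<close>

lemma avail_lower:
  assumes e: "e \<in> B"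
  shows "\<theta> ^ i * (1 - (\<Sum>r<i. (\<Sum>x\<in>objs e. EE r (\<lambda>\<omega>. of_bool (e \<in> Av (fst \<omega>) \<and> exc r x \<omega>))) / \<theta> ^ r))
    \<le> EE i (\<lambda>\<omega>. of_bool (e \<in> Av (fst \<omega>)))"
proof (induction i)
  case 0
  then show ?case using e objs_subset_Obj by (simp add: Av_def)
next
  case (Suc i)
  let ?x = "\<lambda>r. \<Sum>x\<in>objs e. EE r (\<lambda>\<omega>. of_bool (e \<in> Av (fst \<omega>) \<and> exc r x \<omega>))"
  have "\<theta> ^ Suc i * (1 - (\<Sum>r<Suc i. ?x r / \<theta> ^ r)) = \<theta> * (\<theta> ^ i * (1 - (\<Sum>r<i. ?x r / \<theta> ^ r)) - ?x i)"
    using \<theta>_bounds by (simp add: field_simps)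
  also have "\<dots> \<le> \<theta> * (EE i (\<lambda>\<omega>. of_bool (e \<in> Av (fst \<omega>))) - ?x i)"
    using Suc \<theta>_bounds by (intro mult_left_mono) auto
  also have "\<dots> \<le> EE (Suc i) (\<lambda>\<omega>. of_bool (e \<in> Av (fst \<omega>)))"
    by (rule avail_step[OF e])
  finally show ?case .
qed

lemma prod_nom_le:
  assumes "finite Y" "Y' \<subseteq> Y"
  shows "(\<Prod>x\<in>Y. 1 - nom x) \<le> (\<Prod>x\<in>Y'. 1 - nom x)"
proof -
  have fin: "finite Y'" using assms finite_subset by auto
  have "(\<Prod>x\<in>Y. 1 - nom x) = (\<Prod>x\<in>Y - Y'. 1 - nom x) * (\<Prod>x\<in>Y'. 1 - nom x)"
    using assms by (intro prod.subset_diff) auto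
  also have "\<dots> \<le> 1 * (\<Prod>x\<in>Y'. 1 - nom x)"
    using nom01 by (intro mult_right_mono prod_le_1 prod_nonneg) (auto simp: less_imp_le)
  finally show ?thesis by simp
qed

section \<open>Joint availability of blocks through one point\<close>

definition star :: "'v set \<Rightarrow> 'b set" where
  "star q = {e \<in> B. q \<in> J e}"

definition Ovs :: "(nat \<times> 'b) set \<Rightarrow> 'b set \<Rightarrow> 'b set" where
  "Ovs H R = (\<Union>e\<in>R. \<Union>f\<in>R. Ov H {e, f}) \<union> R"

lemma finite_Ov: "finite (Ov H S0)"
  by (rule finite_subset[OF _ finB]) (auto simp: Ov_def)

text \<open>Blocks through a common point \<open>q\<close> that are otherwise vertex disjoint survive almost independently.\<close>

lemma generic_step:
  assumes R: "R \<subseteq> star q" "R \<noteq> {}" and gen: "\<And>e f. e \<in> R \<Longrightarrow> f \<in> R \<Longrightarrow> e \<noteq> f \<Longrightarrow> V e \<inter> V f = q"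
    and F: "1 \<le> F * (1 - p i) ^ (card R * (s + 1) * t)"
  shows "EE (Suc i) (\<lambda>\<omega>. of_bool (R \<subseteq> Av (fst \<omega>)))
    \<le> F * ((1 - \<rho>) ^ (s - 1) * (1 - \<kappa>)) ^ card R * EE i (\<lambda>\<omega>. of_bool (R \<subseteq> Av (fst \<omega>)))
      + EE i (\<lambda>\<omega>. of_bool (t < card (Ovs (snd \<omega>) R)))"
proof -
  define \<nu> where "\<nu> = ((1 - \<rho>) ^ (s - 1) * (1 - \<kappa>)) ^ card R"
  have RB: "R \<subseteq> B" using R by (auto simp: star_def)
  have finR: "finite R" using RB finB finite_subset by auto
  define Y where "Y = (\<Union>e\<in>R. objs e)"
  have finY: "finite Y" using RB finR finite_objs by (auto simp: Y_def)
  have YO: "Y \<subseteq> Obj" using RB objs_subset_Obj by (auto simp: Y_def)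
  have qJ: "q \<in> J e" if "e \<in> R" for e using that R by (auto simp: star_def)
  have q2: "card q = 2" using R qJ card2J RB by blast
  have F0: "0 < F"
  proof -
    have "0 < F * (1 - p i) ^ (card R * (s + 1) * t)" using F by linarith
    then show ?thesis using p01[of i] by (simp add: zero_less_mult_iff)
  qed
  have \<nu>0: "0 \<le> \<nu>" using \<rho>01 \<kappa>01 by (auto simp: \<nu>_def)
  have prodY: "(\<Prod>x\<in>Y. 1 - nom x) \<le> \<nu>"
  proof -
    \<comment> \<open>The common point \<open>q\<close> is dropped: its factor would only sharpen
      the bound, and without it the object sets are disjoint. What remains is the survival of the
      blocks as if \<open>q\<close> were alive.\<close>
    have "(\<Prod>x\<in>Y. 1 - nom x) \<le> (\<Prod>x\<in>(\<Union>e\<in>R. objs e - {Inl q}). 1 - nom x)"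
      using finY by (intro prod_nom_le) (auto simp: Y_def)
    also have "\<dots> = (\<Prod>e\<in>R. \<Prod>x\<in>objs e - {Inl q}. 1 - nom x)"
    proof (rule prod.UNION_disjoint[OF finR])
      show "\<forall>e\<in>R. finite (objs e - {Inl q})" using RB finite_objs by auto
      show "\<forall>e\<in>R. \<forall>f\<in>R. e \<noteq> f \<longrightarrow> (objs e - {Inl q}) \<inter> (objs f - {Inl q}) = {}"
      proof (intro ballI impI)
        fix e f assume ef: "e \<in> R" "f \<in> R" "e \<noteq> f"
        have "r = q" if "r \<in> J e" "r \<in> J f" for r
        proof -
          have "r \<subseteq> q" using subJ[of e r] subJ[of f r] that ef RB gen[OF ef] by blast
          moreover have "card r = 2" using card2J[of e r] that ef RB by auto
          ultimately show ?thesis using q2 by (metis card.infinite card_subset_eq zero_neq_numeral)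
        qed
        then show "(objs e - {Inl q}) \<inter> (objs f - {Inl q}) = {}"
          using ef by (auto simp: objs_def)
      qed
    qed
    also have "\<dots> = (\<Prod>e\<in>R. (1 - \<rho>) ^ (s - 1) * (1 - \<kappa>))"
    proof (rule prod.cong[OF refl])
      fix e assume e: "e \<in> R"
      have eB: "e \<in> B" using e RB by auto
      have "objs e - {Inl q} = insert (Inr e) (Inl ` (J e - {q}))" by (auto simp: objs_def)
      then have "(\<Prod>x\<in>objs e - {Inl q}. 1 - nom x) = (1 - \<kappa>) * (\<Prod>x\<in>Inl ` (J e - {q}). 1 - nom x)"
        using finJ[OF eB] by (subst \<open>objs e - {Inl q} = _\<close>, subst prod.insert) (auto simp: nom_def)
      also have "(\<Prod>x\<in>Inl ` (J e - {q}). 1 - nom x) = (1 - \<rho>) ^ (s - 1)"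
        using cardJ[OF eB] qJ[OF e] finJ[OF eB] by (subst prod.reindex) (auto simp: nom_def)
      finally show "(\<Prod>x\<in>objs e - {Inl q}. 1 - nom x) = (1 - \<rho>) ^ (s - 1) * (1 - \<kappa>)" by simp
    qed
    finally show ?thesis by (simp add: \<nu>_def)
  qed
  have cardY: "card Y \<le> card R * (s + 1)"
  proof -
    have "card Y \<le> (\<Sum>e\<in>R. card (objs e))" unfolding Y_def by (rule card_UN_le[OF finR])
    also have "\<dots> \<le> (\<Sum>e\<in>R. s + 1)"
    proof (rule sum_mono)
      fix e assume "e \<in> R"
      then have "e \<in> B" using RB by auto
      then show "card (objs e) \<le> s + 1"
        unfolding objs_def using finJ cardJ by (simp add: card_insert_if card_image)
    qed
    finally show ?thesis by simp
  qed
  have "EE (Suc i) (\<lambda>\<omega>. of_bool (R \<subseteq> Av (fst \<omega>)))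
    \<le> EE i (\<lambda>\<omega>. F * \<nu> * of_bool (R \<subseteq> Av (fst \<omega>)) + of_bool (t < card (Ovs (snd \<omega>) R)))"
    unfolding EE.simps
  proof (rule EE_mono)
    fix \<omega> :: "('v set + 'b) set \<times> (nat \<times> 'b) set"
    obtain L H where \<omega>: "\<omega> = (L, H)" by (cases \<omega>)
    have iff: "R \<subseteq> Av (fst (nxt i \<omega> Sel C)) \<longleftrightarrow> Y \<subseteq> surv \<omega> Sel C" for Sel C
      using RB by (auto simp: Y_def Av_def fst_nxt)
    let ?r = "rnd i \<omega> (\<lambda>Sel C. of_bool (R \<subseteq> Av (fst (nxt i \<omega> Sel C))))"
    have r1: "?r \<le> 1" using rnd_mono[of _ "\<lambda>_ _. 1"] by (simp add: rnd_const)
    have nn: "0 \<le> F * \<nu> * of_bool (R \<subseteq> Av (fst \<omega>))" using F0 \<nu>0 by simp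
    show "?r \<le> F * \<nu> * of_bool (R \<subseteq> Av (fst \<omega>)) + of_bool (t < card (Ovs (snd \<omega>) R))"
    proof (cases "t < card (Ovs (snd \<omega>) R)")
      case True
      then show ?thesis using r1 nn by simp
    next
      case small: False
      show ?thesis
      proof (cases "R \<subseteq> Av (fst \<omega>)")
        case False
        then have "\<not> R \<subseteq> Av (fst (nxt i \<omega> Sel C))" for Sel C
          unfolding fst_nxt using Av_surv[of \<omega> Sel C] by blast
        then have "?r = 0" by (simp add: rnd_const)
        then show ?thesis using nn by simp
      next
        case True
        then have YL: "Y \<subseteq> fst \<omega>" by (auto simp: Y_def Av_def)
        have "?r = rnd i \<omega> (\<lambda>Sel C. of_bool ({} \<subseteq> Sel \<and> Y \<subseteq> surv \<omega> Sel C))"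
          unfolding iff by simp
        also have "\<dots> \<le> p i ^ card ({} :: 'b set) * (\<Prod>x\<in>Y. 1 - nom x) / (1 - p i) ^ (card Y * t)"
        proof (rule rnd_surv_upper[OF _ YO YL, where Z = "Ovs (snd \<omega>) R"])
          show "finite (Ovs (snd \<omega>) R)" using finR finite_Ov by (auto simp: Ovs_def)
          show "card (Ovs (snd \<omega>) R) \<le> t" using small by simp
          fix x y assume xy: "x \<in> Y" "y \<in> Y" "x \<noteq> y"
          then obtain e f where ef: "e \<in> R" "f \<in> R" "x \<in> objs e" "y \<in> objs f" by (auto simp: Y_def)
          have "tight {e, f}"
            using ef RB gen[of e f] q2 by (intro pair_tight) auto
          from killers_overlap[OF this _ _ ef(3,4) xy(3), of L H]
          show "killers \<omega> x \<inter> killers \<omega> y \<subseteq> Ovs (snd \<omega>) R"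
            using ef unfolding \<omega> Ovs_def by auto
        qed simp
        also have "\<dots> \<le> \<nu> / (1 - p i) ^ (card Y * t)"
          using prodY p01[of i] by (simp add: divide_right_mono)
        also have "\<dots> \<le> F * \<nu>"
        proof -
          have "card Y * t \<le> card R * (s + 1) * t" using cardY by simp
          then have "(1 - p i) ^ (card R * (s + 1) * t) \<le> (1 - p i) ^ (card Y * t)"
            using p01[of i] by (intro power_decreasing) auto
          then have "1 \<le> F * (1 - p i) ^ (card Y * t)"
            using F F0 mult_left_mono[of "(1 - p i) ^ (card R * (s + 1) * t)" "(1 - p i) ^ (card Y * t)" F] by linarith
          then have "\<nu> * 1 \<le> \<nu> * (F * (1 - p i) ^ (card Y * t))" using \<nu>0 by (intro mult_left_mono)
          then show ?thesis using p01[of i] by (simp add: field_simps)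
        qed
        finally show ?thesis using True by simp
      qed
    qed
  qed
  also have "\<dots> = F * \<nu> * EE i (\<lambda>\<omega>. of_bool (R \<subseteq> Av (fst \<omega>))) + EE i (\<lambda>\<omega>. of_bool (t < card (Ovs (snd \<omega>) R)))"
    by (simp only: EE_add EE_cmult)
  finally show ?thesis by (simp add: \<nu>_def)
qed

text \<open>Markov's inequality: any two members of \<open>R\<close>, equal or not, form a tight
  set, so each overlap count has mean at most \<open>Y\<close>.\<close>

lemma Ovs_expectation:
  assumes R: "R \<subseteq> star q" and gen: "\<And>e f. e \<in> R \<Longrightarrow> f \<in> R \<Longrightarrow> e \<noteq> f \<Longrightarrow> V e \<inter> V f = q"
    and l: "(\<Sum>r<i. p r) \<le> l"
    and Y: "\<And>S0. tight S0 \<Longrightarrow> card S0 \<le> 8 \<Longrightarrow>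
      (\<Sum>S\<in>dang S0. real (card (S - S0)) * l ^ (card (S - S0) - 1)) \<le> Y"
    and t: "0 < t"
  shows "EE i (\<lambda>\<omega>. of_bool (t < card (Ovs (snd \<omega>) R))) \<le> (real (card R)^2 * Y + card R) / t"
proof -
  have RB: "R \<subseteq> B" using R by (auto simp: star_def)
  have finR: "finite R" using RB finB finite_subset by auto
  have "EE i (\<lambda>\<omega>. of_bool (t < card (Ovs (snd \<omega>) R)))
    \<le> EE i (\<lambda>\<omega>. (1 / t) * ((\<Sum>e\<in>R. \<Sum>f\<in>R. real (card (Ov (snd \<omega>) {e, f}))) + card R))"
  proof (rule EE_mono)
    fix \<omega>
    have "card (Ovs (snd \<omega>) R) \<le> card (\<Union>e\<in>R. \<Union>f\<in>R. Ov (snd \<omega>) {e, f}) + card R"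
      unfolding Ovs_def by (rule card_Un_le)
    also have "card (\<Union>e\<in>R. \<Union>f\<in>R. Ov (snd \<omega>) {e, f}) \<le> (\<Sum>e\<in>R. card (\<Union>f\<in>R. Ov (snd \<omega>) {e, f}))"
      by (rule card_UN_le[OF finR])
    also have "\<dots> \<le> (\<Sum>e\<in>R. \<Sum>f\<in>R. card (Ov (snd \<omega>) {e, f}))"
      by (intro sum_mono card_UN_le[OF finR])
    finally have "real (card (Ovs (snd \<omega>) R)) \<le> (\<Sum>e\<in>R. \<Sum>f\<in>R. real (card (Ov (snd \<omega>) {e, f}))) + card R"
      by (simp only: of_nat_sum[symmetric] of_nat_add[symmetric] of_nat_le_iff)
    moreover have "(of_bool (t < card (Ovs (snd \<omega>) R)) :: real) \<le> (1 / t) * card (Ovs (snd \<omega>) R)"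
      using t by (auto simp: field_simps)
    ultimately show "of_bool (t < card (Ovs (snd \<omega>) R)) \<le> (1 / t) * ((\<Sum>e\<in>R. \<Sum>f\<in>R. real (card (Ov (snd \<omega>) {e, f}))) + card R)"
      using t mult_left_mono[of "real (card (Ovs (snd \<omega>) R))" _ "1 / t"] by (smt (verit) of_nat_0_less_iff zero_less_divide_1_iff)
  qed
  also have "\<dots> = (1 / t) * ((\<Sum>e\<in>R. \<Sum>f\<in>R. EE i (\<lambda>\<omega>. real (card (Ov (snd \<omega>) {e, f})))) + card R)"
    by (simp only: EE_cmult EE_add EE_sum EE_const)
  also have "\<dots> \<le> (1 / t) * ((\<Sum>e\<in>R. \<Sum>f\<in>R. Y) + card R)"
  proof (intro mult_left_mono add_mono sum_mono order_refl)
    fix e f assume ef: "e \<in> R" "f \<in> R"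
    have q2: "card q = 2" using ef(1) R card2J by (auto simp: star_def)
    have t2: "tight {e, f}" using ef RB gen[of e f] q2 by (intro pair_tight) auto
    have "card {e, f} \<le> 8" by (rule order_trans[OF card_insert_le_m1[of 2]]) auto
    from Ov_expectation[OF tightD(1)[OF t2], of "{}" i l Y] Y[OF t2 this] l
    show "EE i (\<lambda>\<omega>. real (card (Ov (snd \<omega>) {e, f}))) \<le> Y" by simp
  qed (use t in auto)
  also have "\<dots> = (real (card R)^2 * Y + card R) / t"
    by (simp add: power2_eq_square)
  finally show ?thesis .
qed

text \<open>\<open>F\<close> absorbs the overlap correction of one round and accumulates as a power;
  the probabilities that the overlap bound \<open>t\<close> fails are added.\<close>

lemma generic_avail:
  assumes R: "R \<subseteq> star q" "R \<noteq> {}" and gen: "\<And>e f. e \<in> R \<Longrightarrow> f \<in> R \<Longrightarrow> e \<noteq> f \<Longrightarrow> V e \<inter> V f = q"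
    and F: "\<And>i. i < T \<Longrightarrow> 1 \<le> F * (1 - p i) ^ (card R * (s + 1) * t)" and F1: "1 \<le> F"
    and l: "(\<Sum>r<T. p r) \<le> l"
    and Y: "\<And>S0. tight S0 \<Longrightarrow> card S0 \<le> 8 \<Longrightarrow>
      (\<Sum>S\<in>dang S0. real (card (S - S0)) * l ^ (card (S - S0) - 1)) \<le> Y"
    and t: "0 < t" and iT: "i \<le> T" and Y0: "0 \<le> Y"
  shows "EE i (\<lambda>\<omega>. of_bool (R \<subseteq> Av (fst \<omega>)))
    \<le> F ^ i * ((((1 - \<rho>) ^ (s - 1) * (1 - \<kappa>)) ^ i) ^ card R + i * ((real (card R)^2 * Y + card R) / t))"
  using iT
proof (induction i)
  case 0
  then show ?case by simp
next
  case (Suc i)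
  define a where "a = (1 - \<rho>) ^ (s - 1) * (1 - \<kappa>)"
  define \<eta> where "\<eta> = (real (card R)^2 * Y + card R) / t"
  have \<eta>0: "0 \<le> \<eta>" using Y0 by (simp add: \<eta>_def)
  have a01: "0 \<le> a" "a \<le> 1" using \<rho>01 \<kappa>01 by (auto simp: a_def intro!: mult_le_one power_le_one)
  have l': "(\<Sum>r<i. p r) \<le> l"
  proof -
    have "(\<Sum>r<i. p r) \<le> (\<Sum>r<T. p r)" using Suc.prems p01 by (intro sum_mono2) (auto simp: less_imp_le)
    then show ?thesis using l by linarith
  qed
  have ov: "EE i (\<lambda>\<omega>. of_bool (t < card (Ovs (snd \<omega>) R))) \<le> \<eta>"
    unfolding \<eta>_def by (rule Ovs_expectation[OF R(1) gen l' Y t]) auto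
  have "EE (Suc i) (\<lambda>\<omega>. of_bool (R \<subseteq> Av (fst \<omega>)))
    \<le> F * a ^ card R * EE i (\<lambda>\<omega>. of_bool (R \<subseteq> Av (fst \<omega>))) + EE i (\<lambda>\<omega>. of_bool (t < card (Ovs (snd \<omega>) R)))"
    unfolding a_def using Suc.prems by (intro generic_step[OF R gen] F) auto
  also have "\<dots> \<le> F * a ^ card R * (F ^ i * ((a ^ i) ^ card R + i * \<eta>)) + \<eta>"
    using Suc ov F1 a01 by (intro add_mono mult_left_mono) (auto simp: a_def \<eta>_def)
  also have "\<dots> = F ^ Suc i * ((a ^ Suc i) ^ card R + a ^ card R * (i * \<eta>)) + \<eta>"
    by (simp add: algebra_simps power_mult_distrib)
  also have "\<dots> \<le> F ^ Suc i * ((a ^ Suc i) ^ card R + 1 * (i * \<eta>)) + F ^ Suc i * \<eta>"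
  proof (intro add_mono mult_left_mono mult_right_mono)
    show "a ^ card R \<le> 1" using a01 by (rule power_le_one)
    show "\<eta> \<le> F ^ Suc i * \<eta>" using F1 \<eta>0 one_le_power[OF F1, of "Suc i"] mult_right_mono[of 1 "F ^ Suc i" \<eta>] by simp
  qed (use \<eta>0 F1 in auto)
  also have "\<dots> = F ^ Suc i * ((a ^ Suc i) ^ card R + Suc i * \<eta>)"
    by (simp add: algebra_simps)
  finally show ?case unfolding a_def \<eta>_def .
qed

text \<open>If \<open>\<mu>\<close> is the expected future selection mass of an available block, then \<open>Psi\<close> estimates the
  number of conflicts through \<open>e\<close> that eventually threaten it; it is nearly a supermartingale.\<close>

definition wt :: "real \<Rightarrow> ('v set + 'b) set \<times> (nat \<times> 'b) set \<Rightarrow> 'b \<Rightarrow> real" where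
  "wt \<mu> \<omega> f = (if f \<in> Tk (snd \<omega>) then 1 else if f \<in> Av (fst \<omega>) then \<mu> else 0)"

definition Psi :: "real \<Rightarrow> 'b \<Rightarrow> ('v set + 'b) set \<times> (nat \<times> 'b) set \<Rightarrow> real" where
  "Psi \<mu> e \<omega> = of_bool (e \<in> Av (fst \<omega>)) * (\<Sum>c\<in>{c \<in> conf. e \<in> c}. \<Prod>f\<in>c - {e}. wt \<mu> \<omega> f)"

lemma finite_conf: "finite conf"
  by (rule finite_subset[of _ "Pow B"]) (use finB in \<open>auto simp: conf_def\<close>)

lemma wt_nonneg: "0 \<le> \<mu> \<Longrightarrow> 0 \<le> wt \<mu> \<omega> f"
  by (simp add: wt_def)

text \<open>Two members of a conflict form a proper part of it, hence have excess at least 3 and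
  share at most one vertex.\<close>

lemma conf_objs_disjoint:
  assumes c: "c \<in> conf" "f \<in> c" "g \<in> c" "f \<noteq> g"
  shows "objs f \<inter> objs g = {}"
proof -
  note cD = confD[OF c(1)]
  have B: "f \<in> B" "g \<in> B" using c cD by auto
  have "card {f, g} = 2" using c by simp
  then have "{f, g} \<subset> c" using c cD(2) by auto
  then have "3 \<le> df {f, g}" using cD(6)[of "{f, g}"] c(4) by simp
  then have le: "card (V f \<inter> V g) \<le> 1"
    using df_insert[of "{g}" f] B c(4) df_single[OF B(2)] by simp
  have False if "q \<in> J f" "q \<in> J g" for q
  proof -
    have "card q \<le> card (V f \<inter> V g)"
      using subJ[OF B(1) that(1)] subJ[OF B(2) that(2)] finV[OF B(1)] by (intro card_mono) auto
    then show False using card2J[OF B(1) that(1)] le by simp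
  qed
  then show ?thesis using c(4) by (auto simp: objs_def)
qed

lemma card_objs: "e \<in> B \<Longrightarrow> card (objs e) \<le> s + 1"
  unfolding objs_def using finJ cardJ by (simp add: card_insert_if card_image)

text \<open>After the round, an undecided block of \<open>c\<close> either is taken, with
  probability \<open>p i\<close> and weight 1, or is still available, with nominal probability
  \<theta> and weight \<mu>'; hence the assumption
  \<open>p i + \<theta> * \<mu>' \<le> \<mu>\<close>. The factor \<theta> in front is the survival
  of \<open>e\<close>. If the overlap bound \<open>t\<close> fails, survival is estimated by 1,
  which leads to the weight \<open>lm\<close>.\<close>

lemma psi_term_step:
  assumes inv: "inv i \<omega>" and c: "c \<in> conf" "e \<in> c" and eAv: "e \<in> Av (fst \<omega>)"
    and lam: "0 \<le> \<mu>'" "p i + \<theta> * \<mu>' \<le> \<mu>" and F: "1 \<le> F * (1 - p i) ^ (8 * (s + 1) * t)"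
    and lm: "p i + \<mu>' \<le> lm"
  shows "rnd i \<omega> (\<lambda>Sel C. of_bool (e \<in> Av (fst (nxt i \<omega> Sel C))) * (\<Prod>f\<in>c - {e}. wt \<mu>' (nxt i \<omega> Sel C) f))
    \<le> \<theta> * F * (\<Prod>f\<in>c - {e}. wt \<mu> \<omega> f)
      + of_bool (t < card (Ov (snd \<omega>) c \<union> c)) * (\<Prod>f\<in>c - {e}. wt lm \<omega> f)"
proof -
  note cD = confD[OF c(1)]
  obtain L H where \<omega>: "\<omega> = (L, H)" by (cases \<omega>)
  define K where "K = c - {e}"
  have finK: "finite K" using cD(5) by (simp add: K_def)
  \<comment> \<open>The undecided members of the conflict; the term vanishes after the round unless
    all of them are available now.\<close>
  define D where "D = {f \<in> K. f \<notin> Tk (snd \<omega>)}"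
  have finD: "finite D" using finK by (simp add: D_def)
  have DB: "D \<subseteq> B" using cD(1) by (auto simp: D_def K_def)
  have q: "0 < p i" "p i < 1" using p01 by auto
  have F0: "0 < F"
  proof -
    have "0 < F * (1 - p i) ^ (8 * (s + 1) * t)" using F by linarith
    then show ?thesis using q by (simp add: zero_less_mult_iff)
  qed
  have lam0: "0 \<le> \<mu>" using lam q mult_nonneg_nonneg[of \<theta> \<mu>'] \<theta>_bounds by linarith
  have lm0: "0 \<le> lm" using lm lam q by linarith
  let ?l = "rnd i \<omega> (\<lambda>Sel C. of_bool (e \<in> Av (fst (nxt i \<omega> Sel C))) * (\<Prod>f\<in>c - {e}. wt \<mu>' (nxt i \<omega> Sel C) f))"
  have prod_wt: "(\<Prod>f\<in>K. wt \<mu> \<omega> f) = \<mu> ^ card D" if "D \<subseteq> Av (fst \<omega>)" for \<mu>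
  proof -
    have "(\<Prod>f\<in>K. wt \<mu> \<omega> f) = (\<Prod>f\<in>K. if f \<in> D then \<mu> else 1)"
      using that by (intro prod.cong) (auto simp: wt_def D_def)
    also have "\<dots> = (\<Prod>f\<in>D. \<mu>)"
      using prod.inter_restrict[OF finK, of "\<lambda>_. \<mu>" D] by (simp add: Int_absorb1 D_def Int_def conj_commute)
    finally show ?thesis by simp
  qed
  show ?thesis
  proof (cases "D \<subseteq> Av (fst \<omega>)")
    case False
    then obtain f where f: "f \<in> K" "f \<notin> Tk (snd \<omega>)" "f \<notin> Av (fst \<omega>)" by (auto simp: D_def)
    have "wt \<mu>' (nxt i \<omega> Sel C) f = 0" for Sel C
    proof -
      have "f \<notin> Av (fst (nxt i \<omega> Sel C))" using Av_surv f(3) unfolding fst_nxt by blast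
      moreover have "f \<notin> Tk (snd (nxt i \<omega> Sel C))" using f by (auto simp: snd_nxt Tk_Un)
      ultimately show ?thesis by (simp add: wt_def)
    qed
    then have "(\<Prod>f\<in>c - {e}. wt \<mu>' (nxt i \<omega> Sel C) f) = 0" for Sel C
      using f(1) finK by (auto simp: K_def intro!: prod_zero)
    then have "?l = 0" by (simp add: rnd_const)
    moreover have "0 \<le> \<theta> * F * (\<Prod>f\<in>c - {e}. wt \<mu> \<omega> f)"
      using \<theta>_bounds F0 lam0 by (intro mult_nonneg_nonneg prod_nonneg wt_nonneg ballI) auto
    moreover have "0 \<le> of_bool (t < card (Ov (snd \<omega>) c \<union> c)) * (\<Prod>f\<in>c - {e}. wt lm \<omega> f)"
      using lm0 by (intro mult_nonneg_nonneg prod_nonneg wt_nonneg ballI) auto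
    ultimately show ?thesis by linarith
  next
    case True
    define YY where "YY = (\<lambda>G. \<Union>f\<in>insert e (D - G). objs f)"
    have wt_le: "wt \<mu>' (nxt i \<omega> Sel C) f \<le> of_bool (f \<in> Sel) + \<mu>' * of_bool (objs f \<subseteq> surv \<omega> Sel C)"
      if "f \<in> D" for f Sel C
    proof -
      have "f \<in> Sel" if "f \<in> Tk (snd (nxt i \<omega> Sel C))"
        using that \<open>f \<in> D\<close> by (auto simp: snd_nxt Tk_Un D_def)
      moreover have "f \<in> Av (surv \<omega> Sel C) \<longleftrightarrow> objs f \<subseteq> surv \<omega> Sel C"
        using that DB by (intro Av_iff) auto
      ultimately show ?thesis using lam(1) by (auto simp: wt_def fst_nxt)
    qed
    \<comment> \<open>The product over \<open>D\<close> is expanded: \<open>G\<close> is the part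
      selected now, and the rest must survive together with \<open>e\<close>.\<close>
    have pt: "of_bool (e \<in> Av (fst (nxt i \<omega> Sel C))) * (\<Prod>f\<in>c - {e}. wt \<mu>' (nxt i \<omega> Sel C) f)
      \<le> (\<Sum>G\<in>Pow D. \<mu>' ^ card (D - G) * of_bool (G \<subseteq> Sel \<and> YY G \<subseteq> surv \<omega> Sel C))" for Sel C
    proof -
      let ?W = "wt \<mu>' (nxt i \<omega> Sel C)"
      have "(\<Prod>f\<in>c - {e}. ?W f) = (\<Prod>f\<in>K - D. ?W f) * (\<Prod>f\<in>D. ?W f)"
        unfolding K_def[symmetric] using finK by (intro prod.subset_diff) (auto simp: D_def)
      also have "(\<Prod>f\<in>K - D. ?W f) = 1"
        by (intro prod.neutral) (auto simp: wt_def D_def snd_nxt Tk_Un)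
      also have "1 * (\<Prod>f\<in>D. ?W f) \<le> (\<Prod>f\<in>D. of_bool (f \<in> Sel) + \<mu>' * of_bool (objs f \<subseteq> surv \<omega> Sel C))"
        unfolding mult_1 by (intro prod_mono conjI wt_nonneg wt_le lam(1))
      also have "\<dots> = (\<Sum>G\<in>Pow D. (\<Prod>f\<in>G. of_bool (f \<in> Sel)) * (\<Prod>f\<in>D - G. \<mu>' * of_bool (objs f \<subseteq> surv \<omega> Sel C)))"
        by (rule prod_add[OF finD])
      also have "\<dots> = (\<Sum>G\<in>Pow D. \<mu>' ^ card (D - G) * of_bool (G \<subseteq> Sel \<and> (\<Union>f\<in>D - G. objs f) \<subseteq> surv \<omega> Sel C))"
      proof (rule sum.cong[OF refl])
        fix G assume "G \<in> Pow D"
        then have fin: "finite G" "finite (D - G)" using finD finite_subset by auto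
        have 1: "(\<Prod>f\<in>G. of_bool (f \<in> Sel) :: real) = of_bool (G \<subseteq> Sel)"
          using fin(1) by (auto simp: of_bool_def intro!: prod_zero prod.neutral)
        have 2: "(\<Prod>f\<in>D - G. of_bool (objs f \<subseteq> surv \<omega> Sel C) :: real) = of_bool ((\<Union>f\<in>D - G. objs f) \<subseteq> surv \<omega> Sel C)"
          using fin(2) by (auto simp: of_bool_def UN_subset_iff intro!: prod_zero prod.neutral)
        show "(\<Prod>f\<in>G. of_bool (f \<in> Sel)) * (\<Prod>f\<in>D - G. \<mu>' * of_bool (objs f \<subseteq> surv \<omega> Sel C))
          = \<mu>' ^ card (D - G) * of_bool (G \<subseteq> Sel \<and> (\<Union>f\<in>D - G. objs f) \<subseteq> surv \<omega> Sel C)"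
          unfolding prod.distrib 1 2 prod_constant of_bool_conj by (simp only: mult_ac)
      qed
      finally have "of_bool (e \<in> Av (fst (nxt i \<omega> Sel C))) * (\<Prod>f\<in>c - {e}. ?W f)
        \<le> of_bool (e \<in> Av (fst (nxt i \<omega> Sel C))) * \<dots>"
        by (intro mult_left_mono) auto
      also have "\<dots> = (\<Sum>G\<in>Pow D. \<mu>' ^ card (D - G) * of_bool (G \<subseteq> Sel \<and> YY G \<subseteq> surv \<omega> Sel C))"
        unfolding sum_distrib_left
      proof (rule sum.cong[OF refl])
        fix G
        have "e \<in> B" using c cD by auto
        then have "e \<in> Av (fst (nxt i \<omega> Sel C)) \<longleftrightarrow> objs e \<subseteq> surv \<omega> Sel C"
          by (simp add: Av_iff fst_nxt)
        moreover have "YY G \<subseteq> surv \<omega> Sel C \<longleftrightarrow> objs e \<subseteq> surv \<omega> Sel C \<and> (\<Union>f\<in>D - G. objs f) \<subseteq> surv \<omega> Sel C"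
          by (auto simp: YY_def)
        ultimately show "of_bool (e \<in> Av (fst (nxt i \<omega> Sel C))) *
           (\<mu>' ^ card (D - G) * of_bool (G \<subseteq> Sel \<and> (\<Union>f\<in>D - G. objs f) \<subseteq> surv \<omega> Sel C))
          = \<mu>' ^ card (D - G) * of_bool (G \<subseteq> Sel \<and> YY G \<subseteq> surv \<omega> Sel C)"
          by simp
      qed
      finally show ?thesis .
    qed
    have l_le: "?l \<le> (\<Sum>G\<in>Pow D. \<mu>' ^ card (D - G) * rnd i \<omega> (\<lambda>Sel C. of_bool (G \<subseteq> Sel \<and> YY G \<subseteq> surv \<omega> Sel C)))"
      using rnd_mono[OF pt, of i \<omega>] unfolding rnd_sum rnd_cmult .
    show ?thesis
    proof (cases "t < card (Ov (snd \<omega>) c \<union> c)")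
      case big: True
      have "?l \<le> (\<Sum>G\<in>Pow D. \<mu>' ^ card (D - G) * p i ^ card G)"
      proof (rule order_trans[OF l_le], intro sum_mono mult_left_mono)
        fix G assume "G \<in> Pow D"
        then have "G \<subseteq> B" using DB by auto
        from rnd_sel[OF this, of i \<omega>]
        have "p i ^ card G = rnd i \<omega> (\<lambda>Sel C. of_bool (G \<subseteq> Sel))" by simp
        then show "rnd i \<omega> (\<lambda>Sel C. of_bool (G \<subseteq> Sel \<and> YY G \<subseteq> surv \<omega> Sel C)) \<le> p i ^ card G"
          by (simp only:) (intro rnd_mono, auto)
      qed (use lam in auto)
      also have "\<dots> = (p i + \<mu>') ^ card D"
        using sum_Pow_binomial[OF finD, of "p i" \<mu>'] by (simp add: mult.commute)
      also have "\<dots> \<le> lm ^ card D" using lm lam q by (intro power_mono) auto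
      also have "\<dots> = (\<Prod>f\<in>c - {e}. wt lm \<omega> f)" using prod_wt[OF True] by (simp add: K_def)
      finally have "?l \<le> (\<Prod>f\<in>c - {e}. wt lm \<omega> f)" .
      moreover have "0 \<le> \<theta> * F * (\<Prod>f\<in>c - {e}. wt \<mu> \<omega> f)"
        using \<theta>_bounds F0 lam0 by (intro mult_nonneg_nonneg prod_nonneg wt_nonneg ballI) auto
      ultimately show ?thesis using big by simp
    next
      case small: False
      have "?l \<le> (\<Sum>G\<in>Pow D. \<mu>' ^ card (D - G) * (F * \<theta> * (p i ^ card G * \<theta> ^ card (D - G))))"
      proof (rule order_trans[OF l_le], intro sum_mono mult_left_mono)
        fix G assume G: "G \<in> Pow D"
        have GB: "G \<subseteq> B" using DB G by auto
        have finDG: "finite (D - G)" using finD by simp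
        have sub: "insert e (D - G) \<subseteq> c" using c by (auto simp: D_def K_def)
        have enD: "e \<notin> D - G" by (auto simp: D_def K_def)
        have sB: "insert e (D - G) \<subseteq> B" using sub cD(1) by auto
        have fins: "finite (insert e (D - G))" using finDG by simp
        have cardDG: "card (insert e (D - G)) \<le> 8" using card_mono[OF cD(5) sub] cD(3) by linarith
        have YO: "YY G \<subseteq> Obj" unfolding YY_def using sB objs_subset_Obj by blast
        have YL: "YY G \<subseteq> fst \<omega>" using eAv True unfolding YY_def Av_def by blast
        have disj: "\<forall>f\<in>insert e (D - G). \<forall>g\<in>insert e (D - G). f \<noteq> g \<longrightarrow> objs f \<inter> objs g = {}"
          using conf_objs_disjoint[OF c(1)] sub by blast
        have pr: "(\<Prod>x\<in>YY G. 1 - nom x) = \<theta> * \<theta> ^ card (D - G)"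
        proof -
          have "(\<Prod>x\<in>YY G. 1 - nom x) = (\<Prod>f\<in>insert e (D - G). \<Prod>x\<in>objs f. 1 - nom x)"
            unfolding YY_def using fins disj sB finite_objs by (intro prod.UNION_disjoint) auto
          also have "\<dots> = (\<Prod>f\<in>insert e (D - G). \<theta>)"
            using sB by (intro prod.cong refl prod_objs) auto
          also have "\<dots> = \<theta> * \<theta> ^ card (D - G)" using finDG enD by simp
          finally show ?thesis .
        qed
        have "card (YY G) \<le> (\<Sum>f\<in>insert e (D - G). card (objs f))"
          unfolding YY_def by (rule card_UN_le[OF fins])
        also have "\<dots> \<le> (\<Sum>f\<in>insert e (D - G). s + 1)"
          using sB card_objs by (intro sum_mono) auto
        also have "\<dots> = card (insert e (D - G)) * (s + 1)" by simp
        also have "\<dots> \<le> 8 * (s + 1)" using cardDG by (rule mult_right_mono) simp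
        finally have cY: "card (YY G) * t \<le> 8 * (s + 1) * t" by simp
        have "rnd i \<omega> (\<lambda>Sel C. of_bool (G \<subseteq> Sel \<and> YY G \<subseteq> surv \<omega> Sel C))
          \<le> p i ^ card G * (\<Prod>x\<in>YY G. 1 - nom x) / (1 - p i) ^ (card (YY G) * t)"
        proof (rule rnd_surv_upper[OF GB YO YL, where Z = "Ov (snd \<omega>) c \<union> c"])
          show "finite (Ov (snd \<omega>) c \<union> c)" using finite_Ov cD(5) by simp
          show "card (Ov (snd \<omega>) c \<union> c) \<le> t" using small by simp
          fix x y assume xy: "x \<in> YY G" "y \<in> YY G" "x \<noteq> y"
          then obtain f g where fg: "f \<in> c" "g \<in> c" "x \<in> objs f" "y \<in> objs g"
            using sub unfolding YY_def by blast
          show "killers \<omega> x \<inter> killers \<omega> y \<subseteq> Ov (snd \<omega>) c \<union> c"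
            using killers_overlap[OF conf_tight[OF c(1)] fg xy(3), of L H] unfolding \<omega> by simp
        qed
        also have "\<dots> \<le> p i ^ card G * (\<theta> * \<theta> ^ card (D - G)) * F"
        proof -
          have "(1 - p i) ^ (8 * (s + 1) * t) \<le> (1 - p i) ^ (card (YY G) * t)"
            using q cY by (intro power_decreasing) auto
          then have "1 \<le> F * (1 - p i) ^ (card (YY G) * t)"
            using F F0 mult_left_mono[of "(1 - p i) ^ (8 * (s + 1) * t)" "(1 - p i) ^ (card (YY G) * t)" F] by linarith
          moreover have "0 \<le> p i ^ card G * (\<theta> * \<theta> ^ card (D - G))"
            using q \<theta>_bounds by simp
          ultimately have "p i ^ card G * (\<theta> * \<theta> ^ card (D - G)) * 1
            \<le> p i ^ card G * (\<theta> * \<theta> ^ card (D - G)) * (F * (1 - p i) ^ (card (YY G) * t))"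
            by (intro mult_left_mono)
          then show ?thesis unfolding pr using q by (simp add: field_simps)
        qed
        finally show "rnd i \<omega> (\<lambda>Sel C. of_bool (G \<subseteq> Sel \<and> YY G \<subseteq> surv \<omega> Sel C))
          \<le> F * \<theta> * (p i ^ card G * \<theta> ^ card (D - G))" by (simp add: mult_ac)
      qed (use lam in auto)
      also have "\<dots> = F * \<theta> * (\<Sum>G\<in>Pow D. p i ^ card G * (\<theta> * \<mu>') ^ card (D - G))"
        unfolding sum_distrib_left by (intro sum.cong refl) (simp add: power_mult_distrib mult_ac)
      also have "\<dots> = F * \<theta> * (p i + \<theta> * \<mu>') ^ card D"
        by (simp only: sum_Pow_binomial[OF finD])
      also have "\<dots> \<le> F * \<theta> * \<mu> ^ card D"
        using lam q \<theta>_bounds F0 by (intro mult_left_mono power_mono) auto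
      also have "\<dots> = \<theta> * F * (\<Prod>f\<in>c - {e}. wt \<mu> \<omega> f)"
        using prod_wt[OF True] by (simp add: K_def)
      finally show ?thesis using small by simp
    qed
  qed
qed

text \<open>Each killer \<open>g\<close> of \<open>e\<close> comes with a conflict whose remaining
  members are all taken, so its term equals \<mu>. Different killers have different conflicts,
  because a killer is available and hence not taken.\<close>

lemma psi_ge_killers:
  fixes \<mu> :: real
  assumes inv: "inv i \<omega>" and e: "e \<in> Av (fst \<omega>)" and l: "0 \<le> \<mu>"
  shows "\<mu> * card (killers \<omega> (Inr e)) \<le> Psi \<mu> e \<omega>"
proof -
  obtain L H where \<omega>: "\<omega> = (L, H)" by (cases \<omega>)
  define K where "K = killers \<omega> (Inr e)"
  have finK: "finite K" using killers_subset finB finite_subset unfolding K_def by blast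
  have "\<forall>g\<in>K. \<exists>c. c \<in> conf \<and> e \<in> c \<and> g \<in> c \<and> g \<noteq> e \<and> c - {e, g} \<subseteq> Tk H \<and> g \<in> Av L"
    unfolding K_def \<omega> by auto
  then obtain cc where cc: "\<And>g. g \<in> K \<Longrightarrow> cc g \<in> conf \<and> e \<in> cc g \<and> g \<in> cc g \<and> g \<noteq> e \<and> cc g - {e, g} \<subseteq> Tk H \<and> g \<in> Av L"
    by metis
  have nT: "g \<notin> Tk H" if "g \<in> Av L" for g
  proof
    assume "g \<in> Tk H"
    then obtain r where r: "(r, g) \<in> H" by (auto simp: Tk_def)
    have gB: "g \<in> B" using that by (auto simp: Av_def)
    then have "J g \<noteq> {}" using cardJ[OF gB] s_pos by auto
    then obtain q where q: "q \<in> J g" by auto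
    have "\<forall>(r, e)\<in>H. \<forall>q\<in>J e. Inl q \<notin> L" using inv unfolding inv_def \<omega> fst_conv snd_conv by (elim conjE)
    then have "Inl q \<notin> L" using r q by blast
    moreover have "Inl q \<in> L" using that q by (auto simp: Av_def objs_def)
    ultimately show False by simp
  qed
  have inj: "inj_on cc K"
  proof (rule inj_onI)
    fix g h assume gh: "g \<in> K" "h \<in> K" "cc g = cc h"
    show "g = h"
    proof (rule ccontr)
      assume "g \<noteq> h"
      then have "h \<in> cc g - {e, g}" using cc[OF gh(1)] cc[OF gh(2)] gh(3) by auto
      then have "h \<in> Tk H" using cc[OF gh(1)] by auto
      then show False using nT cc[OF gh(2)] by auto
    qed
  qed
  have val: "(\<Prod>f\<in>cc g - {e}. wt \<mu> \<omega> f) = \<mu>" if "g \<in> K" for g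
  proof -
    note c = cc[OF that]
    have fin: "finite (cc g)" using c confD(5) by auto
    have "cc g - {e} = insert g (cc g - {e, g})" using c by auto
    then have "(\<Prod>f\<in>cc g - {e}. wt \<mu> \<omega> f) = wt \<mu> \<omega> g * (\<Prod>f\<in>cc g - {e, g}. wt \<mu> \<omega> f)"
      using fin by simp
    also have "(\<Prod>f\<in>cc g - {e, g}. wt \<mu> \<omega> f) = 1"
      by (intro prod.neutral) (use c in \<open>auto simp: wt_def \<omega>\<close>)
    also have "wt \<mu> \<omega> g = \<mu>" using c nT by (auto simp: wt_def \<omega>)
    finally show ?thesis by simp
  qed
  have "\<mu> * card K = (\<Sum>g\<in>K. \<Prod>f\<in>cc g - {e}. wt \<mu> \<omega> f)" by (simp add: val)
  also have "\<dots> = (\<Sum>c\<in>cc ` K. \<Prod>f\<in>c - {e}. wt \<mu> \<omega> f)"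
    by (simp add: sum.reindex[OF inj])
  also have "\<dots> \<le> (\<Sum>c\<in>{c \<in> conf. e \<in> c}. \<Prod>f\<in>c - {e}. wt \<mu> \<omega> f)"
    using cc finite_conf l by (intro sum_mono2 prod_nonneg) (auto intro: wt_nonneg)
  finally show ?thesis using e by (simp add: Psi_def K_def)
qed

text \<open>Markov's inequality after expanding the weights: \<open>G\<close> runs over parts of
  \<open>c\<close> that are required to be taken, the extra event for which
  \<open>Ov_expectation\<close> makes room. The 8 pays for the blocks of \<open>c\<close>
  itself.\<close>

lemma wt_Ov_expectation:
  assumes c: "c \<in> conf" "e \<in> c" and l: "(\<Sum>r<i. p r) \<le> l" and lm: "0 \<le> lm" and t: "0 < t"
    and Y: "(\<Sum>S\<in>dang c. real (card (S - c)) * l ^ (card (S - c) - 1)) \<le> Y"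
  shows "EE i (\<lambda>\<omega>. of_bool (t < card (Ov (snd \<omega>) c \<union> c)) * (\<Prod>f\<in>c - {e}. wt lm \<omega> f))
    \<le> (lm + l) ^ (card c - 1) * ((Y + 8) / t)"
proof -
  note cD = confD[OF c(1)]
  have l0: "0 \<le> l" using l p_sum_nonneg[of i] by linarith
  define K where "K = c - {e}"
  have finK: "finite K" using cD(5) by (simp add: K_def)
  have cardK: "card K = card c - 1" using c cD(5) by (simp add: K_def)
  have "EE i (\<lambda>\<omega>. of_bool (t < card (Ov (snd \<omega>) c \<union> c)) * (\<Prod>f\<in>c - {e}. wt lm \<omega> f))
    \<le> EE i (\<lambda>\<omega>. \<Sum>G\<in>Pow K. lm ^ card (K - G) / t * (of_bool (G \<subseteq> Tk (snd \<omega>)) * real (card (Ov (snd \<omega>) c)) + 8 * of_bool (G \<subseteq> Tk (snd \<omega>))))"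
  proof (rule EE_mono)
    fix \<omega>
    have 1: "(\<Prod>f\<in>c - {e}. wt lm \<omega> f) \<le> (\<Sum>G\<in>Pow K. lm ^ card (K - G) * of_bool (G \<subseteq> Tk (snd \<omega>)))"
    proof -
      have "(\<Prod>f\<in>c - {e}. wt lm \<omega> f) \<le> (\<Prod>f\<in>K. of_bool (f \<in> Tk (snd \<omega>)) + lm)"
        unfolding K_def using lm by (intro prod_mono) (auto simp: wt_def)
      also have "\<dots> = (\<Sum>G\<in>Pow K. (\<Prod>f\<in>G. of_bool (f \<in> Tk (snd \<omega>))) * (\<Prod>f\<in>K - G. lm))"
        by (rule prod_add[OF finK])
      also have "\<dots> = (\<Sum>G\<in>Pow K. lm ^ card (K - G) * of_bool (G \<subseteq> Tk (snd \<omega>)))"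
      proof (rule sum.cong[OF refl])
        fix G assume "G \<in> Pow K"
        then have "finite G" using finK finite_subset by auto
        then have "(\<Prod>f\<in>G. of_bool (f \<in> Tk (snd \<omega>)) :: real) = of_bool (G \<subseteq> Tk (snd \<omega>))"
          by (auto simp: of_bool_def intro!: prod_zero prod.neutral)
        then show "(\<Prod>f\<in>G. of_bool (f \<in> Tk (snd \<omega>))) * (\<Prod>f\<in>K - G. lm) = lm ^ card (K - G) * of_bool (G \<subseteq> Tk (snd \<omega>))"
          by simp
      qed
      finally show ?thesis .
    qed
    have "card (Ov (snd \<omega>) c \<union> c) \<le> card (Ov (snd \<omega>) c) + 8"
      using card_Un_le[of "Ov (snd \<omega>) c" c] cD(3) by linarith
    then have 2: "(of_bool (t < card (Ov (snd \<omega>) c \<union> c)) :: real) \<le> (real (card (Ov (snd \<omega>) c)) + 8) / t"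
      using t by (auto simp: field_simps)
    have "of_bool (t < card (Ov (snd \<omega>) c \<union> c)) * (\<Prod>f\<in>c - {e}. wt lm \<omega> f)
      \<le> (real (card (Ov (snd \<omega>) c)) + 8) / t * (\<Sum>G\<in>Pow K. lm ^ card (K - G) * of_bool (G \<subseteq> Tk (snd \<omega>)))"
      using 1 2 lm t by (intro mult_mono prod_nonneg) (auto intro: wt_nonneg)
    also have "\<dots> = (\<Sum>G\<in>Pow K. lm ^ card (K - G) / t * (of_bool (G \<subseteq> Tk (snd \<omega>)) * real (card (Ov (snd \<omega>) c)) + 8 * of_bool (G \<subseteq> Tk (snd \<omega>))))"
      unfolding sum_distrib_left by (intro sum.cong refl) (simp add: field_simps)
    finally show "of_bool (t < card (Ov (snd \<omega>) c \<union> c)) * (\<Prod>f\<in>c - {e}. wt lm \<omega> f) \<le> \<dots>" .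
  qed
  also have "\<dots> = (\<Sum>G\<in>Pow K. lm ^ card (K - G) / t * (EE i (\<lambda>\<omega>. of_bool (G \<subseteq> Tk (snd \<omega>)) * real (card (Ov (snd \<omega>) c)))
      + 8 * EE i (\<lambda>\<omega>. of_bool (G \<subseteq> Tk (snd \<omega>)))))"
    unfolding EE_sum EE_cmult EE_add ..
  also have "\<dots> \<le> (\<Sum>G\<in>Pow K. lm ^ card (K - G) / t * (l ^ card G * Y + 8 * l ^ card G))"
  proof (intro sum_mono mult_left_mono add_mono)
    fix G assume G: "G \<in> Pow K"
    show "EE i (\<lambda>\<omega>. of_bool (G \<subseteq> Tk (snd \<omega>)) * real (card (Ov (snd \<omega>) c))) \<le> l ^ card G * Y"
      using G by (intro Ov_expectation[OF cD(1) _ l Y]) (auto simp: K_def)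
    have "EE i (\<lambda>\<omega>. of_bool (G \<subseteq> Tk (snd \<omega>))) \<le> (\<Sum>r<i. p r) ^ card G"
      using G cD(1) by (intro taken_le) (auto simp: K_def)
    also have "\<dots> \<le> l ^ card G" using l p_sum_nonneg by (intro power_mono) auto
    finally show "EE i (\<lambda>\<omega>. of_bool (G \<subseteq> Tk (snd \<omega>))) \<le> l ^ card G" .
  qed (use lm t in auto)
  also have "\<dots> = (\<Sum>G\<in>Pow K. l ^ card G * lm ^ card (K - G)) * ((Y + 8) / t)"
    unfolding sum_distrib_right by (intro sum.cong refl) (simp add: field_simps)
  also have "\<dots> = (lm + l) ^ (card c - 1) * ((Y + 8) / t)"
    by (simp only: sum_Pow_binomial[OF finK] cardK add.commute)
  finally show ?thesis .
qed

text \<open>By Bernoulli's inequality an exceptional \<open>e\<close> has at least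
  \<open>\<kappa> / p i\<close> killers, hence potential at least
  \<open>\<kappa> * \<mu> / p i\<close>. Its coin is 0, so all of this is lost in the round; the
  subtracted term records the loss.\<close>

lemma psi_step:
  assumes e: "e \<in> B" and lam: "0 \<le> \<mu>'" "p i + \<theta> * \<mu>' \<le> \<mu>"
    and F: "1 \<le> F * (1 - p i) ^ (8 * (s + 1) * t)" and lm: "p i + \<mu>' \<le> lm"
    and l: "(\<Sum>r<i. p r) \<le> l" and t: "0 < t"
    and Y: "\<And>S0. tight S0 \<Longrightarrow> card S0 \<le> 8 \<Longrightarrow>
      (\<Sum>S\<in>dang S0. real (card (S - S0)) * l ^ (card (S - S0) - 1)) \<le> Y"
  shows "EE (Suc i) (Psi \<mu>' e) \<le> \<theta> * F * (EE i (Psi \<mu> e) -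
      \<kappa> * \<mu> / p i * EE i (\<lambda>\<omega>. of_bool (e \<in> Av (fst \<omega>) \<and> exc i (Inr e) \<omega>)))
     + (\<Sum>c\<in>{c \<in> conf. e \<in> c}. (lm + l) ^ (card c - 1)) * ((Y + 8) / t)"
proof -
  define CC where "CC = {c \<in> conf. e \<in> c}"
  have q: "0 < p i" "p i < 1" using p01 by auto
  have F0: "0 < F"
  proof -
    have "0 < F * (1 - p i) ^ (8 * (s + 1) * t)" using F by linarith
    then show ?thesis using q by (simp add: zero_less_mult_iff)
  qed
  have lam0: "0 \<le> \<mu>" using lam q mult_nonneg_nonneg[of \<theta> \<mu>'] \<theta>_bounds by linarith
  have lm0: "0 \<le> lm" using lm lam q by linarith
  have "EE (Suc i) (Psi \<mu>' e) \<le> EE i (\<lambda>\<omega>. \<theta> * F * (Psi \<mu> e \<omega> -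
      \<kappa> * \<mu> / p i * of_bool (e \<in> Av (fst \<omega>) \<and> exc i (Inr e) \<omega>)) +
      (\<Sum>c\<in>CC. of_bool (t < card (Ov (snd \<omega>) c \<union> c)) * (\<Prod>f\<in>c - {e}. wt lm \<omega> f)))"
    unfolding EE.simps
  proof (rule EE_mono)
    fix \<omega> assume inv: "inv i \<omega>"
    let ?l = "rnd i \<omega> (\<lambda>Sel C. Psi \<mu>' e (nxt i \<omega> Sel C))"
    let ?R = "\<Sum>c\<in>CC. of_bool (t < card (Ov (snd \<omega>) c \<union> c)) * (\<Prod>f\<in>c - {e}. wt lm \<omega> f)"
    have R0: "0 \<le> ?R" using lm0 by (intro sum_nonneg mult_nonneg_nonneg prod_nonneg) (auto intro: wt_nonneg)
    have Psi0: "0 \<le> Psi \<mu> e \<omega>" if "0 \<le> \<mu>" for \<mu>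
      unfolding Psi_def using that by (intro mult_nonneg_nonneg sum_nonneg prod_nonneg) (auto intro: wt_nonneg)
    show "?l \<le> \<theta> * F * (Psi \<mu> e \<omega> - \<kappa> * \<mu> / p i * of_bool (e \<in> Av (fst \<omega>) \<and> exc i (Inr e) \<omega>)) + ?R"
    proof (cases "e \<in> Av (fst \<omega>)")
      case False
      then have "e \<notin> Av (fst (nxt i \<omega> Sel C))" for Sel C
        unfolding fst_nxt using Av_surv by blast
      then have "?l = 0" by (simp add: Psi_def rnd_const)
      moreover have "0 \<le> \<theta> * F * Psi \<mu> e \<omega>" using Psi0[OF lam0] \<theta>_bounds F0 by simp
      ultimately show ?thesis using False R0 by simp
    next
      case av: True
      show ?thesis
      proof (cases "exc i (Inr e) \<omega>")
        case True
        then have lt: "(1 - p i) ^ card (killers \<omega> (Inr e)) < 1 - \<kappa>" by (simp add: exc_def nom_def)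
        have "rnd i \<omega> (\<lambda>Sel C. Psi \<mu>' e (nxt i \<omega> Sel C)) = 0"
        proof -
          have "rnd i \<omega> (\<lambda>Sel C. of_bool ({} \<subseteq> Sel \<and> {Inr e} \<subseteq> surv \<omega> Sel C)) = 0"
            using av lt objs_subset_Obj[OF e]
            by (subst rnd_indep) (auto simp: coin_def nom_def Av_def objs_def)
          \<comment> \<open>A crude bound for the sum over conflicts, as every weight is at most
            \<open>max 1 \<mu>'\<close>; it is multiplied by the survival probability of
            \<open>Inr e\<close>, which is 0.\<close>
          moreover define X where "X = (\<Sum>c\<in>CC. \<Prod>f\<in>c - {e}. max 1 \<mu>')"
          have "Psi \<mu>' e (nxt i \<omega> Sel C) \<le> X * of_bool ({} \<subseteq> Sel \<and> {Inr e} \<subseteq> surv \<omega> Sel C)" for Sel C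
          proof (cases "e \<in> Av (fst (nxt i \<omega> Sel C))")
            case True
            then have "Inr e \<in> surv \<omega> Sel C" by (auto simp: fst_nxt Av_def objs_def)
            moreover have "(\<Sum>c\<in>CC. \<Prod>f\<in>c - {e}. wt \<mu>' (nxt i \<omega> Sel C) f) \<le> X"
              unfolding X_def using lam(1) by (intro sum_mono prod_mono) (auto simp: wt_def)
            ultimately show ?thesis using True by (simp add: Psi_def CC_def)
          next
            case False
            have "0 \<le> X" unfolding X_def using lam(1) by (intro sum_nonneg prod_nonneg) auto
            then show ?thesis using False by (simp add: Psi_def)
          qed
          then have "?l \<le> X * rnd i \<omega> (\<lambda>Sel C. of_bool ({} \<subseteq> Sel \<and> {Inr e} \<subseteq> surv \<omega> Sel C))"
            unfolding rnd_cmult[symmetric] by (intro rnd_mono)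
          ultimately have "?l \<le> 0" by simp
          moreover have "rnd i \<omega> (\<lambda>_ _. 0) \<le> ?l"
            using lam(1) by (intro rnd_mono) (auto simp: Psi_def intro!: sum_nonneg prod_nonneg wt_nonneg)
          ultimately show ?thesis by (simp add: rnd_const)
        qed
        moreover have "\<kappa> * \<mu> / p i \<le> Psi \<mu> e \<omega>"
        proof -
          have "1 - card (killers \<omega> (Inr e)) * p i \<le> (1 - p i) ^ card (killers \<omega> (Inr e))"
            using Bernoulli_inequality[of "- p i" "card (killers \<omega> (Inr e))"] q by simp
          then have "\<kappa> \<le> card (killers \<omega> (Inr e)) * p i" using lt by linarith
          then have "\<kappa> / p i \<le> card (killers \<omega> (Inr e))" using q by (simp add: field_simps)
          then have "\<mu> * (\<kappa> / p i) \<le> \<mu> * card (killers \<omega> (Inr e))" using lam0 by (intro mult_left_mono)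
          then show ?thesis using psi_ge_killers[OF inv av lam0] by (simp add: mult.commute)
        qed
        then have "0 \<le> \<theta> * F * (Psi \<mu> e \<omega> - \<kappa> * \<mu> / p i)" using \<theta>_bounds F0 by simp
        ultimately show ?thesis using av True R0 by simp
      next
        case False
        have "?l = (\<Sum>c\<in>CC. rnd i \<omega> (\<lambda>Sel C. of_bool (e \<in> Av (fst (nxt i \<omega> Sel C))) * (\<Prod>f\<in>c - {e}. wt \<mu>' (nxt i \<omega> Sel C) f)))"
          unfolding Psi_def CC_def[symmetric] sum_distrib_left rnd_sum ..
        also have "\<dots> \<le> (\<Sum>c\<in>CC. \<theta> * F * (\<Prod>f\<in>c - {e}. wt \<mu> \<omega> f)
           + of_bool (t < card (Ov (snd \<omega>) c \<union> c)) * (\<Prod>f\<in>c - {e}. wt lm \<omega> f))"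
          by (intro sum_mono psi_term_step[OF inv _ _ av lam F lm]) (auto simp: CC_def)
        also have "\<dots> = \<theta> * F * (\<Sum>c\<in>CC. \<Prod>f\<in>c - {e}. wt \<mu> \<omega> f) + ?R"
          by (simp only: sum.distrib sum_distrib_left)
        finally show ?thesis using av False by (simp add: Psi_def CC_def)
      qed
    qed
  qed
  also have "\<dots> = \<theta> * F * (EE i (Psi \<mu> e) - \<kappa> * \<mu> / p i * EE i (\<lambda>\<omega>. of_bool (e \<in> Av (fst \<omega>) \<and> exc i (Inr e) \<omega>)))
     + (\<Sum>c\<in>CC. EE i (\<lambda>\<omega>. of_bool (t < card (Ov (snd \<omega>) c \<union> c)) * (\<Prod>f\<in>c - {e}. wt lm \<omega> f)))"
    unfolding EE_add EE_sum EE_cmult EE_diff by simp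
  also have "\<dots> \<le> \<theta> * F * (EE i (Psi \<mu> e) - \<kappa> * \<mu> / p i * EE i (\<lambda>\<omega>. of_bool (e \<in> Av (fst \<omega>) \<and> exc i (Inr e) \<omega>)))
     + (\<Sum>c\<in>CC. (lm + l) ^ (card c - 1) * ((Y + 8) / t))"
  proof (intro add_left_mono sum_mono)
    fix c assume "c \<in> CC"
    then have c: "c \<in> conf" "e \<in> c" by (auto simp: CC_def)
    show "EE i (\<lambda>\<omega>. of_bool (t < card (Ov (snd \<omega>) c \<union> c)) * (\<Prod>f\<in>c - {e}. wt lm \<omega> f))
      \<le> (lm + l) ^ (card c - 1) * ((Y + 8) / t)"
      using confD(3)[OF c(1)] by (intro wt_Ov_expectation[OF c l lm0 t] Y conf_tight) (use c in auto)
  qed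
  finally show ?thesis by (simp only: CC_def sum_distrib_right)
qed

end

text \<open>The right side is the falling factorial, all of whose \<open>k\<close> factors exceed
  \<open>n - k\<close>.\<close>

lemma power_le_binomial_fact:
  fixes n k :: nat
  shows "k \<le> n \<Longrightarrow> (n - k) ^ k \<le> (n choose k) * fact k"
proof (induction k arbitrary: n)
  case (Suc k)
  obtain m where n: "n = Suc m" using Suc.prems by (cases n) auto
  have "(n - Suc k) ^ Suc k = (m - k) * (m - k) ^ k" by (simp add: n)
  also have "\<dots> \<le> Suc m * ((m choose k) * fact k)"
    using Suc.prems Suc.IH[of m] n by (intro mult_mono) auto
  also have "\<dots> = (n choose Suc k) * fact (Suc k)"
    using Suc_times_binomial_eq[of m k] by (simp add: n algebra_simps)
  finally show ?case .
qed simp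

context nibble_process
begin

section \<open>Rarity of exceptional blocks and points\<close>

lemma inv_H: "inv i \<omega> \<Longrightarrow> snd \<omega> \<subseteq> {..<i} \<times> B"
  unfolding inv_def by (elim conjE)

lemma finite_H: "inv i \<omega> \<Longrightarrow> finite (snd \<omega>)"
  by (rule finite_subset[OF inv_H]) (use finB in auto)

lemma p_sum_mono: "i \<le> T \<Longrightarrow> (\<Sum>r<i. p r) \<le> (\<Sum>r<T. p r)"
  using p01 by (intro sum_mono2) (auto simp: less_imp_le)

text \<open>The Doob-type estimate for the potential: an exceptional block carries potential at least
  \<open>\<kappa>\<^sub>1\<close> and is killed at once, so the discounted number of exceptional events is bounded by the
  initial potential.\<close>

lemma exceptional_blocks:
  assumes e: "e \<in> B" and lam: "\<And>i. 0 \<le> \<mu> i" "\<And>i. i < T \<Longrightarrow> p i + \<theta> * \<mu> (Suc i) \<le> \<mu> i"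
    and F: "\<And>i. i < T \<Longrightarrow> 1 \<le> F * (1 - p i) ^ (8 * (s + 1) * t)" and F1: "1 \<le> F"
    and lm: "\<And>i. i < T \<Longrightarrow> p i + \<mu> (Suc i) \<le> lm"
    and l: "(\<Sum>r<T. p r) \<le> l" and t: "0 < t"
    and Y: "\<And>S0. tight S0 \<Longrightarrow> card S0 \<le> 8 \<Longrightarrow>
      (\<Sum>S\<in>dang S0. real (card (S - S0)) * l ^ (card (S - S0) - 1)) \<le> Y" and Y0: "0 \<le> Y"
    and \<kappa>1: "\<And>i. i < T \<Longrightarrow> \<kappa>1 \<le> \<kappa> * \<mu> i / p i"
    and err: "(\<Sum>c\<in>{c \<in> conf. e \<in> c}. (lm + l) ^ (card c - 1)) * ((Y + 8) / t) \<le> err" and err0: "0 \<le> err"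
    and "0 \<le> \<kappa>1"
  shows "\<kappa>1 * (\<Sum>i<T. EE i (\<lambda>\<omega>. of_bool (e \<in> Av (fst \<omega>) \<and> exc i (Inr e) \<omega>)) / \<theta> ^ i)
    \<le> F ^ T * ((\<Sum>c\<in>{c \<in> conf. e \<in> c}. \<mu> 0 ^ (card c - 1)) + T * err / \<theta> ^ T)"
proof -
  define x where "x = (\<lambda>i. EE i (\<lambda>\<omega>. of_bool (e \<in> Av (fst \<omega>) \<and> exc i (Inr e) \<omega>)))"
  define y where "y = (\<lambda>i. EE i (Psi (\<mu> i) e))"
  define P0 where "P0 = (\<Sum>c\<in>{c \<in> conf. e \<in> c}. \<mu> 0 ^ (card c - 1))"
  define G where "G = \<theta> * F"
  have G0: "0 < G" using \<theta>_bounds F1 by (simp add: G_def)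
  have x0: "0 \<le> x i" for i unfolding x_def by (rule EE_nonneg) simp
  have step: "y (Suc i) \<le> G * (y i - \<kappa>1 * x i) + err" if i: "i < T" for i
  proof -
    have l': "(\<Sum>r<i. p r) \<le> l" using p_sum_mono[of i T] i l by simp
    have "y (Suc i) \<le> \<theta> * F * (y i - \<kappa> * \<mu> i / p i * x i)
      + (\<Sum>c\<in>{c \<in> conf. e \<in> c}. (lm + l) ^ (card c - 1)) * ((Y + 8) / t)"
      unfolding y_def x_def
      by (rule psi_step[OF e lam(1) lam(2)[OF i] F[OF i] lm[OF i] l' t Y])
    also have "\<dots> \<le> G * (y i - \<kappa>1 * x i) + err"
      unfolding G_def using \<kappa>1[OF i] err x0[of i] \<theta>_bounds F1
      by (intro add_mono mult_left_mono diff_left_mono mult_right_mono) auto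
    finally show ?thesis .
  qed
  have y0: "y 0 \<le> P0"
  proof -
    have "wt (\<mu> 0) (Obj, {}) f \<le> \<mu> 0" for f using lam(1)[of 0] by (simp add: wt_def Tk_def)
    then have "(\<Prod>f\<in>c - {e}. wt (\<mu> 0) (Obj, {}) f) \<le> \<mu> 0 ^ (card c - 1)" if "c \<in> conf" "e \<in> c" for c
      using prod_mono[of "c - {e}" "wt (\<mu> 0) (Obj, {})" "\<lambda>_. \<mu> 0"] that confD(5)[of c] lam(1)[of 0]
      by (simp add: wt_nonneg)
    then have "(\<Sum>c\<in>{c \<in> conf. e \<in> c}. \<Prod>f\<in>c - {e}. wt (\<mu> 0) (Obj, {}) f) \<le> P0"
      unfolding P0_def by (intro sum_mono) auto
    moreover have "0 \<le> P0" unfolding P0_def using lam(1) by (intro sum_nonneg) simp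
    ultimately show ?thesis by (auto simp: y_def Psi_def)
  qed
  have ynn: "0 \<le> y i" for i
    unfolding y_def Psi_def using lam(1)
    by (intro EE_nonneg mult_nonneg_nonneg sum_nonneg prod_nonneg ballI wt_nonneg) auto
  \<comment> \<open>Normalised by powers of the decay rate \<open>G\<close>, potential plus
    accumulated losses increases only by the error terms.\<close>
  have ind: "i \<le> T \<Longrightarrow> y i / G ^ i + \<kappa>1 * (\<Sum>r<i. x r / G ^ r) \<le> P0 + (\<Sum>r<i. err / G ^ Suc r)" for i
  proof (induction i)
    case 0
    then show ?case using y0 by simp
  next
    case (Suc i)
    have "y (Suc i) / G ^ Suc i \<le> (G * (y i - \<kappa>1 * x i) + err) / G ^ Suc i"
      using step[of i] Suc.prems G0 by (intro divide_right_mono) auto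
    also have "\<dots> = y i / G ^ i - \<kappa>1 * (x i / G ^ i) + err / G ^ Suc i"
      using G0 by (simp add: field_simps)
    finally show ?case using Suc by (simp add: algebra_simps)
  qed
  have "\<kappa>1 * (\<Sum>r<T. x r / \<theta> ^ r) \<le> F ^ T * (\<kappa>1 * (\<Sum>r<T. x r / G ^ r))"
  proof -
    have "(\<Sum>r<T. x r / \<theta> ^ r) \<le> (\<Sum>r<T. F ^ T * (x r / G ^ r))"
    proof (rule sum_mono)
      fix r assume "r \<in> {..<T}"
      then have "F ^ r \<le> F ^ T" using F1 by (intro power_increasing) auto
      have "x r / \<theta> ^ r = F ^ r * (x r / G ^ r)" using F1 by (simp add: G_def power_mult_distrib)
      also have "\<dots> \<le> F ^ T * (x r / G ^ r)"
        using \<open>F ^ r \<le> F ^ T\<close> x0[of r] G0 by (intro mult_right_mono) auto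
      finally show "x r / \<theta> ^ r \<le> F ^ T * (x r / G ^ r)" .
    qed
    then have "\<kappa>1 * (\<Sum>r<T. x r / \<theta> ^ r) \<le> \<kappa>1 * (\<Sum>r<T. F ^ T * (x r / G ^ r))"
      using \<open>0 \<le> \<kappa>1\<close> by (rule mult_left_mono)
    also have "\<dots> = F ^ T * (\<kappa>1 * (\<Sum>r<T. x r / G ^ r))"
      unfolding sum_distrib_left[symmetric] by (rule mult.left_commute)
    finally show ?thesis .
  qed
  also have "\<dots> \<le> F ^ T * (P0 + (\<Sum>r<T. err / G ^ Suc r))"
  proof (rule mult_left_mono)
    have "0 \<le> y T / G ^ T" using ynn[of T] G0 by simp
    then show "\<kappa>1 * (\<Sum>r<T. x r / G ^ r) \<le> P0 + (\<Sum>r<T. err / G ^ Suc r)"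
      using ind[of T] by linarith
  qed (use F1 in simp)
  also have "\<dots> \<le> F ^ T * (P0 + (\<Sum>r<T. err / \<theta> ^ T))"
  proof (intro mult_left_mono add_left_mono sum_mono)
    fix r assume r: "r \<in> {..<T}"
    have "\<theta> ^ T \<le> \<theta> ^ Suc r" using r \<theta>_bounds by (intro power_decreasing) auto
    also have "\<dots> \<le> G ^ Suc r" unfolding G_def using \<theta>_bounds F1 by (intro power_mono) auto
    finally show "err / G ^ Suc r \<le> err / \<theta> ^ T"
      using err0 \<theta>_bounds by (intro divide_left_mono mult_pos_pos) (auto simp: G0)
  qed (use F1 in simp)
  finally show ?thesis by (simp add: x_def P0_def)
qed

text \<open>A \<open>k\<close>-th moment argument: an exceptional \<open>q\<close> has more than
  \<open>\<rho> / p i\<close> available blocks through it, hence many available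
  \<open>k\<close>-subsets. Subsets whose blocks meet only in \<open>q\<close> are handled by
  \<open>generic_avail\<close>; the others are few, since each block has at most \<open>h\<close>
  bad partners, and are given probability 1.\<close>

lemma exceptional_points:
  assumes k: "2 \<le> k" and iT: "i < T" and d: "card (star q) \<le> d" "1 \<le> d"
    and h: "\<And>e. e \<in> star q \<Longrightarrow> card {f \<in> star q. f \<noteq> e \<and> V e \<inter> V f \<noteq> q} \<le> h"
    and F: "\<And>i. i < T \<Longrightarrow> 1 \<le> F * (1 - p i) ^ (k * (s + 1) * t)" and F1: "1 \<le> F"
    and l: "(\<Sum>r<T. p r) \<le> l"
    and Y: "\<And>S0. tight S0 \<Longrightarrow> card S0 \<le> 8 \<Longrightarrow>
      (\<Sum>S\<in>dang S0. real (card (S - S0)) * l ^ (card (S - S0) - 1)) \<le> Y" and Y0: "0 \<le> Y"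
    and t: "0 < t" and tau: "k < \<rho> / p i"
  shows "EE i (\<lambda>\<omega>. of_bool (exc i (Inl q) \<omega>)) \<le>
     (F ^ T * real d ^ k * ((((1 - \<rho>) ^ (s - 1) * (1 - \<kappa>)) ^ i) ^ k + T * ((real k^2 * Y + k) / t))
       + fact k * real d ^ (k - 1) * real h) / (\<rho> / p i - k) ^ k"
proof -
  define a where "a = (1 - \<rho>) ^ (s - 1) * (1 - \<kappa>)"
  define \<eta> where "\<eta> = (real k^2 * Y + k) / t"
  define \<tau> where "\<tau> = \<rho> / p i"
  have q: "0 < p i" "p i < 1" using p01 by auto
  have a01: "0 \<le> a" "a \<le> 1" using \<rho>01 \<kappa>01 by (auto simp: a_def intro!: mult_le_one power_le_one)
  have \<eta>0: "0 \<le> \<eta>" using Y0 by (simp add: \<eta>_def)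
  have finS: "finite (star q)" using finB by (auto simp: star_def)
  define RR where "RR = {R. R \<subseteq> star q \<and> card R = k}"
  define gen where "gen = (\<lambda>R. \<forall>e\<in>R. \<forall>f\<in>R. e \<noteq> f \<longrightarrow> V e \<inter> V f = q)"
  have finRR: "finite RR" unfolding RR_def using finS by simp
  have cardRR: "card RR \<le> card (star q) choose k"
    unfolding RR_def using n_subsets[OF finS, of k] by simp
  have bin: "real (n choose j) * fact j \<le> real d ^ j" if "n \<le> d" for n j
  proof -
    have "(n choose j) * fact j \<le> n ^ j" using binomial_fact_pow[of n j] .
    also have "\<dots> \<le> d ^ j" using that by (rule power_mono) simp
    finally show ?thesis by (metis of_nat_fact of_nat_le_iff of_nat_mult of_nat_power)
  qed
  have ng: "card {R \<in> RR. \<not> gen R} \<le> card (star q) * h * d ^ (k - 2)"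
  proof -
    \<comment> \<open>A non-generic \<open>k\<close>-subset consists of an offending ordered pair
      from \<open>P\<close> and \<open>k - 2\<close> further blocks from \<open>Q\<close>.\<close>
    define P where "P = (SIGMA e:star q. {f \<in> star q. f \<noteq> e \<and> V e \<inter> V f \<noteq> q})"
    define Q where "Q = {R'. R' \<subseteq> star q \<and> card R' = k - 2}"
    have finP: "finite P" unfolding P_def using finS by simp
    have finQ: "finite Q" unfolding Q_def using finS by simp
    have "{R \<in> RR. \<not> gen R} \<subseteq> (\<lambda>((e, f), R'). insert e (insert f R')) ` (P \<times> Q)"
    proof
      fix R assume "R \<in> {R \<in> RR. \<not> gen R}"
      then have R: "R \<subseteq> star q" "card R = k" "\<not> gen R" by (auto simp: RR_def)
      then obtain e f where ef: "e \<in> R" "f \<in> R" "e \<noteq> f" "V e \<inter> V f \<noteq> q" by (auto simp: gen_def)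
      have "finite R" using R(1) finS finite_subset by auto
      then have "card (R - {e, f}) = k - 2" using ef R by (simp add: card_Diff_subset)
      then have "R - {e, f} \<in> Q" using R by (auto simp: Q_def)
      moreover have "(e, f) \<in> P" using ef R by (auto simp: P_def)
      moreover have "R = insert e (insert f (R - {e, f}))" using ef by auto
      ultimately show "R \<in> (\<lambda>((e, f), R'). insert e (insert f R')) ` (P \<times> Q)"
        by (metis (mono_tags, lifting) SigmaI case_prod_conv image_eqI)
    qed
    then have "card {R \<in> RR. \<not> gen R} \<le> card P * card Q"
      using card_mono[of "(\<lambda>((e, f), R'). insert e (insert f R')) ` (P \<times> Q)"] finP finQ
        card_image_le[of "P \<times> Q" "\<lambda>((e, f), R'). insert e (insert f R')"]
      by (simp add: card_cartesian_product) (meson finite_SigmaI finite_imageI order_trans)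
    also have "card P \<le> card (star q) * h"
    proof -
      have "card P = (\<Sum>e\<in>star q. card {f \<in> star q. f \<noteq> e \<and> V e \<inter> V f \<noteq> q})"
        unfolding P_def using finS by (intro card_SigmaI) auto
      also have "\<dots> \<le> (\<Sum>e\<in>star q. h)" using h by (intro sum_mono)
      finally show ?thesis by simp
    qed
    also have "card Q \<le> d ^ (k - 2)"
    proof -
      have "card Q = card (star q) choose (k - 2)" unfolding Q_def by (rule n_subsets[OF finS])
      also have "\<dots> \<le> card (star q) ^ (k - 2)"
        using binomial_fact_pow[of "card (star q)" "k - 2"]
        by (metis fact_ge_1 le_trans mult.right_neutral mult_le_mono2)
      also have "\<dots> \<le> d ^ (k - 2)" using d by (intro power_mono) auto
      finally show ?thesis .
    qed
    finally show ?thesis by simp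
  qed
  have EEgen: "EE i (\<lambda>\<omega>. of_bool (R \<subseteq> Av (fst \<omega>))) \<le> F ^ T * ((a ^ i) ^ k + T * \<eta>)"
    if R: "R \<in> RR" "gen R" for R
  proof -
    have cR: "card R = k" "R \<subseteq> star q" "R \<noteq> {}" using R k by (auto simp: RR_def)
    have "EE i (\<lambda>\<omega>. of_bool (R \<subseteq> Av (fst \<omega>)))
      \<le> F ^ i * ((((1 - \<rho>) ^ (s - 1) * (1 - \<kappa>)) ^ i) ^ card R + i * ((real (card R)^2 * Y + card R) / t))"
    proof (rule generic_avail[OF cR(2,3), where T = T])
      show "V e \<inter> V f = q" if "e \<in> R" "f \<in> R" "e \<noteq> f" for e f using R(2) that by (auto simp: gen_def)
    qed (use cR F F1 l Y t iT Y0 in auto)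
    also have "\<dots> \<le> F ^ T * ((a ^ i) ^ k + T * \<eta>)"
      unfolding cR a_def[symmetric] \<eta>_def[symmetric] using F1 iT \<eta>0 a01
      by (intro order_refl mult_mono add_mono power_increasing) auto
    finally show ?thesis .
  qed
  define m where "m = nat \<lceil>\<tau>\<rceil>"
  have km: "k \<le> m" "\<tau> \<le> m" using tau unfolding m_def \<tau>_def by linarith+
  have tk: "0 < \<tau> - k" using tau by (simp add: \<tau>_def)
  have low: "(\<tau> - k) ^ k \<le> real (m choose k) * fact k"
  proof -
    have "(\<tau> - k) ^ k \<le> real (m - k) ^ k" using tk km by (intro power_mono) auto
    also have "\<dots> = real ((m - k) ^ k)" by simp
    also have "\<dots> \<le> real ((m choose k) * fact k)"
      using power_le_binomial_fact[OF km(1)] by (rule of_nat_mono)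
    finally show ?thesis by simp
  qed
  have "(\<tau> - k) ^ k * EE i (\<lambda>\<omega>. of_bool (exc i (Inl q) \<omega>))
     = EE i (\<lambda>\<omega>. (\<tau> - k) ^ k * of_bool (exc i (Inl q) \<omega>))" by (simp only: EE_cmult)
  also have "\<dots> \<le> EE i (\<lambda>\<omega>. fact k * (\<Sum>R\<in>RR. of_bool (R \<subseteq> Av (fst \<omega>))))"
  proof (rule EE_mono)
    fix \<omega> :: "('v set + 'b) set \<times> (nat \<times> 'b) set"
    obtain L H where \<omega>: "\<omega> = (L, H)" by (cases \<omega>)
    define N where "N = killers \<omega> (Inl q)"
    have N: "N = star q \<inter> Av L" by (auto simp: N_def \<omega> star_def Av_def)
    have finN: "finite N" using finS N by auto
    have "(\<Sum>R\<in>RR. of_bool (R \<subseteq> Av (fst \<omega>)) :: real) = card (RR \<inter> {R. R \<subseteq> Av L})"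
      using finRR by (simp add: sum_of_bool_eq \<omega>)
    also have "RR \<inter> {R. R \<subseteq> Av L} = {R. R \<subseteq> N \<and> card R = k}" by (auto simp: RR_def N)
    also have "card \<dots> = card N choose k" by (rule n_subsets[OF finN])
    finally have sumeq: "(\<Sum>R\<in>RR. of_bool (R \<subseteq> Av (fst \<omega>)) :: real) = real (card N choose k)" .
    show "(\<tau> - k) ^ k * of_bool (exc i (Inl q) \<omega>) \<le> fact k * (\<Sum>R\<in>RR. of_bool (R \<subseteq> Av (fst \<omega>)))"
    proof (cases "exc i (Inl q) \<omega>")
      case True
      then have "(1 - p i) ^ card N < 1 - \<rho>" by (simp add: exc_def nom_def N_def)
      moreover have "1 - card N * p i \<le> (1 - p i) ^ card N"
        using Bernoulli_inequality[of "- p i" "card N"] q by simp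
      ultimately have "\<rho> < card N * p i" by linarith
      then have "\<tau> < card N" using q by (simp add: \<tau>_def field_simps)
      then have "m \<le> card N" unfolding m_def by linarith
      then have "real (m choose k) \<le> real (card N choose k)" using binomial_right_mono[of m "card N" k] by simp
      then have "real (m choose k) * fact k \<le> real (card N choose k) * fact k" by (rule mult_right_mono) simp
      then have "(\<tau> - k) ^ k \<le> real (card N choose k) * fact k" using low by linarith
      then show ?thesis using True sumeq by (simp add: mult.commute)
    qed (simp add: sumeq)
  qed
  also have "\<dots> = fact k * (\<Sum>R\<in>RR. EE i (\<lambda>\<omega>. of_bool (R \<subseteq> Av (fst \<omega>))))"
    by (simp only: EE_cmult EE_sum)
  also have "\<dots> \<le> fact k * (\<Sum>R\<in>RR. F ^ T * ((a ^ i) ^ k + T * \<eta>) + of_bool (\<not> gen R))"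
  proof (intro mult_left_mono sum_mono)
    fix R assume R: "R \<in> RR"
    have nn: "0 \<le> F ^ T * ((a ^ i) ^ k + T * \<eta>)" using F1 a01 \<eta>0 by simp
    show "EE i (\<lambda>\<omega>. of_bool (R \<subseteq> Av (fst \<omega>))) \<le> F ^ T * ((a ^ i) ^ k + T * \<eta>) + of_bool (\<not> gen R)"
    proof (cases "gen R")
      case False
      have "EE i (\<lambda>\<omega>. of_bool (R \<subseteq> Av (fst \<omega>))) \<le> EE i (\<lambda>_. 1)" by (rule EE_mono) simp
      then show ?thesis using False nn by (simp add: EE_const)
    qed (use EEgen[OF R] in simp)
  qed simp
  also have "\<dots> = fact k * (card RR * (F ^ T * ((a ^ i) ^ k + T * \<eta>)) + card {R \<in> RR. \<not> gen R})"
  proof -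
    have "RR \<inter> {R. \<not> gen R} = {R \<in> RR. \<not> gen R}" by auto
    then show ?thesis using finRR by (simp add: sum.distrib sum_of_bool_eq)
  qed
  also have "\<dots> = (fact k * real (card RR)) * (F ^ T * ((a ^ i) ^ k + T * \<eta>)) + fact k * real (card {R \<in> RR. \<not> gen R})"
    by (simp add: algebra_simps)
  also have "\<dots> \<le> real d ^ k * (F ^ T * ((a ^ i) ^ k + T * \<eta>)) + fact k * (real d ^ (k - 1) * real h)"
  proof (intro add_mono mult_right_mono mult_left_mono)
    have "fact k * real (card RR) \<le> fact k * real (card (star q) choose k)"
      using cardRR by (intro mult_left_mono) auto
    also have "\<dots> \<le> real d ^ k" using bin[OF d(1), of k] by (simp add: mult.commute)
    finally show "fact k * real (card RR) \<le> real d ^ k" .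
    have "card {R \<in> RR. \<not> gen R} \<le> card (star q) * h * d ^ (k - 2)" by (rule ng)
    also have "\<dots> \<le> d * h * d ^ (k - 2)" using d by (intro mult_right_mono) auto
    also have "\<dots> = d ^ (k - 1) * h"
    proof -
      have "k - 1 = Suc (k - 2)" using k by simp
      then show ?thesis by simp
    qed
    finally show "real (card {R \<in> RR. \<not> gen R}) \<le> real d ^ (k - 1) * real h"
      by (simp only: of_nat_power[symmetric] of_nat_mult[symmetric] of_nat_le_iff)
  qed (use F1 a01 \<eta>0 in auto)
  finally have "(\<tau> - k) ^ k * EE i (\<lambda>\<omega>. of_bool (exc i (Inl q) \<omega>))
    \<le> F ^ T * real d ^ k * ((a ^ i) ^ k + T * \<eta>) + fact k * real d ^ (k - 1) * real h"
    by (simp add: mult_ac)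
  then show ?thesis
    using tk unfolding a_def[symmetric] \<eta>_def[symmetric] \<tau>_def[symmetric]
    by (simp add: pos_le_divide_eq mult.commute)
qed

section \<open>From the process to a packing\<close>

lemma taken_expectation:
  "(\<Sum>i<T. p i * (\<Sum>e\<in>B. EE i (\<lambda>\<omega>. of_bool (e \<in> Av (fst \<omega>))))) \<le> EE T (\<lambda>\<omega>. real (card (snd \<omega>)))"
proof (induction T)
  case (Suc T)
  have "EE T (\<lambda>\<omega>. real (card (snd \<omega>)) + p T * (\<Sum>e\<in>B. of_bool (e \<in> Av (fst \<omega>)))) \<le> EE (Suc T) (\<lambda>\<omega>. real (card (snd \<omega>)))"
    unfolding EE.simps
  proof (rule EE_mono)
    fix \<omega> assume inv: "inv T \<omega>"
    have fin: "finite (snd \<omega>)" using finite_H[OF inv] .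
    have "real (card (snd \<omega>)) + p T * (\<Sum>e\<in>B. of_bool (e \<in> Av (fst \<omega>)))
      = rnd T \<omega> (\<lambda>Sel C. real (card (snd \<omega>)) + (\<Sum>e\<in>B. of_bool (e \<in> Av (fst \<omega>)) * of_bool ({e} \<subseteq> Sel)))"
      unfolding rnd_add rnd_const rnd_sum rnd_cmult sum_distrib_left
      by (simp add: rnd_sel[of "{_}", simplified] mult.commute)
    also have "\<dots> \<le> rnd T \<omega> (\<lambda>Sel C. real (card (snd (nxt T \<omega> Sel C))))"
    proof (rule rnd_mono)
      fix Sel C assume Sel: "Sel \<subseteq> B"
      let ?N = "Sel \<inter> Av (fst \<omega>)"
      have finN: "finite ?N" using Sel finB finite_subset by blast
      have "card (snd \<omega> \<union> {T} \<times> ?N) = card (snd \<omega>) + card ({T} \<times> ?N)"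
        using inv_H[OF inv] fin finN by (intro card_Un_disjoint) auto
      then have "real (card (snd (nxt T \<omega> Sel C))) = real (card (snd \<omega>)) + card ?N"
        by (simp add: snd_nxt card_cartesian_product)
      moreover have "(\<Sum>e\<in>B. of_bool (e \<in> Av (fst \<omega>)) * of_bool ({e} \<subseteq> Sel)) = (\<Sum>e\<in>B. of_bool (e \<in> ?N) :: real)"
        by (intro sum.cong) auto
      moreover have "(\<Sum>e\<in>B. of_bool (e \<in> ?N) :: real) = card (B \<inter> ?N)"
        using finB by (subst sum_of_bool_eq) (auto intro!: arg_cong[where f = card])
      moreover have "B \<inter> ?N = ?N" using Sel by auto
      ultimately show "real (card (snd \<omega>)) + (\<Sum>e\<in>B. of_bool (e \<in> Av (fst \<omega>)) * of_bool ({e} \<subseteq> Sel))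
        \<le> real (card (snd (nxt T \<omega> Sel C)))" by simp
    qed
    finally show "real (card (snd \<omega>)) + p T * (\<Sum>e\<in>B. of_bool (e \<in> Av (fst \<omega>)))
      \<le> rnd T \<omega> (\<lambda>Sel C. real (card (snd (nxt T \<omega> Sel C))))" .
  qed
  moreover have "EE T (\<lambda>\<omega>. real (card (snd \<omega>)) + p T * (\<Sum>e\<in>B. of_bool (e \<in> Av (fst \<omega>))))
    = EE T (\<lambda>\<omega>. real (card (snd \<omega>))) + p T * (\<Sum>e\<in>B. EE T (\<lambda>\<omega>. of_bool (e \<in> Av (fst \<omega>))))"
    by (simp only: EE_add EE_cmult EE_sum)
  ultimately show ?case using Suc by simp
qed simp


lemma inv_point_disjoint:
  assumes inv: "inv i \<omega>" and "(r, e) \<in> snd \<omega>" "(r', f) \<in> snd \<omega>" "r \<noteq> r'"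
  shows "J e \<inter> J f = {}"
proof -
  have "\<forall>(r, e)\<in>snd \<omega>. \<forall>(r', f)\<in>snd \<omega>. r \<noteq> r' \<longrightarrow> J e \<inter> J f = {}"
    using inv unfolding inv_def by (elim conjE)
  then show ?thesis using assms by blast
qed

text \<open>A block taken in two rounds would have essential pairs disjoint from themselves, but
  every \<open>J e\<close> is nonempty.\<close>

lemma inj_on_H:
  assumes inv: "inv i \<omega>"
  shows "inj_on snd (snd \<omega>)"
proof (rule inj_onI)
  fix x y assume xy: "x \<in> snd \<omega>" "y \<in> snd \<omega>" "snd x = snd y"
  show "x = y"
  proof (rule ccontr)
    assume ne: "x \<noteq> y"
    obtain r r' e where x: "x = (r, e)" "y = (r', e)" using xy(3) by (cases x, cases y) auto
    have "J e \<inter> J e = {}"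
      by (rule inv_point_disjoint[OF inv, of r e r' e]) (use xy x ne in auto)
    moreover have "e \<in> B" using inv_H[OF inv] xy(1) x by auto
    ultimately show False using cardJ[of e] s_pos by auto
  qed
qed

lemma card_Tk:
  assumes "inv i \<omega>"
  shows "card (Tk (snd \<omega>)) = card (snd \<omega>)"
  unfolding Tk_def by (rule card_image[OF inj_on_H[OF assms]])

text \<open>In a conflict all of whose blocks are taken, two blocks are taken in the same round: otherwise
  the last block would have been killed when the last but one was taken.\<close>

lemma conf_same:
  assumes inv: "inv i \<omega>" and c: "c \<in> conf" "c \<subseteq> Tk (snd \<omega>)"
  shows "\<exists>e\<in>c. \<exists>f\<in>c. e \<noteq> f \<and> same e f (snd \<omega>)"
proof (rule ccontr)
  assume no: "\<not> ?thesis"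
  note cD = confD[OF c(1)]
  have "\<forall>e\<in>c. \<exists>r. (r, e) \<in> snd \<omega>" using c(2) by (force simp: Tk_def)
  then obtain rd where rd: "\<And>e. e \<in> c \<Longrightarrow> (rd e, e) \<in> snd \<omega>" by metis
  have inj: "rd e \<noteq> rd f" if "e \<in> c" "f \<in> c" "e \<noteq> f" for e f
  proof
    assume eq: "rd e = rd f"
    have "(rd e, f) \<in> snd \<omega>" unfolding eq by (rule rd[OF that(2)])
    then have "same e f (snd \<omega>)" unfolding same_def using rd[OF that(1)] by blast
    then show False using no that by blast
  qed
  have ne: "c \<noteq> {}" using cD(2) by auto
  obtain e where em: "e \<in> c" "Max (rd ` c) = rd e"
    using Max_in[OF finite_imageI[OF cD(5)], of rd] ne by blast
  have e: "e \<in> c" "rd f \<le> rd e" if "f \<in> c" for f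
    unfolding em(2)[symmetric] using that em(1) cD(5) by (auto intro: Max_ge)
  have ne': "rd ` (c - {e}) \<noteq> {}"
  proof
    assume "rd ` (c - {e}) = {}"
    then have "c - {e} = {}" by simp
    then have "card c \<le> card {e}" by (intro card_mono) auto
    then show False using cD(2) by simp
  qed
  have finr: "finite (rd ` (c - {e}))" using cD(5) by simp
  obtain g where g: "g \<in> c - {e}" "rd g = Max (rd ` (c - {e}))"
    using Max_in[OF finr ne'] by (metis imageE)
  have oth: "\<forall>f\<in>c - {e, g}. \<exists>r'<rd g. (r', f) \<in> snd \<omega>"
  proof
    fix f assume f: "f \<in> c - {e, g}"
    have "rd f \<le> rd g" unfolding g(2) using f cD(5) by (intro Max_ge) auto
    then have "rd f < rd g" using inj[of f g] f g(1) by force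
    then show "\<exists>r'<rd g. (r', f) \<in> snd \<omega>" using rd f by blast
  qed
  have "rd g \<le> rd e" "rd g \<noteq> rd e" using e(2)[of g] inj[of g e] g(1) em(1) by auto
  then have "rd g < rd e" by simp
  have "\<forall>c\<in>conf. \<forall>e\<in>c. \<forall>(r, g)\<in>snd \<omega>. g \<in> c \<longrightarrow> g \<noteq> e \<longrightarrow>
          (\<forall>f\<in>c - {e, g}. \<exists>r'<r. (r', f) \<in> snd \<omega>) \<longrightarrow>
          Inr e \<notin> fst \<omega> \<and> (\<forall>r'>r. (r', e) \<notin> snd \<omega>)"
    using inv unfolding inv_def by (elim conjE)
  note bspec[OF bspec[OF bspec[OF this c(1)] em(1)] rd[of g], unfolded prod.case]
  then have "(rd e, e) \<notin> snd \<omega>" using g(1) oth \<open>rd g < rd e\<close> by blast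
  then show False using rd em(1) by blast
qed

definition bad2 :: "('b \<times> 'b) set" where
  "bad2 = {(e, f). e \<in> B \<and> f \<in> B \<and> e \<noteq> f \<and> J e \<inter> J f \<noteq> {}}"

definition degen :: "'b set set" where
  "degen = {S. S \<subseteq> B \<and> 2 \<le> card S \<and> card S \<le> 8 \<and> df S \<le> 1}"

text \<open>The deletion method. Three kinds of defects can remain among the taken blocks: two
  blocks of one round with a common point, conflicts, which by \<open>conf_same\<close> have two
  members of one round, and sets of excess at most 1. One block is removed per defect. The 64 bounds
  the number of ordered pairs in a conflict.\<close>

lemma extraction:
  shows "\<exists>BB\<subseteq>B. real (card BB) \<ge> (\<Sum>i<T. p i * (\<Sum>e\<in>B. EE i (\<lambda>\<omega>. of_bool (e \<in> Av (fst \<omega>)))))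
       - card bad2 * (\<Sum>r<T. p r ^ 2) - (\<Sum>c\<in>conf. 64 * ((\<Sum>r<T. p r ^ 2) * (\<Sum>r<T. p r) ^ (card c - 2)))
       - (\<Sum>S\<in>degen. (\<Sum>r<T. p r) ^ card S)
     \<and> (\<forall>e\<in>BB. \<forall>f\<in>BB. e \<noteq> f \<longrightarrow> J e \<inter> J f = {}) \<and> (\<forall>c\<in>conf. \<not> c \<subseteq> BB)
     \<and> (\<forall>S\<subseteq>BB. 2 \<le> card S \<longrightarrow> card S \<le> 8 \<longrightarrow> 2 \<le> df S)"
proof -
  let ?val = "(\<Sum>i<T. p i * (\<Sum>e\<in>B. EE i (\<lambda>\<omega>. of_bool (e \<in> Av (fst \<omega>)))))
       - card bad2 * (\<Sum>r<T. p r ^ 2) - (\<Sum>c\<in>conf. 64 * ((\<Sum>r<T. p r ^ 2) * (\<Sum>r<T. p r) ^ (card c - 2)))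
       - (\<Sum>S\<in>degen. (\<Sum>r<T. p r) ^ card S)"
  define ef where "ef = (\<lambda>c. {x \<in> c \<times> c. fst x \<noteq> snd x} :: ('b \<times> 'b) set)"
  define f2 where "f2 = (\<lambda>\<omega> :: ('v set + 'b) set \<times> (nat \<times> 'b) set.
    \<Sum>x\<in>bad2. of_bool (same (fst x) (snd x) (snd \<omega>) \<and> {} \<subseteq> Tk (snd \<omega>)) :: real)"
  define f3 where "f3 = (\<lambda>\<omega> :: ('v set + 'b) set \<times> (nat \<times> 'b) set.
    \<Sum>c\<in>conf. \<Sum>x\<in>ef c. of_bool (same (fst x) (snd x) (snd \<omega>) \<and> c - {fst x, snd x} \<subseteq> Tk (snd \<omega>)) :: real)"
  define f4 where "f4 = (\<lambda>\<omega> :: ('v set + 'b) set \<times> (nat \<times> 'b) set. \<Sum>S\<in>degen. of_bool (S \<subseteq> Tk (snd \<omega>)) :: real)"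
  have "bad2 \<subseteq> B \<times> B" by (auto simp: bad2_def)
  moreover have "finite (B \<times> B)" using finB by simp
  ultimately have fin2: "finite bad2" by (rule finite_subset)
  have "degen \<subseteq> Pow B" by (auto simp: degen_def)
  moreover have "finite (Pow B)" using finB by simp
  ultimately have fin4: "finite degen" by (rule finite_subset)
  have finef: "finite (ef c)" if "c \<in> conf" for c using confD(5)[OF that] by (simp add: ef_def)
  have cef: "card (ef c) \<le> 64" if "c \<in> conf" for c
  proof -
    have "card (ef c) \<le> card (c \<times> c)" unfolding ef_def using confD(5)[OF that] by (intro card_mono) auto
    also have "\<dots> \<le> 8 * 8" unfolding card_cartesian_product using confD(3)[OF that] by (intro mult_mono) auto
    finally show ?thesis by simp
  qed
  have s0: "0 \<le> (\<Sum>r<T. p r ^ 2)" by (intro sum_nonneg) auto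
  have e2: "EE T f2 \<le> card bad2 * (\<Sum>r<T. p r ^ 2)"
  proof -
    have "EE T f2 = (\<Sum>x\<in>bad2. EE T (\<lambda>\<omega>. of_bool (same (fst x) (snd x) (snd \<omega>) \<and> {} \<subseteq> Tk (snd \<omega>))))"
      unfolding f2_def EE_sum ..
    also have "\<dots> \<le> (\<Sum>x\<in>bad2. (\<Sum>r<T. p r ^ 2) * (\<Sum>r<T. p r) ^ card ({} :: 'b set))"
      by (intro sum_mono same_taken_le) (auto simp: bad2_def)
    finally show ?thesis by simp
  qed
  have e3: "EE T f3 \<le> (\<Sum>c\<in>conf. 64 * ((\<Sum>r<T. p r ^ 2) * (\<Sum>r<T. p r) ^ (card c - 2)))"
  proof -
    have "EE T f3 = (\<Sum>c\<in>conf. \<Sum>x\<in>ef c. EE T (\<lambda>\<omega>. of_bool (same (fst x) (snd x) (snd \<omega>) \<and> c - {fst x, snd x} \<subseteq> Tk (snd \<omega>))))"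
      unfolding f3_def EE_sum ..
    also have "\<dots> \<le> (\<Sum>c\<in>conf. \<Sum>x\<in>ef c. (\<Sum>r<T. p r ^ 2) * (\<Sum>r<T. p r) ^ (card c - 2))"
    proof (intro sum_mono)
      fix c x assume c: "c \<in> conf" and x: "x \<in> ef c"
      have xx: "fst x \<in> c" "snd x \<in> c" "fst x \<noteq> snd x" using x by (auto simp: ef_def)
      have "card (c - {fst x, snd x}) = card c - 2" using xx by (simp add: card_Diff_subset)
      then show "EE T (\<lambda>\<omega>. of_bool (same (fst x) (snd x) (snd \<omega>) \<and> c - {fst x, snd x} \<subseteq> Tk (snd \<omega>)))
        \<le> (\<Sum>r<T. p r ^ 2) * (\<Sum>r<T. p r) ^ (card c - 2)"
        using same_taken_le[of "c - {fst x, snd x}" "fst x" "snd x" T] xx confD(1)[OF c] by auto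
    qed
    also have "\<dots> = (\<Sum>c\<in>conf. card (ef c) * ((\<Sum>r<T. p r ^ 2) * (\<Sum>r<T. p r) ^ (card c - 2)))" by simp
    also have "\<dots> \<le> (\<Sum>c\<in>conf. 64 * ((\<Sum>r<T. p r ^ 2) * (\<Sum>r<T. p r) ^ (card c - 2)))"
    proof (intro sum_mono mult_right_mono)
      fix c assume "c \<in> conf"
      then show "real (card (ef c)) \<le> 64" using cef[of c] by simp
    qed (use s0 p_sum_nonneg in auto)
    finally show ?thesis .
  qed
  have e4: "EE T f4 \<le> (\<Sum>S\<in>degen. (\<Sum>r<T. p r) ^ card S)"
    unfolding f4_def EE_sum by (intro sum_mono taken_le) (auto simp: degen_def)
  have "?val \<le> EE T (\<lambda>\<omega>. real (card (snd \<omega>)) - f2 \<omega> - f3 \<omega> - f4 \<omega>)"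
    unfolding EE_diff using taken_expectation[of T] e2 e3 e4 by linarith
  from EE_exists[OF this] obtain \<omega> where inv: "inv T \<omega>"
    and \<omega>: "?val \<le> real (card (snd \<omega>)) - f2 \<omega> - f3 \<omega> - f4 \<omega>" by blast
  define X where "X = Tk (snd \<omega>)"
  have XB: "X \<subseteq> B" using inv_H[OF inv] by (auto simp: X_def Tk_def)
  have finX: "finite X" using XB finB finite_subset by auto
  define A2 where "A2 = {x \<in> bad2. same (fst x) (snd x) (snd \<omega>)}"
  define A3 where "A3 = {(c, x). c \<in> conf \<and> x \<in> ef c \<and> same (fst x) (snd x) (snd \<omega>) \<and> c - {fst x, snd x} \<subseteq> X}"
  define A4 where "A4 = {S \<in> degen. S \<subseteq> X}"
  have A3eq: "A3 = (SIGMA c:conf. {x \<in> ef c. same (fst x) (snd x) (snd \<omega>) \<and> c - {fst x, snd x} \<subseteq> X})"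
    by (auto simp: A3_def)
  have finA: "finite A2" "finite A3" "finite A4"
    unfolding A2_def A3eq A4_def using fin2 fin4 finite_conf finef by auto
  have c2: "f2 \<omega> = card A2"
  proof -
    have "f2 \<omega> = card (bad2 \<inter> {x. same (fst x) (snd x) (snd \<omega>) \<and> {} \<subseteq> Tk (snd \<omega>)})"
      by (simp add: f2_def fin2)
    also have "bad2 \<inter> {x. same (fst x) (snd x) (snd \<omega>) \<and> {} \<subseteq> Tk (snd \<omega>)} = A2" by (auto simp: A2_def)
    finally show ?thesis .
  qed
  have c3: "f3 \<omega> = card A3"
  proof -
    have "f3 \<omega> = (\<Sum>c\<in>conf. real (card (ef c \<inter> {x. same (fst x) (snd x) (snd \<omega>) \<and> c - {fst x, snd x} \<subseteq> Tk (snd \<omega>)})))"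
      unfolding f3_def by (intro sum.cong refl) (simp add: finef)
    also have "\<dots> = (\<Sum>c\<in>conf. real (card {x \<in> ef c. same (fst x) (snd x) (snd \<omega>) \<and> c - {fst x, snd x} \<subseteq> X}))"
      unfolding X_def by (intro sum.cong refl arg_cong[where f = real] arg_cong[where f = card]) auto
    also have "\<dots> = card A3"
      unfolding A3eq using finite_conf finef by (subst card_SigmaI) auto
    finally show ?thesis .
  qed
  have c4: "f4 \<omega> = card A4"
  proof -
    have "f4 \<omega> = card (degen \<inter> {S. S \<subseteq> Tk (snd \<omega>)})"
      by (simp add: f4_def fin4)
    also have "degen \<inter> {S. S \<subseteq> Tk (snd \<omega>)} = A4" by (auto simp: A4_def X_def)
    finally show ?thesis .
  qed
  define del where "del = fst ` A2 \<union> (\<lambda>(c, x). fst x) ` A3 \<union> (\<lambda>S. SOME e. e \<in> S) ` A4"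
  define BB where "BB = X - del"
  have "card del \<le> card (fst ` A2 \<union> (\<lambda>(c, x). fst x) ` A3) + card ((\<lambda>S. SOME e. e \<in> S) ` A4)"
    unfolding del_def by (rule card_Un_le)
  also have "\<dots> \<le> (card (fst ` A2) + card ((\<lambda>(c, x). fst x) ` A3)) + card ((\<lambda>S. SOME e. e \<in> S) ` A4)"
    by (intro add_right_mono card_Un_le)
  also have "\<dots> \<le> card A2 + card A3 + card A4"
    by (intro add_mono card_image_le finA)
  finally have "card del \<le> card A2 + card A3 + card A4" .
  moreover have "card X \<le> card BB + card del"
  proof -
    have "finite del" unfolding del_def using finA by auto
    then have "card X \<le> card (BB \<union> del)" using finX by (intro card_mono) (auto simp: BB_def)
    also have "\<dots> \<le> card BB + card del" by (rule card_Un_le)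
    finally show ?thesis .
  qed
  moreover have "card X = card (snd \<omega>)" unfolding X_def by (rule card_Tk[OF inv])
  ultimately have "real (card (snd \<omega>)) - f2 \<omega> - f3 \<omega> - f4 \<omega> \<le> card BB"
    unfolding c2 c3 c4 by linarith
  then have size: "?val \<le> card BB" using \<omega> by linarith
  have p1: "J e \<inter> J f = {}" if ef: "e \<in> BB" "f \<in> BB" "e \<noteq> f" for e f
  proof (rule ccontr)
    assume ne: "J e \<inter> J f \<noteq> {}"
    obtain r r' where r: "(r, e) \<in> snd \<omega>" "(r', f) \<in> snd \<omega>"
      using ef by (force simp: BB_def X_def Tk_def)
    have "r = r'" using inv_point_disjoint[OF inv r] ne by auto
    then have "same e f (snd \<omega>)" using r by (auto simp: same_def)
    then have "(e, f) \<in> A2" using ef ne XB by (auto simp: A2_def bad2_def BB_def)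
    then have "e \<in> del" unfolding del_def by force
    then show False using ef by (simp add: BB_def)
  qed
  have p2: "\<not> c \<subseteq> BB" if c: "c \<in> conf" for c
  proof
    assume cB: "c \<subseteq> BB"
    then have cX: "c \<subseteq> X" by (auto simp: BB_def)
    obtain e f where ef': "e \<in> c" "f \<in> c" "e \<noteq> f" "same e f (snd \<omega>)"
      using conf_same[OF inv c] cX unfolding X_def by blast
    then have "(c, (e, f)) \<in> A3" using c cX by (auto simp: A3_def ef_def)
    then have "e \<in> del" unfolding del_def by force
    then show False using ef' cB by (auto simp: BB_def)
  qed
  have p3: "2 \<le> df S" if S: "S \<subseteq> BB" "2 \<le> card S" "card S \<le> 8" for S
  proof (rule ccontr)
    assume "\<not> 2 \<le> df S"
    then have "S \<in> A4" using S XB by (auto simp: A4_def degen_def BB_def)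
    then have "(SOME e. e \<in> S) \<in> del" unfolding del_def by blast
    moreover have "(SOME e. e \<in> S) \<in> S" using S(2) by (metis card.empty ex_in_conv not_numeral_le_zero someI_ex)
    ultimately show False using S(1) by (auto simp: BB_def)
  qed
  have "BB \<subseteq> B" using XB by (auto simp: BB_def)
  then show ?thesis using size p1 p2 p3 by blast
qed

end

section \<open>Counting hypotheses and the choice of parameters\<close>

text \<open>Conflicts through a fixed block, weighted as if every other member were taken with
  probability \<open>x / D\<close>: a conflict of \<open>l\<close> blocks has
  \<open>M * (l - 1)\<close> further vertices, and \<open>n ^ M\<close> is at most
  \<open>K * D\<close>.\<close>

definition kap :: "real \<Rightarrow> real \<Rightarrow> real" where
  "kap K x = (\<Sum>l=3..8. K * (K * x) ^ (l - 1))"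

text \<open>The companion of \<open>kap\<close> for dangerous enlargements by \<open>j\<close>
  blocks, one of which stays free: this explains the factor \<open>j\<close> and the exponent
  \<open>j - 1\<close>.\<close>

definition ycon :: "real \<Rightarrow> real \<Rightarrow> real" where
  "ycon K x = (\<Sum>j=1..14. real j * (K * K ^ j) * x ^ (j - 1))"

text \<open>\<open>D\<close> is the intended number of blocks through a point, of order at least
  \<open>n ^ M\<close>. In \<open>count\<close> only new vertices cost a factor \<open>n\<close>;
  the bounds 8 and 14 match the tight sets in use and the enlargements in
  \<open>dang\<close>.\<close>

locale counted = block_system B V J M s
  for B :: "'b set" and V :: "'b \<Rightarrow> 'v set" and J M s +
  fixes n :: nat and K D :: real
  assumes K1: "1 \<le> K" and n1: "1 \<le> n" and D0: "0 < D" and nD: "real n ^ M \<le> K * D"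
    and count: "S0 \<subseteq> B \<Longrightarrow> S0 \<noteq> {} \<Longrightarrow> card S0 \<le> 8 \<Longrightarrow> j \<le> 14 \<Longrightarrow>
      real (card {S. S0 \<subseteq> S \<and> S \<subseteq> B \<and> card S = card S0 + j \<and>
        card (\<Union>(V ` S)) \<le> card (\<Union>(V ` S0)) + a}) \<le> K * real n ^ a"
begin

lemma n_power_le: "real n ^ (M * j) \<le> (K * D) ^ j"
  using power_mono[OF nD, of j] by (simp add: power_mult)

lemma n_power_le': "1 \<le> j \<Longrightarrow> real n ^ (M * j - 1) \<le> (K * D) ^ j / n"
proof -
  assume j: "1 \<le> j"
  then have "1 \<le> M * j" using M_pos by simp
  then have "real n ^ (M * j - 1) * n = real n ^ (M * j)"
    by (metis One_nat_def Suc_pred' less_le_trans mult.commute power_Suc zero_less_Suc zero_less_one)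
  then show ?thesis using n_power_le[of j] n1 by (simp add: field_simps)
qed

lemma conf_sum:
  assumes e: "e \<in> B" and x: "0 \<le> x"
  shows "(\<Sum>c\<in>{c \<in> conf. e \<in> c}. (x / D) ^ (card c - 1)) \<le> kap K x"
proof -
  define A where "A = (\<lambda>l. {c \<in> conf. e \<in> c \<and> card c = l})"
  have finA: "finite (A l)" for l
    by (rule finite_subset[of _ "Pow B"]) (use finB in \<open>auto simp: A_def conf_def\<close>)
  have "{c \<in> conf. e \<in> c} = (\<Union>l\<in>{3..8}. A l)" using confD(2,3) by (auto simp: A_def)
  then have "(\<Sum>c\<in>{c \<in> conf. e \<in> c}. (x / D) ^ (card c - 1)) = (\<Sum>c\<in>(\<Union>l\<in>{3..8}. A l). (x / D) ^ (card c - 1))" by simp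
  also have "\<dots> = (\<Sum>l\<in>{3..8}. \<Sum>c\<in>A l. (x / D) ^ (card c - 1))"
    using finA by (intro sum.UNION_disjoint) (auto simp: A_def)
  also have "\<dots> \<le> (\<Sum>l\<in>{3..8}. K * (K * x) ^ (l - 1))"
  proof (rule sum_mono)
    fix l :: nat assume l: "l \<in> {3..8}"
    have "A l \<subseteq> {S. {e} \<subseteq> S \<and> S \<subseteq> B \<and> card S = card {e} + (l - 1) \<and>
        card (\<Union>(V ` S)) \<le> card (\<Union>(V ` {e})) + M * (l - 1)}" (is "_ \<subseteq> ?R")
    proof
      fix c assume "c \<in> A l"
      then have c: "c \<in> conf" "e \<in> c" "card c = l" by (auto simp: A_def)
      note cD = confD[OF c(1)]
      have "int (card (\<Union>(V ` c))) = int M * int l + 2" using cD(4) c(3) by (simp add: df_def)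
      then have "card (\<Union>(V ` c)) = M * l + 2" by (simp flip: of_nat_mult)
      also have "M * l = M + M * (l - 1)" using l by (cases l) auto
      finally show "c \<in> ?R" using c cD(1) l cardV[OF e] by auto
    qed
    then have "card (A l) \<le> card ?R"
      by (rule card_mono[rotated]) (rule finite_subset[of _ "Pow B"], use finB in auto)
    then have "real (card (A l)) \<le> real (card ?R)" by simp
    also have "\<dots> \<le> K * real n ^ (M * (l - 1))"
      using e l by (intro count) auto
    also have "\<dots> \<le> K * (K * D) ^ (l - 1)"
      using n_power_le K1 by (intro mult_left_mono) auto
    finally have cA: "real (card (A l)) \<le> K * (K * D) ^ (l - 1)" .
    have "(\<Sum>c\<in>A l. (x / D) ^ (card c - 1)) = real (card (A l)) * (x / D) ^ (l - 1)"
      by (simp add: A_def)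
    also have "\<dots> \<le> K * (K * D) ^ (l - 1) * (x / D) ^ (l - 1)"
      using cA x D0 by (intro mult_right_mono) auto
    also have "\<dots> = K * (K * x) ^ (l - 1)"
      using D0 by (simp add: power_mult_distrib power_divide)
    finally show "(\<Sum>c\<in>A l. (x / D) ^ (card c - 1)) \<le> K * (K * x) ^ (l - 1)" .
  qed
  finally show ?thesis by (simp add: kap_def)
qed

text \<open>Falling from excess 2 to at most 1 leaves at most \<open>M * j - 1\<close> new vertices
  for \<open>j\<close> new blocks; the missing vertex is the gain \<open>1 / n\<close>.\<close>

lemma dang_sum:
  assumes S0: "tight S0" "S0 \<noteq> {}" "card S0 \<le> 8" and x: "0 \<le> x"
  shows "(\<Sum>S\<in>dang S0. real (card (S - S0)) * (x / D) ^ (card (S - S0) - 1)) \<le> ycon K x * D / n"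
proof -
  note t = tightD[OF S0(1)]
  define A where "A = (\<lambda>j. {S \<in> dang S0. card S = card S0 + j})"
  have finA: "finite (A j)" for j
    by (rule finite_subset[of _ "Pow B"]) (use finB in \<open>auto simp: A_def dang_def\<close>)
  have fin: "finite S" if "S \<in> dang S0" for S
    using that finB finite_subset by (auto simp: dang_def)
  have eq: "dang S0 = (\<Union>j\<in>{1..14}. A j)"
  proof (intro equalityI subsetI)
    fix S assume S: "S \<in> dang S0"
    have "card S0 < card S" using S fin[OF S] by (intro psubset_card_mono) (auto simp: dang_def)
    then have "S \<in> A (card S - card S0)" "card S - card S0 \<in> {1..14}" using S by (auto simp: A_def dang_def)
    then show "S \<in> (\<Union>j\<in>{1..14}. A j)" by blast
  qed (auto simp: A_def)
  have cardD: "card (S - S0) = j" if "S \<in> A j" for S j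
    using that t(4) by (subst card_Diff_subset) (auto simp: A_def dang_def)
  have "(\<Sum>S\<in>dang S0. real (card (S - S0)) * (x / D) ^ (card (S - S0) - 1))
    = (\<Sum>j\<in>{1..14}. \<Sum>S\<in>A j. real (card (S - S0)) * (x / D) ^ (card (S - S0) - 1))"
    unfolding eq using finA by (intro sum.UNION_disjoint) (auto simp: A_def)
  also have "\<dots> \<le> (\<Sum>j\<in>{1..14}. real j * (K * K ^ j) * x ^ (j - 1) * D / n)"
  proof (rule sum_mono)
    fix j :: nat assume j: "j \<in> {1..14}"
    have "A j \<subseteq> {S. S0 \<subseteq> S \<and> S \<subseteq> B \<and> card S = card S0 + j \<and>
        card (\<Union>(V ` S)) \<le> card (\<Union>(V ` S0)) + (M * j - 1)}" (is "_ \<subseteq> ?R")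
    proof
      fix S assume "S \<in> A j"
      then have S: "S0 \<subseteq> S" "S \<subseteq> B" "card S = card S0 + j" "df S \<le> 1" by (auto simp: A_def dang_def)
      have "int M * int (card S) = int M * int (card S0) + int (M * j)" using S(3) by (simp add: algebra_simps)
      then have "card (\<Union>(V ` S)) + 1 \<le> card (\<Union>(V ` S0)) + M * j"
        using S(4) t(2) unfolding df_def by linarith
      moreover have "1 \<le> M * j" using M_pos j by simp
      ultimately have "card (\<Union>(V ` S)) \<le> card (\<Union>(V ` S0)) + (M * j - 1)" by linarith
      then show "S \<in> ?R" using S by simp
    qed
    then have "card (A j) \<le> card ?R"
      by (rule card_mono[rotated]) (rule finite_subset[of _ "Pow B"], use finB in auto)
    then have "real (card (A j)) \<le> real (card ?R)" by simp
    also have "\<dots> \<le> K * real n ^ (M * j - 1)"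
      using S0 t j by (intro count) auto
    also have "\<dots> \<le> K * ((K * D) ^ j / n)"
      using n_power_le'[of j] K1 j by (intro mult_left_mono) auto
    finally have cA: "real (card (A j)) \<le> K * ((K * D) ^ j / n)" .
    have "(\<Sum>S\<in>A j. real (card (S - S0)) * (x / D) ^ (card (S - S0) - 1)) = real (card (A j)) * (real j * (x / D) ^ (j - 1))"
      using cardD by simp
    also have "\<dots> \<le> K * ((K * D) ^ j / n) * (real j * (x / D) ^ (j - 1))"
      using cA x D0 by (intro mult_right_mono) auto
    also have "\<dots> = real j * (K * K ^ j) * x ^ (j - 1) * (D ^ j / D ^ (j - 1)) / n"
      by (simp add: power_mult_distrib power_divide mult_ac)
    also have "D ^ j / D ^ (j - 1) = D" using j D0 by (cases j) auto
    finally show "(\<Sum>S\<in>A j. real (card (S - S0)) * (x / D) ^ (card (S - S0) - 1))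
      \<le> real j * (K * K ^ j) * x ^ (j - 1) * D / n" .
  qed
  also have "\<dots> = ycon K x * D / n"
    by (simp add: ycon_def sum_distrib_right sum_divide_distrib)
  finally show ?thesis .
qed

lemma ycon_nonneg: "0 \<le> x \<Longrightarrow> 0 \<le> ycon K x"
  unfolding ycon_def using K1 by (intro sum_nonneg mult_nonneg_nonneg) auto

lemma pair_count:
  assumes e: "e \<in> B" and k: "k \<le> M + 2"
  shows "real (card {f \<in> B. f \<noteq> e \<and> k \<le> card (V e \<inter> V f)}) \<le> K * real n ^ (M + 2 - k)"
proof -
  let ?A = "{f \<in> B. f \<noteq> e \<and> k \<le> card (V e \<inter> V f)}"
  let ?R = "{S. {e} \<subseteq> S \<and> S \<subseteq> B \<and> card S = card {e} + 1 \<and>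
      card (\<Union>(V ` S)) \<le> card (\<Union>(V ` {e})) + (M + 2 - k)}"
  have "(\<lambda>f. {e, f}) ` ?A \<subseteq> ?R"
  proof (rule image_subsetI)
    fix f assume f: "f \<in> ?A"
    then have fB: "f \<in> B" "f \<noteq> e" "k \<le> card (V e \<inter> V f)" by auto
    have "card (V e \<union> V f) + card (V e \<inter> V f) = 2 * (M + 2)"
      using card_Un_Int[OF finV[OF e] finV[OF fB(1)]] cardV[OF e] cardV[OF fB(1)] by simp
    moreover obtain d where d: "M + 2 = k + d" using k le_Suc_ex by blast
    ultimately have "card (V e \<union> V f) + card (V e \<inter> V f) = (M + 2) + (k + d)" by simp
    then have "card (V e \<union> V f) + card (V e \<inter> V f) \<le> (M + 2 + d) + card (V e \<inter> V f)"
      using fB(3) by presburger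
    then have "card (V e \<union> V f) \<le> M + 2 + d" by (rule add_le_imp_le_right)
    then have "card (V e \<union> V f) \<le> M + 2 + (M + 2 - k)" unfolding d by simp
    then show "{e, f} \<in> ?R" using fB e cardV[OF e] by simp
  qed
  moreover have "finite ?R" by (rule finite_subset[of _ "Pow B"]) (use finB in auto)
  ultimately have "card ((\<lambda>f. {e, f}) ` ?A) \<le> card ?R" by (intro card_mono)
  moreover have "inj_on (\<lambda>f. {e, f}) ?A" by (rule inj_onI) (auto simp: doubleton_eq_iff)
  ultimately have "real (card ?A) \<le> real (card ?R)" by (simp add: card_image)
  also have "\<dots> \<le> K * real n ^ (M + 2 - k)" using e by (intro count) auto
  finally show ?thesis .
qed

text \<open>Failure of \<open>V e \<inter> V f = q\<close> means a third common vertex, so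
  \<open>f\<close> brings at most \<open>M - 1\<close> new ones, one fewer than for a generic block
  through \<open>q\<close>.\<close>

lemma generic_count:
  assumes e: "e \<in> B" "q \<in> J e"
  shows "real (card {f \<in> B. q \<in> J f \<and> f \<noteq> e \<and> V e \<inter> V f \<noteq> q}) \<le> K * (K * D) / n"
proof -
  have "{f \<in> B. q \<in> J f \<and> f \<noteq> e \<and> V e \<inter> V f \<noteq> q} \<subseteq> {f \<in> B. f \<noteq> e \<and> 3 \<le> card (V e \<inter> V f)}"
  proof clarify
    fix f assume f: "f \<in> B" "q \<in> J f" "V e \<inter> V f \<noteq> q"
    have "q \<subset> V e \<inter> V f" using f subJ[OF e] subJ[OF f(1,2)] by auto
    then have "card q < card (V e \<inter> V f)" using finV[OF e(1)] by (intro psubset_card_mono) auto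
    then show "3 \<le> card (V e \<inter> V f)" using card2J[OF e] by simp
  qed
  then have "card {f \<in> B. q \<in> J f \<and> f \<noteq> e \<and> V e \<inter> V f \<noteq> q} \<le> card {f \<in> B. f \<noteq> e \<and> 3 \<le> card (V e \<inter> V f)}"
    using finB by (intro card_mono) auto
  also have "real \<dots> \<le> K * real n ^ (M + 2 - 3)" using e M_pos by (intro pair_count) auto
  also have "M + 2 - 3 = M * 1 - 1" by simp
  also have "K * real n ^ (M * 1 - 1) \<le> K * ((K * D) ^ 1 / n)"
    using n_power_le'[of 1] K1 by (intro mult_left_mono) auto
  finally show ?thesis by simp
qed

lemma bad_pairs_count:
  "real (card {(e, f). e \<in> B \<and> f \<in> B \<and> e \<noteq> f \<and> J e \<inter> J f \<noteq> {}}) \<le> card B * (K * (K * D))"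
proof -
  let ?A = "{(e, f). e \<in> B \<and> f \<in> B \<and> e \<noteq> f \<and> J e \<inter> J f \<noteq> {}}"
  have "?A \<subseteq> (SIGMA e:B. {f \<in> B. f \<noteq> e \<and> 2 \<le> card (V e \<inter> V f)})"
  proof
    fix x assume "x \<in> ?A"
    then obtain e f q where x: "x = (e, f)" and a: "e \<in> B" "f \<in> B" "e \<noteq> f" "q \<in> J e" "q \<in> J f"
      by blast
    have "card q \<le> card (V e \<inter> V f)"
      using subJ[OF a(1,4)] subJ[OF a(2,5)] finV[OF a(1)] by (intro card_mono) auto
    then show "x \<in> (SIGMA e:B. {f \<in> B. f \<noteq> e \<and> 2 \<le> card (V e \<inter> V f)})"
      using card2J[OF a(1,4)] a x by simp
  qed
  then have "card ?A \<le> card (SIGMA e:B. {f \<in> B. f \<noteq> e \<and> 2 \<le> card (V e \<inter> V f)})"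
    using finB by (intro card_mono) auto
  also have "\<dots> = (\<Sum>e\<in>B. card {f \<in> B. f \<noteq> e \<and> 2 \<le> card (V e \<inter> V f)})"
    using finB by (intro card_SigmaI) auto
  finally have "real (card ?A) \<le> (\<Sum>e\<in>B. real (card {f \<in> B. f \<noteq> e \<and> 2 \<le> card (V e \<inter> V f)}))"
    by (simp only: of_nat_sum[symmetric] of_nat_le_iff)
  also have "\<dots> \<le> (\<Sum>e\<in>B. K * (K * D))"
  proof (rule sum_mono)
    fix e assume e: "e \<in> B"
    have "real (card {f \<in> B. f \<noteq> e \<and> 2 \<le> card (V e \<inter> V f)}) \<le> K * real n ^ (M + 2 - 2)"
      using e by (intro pair_count) auto
    also have "\<dots> \<le> K * (K * D)" using nD K1 by (intro mult_left_mono) auto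
    finally show "real (card {f \<in> B. f \<noteq> e \<and> 2 \<le> card (V e \<inter> V f)}) \<le> K * (K * D)" .
  qed
  finally show ?thesis by simp
qed

text \<open>Every conflict is charged to its members, which reduces the sum to
  \<open>conf_sum\<close>; the exponent \<open>card c - 2\<close> in place of
  \<open>card c - 1\<close> costs the factor \<open>D\<close>.\<close>

lemma conf_total:
  assumes x: "1 \<le> x"
  shows "(\<Sum>c\<in>conf. (x / D) ^ (card c - 2)) \<le> card B * (kap K x * D)"
proof -
  have fin: "finite conf" by (rule finite_subset[of _ "Pow B"]) (use finB in \<open>auto simp: conf_def\<close>)
  have "(\<Sum>c\<in>conf. (x / D) ^ (card c - 2)) \<le> (\<Sum>c\<in>conf. \<Sum>e\<in>c. (x / D) ^ (card c - 1) * D)"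
  proof (rule sum_mono)
    fix c assume c: "c \<in> conf"
    note cD = confD[OF c]
    have xD: "0 < x / D" using x D0 by simp
    have "(x / D) ^ (card c - 2) * 1 \<le> (x / D) ^ (card c - 2) * x" using x xD by (intro mult_left_mono) auto
    also have "\<dots> = (x / D) ^ (card c - 1) * D"
    proof -
      have "card c - 1 = Suc (card c - 2)" using cD(2) by simp
      then show ?thesis using D0 by simp
    qed
    also have "\<dots> \<le> real (card c) * ((x / D) ^ (card c - 1) * D)"
      using cD(2) xD D0 mult_right_mono[of 1 "real (card c)" "(x / D) ^ (card c - 1) * D"] by simp
    finally show "(x / D) ^ (card c - 2) \<le> (\<Sum>e\<in>c. (x / D) ^ (card c - 1) * D)" by simp
  qed
  also have "\<dots> = (\<Sum>c\<in>conf. \<Sum>e | e \<in> B \<and> e \<in> c. (x / D) ^ (card c - 1) * D)"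
    using confD(1) by (intro sum.cong refl) auto
  also have "\<dots> = (\<Sum>e\<in>B. \<Sum>c | c \<in> conf \<and> e \<in> c. (x / D) ^ (card c - 1) * D)"
    by (rule sum.swap_restrict[OF fin finB])
  also have "\<dots> \<le> (\<Sum>e\<in>B. kap K x * D)"
  proof (rule sum_mono)
    fix e assume "e \<in> B"
    then have "(\<Sum>c | c \<in> conf \<and> e \<in> c. (x / D) ^ (card c - 1)) * D \<le> kap K x * D"
      using conf_sum[of e x] x D0 by (intro mult_right_mono) auto
    then show "(\<Sum>c | c \<in> conf \<and> e \<in> c. (x / D) ^ (card c - 1) * D) \<le> kap K x * D"
      by (simp only: sum_distrib_right)
  qed
  finally show ?thesis by simp
qed

text \<open>For each of its members \<open>e\<close>, a degenerate set is a dangerous enlargement of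
  the tight set \<open>{e}\<close>, so \<open>dang_sum\<close> supplies the gain
  \<open>1 / n\<close>.\<close>

lemma degen_total:
  assumes x: "0 \<le> x"
  shows "(\<Sum>S\<in>{S. S \<subseteq> B \<and> 2 \<le> card S \<and> card S \<le> 8 \<and> df S \<le> 1}. (x / D) ^ card S)
    \<le> card B / D * (x\<^sup>2 * ycon K x / n)"
proof -
  let ?G = "{S. S \<subseteq> B \<and> 2 \<le> card S \<and> card S \<le> 8 \<and> df S \<le> 1}"
  have fin: "finite ?G" by (rule finite_subset[of _ "Pow B"]) (use finB in auto)
  have xD: "0 \<le> x / D" using x D0 by simp
  have "(\<Sum>S\<in>?G. (x / D) ^ card S) \<le> (\<Sum>S\<in>?G. \<Sum>e\<in>S. (x / D) ^ card S)"
  proof (rule sum_mono)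
    fix S assume "S \<in> ?G"
    then have "1 \<le> card S" by auto
    then show "(x / D) ^ card S \<le> (\<Sum>e\<in>S. (x / D) ^ card S)"
      using xD mult_right_mono[of 1 "real (card S)" "(x / D) ^ card S"] by simp
  qed
  also have "\<dots> = (\<Sum>S\<in>?G. \<Sum>e | e \<in> B \<and> e \<in> S. (x / D) ^ card S)"
    by (intro sum.cong refl) auto
  also have "\<dots> = (\<Sum>e\<in>B. \<Sum>S | S \<in> ?G \<and> e \<in> S. (x / D) ^ card S)"
    by (rule sum.swap_restrict[OF fin finB])
  also have "\<dots> \<le> (\<Sum>e\<in>B. (x / D)\<^sup>2 * (ycon K x * D / n))"
  proof (rule sum_mono)
    fix e assume e: "e \<in> B"
    have tt: "tight {e}" using pair_tight[OF e e] by simp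
    have sub: "{S. S \<in> ?G \<and> e \<in> S} \<subseteq> dang {e}"
    proof clarify
      fix S assume S: "S \<subseteq> B" "2 \<le> card S" "card S \<le> 8" "df S \<le> 1" "e \<in> S"
      have "S \<noteq> {e}" using S(2) by auto
      then show "S \<in> dang {e}" using S by (auto simp: dang_def)
    qed
    have find: "finite (dang {e})" by (rule finite_subset[of _ "Pow B"]) (use finB in \<open>auto simp: dang_def\<close>)
    have "(\<Sum>S | S \<in> ?G \<and> e \<in> S. (x / D) ^ card S)
      \<le> (\<Sum>S | S \<in> ?G \<and> e \<in> S. (x / D)\<^sup>2 * (real (card (S - {e})) * (x / D) ^ (card (S - {e}) - 1)))"
    proof (rule sum_mono)
      fix S assume "S \<in> {S. S \<in> ?G \<and> e \<in> S}"
      then have S: "S \<subseteq> B" "2 \<le> card S" "e \<in> S" by auto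
      have c: "card (S - {e}) = card S - 1" using S finB finite_subset by (auto simp: card_Diff_singleton)
      have "card S = 2 + (card (S - {e}) - 1)" using c S(2) by linarith
      then have "(x / D) ^ card S = (x / D)\<^sup>2 * (1 * (x / D) ^ (card (S - {e}) - 1))"
        by (metis mult_1 power_add)
      also have "\<dots> \<le> (x / D)\<^sup>2 * (real (card (S - {e})) * (x / D) ^ (card (S - {e}) - 1))"
        using xD c S(2) by (intro mult_left_mono mult_right_mono) auto
      finally show "(x / D) ^ card S \<le> (x / D)\<^sup>2 * (real (card (S - {e})) * (x / D) ^ (card (S - {e}) - 1))" .
    qed
    also have "\<dots> \<le> (\<Sum>S\<in>dang {e}. (x / D)\<^sup>2 * (real (card (S - {e})) * (x / D) ^ (card (S - {e}) - 1)))"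
      using sub find xD by (intro sum_mono2) auto
    also have "\<dots> \<le> (x / D)\<^sup>2 * (ycon K x * D / n)"
      unfolding sum_distrib_left[symmetric] using dang_sum[OF tt _ _ x] by (intro mult_left_mono) auto
    finally show "(\<Sum>S | S \<in> ?G \<and> e \<in> S. (x / D) ^ card S) \<le> (x / D)\<^sup>2 * (ycon K x * D / n)" .
  qed
  also have "\<dots> = card B / D * (x\<^sup>2 * ycon K x / n)"
    using D0 by (simp add: power2_eq_square field_simps)
  finally show ?thesis .
qed

text \<open>One run with explicit parameters. With
  \<open>a = (1 - \<rho>) ^ (s - 1) * (1 - \<kappa>)\<close>, a living point should lie in about
  \<open>D * a ^ i\<close> available blocks before round \<open>i\<close>, so
  \<open>p i = \<delta> / (D * a ^ i)\<close> uses a point with probability about \<delta> in every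
  round. The surplus of \<rho> over \<delta> leaves room for degrees up to
  \<open>(1 + \<epsilon>) * D\<close> and for the moment method. The assumptions \<open>err\<close>,
  \<open>pts\<close> and \<open>bads\<close> bound the errors from the potential, from exceptional
  points and from the deletions.\<close>

lemma nibble_run:
  fixes \<epsilon> \<delta> \<rho> \<kappa> \<alpha> L L2 F \<kappa>1 :: real and T t k :: nat
  assumes eps: "0 < \<epsilon>" "\<epsilon> < 1" and \<delta>: "0 < \<delta>" and \<rho>: "\<rho> = (1 + 2 * \<epsilon>) * \<delta>" "\<rho> < 1"
    and \<kappa>: "0 \<le> \<kappa>" "\<kappa> < 1" and \<alpha>: "0 < \<alpha>" "\<alpha> \<le> ((1 - \<rho>) ^ (s - 1) * (1 - \<kappa>)) ^ T"
    and T\<epsilon>: "(1 - \<rho>) ^ T \<le> \<epsilon>"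
    and L: "1 \<le> L" "T * \<delta> / \<alpha> \<le> L" "L + 2 / \<alpha> \<le> L2"
    and F: "1 \<le> F" "F ^ T \<le> 2" "\<delta> / (D * \<alpha>) < 1" "1 \<le> F * (1 - \<delta> / (D * \<alpha>)) ^ (k * (s + 1) * t)"
    and k: "8 \<le> k" "k \<le> \<epsilon> / 2 * D * \<alpha>" and \<kappa>1: "0 < \<kappa>1" "\<kappa>1 \<le> \<kappa> / \<delta>" "2 * (kap K 1 + 1) / \<kappa>1 \<le> \<epsilon> / 2"
    and t: "0 < t"
    and err: "T * (kap K L2 * ((ycon K L * D / n + 8) / t)) / ((1 - \<rho>) ^ s * (1 - \<kappa>)) ^ T \<le> 1"
    and pts: "T * (s * (2 * ((1 + \<epsilon>) / (1 + 3 * \<epsilon> / 2)) ^ k *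
          (1 + T * ((real k ^ 2 * (ycon K L * D / n) + k) / t) / \<alpha> ^ k) + fact k * (K * K) / (n * \<alpha> ^ k)))
        / ((1 - \<rho>) ^ s * (1 - \<kappa>)) ^ T \<le> \<epsilon> / 2"
    and bads: "T * \<delta>\<^sup>2 / \<alpha>\<^sup>2 * (K * K + 64 * kap K L) + L\<^sup>2 * ycon K L / n \<le> \<epsilon>"
    and good: "real (card {e \<in> B. \<exists>q\<in>J e. (1 + \<epsilon>) * D < card {f \<in> B. q \<in> J f}}) \<le> \<epsilon> * card B"
    and D1: "1 \<le> D"
  shows "\<exists>BB\<subseteq>B. (1 - 6 * \<epsilon>) * card B / D \<le> real (card BB)
     \<and> (\<forall>e\<in>BB. \<forall>f\<in>BB. e \<noteq> f \<longrightarrow> J e \<inter> J f = {}) \<and> (\<forall>c\<in>conf. \<not> c \<subseteq> BB)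
     \<and> (\<forall>S\<subseteq>BB. 2 \<le> card S \<longrightarrow> card S \<le> 8 \<longrightarrow> 2 \<le> df S)"
proof -
  define a where "a = (1 - \<rho>) ^ (s - 1) * (1 - \<kappa>)"
  \<comment> \<open>The default \<open>1 / 2\<close> beyond the last round keeps all probabilities
    strictly between 0 and 1, as the locale demands.\<close>
  define p where "p = (\<lambda>i. if i < T then \<delta> / (D * a ^ i) else 1 / 2)"
  define Th where "Th = (1 - \<rho>) ^ s * (1 - \<kappa>)"
  define Y where "Y = ycon K L * D / n"
  have \<rho>0: "0 < \<rho>" using eps \<delta> by (simp add: \<rho>(1))
  have a01: "0 < a" "a \<le> 1" using \<rho>0 \<rho>(2) \<kappa> by (auto simp: a_def intro!: mult_pos_pos mult_le_one power_le_one)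
  have Th01: "0 < Th" "Th \<le> 1" using \<rho>0 \<rho>(2) \<kappa> by (auto simp: Th_def intro!: mult_pos_pos mult_le_one power_le_one)
  have Tha: "Th = a * (1 - \<rho>)"
    using s_pos by (cases s) (auto simp: Th_def a_def)
  have \<alpha>a: "\<alpha> \<le> a ^ i" if "i \<le> T" for i
  proof -
    have "a ^ T \<le> a ^ i" using a01 that by (intro power_decreasing) auto
    then show ?thesis using \<alpha>(2) unfolding a_def[symmetric] by linarith
  qed
  have \<alpha>1: "\<alpha> \<le> 1" using \<alpha>a[of 0] by simp
  have ple: "p i \<le> \<delta> / (D * \<alpha>)" if "i < T" for i
    unfolding p_def using that \<alpha>a[of i] D0 \<delta> \<alpha>(1) a01 by (auto intro!: divide_left_mono mult_left_mono)
  have p01: "0 < p i" "p i < 1" for i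
  proof -
    show "0 < p i" using \<delta> D0 a01 by (simp add: p_def)
    show "p i < 1"
    proof (cases "i < T")
      case True
      then show ?thesis using ple[OF True] F(3) by linarith
    qed (simp add: p_def)
  qed
  interpret np: nibble_process B V J M s p \<rho> \<kappa>
    using p01 \<rho>0 \<rho>(2) \<kappa> by unfold_locales auto
  have np\<theta>: "np.\<theta> = Th" by (simp add: np.\<theta>_def Th_def)
  define l where "l = L / D"
  have psum: "(\<Sum>r<T. p r) \<le> l"
  proof -
    have "(\<Sum>r<T. p r) \<le> (\<Sum>r<T. \<delta> / (D * \<alpha>))" using ple by (intro sum_mono) auto
    also have "\<dots> = (T * \<delta> / \<alpha>) / D" using D0 \<alpha>(1) by (simp add: field_simps)
    also have "\<dots> \<le> L / D" using L(2) D0 by (intro divide_right_mono) auto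
    finally show ?thesis by (simp add: l_def)
  qed
  have Yb: "(\<Sum>S\<in>dang S0. real (card (S - S0)) * l ^ (card (S - S0) - 1)) \<le> Y"
    if "tight S0" "card S0 \<le> 8" for S0
  proof -
    have "S0 \<noteq> {}" using tightD(2)[OF that(1)] by (auto simp: df_def)
    then show ?thesis unfolding l_def Y_def using L(1) by (intro dang_sum that) auto
  qed
  have Y0: "0 \<le> Y" unfolding Y_def using ycon_nonneg[of L] L(1) D0 by simp
  have F0: "1 \<le> F * (1 - p i) ^ N" if "i < T" "N \<le> k * (s + 1) * t" for i N
  proof -
    have "(1 - \<delta> / (D * \<alpha>)) ^ (k * (s + 1) * t) \<le> (1 - p i) ^ (k * (s + 1) * t)"
      using ple[OF that(1)] F(3) by (intro power_mono) auto
    also have "\<dots> \<le> (1 - p i) ^ N" using p01[of i] that(2) by (intro power_decreasing) auto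
    finally have "F * (1 - \<delta> / (D * \<alpha>)) ^ (k * (s + 1) * t) \<le> F * (1 - p i) ^ N"
      using F(1) by (intro mult_left_mono) auto
    then show ?thesis using F(4) by linarith
  qed
  \<comment> \<open>The future selection mass of an available block. As
    \<open>Th = a * (1 - \<rho>)\<close>, the recursion required of \<mu> reduces to
    \<open>\<delta> + (1 - \<rho>) \<le> 1\<close>.\<close>
  define \<mu> where "\<mu> = (\<lambda>i. 1 / (D * a ^ i))"
  have \<mu>0: "0 < \<mu> i" for i using D0 a01 by (simp add: \<mu>_def)
  have \<mu>le: "\<mu> i \<le> 1 / (D * \<alpha>)" if "i \<le> T" for i
    unfolding \<mu>_def using \<alpha>a[OF that] D0 \<alpha>(1) a01 by (auto intro!: divide_left_mono mult_left_mono)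
  have p\<mu>: "p i = \<delta> * \<mu> i" if "i < T" for i using that by (simp add: p_def \<mu>_def)
  have \<delta>\<rho>: "\<delta> \<le> \<rho>" using eps \<delta> by (simp add: \<rho>(1) algebra_simps)
  define lm where "lm = 2 / (D * \<alpha>)"
  define pr where "pr = (\<lambda>i e x. np.EE i (\<lambda>\<omega>. of_bool (e \<in> Av (fst \<omega>) \<and> np.exc i x \<omega>)))"
  have blocks: "(\<Sum>i<T. pr i e (Inr e) / Th ^ i) \<le> \<epsilon> / 2" if e: "e \<in> B" for e
  proof -
    have "\<kappa>1 * (\<Sum>i<T. np.EE i (\<lambda>\<omega>. of_bool (e \<in> Av (fst \<omega>) \<and> np.exc i (Inr e) \<omega>)) / np.\<theta> ^ i)
      \<le> F ^ T * ((\<Sum>c\<in>{c \<in> conf. e \<in> c}. \<mu> 0 ^ (card c - 1)) + T * (kap K L2 * ((Y + 8) / t)) / np.\<theta> ^ T)"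
    proof (rule np.exceptional_blocks[OF e, where lm = lm and l = l and t = t and Y = Y])
      show "0 \<le> \<mu> i" for i using \<mu>0[of i] by simp
      show "p i + np.\<theta> * \<mu> (Suc i) \<le> \<mu> i" if "i < T" for i
      proof -
        have "np.\<theta> * \<mu> (Suc i) = (1 - \<rho>) * \<mu> i"
          unfolding np\<theta> Tha using a01 D0 by (simp add: \<mu>_def field_simps)
        then have "p i + np.\<theta> * \<mu> (Suc i) = (\<delta> + (1 - \<rho>)) * \<mu> i" using p\<mu>[OF that] by (simp add: algebra_simps)
        also have "\<dots> \<le> 1 * \<mu> i" using \<delta>\<rho> \<mu>0[of i] by (intro mult_right_mono) auto
        finally show ?thesis by simp
      qed
      show "1 \<le> F * (1 - p i) ^ (8 * (s + 1) * t)" if "i < T" for i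
        using k(1) by (intro F0 that mult_right_mono) auto
      show "p i + \<mu> (Suc i) \<le> lm" if "i < T" for i
      proof -
        have "p i \<le> \<delta> / (D * \<alpha>)" by (rule ple[OF that])
        also have "\<dots> \<le> 1 / (D * \<alpha>)" using \<delta>\<rho> \<rho>(2) D0 \<alpha>(1) by (intro divide_right_mono) auto
        finally show ?thesis using \<mu>le[of "Suc i"] that unfolding lm_def by simp
      qed
      show "\<kappa>1 \<le> \<kappa> * \<mu> i / p i" if "i < T" for i
        using \<kappa>1(2) \<mu>0[of i] unfolding p\<mu>[OF that] by simp
      show "(\<Sum>c\<in>{c \<in> conf. e \<in> c}. (lm + l) ^ (card c - 1)) * ((Y + 8) / t) \<le> kap K L2 * ((Y + 8) / t)"
      proof (rule mult_right_mono)
        have "0 \<le> lm + l" "lm + l \<le> L2 / D" "0 \<le> L2"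
        proof -
          show "0 \<le> lm + l" using D0 \<alpha>(1) L(1) by (simp add: lm_def l_def)
          have "lm + l = (L + 2 / \<alpha>) / D" using D0 \<alpha>(1) by (simp add: lm_def l_def field_simps)
          also have "\<dots> \<le> L2 / D" using L(3) D0 by (intro divide_right_mono) auto
          finally show "lm + l \<le> L2 / D" .
          have "0 < 2 / \<alpha>" using \<alpha>(1) by simp
          then show "0 \<le> L2" using L(1,3) by linarith
        qed
        then have "(\<Sum>c\<in>{c \<in> conf. e \<in> c}. (lm + l) ^ (card c - 1)) \<le> (\<Sum>c\<in>{c \<in> conf. e \<in> c}. (L2 / D) ^ (card c - 1))"
          by (intro sum_mono power_mono) auto
        also have "\<dots> \<le> kap K L2" using conf_sum[OF e \<open>0 \<le> L2\<close>] .
        finally show "(\<Sum>c\<in>{c \<in> conf. e \<in> c}. (lm + l) ^ (card c - 1)) \<le> kap K L2" .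
      qed (use Y0 t in auto)
      have "0 \<le> 2 / \<alpha>" using \<alpha>(1) by simp
      then have "0 \<le> L2" using L(1,3) by linarith
      then show "0 \<le> kap K L2 * ((Y + 8) / t)"
        unfolding kap_def using K1 Y0 t by (intro mult_nonneg_nonneg sum_nonneg) auto
    qed (use F psum t Y0 \<kappa>1 Yb in auto)
    also have "\<dots> \<le> 2 * (kap K 1 + 1)"
    proof (intro mult_mono add_mono)
      show "(\<Sum>c\<in>{c \<in> conf. e \<in> c}. \<mu> 0 ^ (card c - 1)) \<le> kap K 1"
        using conf_sum[OF e, of 1] by (simp add: \<mu>_def)
      show "T * (kap K L2 * ((Y + 8) / t)) / np.\<theta> ^ T \<le> 1"
        using err unfolding np\<theta> Th_def Y_def .
      have "0 \<le> kap K L2"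
        unfolding kap_def using K1 L \<alpha>(1) by (intro sum_nonneg mult_nonneg_nonneg zero_le_power) (auto intro: order_trans[of _ "L + 2 / \<alpha>"])
      then show "0 \<le> (\<Sum>c\<in>{c \<in> conf. e \<in> c}. \<mu> 0 ^ (card c - 1)) + T * (kap K L2 * ((Y + 8) / t)) / np.\<theta> ^ T"
        using \<mu>0[of 0] Y0 t Th01 unfolding np\<theta>
        by (intro add_nonneg_nonneg sum_nonneg divide_nonneg_nonneg mult_nonneg_nonneg) auto
    qed (use F in auto)
    finally have "(\<Sum>i<T. pr i e (Inr e) / Th ^ i) \<le> 2 * (kap K 1 + 1) / \<kappa>1"
      using \<kappa>1(1) unfolding pr_def np\<theta> by (simp add: pos_le_divide_eq mult.commute)
    then show ?thesis using \<kappa>1(3) by linarith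
  qed
  define G where "G = {e \<in> B. \<forall>q\<in>J e. card {f \<in> B. q \<in> J f} \<le> (1 + \<epsilon>) * D}"
  define PB where "PB = 2 * ((1 + \<epsilon>) / (1 + 3 * \<epsilon> / 2)) ^ k *
          (1 + T * ((real k ^ 2 * Y + k) / t) / \<alpha> ^ k) + fact k * (K * K) / (n * \<alpha> ^ k)"
  have point: "np.EE i (\<lambda>\<omega>. of_bool (np.exc i (Inl q) \<omega>)) \<le> PB"
    if i: "i < T" and q: "card {f \<in> B. q \<in> J f} \<le> (1 + \<epsilon>) * D" for i q
  proof -
    define d where "d = max 1 (card {f \<in> B. q \<in> J f})"
    define h where "h = nat \<lfloor>K * (K * D) / n\<rfloor>"
    define \<eta> where "\<eta> = (real k ^ 2 * Y + k) / t"
    \<comment> \<open>\<open>\<rho> / p i\<close> equals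
      \<open>(1 + 2 * \<epsilon>) * D * a ^ i\<close> and \<open>k\<close> is at most
      \<open>\<epsilon> / 2 * D * a ^ i\<close>, so the threshold minus \<open>k\<close> is still at
      least \<open>w * a ^ i\<close>. The ratio of the degree to \<open>w\<close> is then bounded by
      a constant below 1, and its \<open>k\<close>-th power is small.\<close>
    define w where "w = (1 + 3 * \<epsilon> / 2) * D"
    have "0 \<le> 3 * \<epsilon> / 2 * D" using eps D0 by simp
    then have w0: "0 < w" "D \<le> w" using D0 unfolding w_def distrib_right by linarith+
    have ai: "0 < a ^ i" "\<alpha> \<le> a ^ i" "a ^ i \<le> 1" using a01 \<alpha>a[of i] i by (auto intro: power_le_one)
    have h0: "0 \<le> K * (K * D) / n" using K1 D0 by simp
    have hr: "real h \<le> K * (K * D) / n" using h0 unfolding h_def by linarith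
    have dr: "1 \<le> real d" "real d \<le> (1 + \<epsilon>) * D"
      using q D1 eps mult_mono[of 1 "1 + \<epsilon>" 1 D] by (auto simp: d_def)
    have "(1 + \<epsilon>) * D \<le> w" unfolding w_def using eps D0 by (intro mult_right_mono) auto
    then have dw: "real d \<le> w" using dr(2) by linarith
    have tau: "w * a ^ i \<le> \<rho> / p i - k"
    proof -
      have "\<rho> / p i = (1 + 2 * \<epsilon>) * D * a ^ i"
        using \<delta> D0 ai unfolding p\<mu>[OF i] \<mu>_def \<rho>(1) by simp
      moreover have "real k \<le> \<epsilon> / 2 * D * a ^ i"
      proof -
        have "\<epsilon> / 2 * D * \<alpha> \<le> \<epsilon> / 2 * D * a ^ i" using ai eps D0 by (intro mult_left_mono) auto
        then show ?thesis using k(2) by linarith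
      qed
      ultimately show ?thesis by (simp add: w_def algebra_simps)
    qed
    have wa0: "0 < w * a ^ i" using w0 ai by simp
    have "np.EE i (\<lambda>\<omega>. of_bool (np.exc i (Inl q) \<omega>)) \<le>
     (F ^ T * real d ^ k * ((((1 - \<rho>) ^ (s - 1) * (1 - \<kappa>)) ^ i) ^ k + T * ((real k^2 * Y + k) / t))
       + fact k * real d ^ (k - 1) * real h) / (\<rho> / p i - k) ^ k"
    proof (rule np.exceptional_points[where d = d and h = h and t = t and l = l and Y = Y, OF _ i])
      show "card (np.star q) \<le> d" by (simp add: np.star_def d_def)
      show "card {f \<in> np.star q. f \<noteq> e \<and> V e \<inter> V f \<noteq> q} \<le> h" if "e \<in> np.star q" for e
      proof -
        have e: "e \<in> B" "q \<in> J e" using that by (auto simp: np.star_def)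
        have "{f \<in> np.star q. f \<noteq> e \<and> V e \<inter> V f \<noteq> q} = {f \<in> B. q \<in> J f \<and> f \<noteq> e \<and> V e \<inter> V f \<noteq> q}"
          by (auto simp: np.star_def)
        then show ?thesis using generic_count[OF e] unfolding h_def by (simp add: le_nat_floor)
      qed
      show "1 \<le> F * (1 - p i) ^ (k * (s + 1) * t)" if "i < T" for i by (rule F0[OF that]) simp
    qed (use k F psum Yb Y0 t tau wa0 in \<open>auto simp: d_def\<close>)
    also have "\<dots> = (F ^ T * real d ^ k * ((a ^ i) ^ k + T * \<eta>) + fact k * real d ^ (k - 1) * real h) / (\<rho> / p i - k) ^ k"
      unfolding a_def[symmetric] \<eta>_def ..
    also have "\<dots> \<le> (2 * real d ^ k * ((a ^ i) ^ k + T * \<eta>) + fact k * w ^ (k - 1) * (K * (K * D) / n)) / (w * a ^ i) ^ k"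
    proof (intro frac_le add_mono mult_right_mono mult_mono power_mono)
      have \<eta>0: "0 \<le> \<eta>" using Y0 by (simp add: \<eta>_def)
      show "0 \<le> (a ^ i) ^ k + T * \<eta>" using \<eta>0 ai by simp
      show "0 \<le> 2 * real d ^ k * ((a ^ i) ^ k + T * \<eta>) + fact k * w ^ (k - 1) * (K * (K * D) / n)"
        using \<eta>0 ai w0 h0 by (intro add_nonneg_nonneg mult_nonneg_nonneg) auto
      show "0 < (w * a ^ i) ^ k" using wa0 by simp
    qed (use F hr dw w0 wa0 tau in auto)
    also have "\<dots> = 2 * (real d / w) ^ k * (1 + T * \<eta> / (a ^ i) ^ k) + fact k * (K * K) * (D / w) / (n * (a ^ i) ^ k)"
    proof -
      have "k = Suc (k - 1)" using k(1) by simp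
      then have wk: "w ^ k = w * w ^ (k - 1)" by (metis power_Suc)
      have 1: "2 * real d ^ k * ((a ^ i) ^ k + T * \<eta>) / (w * a ^ i) ^ k = 2 * (real d / w) ^ k * (1 + T * \<eta> / (a ^ i) ^ k)"
      proof -
        have aux: "2 * X * (A + y) / (Z * A) = 2 * (X / Z) * (1 + y / A)" if "Z \<noteq> 0" "A \<noteq> 0" for X A y Z :: real
          using that by (simp add: field_simps)
        show ?thesis unfolding power_mult_distrib[of w] power_divide[of "real d"] using w0 a01 by (intro aux) auto
      qed
      have 2: "fact k * w ^ (k - 1) * (K * (K * D) / n) / (w * a ^ i) ^ k = fact k * (K * K) * (D / w) / (n * (a ^ i) ^ k)"
      proof -
        have aux: "f * W * (K * (K * D) / m) / (w * W * A) = f * (K * K) * (D / w) / (m * A)"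
          if "W \<noteq> 0" "A \<noteq> 0" "m \<noteq> 0" for f W A m :: real
          using that w0 by (simp add: field_simps)
        show ?thesis unfolding power_mult_distrib[of w] wk using w0 a01 n1 by (intro aux) auto
      qed
      show ?thesis unfolding add_divide_distrib 1 2 ..
    qed
    also have "\<dots> \<le> PB"
    proof -
      have \<eta>0: "0 \<le> T * \<eta>" using Y0 by (simp add: \<eta>_def)
      have \<alpha>k: "0 < \<alpha> ^ k" "\<alpha> ^ k \<le> (a ^ i) ^ k" using ai \<alpha>(1) by (auto intro: power_mono)
      have "real d / w \<le> (1 + \<epsilon>) * D / w" using dr w0 by (intro divide_right_mono) auto
      also have "\<dots> = (1 + \<epsilon>) / (1 + 3 * \<epsilon> / 2)" using D0 by (simp add: w_def)
      finally have "(real d / w) ^ k \<le> ((1 + \<epsilon>) / (1 + 3 * \<epsilon> / 2)) ^ k"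
        using w0 by (intro power_mono) auto
      moreover have "T * \<eta> / (a ^ i) ^ k \<le> T * \<eta> / \<alpha> ^ k"
        using \<eta>0 \<alpha>k by (intro divide_left_mono mult_pos_pos) auto
      moreover have "0 \<le> T * \<eta> / (a ^ i) ^ k" using \<eta>0 \<alpha>k by (intro divide_nonneg_nonneg) auto
      ultimately have 1: "2 * (real d / w) ^ k * (1 + T * \<eta> / (a ^ i) ^ k)
        \<le> 2 * ((1 + \<epsilon>) / (1 + 3 * \<epsilon> / 2)) ^ k * (1 + T * \<eta> / \<alpha> ^ k)"
        using eps w0 by (intro mult_mono) auto
      have "fact k * (K * K) * (D / w) \<le> fact k * (K * K) * 1"
        using w0 D0 K1 by (intro mult_left_mono) auto
      then have 2: "fact k * (K * K) * (D / w) / (n * (a ^ i) ^ k) \<le> fact k * (K * K) / (n * \<alpha> ^ k)"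
        using n1 \<alpha>k K1 by (intro frac_le mult_left_mono) auto
      show ?thesis unfolding PB_def \<eta>_def[symmetric] using 1 2 by (rule add_mono)
    qed
    finally show ?thesis .
  qed
  have avail: "Th ^ i * (1 - \<epsilon>) \<le> np.EE i (\<lambda>\<omega>. of_bool (e \<in> Av (fst \<omega>)))" if e: "e \<in> G" and i: "i \<le> T" for e i
  proof -
    have eB: "e \<in> B" using e by (simp add: G_def)
    have pr0: "0 \<le> pr r e x" for r x unfolding pr_def by (rule np.EE_nonneg) simp
    have PB0: "0 \<le> PB"
    proof -
      show ?thesis unfolding PB_def using eps \<alpha>(1) K1 Y0
        by (intro add_nonneg_nonneg mult_nonneg_nonneg divide_nonneg_nonneg) auto
    qed
    have "(\<Sum>r<i. (\<Sum>x\<in>objs e. pr r e x) / Th ^ r) \<le> (\<Sum>r<T. (\<Sum>x\<in>objs e. pr r e x) / Th ^ r)"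
      using i pr0 Th01 by (intro sum_mono2) (auto intro!: divide_nonneg_nonneg sum_nonneg)
    also have "\<dots> = (\<Sum>r<T. pr r e (Inr e) / Th ^ r + (\<Sum>q\<in>J e. pr r e (Inl q)) / Th ^ r)"
    proof (rule sum.cong[OF refl])
      fix r
      have "(\<Sum>x\<in>objs e. pr r e x) = pr r e (Inr e) + (\<Sum>x\<in>Inl ` J e. pr r e x)"
        unfolding objs_def using finJ[OF eB] by (subst sum.insert) auto
      also have "(\<Sum>x\<in>Inl ` J e. pr r e x) = (\<Sum>q\<in>J e. pr r e (Inl q))"
        by (subst sum.reindex) auto
      finally show "(\<Sum>x\<in>objs e. pr r e x) / Th ^ r = pr r e (Inr e) / Th ^ r + (\<Sum>q\<in>J e. pr r e (Inl q)) / Th ^ r"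
        by (simp add: add_divide_distrib)
    qed
    also have "\<dots> = (\<Sum>r<T. pr r e (Inr e) / Th ^ r) + (\<Sum>r<T. (\<Sum>q\<in>J e. pr r e (Inl q)) / Th ^ r)"
      by (rule sum.distrib)
    also have "\<dots> \<le> \<epsilon> / 2 + (\<Sum>r<T. s * PB / Th ^ T)"
    proof (intro add_mono sum_mono blocks[OF eB] frac_le)
      fix r assume r: "r \<in> {..<T}"
      have "(\<Sum>q\<in>J e. pr r e (Inl q)) \<le> (\<Sum>q\<in>J e. PB)"
      proof (rule sum_mono)
        fix q assume q: "q \<in> J e"
        have "pr r e (Inl q) \<le> np.EE r (\<lambda>\<omega>. of_bool (np.exc r (Inl q) \<omega>))"
          unfolding pr_def by (intro np.EE_mono) auto
        also have "\<dots> \<le> PB" using r e q by (intro point) (auto simp: G_def)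
        finally show "pr r e (Inl q) \<le> PB" .
      qed
      then show "(\<Sum>q\<in>J e. pr r e (Inl q)) \<le> s * PB" using cardJ[OF eB] by simp
      show "Th ^ T \<le> Th ^ r" using r Th01 by (intro power_decreasing) auto
    qed (use PB0 Th01 in auto)
    also have "\<dots> = \<epsilon> / 2 + T * (s * PB) / Th ^ T" by simp
    also have "\<dots> \<le> \<epsilon> / 2 + \<epsilon> / 2"
      using pts unfolding PB_def Th_def Y_def by (intro add_left_mono)
    finally have "(\<Sum>r<i. (\<Sum>x\<in>objs e. pr r e x) / Th ^ r) \<le> \<epsilon>" by simp
    then have "Th ^ i * (1 - \<epsilon>) \<le> Th ^ i * (1 - (\<Sum>r<i. (\<Sum>x\<in>objs e. pr r e x) / Th ^ r))"
      using Th01 by (intro mult_left_mono) auto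
    also have "\<dots> \<le> np.EE i (\<lambda>\<omega>. of_bool (e \<in> Av (fst \<omega>)))"
      using np.avail_lower[OF eB, of i] unfolding np\<theta> pr_def .
    finally show ?thesis .
  qed
  have cardG: "(1 - \<epsilon>) * card B \<le> card G"
  proof -
    have "card B = card (G \<union> {e \<in> B. \<exists>q\<in>J e. (1 + \<epsilon>) * D < card {f \<in> B. q \<in> J f}})"
      by (rule arg_cong[where f = card]) (auto simp: G_def not_less[symmetric])
    also have "\<dots> \<le> card G + card {e \<in> B. \<exists>q\<in>J e. (1 + \<epsilon>) * D < card {f \<in> B. q \<in> J f}}"
      by (rule card_Un_le)
    finally show ?thesis using good by (simp add: algebra_simps)
  qed
  \<comment> \<open>\<open>p i * Th ^ i\<close> is \<open>\<delta> / D * (1 - \<rho>) ^ i\<close>: a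
    geometric series with sum close to
    \<open>\<delta> / (D * \<rho>) = 1 / ((1 + 2 * \<epsilon>) * D)\<close>, hence about
    \<open>card B / D\<close> blocks are taken.\<close>
  have main: "(1 - \<epsilon>) ^ 3 / (1 + 2 * \<epsilon>) * (card B / D) \<le> (\<Sum>i<T. p i * (\<Sum>e\<in>B. np.EE i (\<lambda>\<omega>. of_bool (e \<in> Av (fst \<omega>)))))"
  proof -
    have "(1 - \<epsilon>) ^ 3 / (1 + 2 * \<epsilon>) * (card B / D) = (1 - \<epsilon>) * card B * ((1 - \<epsilon>) * ((1 - \<epsilon>) / ((1 + 2 * \<epsilon>) * D)))"
      using D0 eps by (simp add: field_simps power3_eq_cube)
    also have "\<dots> \<le> card G * ((1 - \<epsilon>) * (\<Sum>i<T. \<delta> / D * (1 - \<rho>) ^ i))"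
    proof (intro mult_mono cardG)
      have "(\<Sum>i<T. \<delta> / D * (1 - \<rho>) ^ i) = \<delta> / D * ((1 - (1 - \<rho>) ^ T) / \<rho>)"
        unfolding sum_distrib_left[symmetric] using \<rho>0 by (subst sum_gp_strict) auto
      also have "\<dots> \<ge> \<delta> / D * ((1 - \<epsilon>) / \<rho>)"
        using T\<epsilon> \<delta> D0 \<rho>0 by (intro mult_left_mono divide_right_mono) auto
      also have "\<delta> / D * ((1 - \<epsilon>) / \<rho>) = (1 - \<epsilon>) / ((1 + 2 * \<epsilon>) * D)"
        using \<delta> D0 eps unfolding \<rho>(1) by simp
      finally show "(1 - \<epsilon>) / ((1 + 2 * \<epsilon>) * D) \<le> (\<Sum>i<T. \<delta> / D * (1 - \<rho>) ^ i)" .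
    qed (use eps D0 in auto)
    also have "\<dots> = (\<Sum>i<T. p i * (\<Sum>e\<in>G. Th ^ i * (1 - \<epsilon>)))"
      unfolding sum_distrib_left
    proof (rule sum.cong[OF refl])
      fix i assume "i \<in> {..<T}"
      then have "p i * Th ^ i = \<delta> / D * (1 - \<rho>) ^ i"
        using a01 by (simp add: p_def Tha power_mult_distrib)
      then show "real (card G) * ((1 - \<epsilon>) * (\<delta> / D * (1 - \<rho>) ^ i)) = (\<Sum>e\<in>G. p i * (Th ^ i * (1 - \<epsilon>)))"
        by (simp add: mult.assoc[symmetric])
    qed
    also have "\<dots> \<le> (\<Sum>i<T. p i * (\<Sum>e\<in>G. np.EE i (\<lambda>\<omega>. of_bool (e \<in> Av (fst \<omega>)))))"
      using p01 by (intro sum_mono mult_left_mono avail) (auto simp: less_imp_le)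
    also have "\<dots> \<le> (\<Sum>i<T. p i * (\<Sum>e\<in>B. np.EE i (\<lambda>\<omega>. of_bool (e \<in> Av (fst \<omega>)))))"
      using p01 finB by (intro sum_mono mult_left_mono sum_mono2) (auto simp: less_imp_le G_def intro: np.EE_nonneg)
    finally show ?thesis .
  qed
  define \<sigma> where "\<sigma> = (\<Sum>r<T. p r ^ 2)"
  have \<sigma>0: "0 \<le> \<sigma>" unfolding \<sigma>_def by (intro sum_nonneg) auto
  have \<sigma>: "\<sigma> \<le> T * \<delta>\<^sup>2 / \<alpha>\<^sup>2 / D\<^sup>2"
  proof -
    have "\<sigma> \<le> (\<Sum>r<T. (\<delta> / (D * \<alpha>))\<^sup>2)"
      unfolding \<sigma>_def using ple p01 by (intro sum_mono power_mono) (auto simp: less_imp_le)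
    also have "\<dots> = T * \<delta>\<^sup>2 / \<alpha>\<^sup>2 / D\<^sup>2" by (simp add: power_divide power_mult_distrib mult.commute)
    finally show ?thesis .
  qed
  have l0: "0 \<le> l" using L(1) D0 by (simp add: l_def)
  have b2: "card np.bad2 * \<sigma> \<le> card B / D * (T * \<delta>\<^sup>2 / \<alpha>\<^sup>2 * (K * K))"
  proof -
    have "card np.bad2 * \<sigma> \<le> card B * (K * (K * D)) * (T * \<delta>\<^sup>2 / \<alpha>\<^sup>2 / D\<^sup>2)"
      using bad_pairs_count \<sigma> \<sigma>0 K1 D0 unfolding np.bad2_def by (intro mult_mono) auto
    also have "\<dots> = card B / D * (T * \<delta>\<^sup>2 / \<alpha>\<^sup>2 * (K * K))"
      using D0 by (simp add: field_simps power2_eq_square)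
    finally show ?thesis .
  qed
  have b3: "(\<Sum>c\<in>conf. 64 * (\<sigma> * (\<Sum>r<T. p r) ^ (card c - 2))) \<le> card B / D * (T * \<delta>\<^sup>2 / \<alpha>\<^sup>2 * (64 * kap K L))"
  proof -
    have kap0: "0 \<le> kap K L" unfolding kap_def using K1 L(1) by (intro sum_nonneg mult_nonneg_nonneg) auto
    have "(\<Sum>c\<in>conf. 64 * (\<sigma> * (\<Sum>r<T. p r) ^ (card c - 2))) \<le> (\<Sum>c\<in>conf. 64 * (\<sigma> * l ^ (card c - 2)))"
      using psum np.p_sum_nonneg \<sigma>0 by (intro sum_mono mult_left_mono power_mono) auto
    also have "\<dots> = 64 * \<sigma> * (\<Sum>c\<in>conf. (L / D) ^ (card c - 2))"
      by (simp add: sum_distrib_left l_def mult.assoc)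
    also have "\<dots> \<le> 64 * (T * \<delta>\<^sup>2 / \<alpha>\<^sup>2 / D\<^sup>2) * (card B * (kap K L * D))"
      using conf_total[OF L(1)] \<sigma> \<sigma>0 kap0 D0 L(1) by (intro mult_mono sum_nonneg) auto
    also have "\<dots> = card B / D * (T * \<delta>\<^sup>2 / \<alpha>\<^sup>2 * (64 * kap K L))"
      using D0 by (simp add: field_simps power2_eq_square)
    finally show ?thesis .
  qed
  have b4: "(\<Sum>S\<in>np.degen. (\<Sum>r<T. p r) ^ card S) \<le> card B / D * (L\<^sup>2 * ycon K L / n)"
  proof -
    have "(\<Sum>S\<in>np.degen. (\<Sum>r<T. p r) ^ card S) \<le> (\<Sum>S\<in>np.degen. (L / D) ^ card S)"
      using psum np.p_sum_nonneg unfolding l_def by (intro sum_mono power_mono) auto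
    then show ?thesis using degen_total[of L] L(1) unfolding np.degen_def by simp
  qed
  have tot: "card np.bad2 * \<sigma> + (\<Sum>c\<in>conf. 64 * (\<sigma> * (\<Sum>r<T. p r) ^ (card c - 2))) + (\<Sum>S\<in>np.degen. (\<Sum>r<T. p r) ^ card S)
    \<le> card B / D * \<epsilon>"
  proof -
    have "card B / D * (T * \<delta>\<^sup>2 / \<alpha>\<^sup>2 * (K * K)) + card B / D * (T * \<delta>\<^sup>2 / \<alpha>\<^sup>2 * (64 * kap K L)) + card B / D * (L\<^sup>2 * ycon K L / n)
      = card B / D * (T * \<delta>\<^sup>2 / \<alpha>\<^sup>2 * (K * K + 64 * kap K L) + L\<^sup>2 * ycon K L / n)" by (simp only: distrib_left)
    also have "\<dots> \<le> card B / D * \<epsilon>" using bads D0 by (intro mult_left_mono) auto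
    finally show ?thesis using b2 b3 b4 by linarith
  qed
  have arith: "1 - 5 * \<epsilon> \<le> (1 - \<epsilon>) ^ 3 / (1 + 2 * \<epsilon>)"
  proof -
    have "(1 - 5 * \<epsilon>) * (1 + 2 * \<epsilon>) \<le> (1 - \<epsilon>) ^ 3"
    proof -
      have "(1 - \<epsilon>) ^ 3 - (1 - 5 * \<epsilon>) * (1 + 2 * \<epsilon>) = \<epsilon> * (13 * \<epsilon> - \<epsilon> * \<epsilon>)"
        by (simp add: power3_eq_cube algebra_simps)
      moreover have "0 \<le> \<epsilon> * (13 * \<epsilon> - \<epsilon> * \<epsilon>)" using eps mult_right_mono[of \<epsilon> 13 \<epsilon>] by (intro mult_nonneg_nonneg) auto
      ultimately show ?thesis by linarith
    qed
    then show ?thesis using eps by (simp add: pos_le_divide_eq)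
  qed
  obtain BB where BB: "BB \<subseteq> B" "real (card BB) \<ge> (\<Sum>i<T. p i * (\<Sum>e\<in>B. np.EE i (\<lambda>\<omega>. of_bool (e \<in> Av (fst \<omega>)))))
       - card np.bad2 * \<sigma> - (\<Sum>c\<in>conf. 64 * (\<sigma> * (\<Sum>r<T. p r) ^ (card c - 2)))
       - (\<Sum>S\<in>np.degen. (\<Sum>r<T. p r) ^ card S)"
     "\<forall>e\<in>BB. \<forall>f\<in>BB. e \<noteq> f \<longrightarrow> J e \<inter> J f = {}" "\<forall>c\<in>conf. \<not> c \<subseteq> BB"
     "\<forall>S\<subseteq>BB. 2 \<le> card S \<longrightarrow> card S \<le> 8 \<longrightarrow> 2 \<le> df S"
    using np.extraction[of T, folded \<sigma>_def] by (elim exE conjE) (rule that)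
  have aux: "(1 - 6 * \<epsilon>) * x = (1 - 5 * \<epsilon>) * x - x * \<epsilon>" for x by (simp add: algebra_simps)
  have "(1 - 6 * \<epsilon>) * card B / D = (1 - 5 * \<epsilon>) * (card B / D) - card B / D * \<epsilon>"
    using aux[of "card B / D"] by simp
  also have "\<dots> \<le> (1 - \<epsilon>) ^ 3 / (1 + 2 * \<epsilon>) * (card B / D) - card B / D * \<epsilon>"
    using arith D0 by (intro diff_right_mono mult_right_mono) auto
  also have "\<dots> \<le> card BB" using main tot BB(2) by linarith
  finally show ?thesis using BB(1,3,4,5) by (intro exI[of _ BB] conjI)
qed

end

section \<open>Choice of the parameters\<close>

lemma one_minus_ge_exp:
  fixes u :: real
  assumes "0 \<le> u" "u \<le> 1 / 2"
  shows "exp (- 2 * u) \<le> 1 - u"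
proof -
  have "- u - 2 * u\<^sup>2 \<le> ln (1 - u)" using assms by (intro ln_one_minus_pos_lower_bound) auto
  moreover have "2 * u\<^sup>2 \<le> u" using assms mult_right_mono[of "2 * u" 1 u] by (simp add: power2_eq_square)
  ultimately have "- 2 * u \<le> ln (1 - u)" by linarith
  then have "exp (- 2 * u) \<le> exp (ln (1 - u))" by simp
  then show ?thesis using assms by simp
qed

text \<open>The constants are fixed in the order \<open>\<kappa>1\<close>, \<alpha>,
  \<open>L\<close>, \<open>T\<close>, \<open>k\<close>, \<beta>, \<open>n0\<close>, each from
  earlier ones only. Since \<rho> and \<kappa> are proportional to \<open>1 / T\<close>, the final
  survival factor stays above an \<alpha> chosen before \<open>T\<close>; so \<open>T\<close> can be
  enlarged afterwards to suppress collisions within a round.\<close>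

lemma nibble:
  fixes \<epsilon> K :: real and s :: nat
  assumes eps: "0 < \<epsilon>" "\<epsilon> < 1" and K1: "1 \<le> K" and s: "0 < s"
  shows "\<exists>n0. \<forall>n\<ge>n0. \<forall>(B :: 'b set) (V :: 'b \<Rightarrow> 'v set) J M D. counted B V J M s n K D \<longrightarrow>
     real (card {e \<in> B. \<exists>q\<in>J e. (1 + \<epsilon>) * D < card {f \<in> B. q \<in> J f}}) \<le> \<epsilon> * card B \<longrightarrow>
     (\<exists>BB\<subseteq>B. (1 - 6 * \<epsilon>) * card B / D \<le> real (card BB)
     \<and> (\<forall>e\<in>BB. \<forall>f\<in>BB. e \<noteq> f \<longrightarrow> J e \<inter> J f = {}) \<and> (\<forall>c\<in>block_system.conf B V M. \<not> c \<subseteq> BB)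
     \<and> (\<forall>S\<subseteq>BB. 2 \<le> card S \<longrightarrow> card S \<le> 8 \<longrightarrow> 2 \<le> block_system.df V M S))"
proof -
  \<comment> \<open>With \<open>\<rho> = c / T\<close>, the nominal fraction of uncovered points
    \<open>(1 - \<rho>) ^ T\<close> is at most \<open>exp (- c) = \<epsilon>\<close>.\<close>
  define c where "c = ln (1 / \<epsilon>)"
  have c0: "0 < c" using eps by (simp add: c_def)
  have kap0: "0 \<le> kap K x" if "0 \<le> x" for x
    unfolding kap_def using K1 that by (intro sum_nonneg mult_nonneg_nonneg) auto
  \<comment> \<open>Makes the bound for exceptional blocks, twice the initial potential plus error
    divided by \<open>\<kappa>1\<close>, at most \<open>\<epsilon> / 2\<close>.\<close>
  define \<kappa>1 where "\<kappa>1 = 4 * (kap K 1 + 1) / \<epsilon>"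
  have \<kappa>1: "0 < \<kappa>1" "2 * (kap K 1 + 1) / \<kappa>1 \<le> \<epsilon> / 2"
  proof -
    have A: "0 < kap K 1 + 1" using kap0[of 1] by simp
    have aux: "2 * A / (4 * A / \<epsilon>) = \<epsilon> / 2" if "0 < A" for A using that eps by (simp add: field_simps)
    show "0 < \<kappa>1" unfolding \<kappa>1_def using A eps by (intro divide_pos_pos mult_pos_pos) auto
    show "2 * (kap K 1 + 1) / \<kappa>1 \<le> \<epsilon> / 2" unfolding \<kappa>1_def aux[OF A] ..
  qed
  define x where "x = (s + \<kappa>1) * c"
  have x0: "0 < x" "c \<le> x" using c0 \<kappa>1(1) s mult_right_mono[of 1 "s + \<kappa>1" c] by (auto simp: x_def)
  define \<alpha> where "\<alpha> = exp (- 2 * x)"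
  have \<alpha>: "0 < \<alpha>" "\<alpha> \<le> 1" using x0 by (auto simp: \<alpha>_def)
  define L where "L = (c + 1) / \<alpha>"
  define L2 where "L2 = L + 2 / \<alpha>"
  have L: "1 \<le> L" using \<alpha> c0 by (simp add: L_def le_divide_eq)
  define YC where "YC = ycon K L"
  have YC: "0 \<le> YC" unfolding YC_def ycon_def using K1 L by (intro sum_nonneg mult_nonneg_nonneg) auto
  \<comment> \<open>Two selections in one round spoil a share of at most \<open>C1 / T\<close> of
    the packing; this is the reason for many rounds.\<close>
  define C1 where "C1 = c\<^sup>2 / \<alpha>\<^sup>2 * (K * K + 64 * kap K L)"
  obtain T :: nat where T: "max (max 1 (2 * x)) (2 * C1 / \<epsilon>) \<le> T" using real_arch_simple by blast
  have T0: "0 < T" "1 \<le> real T" "2 * x \<le> T" "2 * C1 / \<epsilon> \<le> T" using T by auto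
  define \<rho> where "\<rho> = c / T"
  define \<delta> where "\<delta> = \<rho> / (1 + 2 * \<epsilon>)"
  define \<kappa> where "\<kappa> = \<kappa>1 * \<rho>"
  have \<rho>: "0 < \<rho>" "\<rho> \<le> 1 / 2" using c0 T0 x0 by (auto simp: \<rho>_def divide_le_eq)
  have \<delta>: "0 < \<delta>" "\<delta> \<le> \<rho>" "\<rho> = (1 + 2 * \<epsilon>) * \<delta>"
    using \<rho> eps by (auto simp: \<delta>_def divide_le_eq)
  have xT: "(s + \<kappa>1) * \<rho> = x / T" by (simp add: x_def \<rho>_def)
  have xT2: "x / T \<le> 1 / 2" using T0 by (simp add: divide_le_eq)
  have \<kappa>: "0 \<le> \<kappa>" "\<kappa> < 1"
  proof -
    have "\<kappa> \<le> (s + \<kappa>1) * \<rho>" unfolding \<kappa>_def using \<rho> by (intro mult_right_mono) auto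
    then show "\<kappa> < 1" using xT xT2 by linarith
    show "0 \<le> \<kappa>" using \<kappa>1 \<rho> by (simp add: \<kappa>_def)
  qed
  have aT: "\<alpha> \<le> ((1 - \<rho>) ^ (s - 1) * (1 - \<kappa>)) ^ T"
  proof -
    have "1 - x / T \<le> 1 - (s - 1) * \<rho> - \<kappa>"
      unfolding xT[symmetric] \<kappa>_def using \<rho> s by (simp add: algebra_simps)
    also have "\<dots> \<le> (1 - (s - 1) * \<rho>) * (1 - \<kappa>)"
      using \<rho> \<kappa> by (simp add: algebra_simps)
    also have "\<dots> \<le> (1 - \<rho>) ^ (s - 1) * (1 - \<kappa>)"
      using Bernoulli_inequality[of "- \<rho>" "s - 1"] \<rho> \<kappa> by (intro mult_right_mono) auto
    finally have "exp (- 2 * (x / T)) \<le> (1 - \<rho>) ^ (s - 1) * (1 - \<kappa>)"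
      using one_minus_ge_exp[of "x / T"] x0 T0 xT2 by simp
    then have "exp (- 2 * (x / T)) ^ T \<le> ((1 - \<rho>) ^ (s - 1) * (1 - \<kappa>)) ^ T"
      by (intro power_mono) auto
    then show ?thesis using T0 by (simp add: \<alpha>_def flip: exp_of_nat_mult)
  qed
  have T\<epsilon>: "(1 - \<rho>) ^ T \<le> \<epsilon>"
  proof -
    have "(1 - \<rho>) ^ T \<le> exp (- \<rho>) ^ T"
      using exp_ge_add_one_self[of "- \<rho>"] \<rho> by (intro power_mono) auto
    also have "\<dots> = exp (- c)" using T0 by (simp add: \<rho>_def flip: exp_of_nat_mult)
    also have "\<dots> = \<epsilon>" using eps by (simp add: c_def exp_minus)
    finally show ?thesis .
  qed
  define Th where "Th = ((1 - \<rho>) ^ s * (1 - \<kappa>)) ^ T"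
  have Th: "0 < Th" using \<rho> \<kappa> by (simp add: Th_def)
  define r where "r = (1 + \<epsilon>) / (1 + 3 * \<epsilon> / 2)"
  have r: "0 < r" "r < 1" using eps by (auto simp: r_def divide_simps)
  \<comment> \<open>The moment bound must beat \<open>Th\<close>, the nominal probability of being
    available at the end; the 10 turns the total \<open>5 * r ^ k\<close> below into
    \<open>\<epsilon> / 2\<close>.\<close>
  obtain k0 where k0: "r ^ k0 < \<epsilon> * Th / (10 * T * s)"
    using real_arch_pow_inv[of "\<epsilon> * Th / (10 * T * s)" r] eps Th T0 s r by auto
  define k where "k = k0 + 8"
  have k: "8 \<le> k" "r ^ k \<le> \<epsilon> * Th / (10 * T * s)"
  proof -
    have "r ^ k \<le> r ^ k0" using r by (intro power_decreasing) (auto simp: k_def)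
    then show "r ^ k \<le> \<epsilon> * Th / (10 * T * s)" using k0 by linarith
  qed (simp add: k_def)
  \<comment> \<open>The overlap threshold will be \<open>t\<close>, about
    \<open>\<beta> * D\<close>: far above the mean overlap, of order \<open>D / n\<close>, yet small
    enough that the correction of one round is at most \<open>F\<close>, where \<open>F ^ T\<close>
    is at most 2.\<close>
  define \<beta> where "\<beta> = ln 2 * \<alpha> / (2 * real (k * (s + 1)) * c)"
  have "0 < k * (s + 1)" using k(1) by simp
  then have ks: "0 < real (k * (s + 1))" by (simp only: of_nat_0_less_iff)
  have \<beta>: "0 < \<beta>" unfolding \<beta>_def using \<alpha> c0 ks by (intro divide_pos_pos mult_pos_pos) (auto simp del: of_nat_mult)
  define F where "F = exp (ln 2 / T)"
  have F: "1 \<le> F" "F ^ T \<le> 2" using T0 by (auto simp: F_def simp flip: exp_of_nat_mult)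
  define E1 where "E1 = T * ((2 * real k ^ 2 * YC + 2 * k * K) / \<beta>) / \<alpha> ^ k"
  define E2 where "E2 = fact k * (K * K) / (\<alpha> ^ k * r ^ k)"
  define E3 where "E3 = T * (kap K L2 * ((2 * YC + 16 * K) / \<beta>)) / Th"
  define E4 where "E4 = 2 * (L\<^sup>2 * YC) / \<epsilon>"
  obtain n0 :: nat where n0: "max (max (max (max 1 K) (max (2 * K / \<beta>) (2 * K * \<delta> / \<alpha>))) (max (2 * k * K / (\<epsilon> * \<alpha>)) E1)) (max (max E2 E3) E4) \<le> n0"
    using real_arch_simple by blast
  show ?thesis
  proof (intro exI[of _ n0] allI impI)
    fix n and B :: "'b set" and V :: "'b \<Rightarrow> 'v set" and J M D
    assume n: "n0 \<le> n" and cnt: "counted B V J M s n K D"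
      and good: "real (card {e \<in> B. \<exists>q\<in>J e. (1 + \<epsilon>) * D < card {f \<in> B. q \<in> J f}}) \<le> \<epsilon> * card B"
    interpret counted B V J M s n K D by (rule cnt)
    have n': "1 \<le> real n" "K \<le> n" "2 * K / \<beta> \<le> n" "2 * K * \<delta> / \<alpha> \<le> n" "2 * k * K / (\<epsilon> * \<alpha>) \<le> n"
      "E1 \<le> n" "E2 \<le> n" "E3 \<le> n" "E4 \<le> n"
      using n0 n by (auto simp: max_def split: if_splits)
    have nK: "n / K \<le> D"
    proof -
      have "real n ^ 1 \<le> real n ^ M" using M_pos n'(1) by (intro power_increasing) auto
      then have "real n \<le> K * D" using nD by (simp only: power_one_right)
      then show ?thesis using K1 by (simp add: divide_le_eq mult.commute)
    qed
    have D_ge: "y \<le> D" if "K * y \<le> n" for y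
    proof -
      have "y \<le> n / K" using that K1 by (simp add: le_divide_eq mult.commute)
      then show ?thesis using nK by linarith
    qed
    have D1: "1 \<le> D" using n'(2) by (intro D_ge) simp
    have D2: "2 / \<beta> \<le> D" using n'(3) by (intro D_ge) (simp add: mult.commute)
    have D3: "2 * \<delta> / \<alpha> \<le> D" using n'(4) by (intro D_ge) (simp add: mult_ac)
    have D4: "2 * k / (\<epsilon> * \<alpha>) \<le> D" using n'(5) by (intro D_ge) (simp add: mult_ac)
    define t where "t = nat \<lfloor>\<beta> * D\<rfloor>"
    have bD: "2 \<le> \<beta> * D" using D2 \<beta> by (simp add: divide_le_eq mult.commute)
    have t: "0 < t" "real t \<le> \<beta> * D" "\<beta> * D / 2 \<le> t"
      using bD unfolding t_def by linarith+
    have invD: "1 / D \<le> K / n" using nK D0 K1 n'(1) by (simp add: divide_simps mult.commute)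
    have frac: "(A * (YC * D / n) + A') / t \<le> (2 * A * YC + 2 * A' * K) / \<beta> / n" if "0 \<le> A" "0 \<le> A'" for A A'
    proof -
      have "(A * (YC * D / n) + A') / t \<le> (A * (YC * D / n) + A') / (\<beta> * D / 2)"
        using t that YC D0 \<beta> bD by (intro divide_left_mono) auto
      also have "\<dots> = (2 * A * YC / n + 2 * A' * (1 / D)) / \<beta>"
        using D0 \<beta> n'(1) by (simp add: field_simps)
      also have "\<dots> \<le> (2 * A * YC / n + 2 * A' * (K / n)) / \<beta>"
        using invD that \<beta> by (intro divide_right_mono add_left_mono mult_left_mono) auto
      also have "\<dots> = (2 * A * YC + 2 * A' * K) / \<beta> / n" using n'(1) by (simp add: field_simps)
      finally show ?thesis .
    qed
    have le1: "E / n \<le> 1" if "E \<le> n" for E :: real using that n'(1) by (simp add: divide_le_eq)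
    define p where "p = \<delta> / (D * \<alpha>)"
    have p: "0 \<le> p" "p \<le> 1 / 2" using D3 \<alpha> D0 \<delta> by (auto simp: p_def divide_simps mult.commute)
    show "\<exists>BB\<subseteq>B. (1 - 6 * \<epsilon>) * card B / D \<le> real (card BB)
     \<and> (\<forall>e\<in>BB. \<forall>f\<in>BB. e \<noteq> f \<longrightarrow> J e \<inter> J f = {}) \<and> (\<forall>c\<in>conf. \<not> c \<subseteq> BB)
     \<and> (\<forall>S\<subseteq>BB. 2 \<le> card S \<longrightarrow> card S \<le> 8 \<longrightarrow> 2 \<le> df S)"
    proof (rule nibble_run[OF eps \<delta>(1,3) _ \<kappa> \<alpha>(1) aT T\<epsilon> L _ _ F _ _ k(1) _ \<kappa>1(1) _ \<kappa>1(2) t(1) _ _ _ good D1])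
      show "\<rho> < 1" using \<rho> by simp
      show "T * \<delta> / \<alpha> \<le> L"
      proof -
        have "T * \<delta> \<le> T * \<rho>" using \<delta> by (intro mult_left_mono) auto
        also have "\<dots> = c" using T0 by (simp add: \<rho>_def)
        finally show ?thesis unfolding L_def using \<alpha> by (intro divide_right_mono) auto
      qed
      show "L + 2 / \<alpha> \<le> L2" by (simp add: L2_def)
      show "\<delta> / (D * \<alpha>) < 1" using p unfolding p_def by linarith
      show "1 \<le> F * (1 - \<delta> / (D * \<alpha>)) ^ (k * (s + 1) * t)"
      proof -
        define u where "u = real (k * (s + 1))"
        have u0: "0 < u" using ks by (simp only: u_def)
        have ut: "real (k * (s + 1) * t) = u * t" by (simp only: u_def of_nat_mult)
        have "2 * p * real (k * (s + 1) * t) \<le> 2 * p * (u * (\<beta> * D))"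
          unfolding ut using t p u0 by (intro mult_left_mono) auto
        also have "\<dots> = 2 * \<delta> / \<alpha> * u * \<beta>" using D0 \<alpha> by (simp add: p_def field_simps)
        also have "\<dots> \<le> 2 * \<rho> / \<alpha> * u * \<beta>"
          using \<delta> \<alpha> \<beta> u0 by (intro mult_right_mono divide_right_mono) auto
        also have "\<dots> = ln 2 / T"
        proof -
          show ?thesis unfolding \<beta>_def \<rho>_def u_def[symmetric] using u0 \<alpha> c0 T0 by (simp add: field_simps)
        qed
        finally have le: "2 * p * real (k * (s + 1) * t) \<le> ln 2 / T" .
        have "exp (- (ln 2 / T)) \<le> exp (real (k * (s + 1) * t) * (- 2 * p))"
          using le unfolding ut by (simp add: mult_ac)
        also have "\<dots> = exp (- 2 * p) ^ (k * (s + 1) * t)" by (rule exp_of_nat_mult)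
        also have "\<dots> \<le> (1 - p) ^ (k * (s + 1) * t)"
          using one_minus_ge_exp[OF p] by (intro power_mono) auto
        finally have "F * exp (- (ln 2 / T)) \<le> F * (1 - p) ^ (k * (s + 1) * t)"
          using F by (intro mult_left_mono) auto
        then show ?thesis unfolding p_def F_def by (simp flip: exp_add)
      qed
      show "real k \<le> \<epsilon> / 2 * D * \<alpha>" using D4 eps \<alpha> by (simp add: divide_simps mult_ac)
      show "\<kappa>1 \<le> \<kappa> / \<delta>"
        using \<delta> \<kappa>1 eps unfolding \<kappa>_def by (simp add: le_divide_eq)
      show "T * (kap K L2 * ((ycon K L * D / n + 8) / t)) / ((1 - \<rho>) ^ s * (1 - \<kappa>)) ^ T \<le> 1"
      proof -
        have L20: "0 \<le> L2" using L \<alpha> by (simp add: L2_def)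
        have "T * (kap K L2 * ((ycon K L * D / n + 8) / t)) / Th \<le> T * (kap K L2 * ((2 * YC + 16 * K) / \<beta> / n)) / Th"
          using frac[of 1 8] Th kap0[OF L20] by (intro divide_right_mono mult_left_mono) (auto simp: YC_def)
        also have "\<dots> = E3 / n" by (simp add: E3_def)
        also have "\<dots> \<le> 1" by (rule le1[OF n'(8)])
        finally show ?thesis by (simp add: Th_def)
      qed
      show "T * (s * (2 * ((1 + \<epsilon>) / (1 + 3 * \<epsilon> / 2)) ^ k *
          (1 + T * ((real k ^ 2 * (ycon K L * D / n) + k) / t) / \<alpha> ^ k) + fact k * (K * K) / (n * \<alpha> ^ k)))
        / ((1 - \<rho>) ^ s * (1 - \<kappa>)) ^ T \<le> \<epsilon> / 2"
      proof -
        have rk: "0 < r ^ k" "0 < \<alpha> ^ k" using r \<alpha> by auto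
        have "T * ((real k ^ 2 * (ycon K L * D / n) + k) / t) / \<alpha> ^ k
          \<le> T * ((2 * real k ^ 2 * YC + 2 * k * K) / \<beta> / n) / \<alpha> ^ k"
          using frac[of "real k ^ 2" k] rk by (intro divide_right_mono mult_left_mono) (auto simp: YC_def)
        also have "\<dots> = E1 / n" by (simp add: E1_def)
        also have "\<dots> \<le> 1" by (rule le1[OF n'(6)])
        finally have 1: "T * ((real k ^ 2 * (ycon K L * D / n) + k) / t) / \<alpha> ^ k \<le> 1" .
        have "fact k * (K * K) / (n * \<alpha> ^ k) = (E2 / n) * r ^ k" using r by (simp add: E2_def)
        also have "\<dots> \<le> 1 * r ^ k" using le1[OF n'(7)] rk by (intro mult_right_mono) auto
        finally have 2: "fact k * (K * K) / (n * \<alpha> ^ k) \<le> r ^ k" by simp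
        have "2 * r ^ k * (1 + T * ((real k ^ 2 * (ycon K L * D / n) + k) / t) / \<alpha> ^ k) \<le> 2 * r ^ k * 2"
          using 1 rk by (intro mult_left_mono) auto
        then have "2 * r ^ k * (1 + T * ((real k ^ 2 * (ycon K L * D / n) + k) / t) / \<alpha> ^ k) + fact k * (K * K) / (n * \<alpha> ^ k) \<le> 5 * r ^ k"
          using 2 by linarith
        then have "T * (s * (2 * r ^ k * (1 + T * ((real k ^ 2 * (ycon K L * D / n) + k) / t) / \<alpha> ^ k) + fact k * (K * K) / (n * \<alpha> ^ k))) / Th
          \<le> T * (s * (5 * r ^ k)) / Th"
          using Th by (intro divide_right_mono mult_left_mono) auto
        also have "\<dots> \<le> T * (s * (5 * (\<epsilon> * Th / (10 * T * s)))) / Th"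
          using k(2) Th by (intro divide_right_mono mult_left_mono) auto
        also have "\<dots> = \<epsilon> / 2" using Th T0 s by simp
        finally show ?thesis by (simp add: Th_def r_def)
      qed
      show "T * \<delta>\<^sup>2 / \<alpha>\<^sup>2 * (K * K + 64 * kap K L) + L\<^sup>2 * ycon K L / n \<le> \<epsilon>"
      proof -
        have kk: "0 \<le> K * K + 64 * kap K L" using K1 kap0[of L] L by simp
        have "T * \<delta>\<^sup>2 / \<alpha>\<^sup>2 * (K * K + 64 * kap K L) \<le> T * \<rho>\<^sup>2 / \<alpha>\<^sup>2 * (K * K + 64 * kap K L)"
          using \<delta> kk by (intro mult_right_mono divide_right_mono mult_left_mono power_mono) auto
        also have "\<dots> = C1 / T" using T0 by (simp add: C1_def \<rho>_def power2_eq_square)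
        also have "\<dots> \<le> \<epsilon> / 2" using T0 eps by (simp add: divide_simps mult_ac)
        finally have 1: "T * \<delta>\<^sup>2 / \<alpha>\<^sup>2 * (K * K + 64 * kap K L) \<le> \<epsilon> / 2" .
        have "L\<^sup>2 * ycon K L / n = E4 / n * (\<epsilon> / 2)" using eps by (simp add: E4_def YC_def)
        also have "\<dots> \<le> 1 * (\<epsilon> / 2)" using le1[OF n'(9)] eps by (intro mult_right_mono) auto
        finally show ?thesis using 1 by linarith
      qed
    qed
  qed
qed

section \<open>Random colouring of the pairs\<close>

lemma card_small_subsets:
  assumes "1 \<le> n"
  shows "card {Z. Z \<subseteq> {..<n} \<and> card Z \<le> a} \<le> (a + 1) * n ^ a"
proof -
  have "{Z. Z \<subseteq> {..<n} \<and> card Z \<le> a} = (\<Union>i\<in>{..a}. {Z. Z \<subseteq> {..<n} \<and> card Z = i})" by auto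
  then have "card {Z. Z \<subseteq> {..<n} \<and> card Z \<le> a} \<le> (\<Sum>i\<in>{..a}. card {Z. Z \<subseteq> {..<n} \<and> card Z = i})"
    by (simp add: card_UN_le)
  also have "\<dots> \<le> (\<Sum>i\<in>{..a}. n ^ a)"
  proof (rule sum_mono)
    fix i assume i: "i \<in> {..a}"
    have "card {Z. Z \<subseteq> {..<n} \<and> card Z = i} = n choose i"
      using n_subsets[of "{..<n}" i] by simp
    also have "\<dots> \<le> n ^ i"
      using binomial_fact_pow[of n i] by (metis fact_ge_1 le_trans mult.right_neutral mult_le_mono2)
    also have "\<dots> \<le> n ^ a" using i assms by (intro power_increasing) auto
    finally show "card {Z. Z \<subseteq> {..<n} \<and> card Z = i} \<le> n ^ a" .
  qed
  finally show ?thesis by simp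
qed

text \<open>A list encodes an injective placement of the pattern: its entry at position
  \<open>i\<close> is the image of pattern vertex \<open>i\<close>.\<close>

definition inj_lists :: "nat \<Rightarrow> nat \<Rightarrow> nat list set" where
  "inj_lists m n = {e. length e = m \<and> distinct e \<and> set e \<subseteq> {..<n}}"

lemma finite_inj_lists: "finite (inj_lists m n)"
  by (rule finite_subset[OF _ finite_lists_length_eq[of "{..<n}" m]]) (auto simp: inj_lists_def)

lemma card_inj_lists:
  assumes "m \<le> n"
  shows "(n - m) ^ m \<le> card (inj_lists m n)"
proof -
  have eq: "inj_lists m n = {xs. length xs = m \<and> distinct xs \<and> set xs \<subseteq> {..<n}}"
    by (simp add: inj_lists_def)
  have "(n - m) ^ m = (\<Prod>i\<in>{n - m + 1..n}. n - m)" using assms by simp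
  also have "\<dots> \<le> \<Prod>{n - m + 1..n}" by (intro prod_mono) auto
  also have "\<dots> = card (inj_lists m n)"
    unfolding eq using assms by (subst card_lists_distinct_length_eq) auto
  finally show ?thesis .
qed

text \<open>The first factor comes from counting small vertex sets, the second is the number of sets
  of lists over at most \<open>(8 + 14) * m\<close> vertices.\<close>

definition cnt :: "nat \<Rightarrow> nat" where
  "cnt m = (14 * m + 1) * 2 ^ ((22 * m) ^ m)"

lemma cnt_ge: "1 \<le> cnt m"
  unfolding cnt_def One_nat_def by (rule Suc_leI, rule mult_pos_pos) auto

text \<open>\<open>S\<close> is a set of lists over \<open>X0 \<union> Z\<close>, where
  \<open>Z\<close> are its new vertices: the choice of \<open>Z\<close> gives the power of
  \<open>n\<close>, the choice of the lists a constant. Passing to \<open>min a (14 * m)\<close>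
  keeps the constant free of \<open>a\<close>.\<close>

lemma count_inj_lists:
  assumes B: "B \<subseteq> inj_lists m n" and n: "1 \<le> n" and S0: "S0 \<subseteq> B" "card S0 \<le> 8" and j: "j \<le> 14"
  shows "real (card {S. S0 \<subseteq> S \<and> S \<subseteq> B \<and> card S = card S0 + j \<and>
        card (\<Union>(set ` S)) \<le> card (\<Union>(set ` S0)) + a})
    \<le> real (cnt m) * real n ^ a"
proof -
  let ?A = "{S. S0 \<subseteq> S \<and> S \<subseteq> B \<and> card S = card S0 + j \<and> card (\<Union>(set ` S)) \<le> card (\<Union>(set ` S0)) + a}"
  define X0 where "X0 = \<Union>(set ` S0)"
  define b where "b = min a (14 * m)"
  define ZZ where "ZZ = {Z. Z \<subseteq> {..<n} \<and> card Z \<le> b}"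
  define W where "W = (\<lambda>Z. {l. set l \<subseteq> X0 \<union> Z \<and> length l = m})"
  have finB: "finite B" using B finite_inj_lists finite_subset by blast
  have finZZ: "finite ZZ" unfolding ZZ_def by (rule finite_subset[of _ "Pow {..<n}"]) auto
  have le: "card (\<Union>(set ` S)) \<le> card S * m" if "S \<subseteq> B" for S
  proof -
    have "card (\<Union>(set ` S)) \<le> (\<Sum>e\<in>S. card (set e))"
      using that finB finite_subset by (intro card_UN_le) auto
    also have "\<dots> \<le> (\<Sum>e\<in>S. m)"
      using that B by (intro sum_mono) (auto simp: inj_lists_def distinct_card subset_iff)
    finally show ?thesis by simp
  qed
  have X0: "X0 \<subseteq> {..<n}" "finite X0" "card X0 \<le> 8 * m"
  proof -
    show "X0 \<subseteq> {..<n}" using S0 B by (auto simp: X0_def inj_lists_def)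
    then show "finite X0" by (rule finite_subset) simp
    have "card X0 \<le> card S0 * m" unfolding X0_def by (rule le[OF S0(1)])
    also have "\<dots> \<le> 8 * m" using S0 by (intro mult_right_mono) auto
    finally show "card X0 \<le> 8 * m" .
  qed
  have "?A \<subseteq> (\<Union>Z\<in>ZZ. Pow (W Z))"
  proof
    fix S assume "S \<in> ?A"
    then have S: "S0 \<subseteq> S" "S \<subseteq> B" "card S = card S0 + j" "card (\<Union>(set ` S)) \<le> card X0 + a"
      by (auto simp: X0_def)
    have finS: "finite S" using S finB finite_subset by auto
    define Z where "Z = \<Union>(set ` S) - X0"
    have X0S: "X0 \<subseteq> \<Union>(set ` S)" using S(1) by (auto simp: X0_def)
    have finU: "finite (\<Union>(set ` S))" using finS by auto
    have "card Z = card (\<Union>(set ` S)) - card X0"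
      unfolding Z_def using X0S X0 by (intro card_Diff_subset) auto
    then have 1: "card Z \<le> a" using S(4) by linarith
    have "Z \<subseteq> \<Union>(set ` (S - S0))" by (auto simp: Z_def X0_def)
    then have "card Z \<le> card (\<Union>(set ` (S - S0)))" using finS by (intro card_mono) auto
    also have "\<dots> \<le> card (S - S0) * m" using S by (intro le) auto
    also have "card (S - S0) = j"
      using S finite_subset[OF S(1) finS] by (subst card_Diff_subset) auto
    also have "j * m \<le> 14 * m" using j by (intro mult_right_mono) auto
    finally have 2: "card Z \<le> 14 * m" .
    have "Z \<subseteq> {..<n}" using S(2) B by (auto simp: Z_def inj_lists_def)
    then have "Z \<in> ZZ" using 1 2 by (auto simp: ZZ_def b_def)
    moreover have "S \<subseteq> W Z" using S(2) B by (auto simp: W_def Z_def inj_lists_def)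
    ultimately show "S \<in> (\<Union>Z\<in>ZZ. Pow (W Z))" by blast
  qed
  moreover have finW: "finite (W Z)" if "Z \<in> ZZ" for Z
    unfolding W_def using that X0 by (intro finite_lists_length_eq) (auto simp: ZZ_def intro: finite_subset)
  ultimately have "card ?A \<le> card (\<Union>Z\<in>ZZ. Pow (W Z))"
    using finZZ by (intro card_mono) auto
  also have "\<dots> \<le> (\<Sum>Z\<in>ZZ. card (Pow (W Z)))" by (rule card_UN_le[OF finZZ])
  also have "\<dots> \<le> (\<Sum>Z\<in>ZZ. 2 ^ ((22 * m) ^ m))"
  proof (rule sum_mono)
    fix Z assume Z: "Z \<in> ZZ"
    have "finite Z" using Z by (auto simp: ZZ_def intro: finite_subset)
    then have "card (W Z) = card (X0 \<union> Z) ^ m" unfolding W_def using X0 by (intro card_lists_length_eq) auto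
    also have "\<dots> \<le> (22 * m) ^ m"
    proof (rule power_mono)
      have "card (X0 \<union> Z) \<le> card X0 + card Z" by (rule card_Un_le)
      then show "card (X0 \<union> Z) \<le> 22 * m" using X0(3) Z by (auto simp: ZZ_def b_def)
    qed simp
    finally show "card (Pow (W Z)) \<le> 2 ^ ((22 * m) ^ m)" using finW[OF Z] by (simp add: card_Pow)
  qed
  also have "\<dots> = card ZZ * 2 ^ ((22 * m) ^ m)" by simp
  also have "\<dots> \<le> ((14 * m + 1) * n ^ a) * 2 ^ ((22 * m) ^ m)"
  proof (rule mult_right_mono)
    have "card ZZ \<le> (b + 1) * n ^ b" unfolding ZZ_def by (rule card_small_subsets[OF n])
    also have "\<dots> \<le> (14 * m + 1) * n ^ a"
      using n by (intro mult_mono power_increasing) (auto simp: b_def)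
    finally show "card ZZ \<le> (14 * m + 1) * n ^ a" .
  qed simp
  finally have "card ?A \<le> ((14 * m + 1) * n ^ a) * 2 ^ ((22 * m) ^ m)" .
  then have "real (card ?A) \<le> real (((14 * m + 1) * n ^ a) * 2 ^ ((22 * m) ^ m))" by (rule of_nat_mono)
  then show ?thesis unfolding cnt_def
    by (simp only: of_nat_mult of_nat_power mult.commute mult.left_commute mult.assoc)
qed

locale pattern =
  fixes M :: nat and J0 :: "nat set set"
  assumes M_pos: "0 < M" and J0: "J0 \<subseteq> {q. q \<subseteq> {..<M + 2} \<and> card q = 2}" and J0_ne: "J0 \<noteq> {}"
begin

definition N0 :: "nat set set" where
  "N0 = {q. q \<subseteq> {..<M + 2} \<and> card q = 2} - J0"

definition Jl :: "nat list \<Rightarrow> nat set set" where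
  "Jl e = (\<lambda>j. (!) e ` j) ` J0"

definition Nl :: "nat list \<Rightarrow> nat set set" where
  "Nl e = (\<lambda>j. (!) e ` j) ` N0"

definition Pairs :: "nat \<Rightarrow> nat set set" where
  "Pairs n = {q. q \<subseteq> {..<n} \<and> card q = 2}"

text \<open>The colouring \<open>X\<close> is the set of black pairs; a block uses black pairs for \<open>J0\<close> and
  white pairs for the remaining pairs.\<close>

definition Bl :: "nat \<Rightarrow> nat set set \<Rightarrow> nat list set" where
  "Bl n X = {e \<in> inj_lists (M + 2) n. Jl e \<subseteq> X \<and> X \<inter> Nl e = {}}"

lemma finite_pairs0: "finite J0" "finite N0"
proof -
  have "finite {q. q \<subseteq> {..<M + 2} \<and> card q = 2}"
    by (rule finite_subset[of _ "Pow {..<M + 2}"]) auto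
  then show "finite J0" "finite N0" using finite_subset[OF J0] by (simp_all add: N0_def)
qed

lemma finite_Pairs: "finite (Pairs n)"
  by (rule finite_subset[of _ "Pow {..<n}"]) (auto simp: Pairs_def)

lemma nth_inj: "e \<in> inj_lists (M + 2) n \<Longrightarrow> inj_on ((!) e) {..<M + 2}"
  by (auto simp: inj_lists_def intro!: inj_onI simp: nth_eq_iff_index_eq)

lemma nth_image: "e \<in> inj_lists (M + 2) n \<Longrightarrow> (!) e ` {..<M + 2} = set e"
  by (auto simp: inj_lists_def set_conv_nth)

lemma image_inj:
  assumes e: "e \<in> inj_lists (M + 2) n" and "i \<subseteq> {..<M + 2}" "j \<subseteq> {..<M + 2}" "(!) e ` i = (!) e ` j"
  shows "i = j"
  using inj_on_image_eq_iff[OF nth_inj[OF e]] assms by blast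

lemma pair_sub: "j \<in> J0 \<Longrightarrow> j \<subseteq> {..<M + 2}" "j \<in> N0 \<Longrightarrow> j \<subseteq> {..<M + 2}"
  using J0 by (auto simp: N0_def)

lemma pair_card: "j \<in> J0 \<Longrightarrow> card j = 2" "j \<in> N0 \<Longrightarrow> card j = 2"
  using J0 by (auto simp: N0_def)

lemma list_pairs:
  assumes e: "e \<in> inj_lists (M + 2) n"
  shows "card (Jl e) = card J0" "card (Nl e) = card N0" "Jl e \<inter> Nl e = {}"
    "Jl e \<subseteq> Pairs n" "Nl e \<subseteq> Pairs n" "q \<in> Jl e \<or> q \<in> Nl e \<longleftrightarrow> q \<subseteq> set e \<and> card q = 2"
proof -
  have sub: "j \<subseteq> {..<M + 2} \<and> card j = 2" if "j \<in> J0 \<union> N0" for j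
    using that pair_sub pair_card by blast
  have eq: "i = j" if "i \<in> J0 \<union> N0" "j \<in> J0 \<union> N0" "(!) e ` i = (!) e ` j" for i j
    using image_inj[OF e _ _ that(3)] sub[OF that(1)] sub[OF that(2)] by simp
  then have inj: "inj_on (\<lambda>j. (!) e ` j) (J0 \<union> N0)" by (rule inj_onI)
  show "card (Jl e) = card J0"
    unfolding Jl_def by (rule card_image[OF inj_on_subset[OF inj]]) simp
  show "card (Nl e) = card N0"
    unfolding Nl_def by (rule card_image[OF inj_on_subset[OF inj]]) simp
  show "Jl e \<inter> Nl e = {}"
  proof (rule ccontr)
    assume "Jl e \<inter> Nl e \<noteq> {}"
    then obtain x where "x \<in> Jl e" "x \<in> Nl e" by blast
    then obtain i j where ij: "i \<in> J0" "j \<in> N0" "x = (!) e ` i" "x = (!) e ` j"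
      unfolding Jl_def Nl_def by (elim imageE)
    have "i = j" by (rule eq) (use ij in auto)
    then show False using ij by (simp add: N0_def)
  qed
  have se: "set e \<subseteq> {..<n}" using e by (simp add: inj_lists_def)
  have c2: "(!) e ` j \<subseteq> set e \<and> card ((!) e ` j) = 2" if "j \<in> J0 \<union> N0" for j
  proof
    show "(!) e ` j \<subseteq> set e"
      unfolding nth_image[OF e, symmetric] using sub[OF that] by (intro image_mono) simp
    show "card ((!) e ` j) = 2"
      using card_image[OF inj_on_subset[OF nth_inj[OF e]], of j] sub[OF that] by simp
  qed
  have JN: "x \<subseteq> set e \<and> card x = 2" if h: "x \<in> Jl e \<or> x \<in> Nl e" for x
  proof -
    obtain j where "j \<in> J0 \<union> N0" "x = (!) e ` j" using h unfolding Jl_def Nl_def by blast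
    then show ?thesis using c2[of j] by simp
  qed
  show "Jl e \<subseteq> Pairs n"
  proof
    fix x assume "x \<in> Jl e"
    then show "x \<in> Pairs n" using JN[of x] se unfolding Pairs_def by blast
  qed
  show "Nl e \<subseteq> Pairs n"
  proof
    fix x assume "x \<in> Nl e"
    then show "x \<in> Pairs n" using JN[of x] se unfolding Pairs_def by blast
  qed
  show "q \<in> Jl e \<or> q \<in> Nl e \<longleftrightarrow> q \<subseteq> set e \<and> card q = 2"
  proof
    assume q: "q \<subseteq> set e \<and> card q = 2"
    then have "q \<subseteq> (!) e ` {..<M + 2}" by (simp only: nth_image[OF e])
    then obtain j where j: "j \<subseteq> {..<M + 2}" "q = (!) e ` j" by (elim subset_imageE)
    then have "card j = 2" using q card_image[OF inj_on_subset[OF nth_inj[OF e] j(1)]] by simp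
    then have "j \<in> J0 \<or> j \<in> N0" using j by (simp add: N0_def)
    then show "q \<in> Jl e \<or> q \<in> Nl e" unfolding Jl_def Nl_def j(2) by blast
  qed (rule JN)
qed

lemma list_system:
  assumes B: "B \<subseteq> inj_lists (M + 2) n"
  shows "block_system B set Jl M (card J0)"
proof
  show "finite B" by (rule finite_subset[OF B finite_inj_lists])
  fix e assume "e \<in> B"
  then have e: "e \<in> inj_lists (M + 2) n" using B by blast
  show "finite (set e)" by simp
  show "card (set e) = M + 2" using e by (simp add: inj_lists_def distinct_card)
  show "card (Jl e) = card J0" by (rule list_pairs(1)[OF e])
  fix q assume "q \<in> Jl e"
  then show "q \<subseteq> set e" "card q = 2" using list_pairs(6)[OF e, of q] by auto
qed (use J0_ne finite_pairs0 M_pos in \<open>auto simp: card_gt_0_iff\<close>)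

text \<open>A placement that sends an essential pair \<open>j\<close> to \<open>q\<close> is
  determined by \<open>j\<close>, the orientation, and the \<open>M\<close> remaining
  entries.\<close>

lemma degree_le:
  assumes n: "1 \<le> n" and q: "q \<in> Pairs n"
  shows "card {e \<in> inj_lists (M + 2) n. q \<in> Jl e} \<le> 2 * card J0 * n ^ M"
proof -
  have one: "card {e \<in> inj_lists (M + 2) n. (!) e ` j = q} \<le> 2 * n ^ M" if j: "j \<in> J0" for j
  proof -
    obtain a b where ab: "j = {a, b}" "a \<noteq> b" using pair_card(1)[OF j] by (auto simp: card_2_iff)
    obtain u v where uv: "q = {u, v}" "u \<noteq> v" using q by (auto simp: Pairs_def card_2_iff)
    have lt: "a < M + 2" "b < M + 2" using pair_sub(1)[OF j] ab by auto
    define R where "R = ({..<M + 2} - {a, b}) \<rightarrow>\<^sub>E {..<n}"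
    let ?f = "\<lambda>e :: nat list. (e ! a = u, restrict ((!) e) ({..<M + 2} - {a, b}))"
    let ?A = "{e \<in> inj_lists (M + 2) n. (!) e ` j = q}"
    have "inj_on ?f ?A"
    proof (rule inj_onI)
      fix e f assume e: "e \<in> ?A" and f: "f \<in> ?A" and eq: "?f e = ?f f"
      have eqa: "(e ! a = u) = (f ! a = u)" and eqr: "restrict ((!) e) ({..<M + 2} - {a, b}) = restrict ((!) f) ({..<M + 2} - {a, b})"
        using eq by (simp_all only: prod.inject)
      have "(!) e ` {a, b} = {u, v}" "(!) f ` {a, b} = {u, v}"
        using e f unfolding ab(1) uv(1) by blast+
      then have "{e ! a, e ! b} = {u, v}" "{f ! a, f ! b} = {u, v}" by (simp_all only: image_insert image_empty)
      then have "(e ! a = u \<and> e ! b = v) \<or> (e ! a = v \<and> e ! b = u)" "(f ! a = u \<and> f ! b = v) \<or> (f ! a = v \<and> f ! b = u)"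
        unfolding doubleton_eq_iff by blast+
      then have ab_eq: "e ! a = f ! a \<and> e ! b = f ! b" using eqa uv(2) by metis
      have len: "length e = M + 2" "length f = M + 2" using e f by (auto simp: inj_lists_def)
      show "e = f"
      proof (rule nth_equalityI)
        fix i assume i: "i < length e"
        show "e ! i = f ! i"
        proof (cases "i = a \<or> i = b")
          case False
          then have "i \<in> {..<M + 2} - {a, b}" using i len by auto
          then show ?thesis using fun_cong[OF eqr, of i] by simp
        qed (use ab_eq in auto)
      qed (use len in simp)
    qed
    moreover have "?f ` ?A \<subseteq> UNIV \<times> R"
    proof (rule image_subsetI)
      fix e assume "e \<in> ?A"
      then have "length e = M + 2" "set e \<subseteq> {..<n}" by (auto simp: inj_lists_def)
      then have "e ! i \<in> {..<n}" if "i < M + 2" for i using that by (metis nth_mem subsetD)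
      then have "restrict ((!) e) ({..<M + 2} - {a, b}) \<in> R" unfolding R_def restrict_PiE_iff by blast
      then show "?f e \<in> UNIV \<times> R" by blast
    qed
    moreover have finR: "finite R" unfolding R_def by (intro finite_PiE) auto
    ultimately have "card ?A \<le> card ((UNIV :: bool set) \<times> R)"
      by (intro card_inj_on_le[of ?f]) auto
    also have "\<dots> = 2 * card R" by (simp add: card_cartesian_product)
    also have "card R = n ^ M"
    proof -
      have "card ({..<M + 2} - {a, b}) = M" using lt ab by (subst card_Diff_subset) auto
      then show ?thesis unfolding R_def by (subst card_PiE) auto
    qed
    finally show ?thesis .
  qed
  have "{e \<in> inj_lists (M + 2) n. q \<in> Jl e} = (\<Union>j\<in>J0. {e \<in> inj_lists (M + 2) n. (!) e ` j = q})"
    by (auto simp: Jl_def)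
  then have "card {e \<in> inj_lists (M + 2) n. q \<in> Jl e} \<le> (\<Sum>j\<in>J0. card {e \<in> inj_lists (M + 2) n. (!) e ` j = q})"
    using card_UN_le[OF finite_pairs0(1)] by simp
  also have "\<dots> \<le> (\<Sum>j\<in>J0. 2 * n ^ M)" by (intro sum_mono one)
  finally show ?thesis by simp
qed


lemma list_counted:
  assumes B: "B \<subseteq> inj_lists (M + 2) n" and n: "1 \<le> n" and D: "0 < D" "real n ^ M \<le> K * D"
    and K: "real (cnt (M + 2)) \<le> K"
  shows "counted B set Jl M (card J0) n K D"
proof -
  interpret block_system B set Jl M "card J0" by (rule list_system[OF B])
  have K1: "1 \<le> K" using of_nat_mono[OF cnt_ge[of "M + 2"], where 'a = real] K by simp
  show ?thesis
  proof
    fix S0 j a assume S0: "S0 \<subseteq> B" "card S0 \<le> 8" and j: "j \<le> (14 :: nat)"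
    have "real (card {S. S0 \<subseteq> S \<and> S \<subseteq> B \<and> card S = card S0 + j \<and>
        card (\<Union>(set ` S)) \<le> card (\<Union>(set ` S0)) + a})
      \<le> real (cnt (M + 2)) * real n ^ a"
      by (rule count_inj_lists[OF B n S0 j])
    also have "\<dots> \<le> K * real n ^ a" by (intro mult_right_mono K) simp
    finally show "real (card {S. S0 \<subseteq> S \<and> S \<subseteq> B \<and> card S = card S0 + j \<and>
        card (\<Union>(set ` S)) \<le> card (\<Union>(set ` S0)) + a}) \<le> K * real n ^ a" .
  qed (use K1 n D in auto)
qed

end

lemma bern_exists:
  assumes I: "finite I" "\<And>i. i \<in> I \<Longrightarrow> 0 \<le> r i \<and> r i \<le> 1" and c: "c \<le> bern I r f"
  shows "\<exists>X\<subseteq>I. c \<le> f X"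
proof (rule ccontr)
  assume no: "\<not> ?thesis"
  have fin: "finite (f ` Pow I)" "f ` Pow I \<noteq> {}" using I(1) by auto
  have "\<forall>y\<in>f ` Pow I. y < c" using no not_le by blast
  then have "Max (f ` Pow I) < c" using Max_less_iff[OF fin] by blast
  moreover have "bern I r f \<le> bern I r (\<lambda>_. Max (f ` Pow I))"
    using fin(1) by (intro bern_mono I(2) Max_ge) auto
  ultimately show False using c by (simp add: bern_const I(1))
qed

context pattern
begin

text \<open>A placement fits the colouring with the constant probability \<pi>, so the admissible
  blocks still have degrees of order \<open>n ^ M\<close>. A second moment bound shows that few of
  them contain a pair of too large degree, which is the regularity required by
  \<open>nibble\<close>; disjoint essential pairs and the colouring then give the separation
  property.\<close>

lemma packing:
  assumes eps: "0 < \<epsilon>" "\<epsilon> < 1 / 9"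
  shows "\<exists>n0. \<forall>n\<ge>n0. \<exists>BB\<subseteq>inj_lists (M + 2) n. (1 - 9 * \<epsilon>) * real n ^ 2 / (2 * card J0) \<le> card BB
    \<and> (\<forall>e\<in>BB. \<forall>f\<in>BB. e \<noteq> f \<longrightarrow> (\<forall>q\<in>Jl e. \<not> q \<subseteq> set f))
    \<and> (\<forall>S\<subseteq>BB. 2 \<le> card S \<longrightarrow> card S \<le> 8 \<longrightarrow> M * card S + 2 \<le> card (\<Union>(set ` S)))
    \<and> (\<forall>c\<subseteq>BB. 3 \<le> card c \<longrightarrow> card c \<le> 8 \<longrightarrow> card (\<Union>(set ` c)) = M * card c + 2 \<longrightarrow>
         (\<exists>d\<subset>c. 2 \<le> card d \<and> card (\<Union>(set ` d)) < M * card d + 3))"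
proof -
  define s where "s = card J0"
  define W where "W = card N0"
  define \<pi> where "\<pi> = (1 - \<epsilon>) ^ s * \<epsilon> ^ W"
  have \<pi>: "0 < \<pi>" "\<pi> \<le> 1" using eps by (auto simp: \<pi>_def intro!: mult_pos_pos mult_le_one power_le_one)
  have s0: "0 < s" using J0_ne finite_pairs0 by (auto simp: s_def card_gt_0_iff)
  define K where "K = max (real (cnt (M + 2))) (1 / \<pi>)"
  have K: "real (cnt (M + 2)) \<le> K" "1 / \<pi> \<le> K" "1 \<le> K"
    using of_nat_mono[OF cnt_ge[of "M + 2"], where 'a = real] by (auto simp: K_def)
  have eps1: "\<epsilon> < 1" using eps by simp
  obtain n1 where n1: "\<forall>n\<ge>n1. \<forall>(B :: nat list set) (V :: nat list \<Rightarrow> nat set) J M D. counted B V J M s n K D \<longrightarrow>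
     real (card {e \<in> B. \<exists>q\<in>J e. (1 + \<epsilon>) * D < card {f \<in> B. q \<in> J f}}) \<le> \<epsilon> * card B \<longrightarrow>
     (\<exists>BB\<subseteq>B. (1 - 6 * \<epsilon>) * card B / D \<le> real (card BB)
     \<and> (\<forall>e\<in>BB. \<forall>f\<in>BB. e \<noteq> f \<longrightarrow> J e \<inter> J f = {}) \<and> (\<forall>c\<in>block_system.conf B V M. \<not> c \<subseteq> BB)
     \<and> (\<forall>S\<subseteq>BB. 2 \<le> card S \<longrightarrow> card S \<le> 8 \<longrightarrow> 2 \<le> block_system.df V M S))"
    using nibble[OF eps(1) eps1 K(3) s0, where 'b = "nat list" and 'v = nat] by (rule exE)
  \<comment> \<open>Chosen so that \<open>x \<le> cc / D * (x - D) ^ 2\<close> whenever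
    \<open>x > (1 + \<epsilon>) * D\<close>.\<close>
  define cc where "cc = (1 + \<epsilon>) / \<epsilon>\<^sup>2"
  define C where "C = cc / \<pi> * (2 * s * (K * K) * \<pi> / (1 - \<epsilon>) + 1)"
  have cc0: "0 < cc" using eps by (simp add: cc_def)
  obtain n2 :: nat where n2: "max (real (M + 2) * real (M + 2) / \<epsilon>) (C / (\<epsilon>\<^sup>2 * (1 - \<epsilon>) * \<pi>)) \<le> n2"
    using real_arch_simple by blast
  show ?thesis
  proof (intro exI[of _ "max (max n1 n2) (M + 2)"] allI impI)
    fix n assume "max (max n1 n2) (M + 2) \<le> n"
    then have n: "n1 \<le> n" "n2 \<le> n" "M + 2 \<le> n" by auto
    have nr: "1 \<le> n" "0 < real n" "real (M + 2) * real (M + 2) / \<epsilon> \<le> n" "C / (\<epsilon>\<^sup>2 * (1 - \<epsilon>) * \<pi>) \<le> n"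
      using n n2 by auto
    define LL where "LL = inj_lists (M + 2) n"
    have finL: "finite LL" unfolding LL_def by (rule finite_inj_lists)
    have cardL: "(1 - \<epsilon>) * real n ^ (M + 2) \<le> card LL"
    proof -
      have "1 - \<epsilon> \<le> 1 + real (M + 2) * (- (real (M + 2) / n))"
      proof -
        have "real (M + 2) * real (M + 2) \<le> n * \<epsilon>" using nr(3) eps by (simp only: divide_le_eq if_True)
        then show ?thesis using nr(2) by (simp only: mult_minus_right times_divide_eq_right) (simp add: divide_le_eq mult.commute)
      qed
      also have "\<dots> \<le> (1 + - (real (M + 2) / n)) ^ (M + 2)"
        using nr(2) n(3) by (intro Bernoulli_inequality) (simp add: le_divide_eq divide_le_eq)
      finally have "(1 - \<epsilon>) * real n ^ (M + 2) \<le> (1 - real (M + 2) / n) ^ (M + 2) * real n ^ (M + 2)"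
        by (intro mult_right_mono) auto
      also have "\<dots> = ((1 - real (M + 2) / n) * n) ^ (M + 2)" by (simp only: power_mult_distrib)
      also have "(1 - real (M + 2) / n) * n = real (n - (M + 2))" using nr(2) n(3) by (simp add: field_simps of_nat_diff)
      also have "real (n - (M + 2)) ^ (M + 2) = real ((n - (M + 2)) ^ (M + 2))" by simp
      also have "\<dots> \<le> card LL" unfolding LL_def by (rule of_nat_mono[OF card_inj_lists[OF n(3)]])
      finally show ?thesis .
    qed
    \<comment> \<open>An upper bound for the mean degree of a pair given that it is black. The
      factor \<pi> cancels in \<open>card (Bl n X) / D\<close>, which leaves
      \<open>real n ^ 2 / (2 * s)\<close> up to factors \<open>1 - \<epsilon>\<close>.\<close>
    define D where "D = 2 * real s * real n ^ M * \<pi> / (1 - \<epsilon>)"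
    have D0: "0 < D" unfolding D_def using s0 nr \<pi> eps by (intro divide_pos_pos mult_pos_pos) auto
    have nD: "real n ^ M \<le> K * D"
    proof -
      have "1 * (real n ^ M * \<pi>) \<le> (2 * real s / (1 - \<epsilon>)) * (real n ^ M * \<pi>)"
        using s0 eps \<pi> by (intro mult_right_mono) (auto simp: le_divide_eq)
      then have "real n ^ M * \<pi> \<le> D" by (simp add: D_def mult_ac)
      then have "real n ^ M \<le> (1 / \<pi>) * D" using \<pi> by (simp add: field_simps)
      also have "\<dots> \<le> K * D" using K D0 by (intro mult_right_mono) auto
      finally show ?thesis .
    qed
    interpret Lc: counted LL set Jl M "card J0" n K D
      unfolding LL_def using nr D0 nD K by (intro list_counted) auto
    define EE2 where "EE2 = bern (Pairs n) (\<lambda>_. 1 - \<epsilon>)"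
    have e01: "0 \<le> 1 - \<epsilon> \<and> 1 - \<epsilon> \<le> 1" using eps by auto
    have EE2_mono: "EE2 f \<le> EE2 g" if "\<And>X. X \<subseteq> Pairs n \<Longrightarrow> f X \<le> g X" for f g
      unfolding EE2_def using e01 by (intro bern_mono that) auto
    have prob: "EE2 (\<lambda>X. of_bool (P \<subseteq> X \<and> X \<inter> Q = {})) = (1 - \<epsilon>) ^ card P * \<epsilon> ^ card Q"
      if "P \<subseteq> Pairs n" "Q \<subseteq> Pairs n" "P \<inter> Q = {}" for P Q
      unfolding EE2_def using bern_prob[OF finite_Pairs that] by simp
    have inB: "e \<in> Bl n X \<longleftrightarrow> Jl e \<subseteq> X \<and> X \<inter> Nl e = {}" if "e \<in> LL" for e X
      using that by (simp add: Bl_def LL_def)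
    have lp: "card (Jl e) = s" "card (Nl e) = W" "Jl e \<inter> Nl e = {}" "Jl e \<subseteq> Pairs n" "Nl e \<subseteq> Pairs n"
      if "e \<in> LL" for e
      using list_pairs[of e n] that by (auto simp: LL_def s_def W_def)
    have EB: "EE2 (\<lambda>X. of_bool (e \<in> Bl n X)) = \<pi>" if "e \<in> LL" for e
      unfolding inB[OF that] using prob[OF lp(4,5,3)[OF that]] lp(1,2)[OF that] by (simp add: \<pi>_def)
    define A where "A = (\<lambda>q. {e \<in> LL. q \<in> Jl e})"
    define dg where "dg = (\<lambda>q X. real (card {e \<in> Bl n X. q \<in> Jl e}))"
    have finA: "finite (A q)" for q using finL by (simp add: A_def)
    have dg_sum: "dg q X = (\<Sum>e\<in>A q. of_bool (e \<in> Bl n X))" for q X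
    proof -
      have "{e \<in> Bl n X. q \<in> Jl e} = A q \<inter> {e. e \<in> Bl n X}" by (auto simp: A_def Bl_def LL_def)
      then show ?thesis using finA by (simp add: dg_def)
    qed
    \<comment> \<open>The 1 accounts for \<open>f = e\<close>, which also violates
      \<open>set e \<inter> set f = q\<close>.\<close>
    define h where "h = K * (K * D) / n + 1"
    have h0: "0 \<le> h" using K D0 by (simp add: h_def)
    have ng: "real (card {f \<in> A q. set e \<inter> set f \<noteq> q}) \<le> h" if "e \<in> A q" for e q
    proof -
      have e: "e \<in> LL" "q \<in> Jl e" using that by (auto simp: A_def)
      have "{f \<in> A q. set e \<inter> set f \<noteq> q} \<subseteq> insert e {f \<in> LL. q \<in> Jl f \<and> f \<noteq> e \<and> set e \<inter> set f \<noteq> q}"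
        by (auto simp: A_def)
      then have "card {f \<in> A q. set e \<inter> set f \<noteq> q} \<le> card (insert e {f \<in> LL. q \<in> Jl f \<and> f \<noteq> e \<and> set e \<inter> set f \<noteq> q})"
        using finL by (intro card_mono) auto
      also have "\<dots> \<le> card {f \<in> LL. q \<in> Jl f \<and> f \<noteq> e \<and> set e \<inter> set f \<noteq> q} + 1"
        by (simp add: card_insert_if finL)
      finally show ?thesis using Lc.generic_count[OF e] unfolding h_def by linarith
    qed
    have pairE: "EE2 (\<lambda>X. of_bool (e \<in> Bl n X) * of_bool (f \<in> Bl n X)) \<le> \<pi>\<^sup>2 / (1 - \<epsilon>) + of_bool (set e \<inter> set f \<noteq> q)"
      if "e \<in> A q" "f \<in> A q" for e f q
    proof -
      have e: "e \<in> LL" "q \<in> Jl e" "f \<in> LL" "q \<in> Jl f" using that by (auto simp: A_def)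
      show ?thesis
      proof (cases "set e \<inter> set f = q")
        case True
        have q2: "card q = 2" using Lc.card2J[OF e(1,2)] .
        have fq: "finite q" using q2 by (metis card.infinite zero_neq_numeral)
        have J: "x \<subseteq> set e \<and> card x = 2" if "x \<in> Jl e \<or> x \<in> Nl e" for x
          using list_pairs(6)[of e n x] e(1) that by (simp add: LL_def)
        have J': "x \<subseteq> set f \<and> card x = 2" if "x \<in> Jl f \<or> x \<in> Nl f" for x
          using list_pairs(6)[of f n x] e(3) that by (simp add: LL_def)
        have only: "x = q" if "x \<in> Jl e \<or> x \<in> Nl e" "x \<in> Jl f \<or> x \<in> Nl f" for x
        proof -
          have "x \<subseteq> q" using J[OF that(1)] J'[OF that(2)] True by blast
          then show ?thesis using J[OF that(1)] q2 fq by (intro card_subset_eq) auto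
        qed
        have qn: "q \<notin> Nl e" "q \<notin> Nl f" using lp(3)[OF e(1)] lp(3)[OF e(3)] e by auto
        have i1: "Jl e \<inter> Jl f = {q}" using only e by blast
        have i2: "Nl e \<inter> Nl f = {}" using only qn by blast
        have i3: "(Jl e \<union> Jl f) \<inter> (Nl e \<union> Nl f) = {}"
          using only qn lp(3)[OF e(1)] lp(3)[OF e(3)] by blast
        have fin: "finite (Jl e)" "finite (Jl f)" "finite (Nl e)" "finite (Nl f)"
          using finite_pairs0 by (auto simp: Jl_def Nl_def)
        \<comment> \<open>The shared pair \<open>q\<close> has to be black only once; this is the
          origin of the factor \<open>1 / (1 - \<epsilon>)\<close> in the correlation.\<close>
        have c1: "card (Jl e \<union> Jl f) = 2 * s - 1"
          using card_Un_Int[OF fin(1,2)] lp(1)[OF e(1)] lp(1)[OF e(3)] i1 by simp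
        have c2: "card (Nl e \<union> Nl f) = 2 * W"
          using card_Un_disjoint[OF fin(3,4) i2] lp(2)[OF e(1)] lp(2)[OF e(3)] by simp
        have eq: "of_bool (e \<in> Bl n X) * of_bool (f \<in> Bl n X) = (of_bool (Jl e \<union> Jl f \<subseteq> X \<and> X \<inter> (Nl e \<union> Nl f) = {}) :: real)" for X
          unfolding inB[OF e(1)] inB[OF e(3)] by auto
        have "EE2 (\<lambda>X. of_bool (e \<in> Bl n X) * of_bool (f \<in> Bl n X)) = (1 - \<epsilon>) ^ (2 * s - 1) * \<epsilon> ^ (2 * W)"
          unfolding eq using lp(4,5)[OF e(1)] lp(4,5)[OF e(3)] i3 by (subst prob) (auto simp: c1 c2)
        also have "\<dots> = \<pi>\<^sup>2 / (1 - \<epsilon>)"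
        proof -
          have "(1 - \<epsilon>) ^ (2 * s - 1) * (1 - \<epsilon>) = (1 - \<epsilon>) ^ (2 * s)"
            using s0 by (simp flip: power_Suc2)
          then have "(1 - \<epsilon>) ^ (2 * s - 1) = (1 - \<epsilon>) ^ (2 * s) / (1 - \<epsilon>)" using eps by (simp add: eq_divide_eq)
          then show ?thesis by (simp add: \<pi>_def power_mult_distrib power_mult[symmetric] mult.commute)
        qed
        finally show ?thesis by simp
      next
        case False
        have "EE2 (\<lambda>X. of_bool (e \<in> Bl n X) * of_bool (f \<in> Bl n X)) \<le> EE2 (\<lambda>_. 1)"
          by (intro EE2_mono) simp
        also have "\<dots> = 1" unfolding EE2_def by (rule bern_const[OF finite_Pairs])
        also have "\<dots> \<le> \<pi>\<^sup>2 / (1 - \<epsilon>) + 1" using eps by simp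
        finally show ?thesis using False by simp
      qed
    qed
    have cardA: "card (A q) \<le> 2 * real s * real n ^ M" if "q \<in> Pairs n" for q
      using of_nat_mono[OF degree_le[OF nr(1) that], where 'a = real] by (simp add: A_def LL_def s_def)
    have var: "EE2 (\<lambda>X. dg q X * of_bool ((1 + \<epsilon>) * D < dg q X)) \<le> cc / D * (2 * real s * real n ^ M * h)"
      if q: "q \<in> Pairs n" for q
    proof -
      \<comment> \<open>The mean degree of \<open>q\<close> given that \<open>q\<close> is black. A
        white \<open>q\<close> has degree 0, so the variance is taken on the event
        \<open>{q} \<subseteq> X\<close>.\<close>
      define mq where "mq = card (A q) * \<pi> / (1 - \<epsilon>)"
      have mqD: "mq \<le> D" unfolding mq_def D_def using cardA[OF q] \<pi> eps by (intro divide_right_mono mult_right_mono) auto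
      have mq0: "0 \<le> mq" unfolding mq_def using \<pi> eps by simp
      have "EE2 (\<lambda>X. dg q X * of_bool ((1 + \<epsilon>) * D < dg q X))
        \<le> EE2 (\<lambda>X. cc / D * ((dg q X)\<^sup>2 + (- 2 * mq) * dg q X + mq\<^sup>2 * of_bool ({q} \<subseteq> X \<and> X \<inter> {} = {})))"
      proof (rule EE2_mono)
        fix X
        have dg0: "0 \<le> dg q X" by (simp add: dg_def)
        show "dg q X * of_bool ((1 + \<epsilon>) * D < dg q X) \<le> cc / D * ((dg q X)\<^sup>2 + (- 2 * mq) * dg q X + mq\<^sup>2 * of_bool ({q} \<subseteq> X \<and> X \<inter> {} = {}))"
        proof (cases "q \<in> X")
          case False
          then have none: "{e \<in> Bl n X. q \<in> Jl e} = {}" by (auto simp: Bl_def)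
          have "dg q X = 0" unfolding dg_def none by simp
          then show ?thesis using D0 cc0 by simp
        next
          case True
          then have eq: "(dg q X)\<^sup>2 + (- 2 * mq) * dg q X + mq\<^sup>2 * of_bool ({q} \<subseteq> X \<and> X \<inter> {} = {}) = (dg q X - mq)\<^sup>2"
            by (simp add: power2_diff)
          show ?thesis
          proof (cases "(1 + \<epsilon>) * D < dg q X")
            case big: True
            define x where "x = dg q X"
            have x: "(1 + \<epsilon>) * D < x" using big by (simp add: x_def)
            have 1: "\<epsilon> * D \<le> x - D" using x by (simp add: algebra_simps)
            have 2: "\<epsilon> * x / (1 + \<epsilon>) \<le> x - D" using x eps by (simp add: field_simps)
            have xD: "0 \<le> x - D" using 1 eps D0 mult_pos_pos[of \<epsilon> D] by linarith
            have "\<epsilon> * D * (\<epsilon> * x / (1 + \<epsilon>)) \<le> (x - D) * (x - D)"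
              using 1 2 xD eps D0 dg0 by (intro mult_mono) (auto simp: x_def)
            also have "\<dots> \<le> (x - mq) * (x - mq)" using mqD xD by (intro mult_mono) auto
            finally have "\<epsilon> * D * (\<epsilon> * x / (1 + \<epsilon>)) \<le> (x - mq)\<^sup>2" by (simp add: power2_eq_square)
            then have "cc / D * (\<epsilon> * D * (\<epsilon> * x / (1 + \<epsilon>))) \<le> cc / D * (x - mq)\<^sup>2"
              using cc0 D0 by (intro mult_left_mono) auto
            moreover have "cc / D * (\<epsilon> * D * (\<epsilon> * x / (1 + \<epsilon>))) = x"
              using eps D0 by (simp add: cc_def power2_eq_square)
            ultimately show ?thesis unfolding eq using big by (simp add: x_def)
          next
            case False
            then show ?thesis unfolding eq using cc0 D0 by simp
          qed
        qed
      qed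
      also have "\<dots> = cc / D * (EE2 (\<lambda>X. (dg q X)\<^sup>2) + (- 2 * mq) * EE2 (dg q) + mq\<^sup>2 * (1 - \<epsilon>))"
        unfolding EE2_def bern_cmult bern_add
        using prob[of "{q}" "{}"] q unfolding EE2_def by simp
      also have "\<dots> \<le> cc / D * (2 * real s * real n ^ M * h)"
      proof (rule mult_left_mono)
        have E1: "EE2 (dg q) = card (A q) * \<pi>"
        proof -
          have "EE2 (dg q) = (\<Sum>e\<in>A q. EE2 (\<lambda>X. of_bool (e \<in> Bl n X)))"
            unfolding EE2_def dg_sum[abs_def] bern_sum ..
          also have "\<dots> = (\<Sum>e\<in>A q. \<pi>)" by (intro sum.cong refl EB) (simp add: A_def)
          finally show ?thesis by simp
        qed
        have E2: "EE2 (\<lambda>X. (dg q X)\<^sup>2) \<le> card (A q) * (card (A q) * (\<pi>\<^sup>2 / (1 - \<epsilon>))) + card (A q) * h"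
        proof -
          have "EE2 (\<lambda>X. (dg q X)\<^sup>2) = (\<Sum>e\<in>A q. \<Sum>f\<in>A q. EE2 (\<lambda>X. of_bool (e \<in> Bl n X) * of_bool (f \<in> Bl n X)))"
            unfolding EE2_def dg_sum power2_eq_square sum_product bern_sum ..
          also have "\<dots> \<le> (\<Sum>e\<in>A q. \<Sum>f\<in>A q. \<pi>\<^sup>2 / (1 - \<epsilon>) + of_bool (set e \<inter> set f \<noteq> q))"
            by (intro sum_mono pairE)
          also have "\<dots> = (\<Sum>e\<in>A q. card (A q) * (\<pi>\<^sup>2 / (1 - \<epsilon>)) + real (card {f \<in> A q. set e \<inter> set f \<noteq> q}))"
          proof (rule sum.cong[OF refl])
            fix e
            have "A q \<inter> {f. set e \<inter> set f \<noteq> q} = {f \<in> A q. set e \<inter> set f \<noteq> q}" by auto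
            then show "(\<Sum>f\<in>A q. \<pi>\<^sup>2 / (1 - \<epsilon>) + of_bool (set e \<inter> set f \<noteq> q))
              = card (A q) * (\<pi>\<^sup>2 / (1 - \<epsilon>)) + real (card {f \<in> A q. set e \<inter> set f \<noteq> q})"
              using finA[of q] by (simp add: sum.distrib)
          qed
          also have "\<dots> \<le> (\<Sum>e\<in>A q. card (A q) * (\<pi>\<^sup>2 / (1 - \<epsilon>)) + h)"
            by (intro sum_mono add_left_mono ng)
          finally show ?thesis by (simp add: algebra_simps)
        qed
        \<comment> \<open>The main terms of the variance cancel exactly; only the non-generic pairs,
          at most \<open>h\<close> for each block, are left.\<close>
        have "card (A q) * (card (A q) * (\<pi>\<^sup>2 / (1 - \<epsilon>))) + (- 2 * mq) * (card (A q) * \<pi>) + mq\<^sup>2 * (1 - \<epsilon>) = 0"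
        proof -
          have "a * (a * (p\<^sup>2 / u)) + (- 2 * (a * p / u)) * (a * p) + (a * p / u)\<^sup>2 * u = 0" if "u \<noteq> 0" for a p u :: real
            using that by (simp add: field_simps power2_eq_square)
          then show ?thesis unfolding mq_def using eps1 by simp
        qed
        then have "EE2 (\<lambda>X. (dg q X)\<^sup>2) + (- 2 * mq) * EE2 (dg q) + mq\<^sup>2 * (1 - \<epsilon>) \<le> card (A q) * h"
          using E2 unfolding E1 by linarith
        also have "\<dots> \<le> 2 * real s * real n ^ M * h" using cardA[OF q] h0 by (intro mult_right_mono) auto
        finally show "EE2 (\<lambda>X. (dg q X)\<^sup>2) + (- 2 * mq) * EE2 (dg q) + mq\<^sup>2 * (1 - \<epsilon>) \<le> 2 * real s * real n ^ M * h" .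
      qed (use cc0 D0 in simp)
      finally show ?thesis .
    qed
    define bad where "bad = (\<lambda>X. real (card {e \<in> Bl n X. \<exists>q\<in>Jl e. (1 + \<epsilon>) * D < card {f \<in> Bl n X. q \<in> Jl f}}))"
    have finB: "finite (Bl n X)" for X by (rule finite_subset[OF _ finL]) (auto simp: Bl_def LL_def)
    have cardP: "real (card (Pairs n)) \<le> real n ^ 2"
    proof -
      have "card (Pairs n) = n choose 2" unfolding Pairs_def using n_subsets[of "{..<n}" 2] by simp
      also have "\<dots> \<le> n ^ 2"
        using binomial_fact_pow[of n 2] by (metis fact_ge_1 le_trans mult.right_neutral mult_le_mono2)
      finally show ?thesis by (metis of_nat_le_iff of_nat_power)
    qed
    \<comment> \<open>The square on \<epsilon> lets a single \<open>X\<close> satisfy both demands: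
      subtracting \<open>bad X / \<epsilon>\<close> still loses only a fraction \<epsilon> of the
      mean.\<close>
    have Ebad: "EE2 bad \<le> \<epsilon>\<^sup>2 * ((1 - \<epsilon>) * \<pi> * real n ^ (M + 2))"
    proof -
      have "EE2 bad \<le> EE2 (\<lambda>X. \<Sum>q\<in>Pairs n. dg q X * of_bool ((1 + \<epsilon>) * D < dg q X))"
      proof (rule EE2_mono)
        fix X
        define Q where "Q = {q \<in> Pairs n. (1 + \<epsilon>) * D < dg q X}"
        have finQ: "finite Q" unfolding Q_def using finite_Pairs by simp
        have "{e \<in> Bl n X. \<exists>q\<in>Jl e. (1 + \<epsilon>) * D < card {f \<in> Bl n X. q \<in> Jl f}} \<subseteq> (\<Union>q\<in>Q. {e \<in> Bl n X. q \<in> Jl e})"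
        proof
          fix e assume "e \<in> {e \<in> Bl n X. \<exists>q\<in>Jl e. (1 + \<epsilon>) * D < card {f \<in> Bl n X. q \<in> Jl f}}"
          then obtain q where e: "e \<in> Bl n X" "q \<in> Jl e" "(1 + \<epsilon>) * D < dg q X" by (auto simp: dg_def)
          then have "q \<in> Pairs n" using lp(4)[of e] by (auto simp: Bl_def LL_def)
          then show "e \<in> (\<Union>q\<in>Q. {e \<in> Bl n X. q \<in> Jl e})" using e by (auto simp: Q_def)
        qed
        then have "card {e \<in> Bl n X. \<exists>q\<in>Jl e. (1 + \<epsilon>) * D < card {f \<in> Bl n X. q \<in> Jl f}} \<le> card (\<Union>q\<in>Q. {e \<in> Bl n X. q \<in> Jl e})"
          using finQ finB by (intro card_mono) auto
        also have "\<dots> \<le> (\<Sum>q\<in>Q. card {e \<in> Bl n X. q \<in> Jl e})" by (rule card_UN_le[OF finQ])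
        finally have "bad X \<le> (\<Sum>q\<in>Q. dg q X)"
          unfolding bad_def dg_def of_nat_sum[symmetric] of_nat_le_iff .
        also have "\<dots> = (\<Sum>q\<in>Pairs n. dg q X * of_bool ((1 + \<epsilon>) * D < dg q X))"
          unfolding Q_def using sum.inter_filter[OF finite_Pairs[of n], where g = "\<lambda>q. dg q X" and P = "\<lambda>q. (1 + \<epsilon>) * D < dg q X"]
          by (simp add: of_bool_def if_distrib cong: if_cong)
        finally show "bad X \<le> (\<Sum>q\<in>Pairs n. dg q X * of_bool ((1 + \<epsilon>) * D < dg q X))" .
      qed
      also have "\<dots> = (\<Sum>q\<in>Pairs n. EE2 (\<lambda>X. dg q X * of_bool ((1 + \<epsilon>) * D < dg q X)))"
        unfolding EE2_def bern_sum ..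
      also have "\<dots> \<le> (\<Sum>q\<in>Pairs n. cc / D * (2 * real s * real n ^ M * h))" by (intro sum_mono var)
      also have "\<dots> \<le> real n ^ 2 * (cc / D * (2 * real s * real n ^ M * h))"
        unfolding sum_constant using cardP cc0 D0 h0 by (intro mult_right_mono) auto
      also have "cc / D * (2 * real s * real n ^ M * h) = cc * (1 - \<epsilon>) / \<pi> * h"
        using s0 nr eps \<pi> by (simp add: D_def)
      also have "\<dots> \<le> cc / \<pi> * h"
        using cc0 \<pi> eps h0 by (intro mult_right_mono divide_right_mono) auto
      also have "\<dots> \<le> cc / \<pi> * ((2 * s * (K * K) * \<pi> / (1 - \<epsilon>) + 1) * real n ^ (M - 1))"
      proof (intro mult_left_mono)
        have nM: "real n ^ M = real n ^ (M - 1) * n" using M_pos by (metis Suc_diff_1 power_Suc2)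
        have "h = 2 * s * (K * K) * \<pi> / (1 - \<epsilon>) * real n ^ (M - 1) + 1"
          unfolding h_def D_def nM using nr by simp
        moreover have "1 \<le> real n ^ (M - 1)" using nr by (intro one_le_power) auto
        ultimately show "h \<le> (2 * s * (K * K) * \<pi> / (1 - \<epsilon>) + 1) * real n ^ (M - 1)" by (simp add: distrib_right)
      qed (use cc0 \<pi> in auto)
      also have "\<dots> = C * real n ^ (M - 1)" by (simp add: C_def)
      finally have "EE2 bad \<le> real n ^ 2 * (C * real n ^ (M - 1))" by (simp add: mult_left_mono)
      also have "\<dots> \<le> real n ^ 2 * ((n * (\<epsilon>\<^sup>2 * (1 - \<epsilon>) * \<pi>)) * real n ^ (M - 1))"
      proof (intro mult_left_mono mult_right_mono)
        have "0 < \<epsilon>\<^sup>2 * (1 - \<epsilon>) * \<pi>" using eps \<pi> by simp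
        then show "C \<le> n * (\<epsilon>\<^sup>2 * (1 - \<epsilon>) * \<pi>)" using nr(4) by (simp only: divide_le_eq if_True)
      qed auto
      also have "\<dots> = \<epsilon>\<^sup>2 * ((1 - \<epsilon>) * \<pi> * real n ^ (M + 2))"
      proof -
        have "real n ^ (M + 2) = real n ^ 2 * (n * real n ^ (M - 1))"
          using M_pos by (metis Suc_diff_1 mult.commute power_Suc power_add)
        then show ?thesis by (simp only: mult_ac)
      qed
      finally show ?thesis .
    qed
    have EcB: "(1 - \<epsilon>) * \<pi> * real n ^ (M + 2) \<le> EE2 (\<lambda>X. real (card (Bl n X)))"
    proof -
      have "real (card (Bl n X)) = (\<Sum>e\<in>LL. of_bool (e \<in> Bl n X))" for X
      proof -
        have "Bl n X = LL \<inter> {e. e \<in> Bl n X}" by (auto simp: Bl_def LL_def)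
        then show ?thesis using finL by simp
      qed
      then have "EE2 (\<lambda>X. real (card (Bl n X))) = (\<Sum>e\<in>LL. EE2 (\<lambda>X. of_bool (e \<in> Bl n X)))"
        unfolding EE2_def bern_sum[symmetric] by simp
      also have "\<dots> = card LL * \<pi>" using EB by simp
      finally show ?thesis using cardL \<pi> mult_right_mono[OF cardL, of \<pi>] by (simp add: mult_ac)
    qed
    have "(1 - \<epsilon>) * ((1 - \<epsilon>) * \<pi> * real n ^ (M + 2)) \<le> EE2 (\<lambda>X. real (card (Bl n X)) + (- 1 / \<epsilon>) * bad X)"
    proof -
      have "EE2 (\<lambda>X. real (card (Bl n X)) + (- 1 / \<epsilon>) * bad X) = EE2 (\<lambda>X. real (card (Bl n X))) + (- 1 / \<epsilon>) * EE2 bad"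
        unfolding EE2_def bern_add bern_cmult ..
      moreover have "(1 / \<epsilon>) * EE2 bad \<le> (1 / \<epsilon>) * (\<epsilon>\<^sup>2 * ((1 - \<epsilon>) * \<pi> * real n ^ (M + 2)))"
        using Ebad eps by (intro mult_left_mono) auto
      moreover have "(1 / \<epsilon>) * (\<epsilon>\<^sup>2 * ((1 - \<epsilon>) * \<pi> * real n ^ (M + 2))) = \<epsilon> * ((1 - \<epsilon>) * \<pi> * real n ^ (M + 2))"
        using eps by (simp add: power2_eq_square)
      moreover have "(1 - \<epsilon>) * y = y - \<epsilon> * y" for y by (simp add: algebra_simps)
      ultimately show ?thesis using EcB by simp
    qed
    then obtain X where X: "X \<subseteq> Pairs n" "(1 - \<epsilon>) * ((1 - \<epsilon>) * \<pi> * real n ^ (M + 2)) \<le> real (card (Bl n X)) + (- 1 / \<epsilon>) * bad X"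
      using bern_exists[OF finite_Pairs, of n "\<lambda>_. 1 - \<epsilon>"] e01 unfolding EE2_def by blast
    have bad0: "0 \<le> bad X" by (simp add: bad_def)
    have pos: "0 \<le> (1 - \<epsilon>) * ((1 - \<epsilon>) * \<pi> * real n ^ (M + 2))" using eps \<pi> by simp
    have badX: "bad X \<le> \<epsilon> * card (Bl n X)"
    proof -
      have "(1 / \<epsilon>) * bad X \<le> card (Bl n X)" using X(2) pos by simp
      then show ?thesis using eps by (simp add: field_simps)
    qed
    have cB: "(1 - \<epsilon>) * ((1 - \<epsilon>) * \<pi> * real n ^ (M + 2)) \<le> card (Bl n X)"
    proof -
      have "0 \<le> (1 / \<epsilon>) * bad X" using bad0 eps by simp
      then show ?thesis using X(2) by simp
    qed
    have BlL: "Bl n X \<subseteq> inj_lists (M + 2) n" by (auto simp: Bl_def)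
    have cnt: "counted (Bl n X) set Jl M s n K D"
      unfolding s_def by (rule list_counted[OF BlL nr(1) D0 nD K(1)])
    interpret Bc: counted "Bl n X" set Jl M s n K D by (rule cnt)
    obtain BB where BB: "BB \<subseteq> Bl n X" "(1 - 6 * \<epsilon>) * card (Bl n X) / D \<le> real (card BB)"
      "\<forall>e\<in>BB. \<forall>f\<in>BB. e \<noteq> f \<longrightarrow> Jl e \<inter> Jl f = {}" "\<forall>c\<in>Bc.conf. \<not> c \<subseteq> BB"
      "\<forall>S\<subseteq>BB. 2 \<le> card S \<longrightarrow> card S \<le> 8 \<longrightarrow> 2 \<le> Bc.df S"
      using n1[THEN spec, THEN mp, OF n(1), THEN spec, THEN spec, THEN spec, THEN spec, THEN spec,
          THEN mp, OF cnt, THEN mp, OF badX[unfolded bad_def]]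
      by (elim exE conjE)
    show "\<exists>BB\<subseteq>inj_lists (M + 2) n. (1 - 9 * \<epsilon>) * real n ^ 2 / (2 * card J0) \<le> card BB
    \<and> (\<forall>e\<in>BB. \<forall>f\<in>BB. e \<noteq> f \<longrightarrow> (\<forall>q\<in>Jl e. \<not> q \<subseteq> set f))
    \<and> (\<forall>S\<subseteq>BB. 2 \<le> card S \<longrightarrow> card S \<le> 8 \<longrightarrow> M * card S + 2 \<le> card (\<Union>(set ` S)))
    \<and> (\<forall>c\<subseteq>BB. 3 \<le> card c \<longrightarrow> card c \<le> 8 \<longrightarrow> card (\<Union>(set ` c)) = M * card c + 2 \<longrightarrow>
         (\<exists>d\<subset>c. 2 \<le> card d \<and> card (\<Union>(set ` d)) < M * card d + 3))"
    proof (rule exI[of _ BB], intro conjI ballI impI allI)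
      show "BB \<subseteq> inj_lists (M + 2) n" using BB(1) BlL by blast
      show "(1 - 9 * \<epsilon>) * real n ^ 2 / (2 * card J0) \<le> card BB"
      proof -
        have b3: "1 - 3 * \<epsilon> \<le> (1 - \<epsilon>) ^ 3" using Bernoulli_inequality[of "- \<epsilon>" 3] eps by simp
        have "1 - 9 * \<epsilon> \<le> (1 - 6 * \<epsilon>) * (1 - 3 * \<epsilon>)" using eps by (simp add: algebra_simps)
        also have "\<dots> \<le> (1 - 6 * \<epsilon>) * (1 - \<epsilon>) ^ 3" using b3 eps by (intro mult_left_mono) auto
        finally have "(1 - 9 * \<epsilon>) * (real n ^ 2 / (2 * s)) \<le> (1 - 6 * \<epsilon>) * (1 - \<epsilon>) ^ 3 * (real n ^ 2 / (2 * s))"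
          by (intro mult_right_mono) auto
        also have "\<dots> = (1 - 6 * \<epsilon>) * ((1 - \<epsilon>) * ((1 - \<epsilon>) * \<pi> * real n ^ (M + 2))) / D"
          unfolding D_def using s0 nr \<pi> eps by (simp add: power_add power3_eq_cube power2_eq_square)
        also have "\<dots> \<le> (1 - 6 * \<epsilon>) * card (Bl n X) / D"
          using cB eps D0 by (intro divide_right_mono mult_left_mono) auto
        also have "\<dots> \<le> card BB" by (rule BB(2))
        finally show ?thesis by (simp add: s_def)
      qed
    next
      fix e f q assume ef: "e \<in> BB" "f \<in> BB" "e \<noteq> f" and q: "q \<in> Jl e"
      show "\<not> q \<subseteq> set f"
      proof
        assume sub: "q \<subseteq> set f"
        have eB: "e \<in> Bl n X" "f \<in> Bl n X" using ef BB(1) by auto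
        have "card q = 2" by (rule Bc.card2J[OF eB(1) q])
        then have "q \<in> Jl f \<or> q \<in> Nl f" using list_pairs(6)[of f n q] sub eB(2) by (simp add: Bl_def)
        moreover have "q \<notin> Jl f" using BB(3) ef q by blast
        \<comment> \<open>Here the colouring acts: \<open>q\<close> is black, whereas the
          nonessential pairs of \<open>f\<close> are white.\<close>
        moreover have "q \<notin> Nl f" using eB q by (auto simp: Bl_def)
        ultimately show False by blast
      qed
    next
      fix S assume S: "S \<subseteq> BB" "2 \<le> card S" "card S \<le> 8"
      then have "2 \<le> Bc.df S" using BB(5) by blast
      then have "int (M * card S + 2) \<le> int (card (\<Union>(set ` S)))" by (simp add: Bc.df_def)
      then show "M * card S + 2 \<le> card (\<Union>(set ` S))" by (simp only: of_nat_le_iff)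
    next
      fix c assume c: "c \<subseteq> BB" "3 \<le> card c" "card c \<le> 8" "card (\<Union>(set ` c)) = M * card c + 2"
      have "Bc.df c = 2" using c(4) by (simp add: Bc.df_def)
      moreover have "c \<notin> Bc.conf" using BB(4) c(1) by blast
      ultimately obtain d where d: "d \<subset> c" "2 \<le> card d" "\<not> 3 \<le> Bc.df d"
        using c BB(1) unfolding Bc.conf_def by blast
      then have "int (card (\<Union>(set ` d))) < int (M * card d + 3)" by (simp add: Bc.df_def)
      then have "card (\<Union>(set ` d)) < M * card d + 3" by (simp only: of_nat_less_iff)
      then show "\<exists>d\<subset>c. 2 \<le> card d \<and> card (\<Union>(set ` d)) < M * card d + 3" using d by blast
    qed
  qed
qed

end

section \<open>Gadgets\<close>

text \<open>The 4 is half of 8: if two blocks contribute to the same 8 triples, one of them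
  contributes at most four.\<close>

definition gadget :: "'a set set \<Rightarrow> 'a set set \<Rightarrow> bool" where
  "gadget F J \<longleftrightarrow> finite F \<and> (\<forall>g\<in>F. card g = 3)
    \<and> (\<forall>E\<subseteq>F. 1 \<le> card E \<longrightarrow> card E \<le> 8 \<longrightarrow> card E + 2 \<le> card (\<Union>E))
    \<and> (\<forall>E\<subseteq>F. card E = 8 \<longrightarrow> 11 \<le> card (\<Union>E))
    \<and> (\<forall>E\<subseteq>F. 1 \<le> card E \<longrightarrow> card E \<le> 4 \<longrightarrow> card (\<Union>E) = card E + 2 \<longrightarrow> nsets (\<Union>E) 2 \<subseteq> J)"

lemma gadgetD:
  assumes "gadget F J"
  shows "finite F" "g \<in> F \<Longrightarrow> card g = 3"
    "\<lbrakk>E \<subseteq> F; 1 \<le> card E; card E \<le> 8\<rbrakk> \<Longrightarrow> card E + 2 \<le> card (\<Union>E)"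
    "\<lbrakk>E \<subseteq> F; card E = 8\<rbrakk> \<Longrightarrow> 11 \<le> card (\<Union>E)"
    "\<lbrakk>E \<subseteq> F; 1 \<le> card E; card E \<le> 4; card (\<Union>E) = card E + 2; q \<subseteq> \<Union>E; card q = 2\<rbrakk> \<Longrightarrow> q \<in> J"
proof -
  show "finite F" "g \<in> F \<Longrightarrow> card g = 3"
    "\<lbrakk>E \<subseteq> F; 1 \<le> card E; card E \<le> 8\<rbrakk> \<Longrightarrow> card E + 2 \<le> card (\<Union>E)"
    "\<lbrakk>E \<subseteq> F; card E = 8\<rbrakk> \<Longrightarrow> 11 \<le> card (\<Union>E)"
    using assms unfolding gadget_def by blast+
  assume E: "E \<subseteq> F" "1 \<le> card E" "card E \<le> 4" "card (\<Union>E) = card E + 2" and q: "q \<subseteq> \<Union>E" "card q = 2"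
  have "nsets (\<Union>E) 2 \<subseteq> J" using assms E unfolding gadget_def by blast
  moreover have "finite q" using q(2) by (metis card.infinite zero_neq_numeral)
  ultimately show "q \<in> J" using q by (auto simp: nsets_def)
qed

text \<open>A single triple already spans \<open>1 + 2\<close> vertices, so its pairs are essential;
  this keeps the triples of different blocks distinct.\<close>

lemma gadget_edge_pair:
  assumes "gadget F J" "g \<in> F"
  obtains q where "q \<in> J" "q \<subseteq> g"
proof -
  have g: "card g = 3" using gadgetD(2)[OF assms] .
  obtain q where q: "q \<subseteq> g" "card q = 2" using obtain_subset_with_card_n[of 2 g] g by auto
  have "q \<in> J" using gadgetD(5)[OF assms(1), of "{g}" q] assms(2) g q by simp
  then show thesis using q that by blast
qed

lemma gadget_image:
  assumes G: "gadget F J" and inj: "inj_on \<phi> (\<Union>F)"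
  shows "gadget ((`) \<phi> ` F) ((`) \<phi> ` J)" and "card ((`) \<phi> ` F) = card F"
proof -
  have inj2: "inj_on ((`) \<phi>) (Pow (\<Union>F))" using inj by (rule inj_on_image_Pow)
  have FP: "F \<subseteq> Pow (\<Union>F)" by blast
  show "card ((`) \<phi> ` F) = card F" by (rule card_image[OF inj_on_subset[OF inj2 FP]])
  have lift: "\<exists>E\<subseteq>F. E' = (`) \<phi> ` E \<and> card E' = card E \<and> card (\<Union>E') = card (\<Union>E) \<and> \<Union>E' = \<phi> ` \<Union>E"
    if E': "E' \<subseteq> (`) \<phi> ` F" for E'
  proof -
    obtain E where E: "E \<subseteq> F" "E' = (`) \<phi> ` E" using E' by (auto simp: subset_image_iff)
    have 1: "card E' = card E" unfolding E(2) using E(1) FP by (intro card_image inj_on_subset[OF inj2]) blast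
    have U: "\<Union>E' = \<phi> ` \<Union>E" unfolding E(2) by blast
    have "card (\<Union>E') = card (\<Union>E)" unfolding U using E(1) by (intro card_image inj_on_subset[OF inj]) blast
    then show ?thesis using E 1 U by blast
  qed
  show "gadget ((`) \<phi> ` F) ((`) \<phi> ` J)"
    unfolding gadget_def
  proof (intro conjI ballI allI impI)
    show "finite ((`) \<phi> ` F)" using gadgetD(1)[OF G] by simp
  next
    fix g assume "g \<in> (`) \<phi> ` F"
    then obtain g' where g': "g' \<in> F" "g = \<phi> ` g'" by blast
    have "card (\<phi> ` g') = card g'" using g'(1) by (intro card_image inj_on_subset[OF inj]) blast
    then show "card g = 3" using gadgetD(2)[OF G g'(1)] g' by simp
  next
    fix E' assume E': "E' \<subseteq> (`) \<phi> ` F" "1 \<le> card E'" "card E' \<le> 8"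
    then show "card E' + 2 \<le> card (\<Union>E')" using lift[OF E'(1)] gadgetD(3)[OF G] by metis
  next
    fix E' assume E': "E' \<subseteq> (`) \<phi> ` F" "card E' = 8"
    then show "11 \<le> card (\<Union>E')" using lift[OF E'(1)] gadgetD(4)[OF G] by metis
  next
    fix E' assume E': "E' \<subseteq> (`) \<phi> ` F" "1 \<le> card E'" "card E' \<le> 4" "card (\<Union>E') = card E' + 2"
    obtain E where E: "E \<subseteq> F" "card E' = card E" "card (\<Union>E') = card (\<Union>E)" "\<Union>E' = \<phi> ` \<Union>E"
      using lift[OF E'(1)] by blast
    show "nsets (\<Union>E') 2 \<subseteq> (`) \<phi> ` J"
    proof
      fix q assume "q \<in> nsets (\<Union>E') 2"
      then have q: "q \<subseteq> \<phi> ` \<Union>E" "card q = 2" using E(4) by (auto simp: nsets_def)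
      obtain p where p: "p \<subseteq> \<Union>E" "q = \<phi> ` p" using q(1) by (meson subset_imageE)
      have "card q = card p" unfolding p(2) using p(1) E(1) by (intro card_image inj_on_subset[OF inj]) blast
      then have "p \<in> J" using gadgetD(5)[OF G E(1), of p] E' E p q by simp
      then show "q \<in> (`) \<phi> ` J" using p by blast
    qed
  qed
qed

text \<open>Completing the 8 triples to the full blocks they come from gives at most
  \<open>M * card S + 2\<close> vertices, so the lower bound is attained and all estimates on the
  way are equalities. By descent two of the blocks share a pair \<open>q\<close>, and the equalities
  place \<open>q\<close> among the vertices of the chosen triples of both.\<close>

lemma no_config:
  fixes BB :: "'b set" and V :: "'b \<Rightarrow> 'v set" and ed J :: "'b \<Rightarrow> 'v set set"
  assumes finBB: "finite BB" and V: "\<And>e. e \<in> BB \<Longrightarrow> finite (V e) \<and> card (V e) = M + 2"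
    and ed: "\<And>e. e \<in> BB \<Longrightarrow> gadget (ed e) (J e)" "\<And>e. e \<in> BB \<Longrightarrow> \<Union>(ed e) \<subseteq> V e"
    and sep: "\<And>e f q. \<lbrakk>e \<in> BB; f \<in> BB; e \<noteq> f; q \<in> J e\<rbrakk> \<Longrightarrow> \<not> q \<subseteq> V f"
    and lower: "\<And>S. \<lbrakk>S \<subseteq> BB; 2 \<le> card S; card S \<le> 8\<rbrakk> \<Longrightarrow> M * card S + 2 \<le> card (\<Union>(V ` S))"
    and descent: "\<And>c. \<lbrakk>c \<subseteq> BB; 3 \<le> card c; card c \<le> 8; card (\<Union>(V ` c)) = M * card c + 2\<rbrakk>
         \<Longrightarrow> \<exists>d\<subset>c. 2 \<le> card d \<and> card (\<Union>(V ` d)) < M * card d + 3"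
  shows "\<not> contains_config (\<Union>(ed ` BB)) 10 8"
    and "\<And>e f. \<lbrakk>e \<in> BB; f \<in> BB; e \<noteq> f\<rbrakk> \<Longrightarrow> ed e \<inter> ed f = {}"
proof -
  show disj: "ed e \<inter> ed f = {}" if ef: "e \<in> BB" "f \<in> BB" "e \<noteq> f" for e f
  proof (rule ccontr)
    assume "ed e \<inter> ed f \<noteq> {}"
    then obtain g where g: "g \<in> ed e" "g \<in> ed f" by blast
    obtain q where "q \<in> J e" "q \<subseteq> g" using gadget_edge_pair[OF ed(1)[OF ef(1)] g(1)] .
    moreover have "g \<subseteq> V f" using ed(2)[OF ef(2)] g(2) by blast
    ultimately show False using sep[OF ef] by blast
  qed
  \<comment> \<open>By \<open>descent\<close> and \<open>lower\<close>, a set of more than two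
    blocks attaining the lower bound contains a smaller one that attains it; this ends with two
    blocks.\<close>
  have pair: "\<exists>d\<subseteq>c. card d = 2 \<and> card (\<Union>(V ` d)) = M * 2 + 2"
    if "c \<subseteq> BB" "2 \<le> card c" "card c \<le> 8" "card (\<Union>(V ` c)) = M * card c + 2" for c
    using that
  proof (induction "card c" arbitrary: c rule: less_induct)
    case less
    show ?case
    proof (cases "card c = 2")
      case True
      then show ?thesis using less.prems by (intro exI[of _ c]) simp
    next
      case False
      then obtain d where d: "d \<subset> c" "2 \<le> card d" "card (\<Union>(V ` d)) < M * card d + 3"
        using descent[OF less.prems(1) _ less.prems(3,4)] less.prems(2) False by (metis le_antisym not_less_eq_eq numeral_2_eq_2 numeral_3_eq_3)
      have finc: "finite c" using less.prems(1) finBB finite_subset by blast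
      have lt: "card d < card c" using psubset_card_mono[OF finc d(1)] .
      have "M * card d + 2 \<le> card (\<Union>(V ` d))" using lower[of d] d lt less.prems by auto
      then have "card (\<Union>(V ` d)) = M * card d + 2" using d(3) by simp
      then have "\<exists>d'\<subseteq>d. card d' = 2 \<and> card (\<Union>(V ` d')) = M * 2 + 2"
        using less.hyps[OF lt _ d(2)] d(1) less.prems lt by (meson le_trans less_imp_le psubset_imp_subset subset_trans)
      then show ?thesis using d(1) by blast
    qed
  qed
  show "\<not> contains_config (\<Union>(ed ` BB)) 10 8"
  proof
    assume "contains_config (\<Union>(ed ` BB)) 10 8"
    then obtain T where T: "T \<subseteq> \<Union>(ed ` BB)" "finite T" "card T = 8" "card (\<Union>T) \<le> 10"
      unfolding contains_config_def by blast
    define p where "p = (\<lambda>e. T \<inter> ed e)"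
    define S where "S = {e \<in> BB. p e \<noteq> {}}"
    have SB: "S \<subseteq> BB" and finS: "finite S" using finBB by (auto simp: S_def)
    have finp: "finite (p e)" for e using T(2) by (simp add: p_def)
    have p1: "1 \<le> card (p e)" if "e \<in> S" for e
      using that finp[of e] by (simp add: S_def Suc_le_eq card_gt_0_iff)
    have TU: "T = (\<Union>e\<in>S. p e)"
    proof (intro equalityI subsetI)
      fix g assume g: "g \<in> T"
      then obtain e where "e \<in> BB" "g \<in> ed e" using T(1) by blast
      then have "e \<in> S" "g \<in> p e" using g by (auto simp: S_def p_def)
      then show "g \<in> (\<Union>e\<in>S. p e)" by blast
    qed (auto simp: p_def)
    have sum8: "(\<Sum>e\<in>S. card (p e)) = 8"
    proof -
      have "card (\<Union>e\<in>S. p e) = (\<Sum>e\<in>S. card (p e))"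
        using finS finp disj SB by (intro card_UN_disjoint) (auto simp: p_def)
      then show ?thesis using TU T(3) by simp
    qed
    have "(\<Sum>e\<in>S. 1) \<le> (\<Sum>e\<in>S. card (p e))" using p1 by (intro sum_mono) auto
    then have S8: "card S \<le> 8" using sum8 by simp
    have p8: "card (p e) \<le> 8" if "e \<in> S" for e
      using member_le_sum[OF that, of "\<lambda>e. card (p e)"] finS sum8 by simp
    have ped: "p e \<subseteq> ed e" for e by (auto simp: p_def)
    have S0: "S \<noteq> {}" using sum8 by auto
    have S1: "card S \<noteq> 1"
    proof
      assume "card S = 1"
      then obtain e where e: "S = {e}" by (auto simp: card_1_singleton_iff)
      have "T = p e" using TU e by simp
      then have "11 \<le> card (\<Union>T)" using gadgetD(4)[OF ed(1), of e T] ped[of e] e SB T(3) by simp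
      then show False using T(4) by simp
    qed
    have "card S \<noteq> 0" using S0 finS by simp
    then have S2: "2 \<le> card S" using S1 by linarith
    \<comment> \<open>Filling up each block by \<open>R e\<close> turns the 8 triples into \<open>S\<close> at a cost of at most
      \<open>M - card (p e)\<close> vertices per block, so all the estimates below are equalities.\<close>
    define R where "R = (\<lambda>e. V e - \<Union>(p e))"
    have pV: "\<Union>(p e) \<subseteq> V e" if "e \<in> S" for e using ed(2)[of e] ped[of e] that SB by blast
    have finV: "finite (V e)" "card (V e) = M + 2" if "e \<in> S" for e using V[of e] that SB by auto
    have tight: "card (p e) + 2 \<le> card (\<Union>(p e))" if "e \<in> S" for e
      using gadgetD(3)[OF ed(1) ped p1[OF that] p8[OF that]] that SB by blast
    have Rc: "card (R e) + card (\<Union>(p e)) = M + 2" if "e \<in> S" for e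
    proof -
      have "card (R e) = card (V e) - card (\<Union>(p e))"
        unfolding R_def using pV[OF that] finV[OF that] finite_subset by (intro card_Diff_subset) auto
      moreover have "card (\<Union>(p e)) \<le> card (V e)" using pV[OF that] finV[OF that] by (intro card_mono)
      ultimately show ?thesis using finV[OF that] by simp
    qed
    have finR: "finite (R e)" if "e \<in> S" for e using finV[OF that] by (simp add: R_def)
    have Rle: "card (R e) + card (p e) \<le> M" if "e \<in> S" for e using Rc[OF that] tight[OF that] by simp
    have finU: "finite (\<Union>T)"
    proof -
      have "\<Union>T = (\<Union>e\<in>S. \<Union>(p e))" using TU by auto
      moreover have "finite (\<Union>(p e))" if "e \<in> S" for e using pV[OF that] finV[OF that] finite_subset by blast
      ultimately show ?thesis using finS by simp
    qed
    have VU: "\<Union>(V ` S) = \<Union>T \<union> (\<Union>e\<in>S. R e)"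
    proof -
      have "\<Union>T = (\<Union>e\<in>S. \<Union>(p e))" using TU by auto
      moreover have "V e = \<Union>(p e) \<union> R e" if "e \<in> S" for e using pV[OF that] by (auto simp: R_def)
      ultimately show ?thesis by auto
    qed
    have low: "M * card S + 2 \<le> card (\<Union>(V ` S))" by (rule lower[OF SB S2 S8])
    have sumR: "(\<Sum>e\<in>S. card (R e)) + 8 \<le> M * card S"
    proof -
      have "(\<Sum>e\<in>S. card (R e)) + 8 = (\<Sum>e\<in>S. card (R e) + card (p e))" using sum8 by (simp add: sum.distrib)
      also have "\<dots> \<le> (\<Sum>e\<in>S. M)" by (intro sum_mono Rle)
      finally show ?thesis by (simp add: mult.commute)
    qed
    have unR: "card (\<Union>e\<in>S. R e) \<le> (\<Sum>e\<in>S. card (R e))" by (rule card_UN_le[OF finS])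
    have finUR: "finite (\<Union>e\<in>S. R e)" using finS finR by blast
    have UR: "card (\<Union>T \<union> (\<Union>e\<in>S. R e)) + card (\<Union>T \<inter> (\<Union>e\<in>S. R e)) = card (\<Union>T) + card (\<Union>e\<in>S. R e)"
      using card_Un_Int[OF finU finUR] by simp
    have eqs: "card (\<Union>(V ` S)) = M * card S + 2" "card (\<Union>T \<inter> (\<Union>e\<in>S. R e)) = 0"
      "card (\<Union>e\<in>S. R e) = (\<Sum>e\<in>S. card (R e))" "(\<Sum>e\<in>S. card (R e)) + 8 = M * card S"
      using low UR unR sumR T(4) unfolding VU by linarith+
    have UR0: "\<Union>T \<inter> (\<Union>e\<in>S. R e) = {}" using eqs(2) finU by simp
    \<comment> \<open>Equality in the union bound forces the sets to be disjoint.\<close>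
    have Rdisj: "R a \<inter> R b = {}" if ab: "a \<in> S" "b \<in> S" "a \<noteq> b" for a b
    proof -
      have "(\<Sum>e\<in>S. card (R e)) = card (R a \<union> (\<Union>e\<in>S - {a}. R e))"
        using eqs(3) ab(1) by (metis UN_insert insert_Diff)
      also have "\<dots> + card (R a \<inter> (\<Union>e\<in>S - {a}. R e)) = card (R a) + card (\<Union>e\<in>S - {a}. R e)"
        using card_Un_Int[of "R a" "\<Union>e\<in>S - {a}. R e"] finR finS ab(1) by simp
      also have "\<dots> \<le> card (R a) + (\<Sum>e\<in>S - {a}. card (R e))"
        using card_UN_le[of "S - {a}" R] finS by simp
      also have "\<dots> = (\<Sum>e\<in>S. card (R e))" using finS ab(1) by (simp add: sum.remove)
      finally have "card (R a \<inter> (\<Union>e\<in>S - {a}. R e)) = 0" by simp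
      then have "R a \<inter> (\<Union>e\<in>S - {a}. R e) = {}" using finR[OF ab(1)] by simp
      then show ?thesis using ab by blast
    qed
    have ptight: "card (\<Union>(p e)) = card (p e) + 2" if e: "e \<in> S" for e
    proof (rule ccontr)
      assume "card (\<Union>(p e)) \<noteq> card (p e) + 2"
      then have "card (R e) + card (p e) < M" using Rc[OF e] tight[OF e] by simp
      then have "(\<Sum>e\<in>S. card (R e) + card (p e)) < (\<Sum>e\<in>S. M)"
        using e Rle finS by (intro sum_strict_mono_ex1) auto
      then show False using eqs(4) sum8 by (simp add: sum.distrib mult.commute)
    qed
    obtain d where d: "d \<subseteq> S" "card d = 2" "card (\<Union>(V ` d)) = M * 2 + 2"
      using pair[OF SB S2 S8 eqs(1)] by blast
    obtain a b where ab: "d = {a, b}" "a \<noteq> b" using d(2) by (meson card_2_iff)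
    have abS: "a \<in> S" "b \<in> S" using ab d(1) by auto
    define q where "q = V a \<inter> V b"
    have "card (V a \<union> V b) = M * 2 + 2" using d(3) ab(1) by simp
    then have q2: "card q = 2"
      using card_Un_Int[of "V a" "V b"] finV[OF abS(1)] finV[OF abS(2)] by (simp add: q_def)
    \<comment> \<open>A common vertex of blocks \<open>a\<close> and \<open>b\<close> lies neither
      in \<open>R a\<close> nor in \<open>R b\<close>, since these are disjoint from each other and
      from all vertices of the triples.\<close>
    have sub: "q \<subseteq> \<Union>(p a)" "q \<subseteq> \<Union>(p b)"
    proof -
      have "V e = R e \<union> \<Union>(p e) \<and> \<Union>(p e) \<inter> \<Union>(R ` S) = {}" if "e \<in> S" for e
        using pV[OF that] UR0 that TU by (auto simp: R_def)
      then show "q \<subseteq> \<Union>(p a)" "q \<subseteq> \<Union>(p b)"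
        unfolding q_def using Rdisj[OF abS ab(2)] abS by blast+
    qed
    have no: False if xy: "x \<in> S" "y \<in> S" "x \<noteq> y" "card (p x) \<le> 4" "q \<subseteq> \<Union>(p x)" "q \<subseteq> \<Union>(p y)" for x y
    proof -
      have "q \<in> J x"
        using gadgetD(5)[OF ed(1) ped p1[OF xy(1)] xy(4) ptight[OF xy(1)] xy(5) q2] xy(1) SB by blast
      then show False using sep[of x y q] xy pV[of y] SB by blast
    qed
    have "card (p a) + card (p b) \<le> 8"
    proof -
      have "(\<Sum>e\<in>{a, b}. card (p e)) \<le> (\<Sum>e\<in>S. card (p e))" using abS finS by (intro sum_mono2) auto
      then show ?thesis using sum8 ab(2) by simp
    qed
    then have "card (p a) \<le> 4 \<or> card (p b) \<le> 4" by linarith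
    then show False using no[of a b] no[of b a] abS ab(2) sub by blast
  qed
qed

lemma (in pattern) bes_ge:
  assumes F0: "gadget F0 J0" "\<Union>F0 \<subseteq> {..<M + 2}" and eps: "0 < \<epsilon>" "\<epsilon> < 1 / 9"
  shows "\<exists>n0. \<forall>n\<ge>n0. (1 - 9 * \<epsilon>) * real n ^ 2 / (2 * card J0) * card F0 \<le> bes 3 n 10 8"
proof -
  obtain n0 where n0: "\<forall>n\<ge>n0. \<exists>BB\<subseteq>inj_lists (M + 2) n. (1 - 9 * \<epsilon>) * real n ^ 2 / (2 * card J0) \<le> card BB
    \<and> (\<forall>e\<in>BB. \<forall>f\<in>BB. e \<noteq> f \<longrightarrow> (\<forall>q\<in>Jl e. \<not> q \<subseteq> set f))
    \<and> (\<forall>S\<subseteq>BB. 2 \<le> card S \<longrightarrow> card S \<le> 8 \<longrightarrow> M * card S + 2 \<le> card (\<Union>(set ` S)))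
    \<and> (\<forall>c\<subseteq>BB. 3 \<le> card c \<longrightarrow> card c \<le> 8 \<longrightarrow> card (\<Union>(set ` c)) = M * card c + 2 \<longrightarrow>
         (\<exists>d\<subset>c. 2 \<le> card d \<and> card (\<Union>(set ` d)) < M * card d + 3))"
    using packing[OF eps] by (rule exE)
  show ?thesis
  proof (rule exI[of _ n0], intro allI impI)
    fix n assume n: "n0 \<le> n"
    obtain BB where BB: "BB \<subseteq> inj_lists (M + 2) n" "(1 - 9 * \<epsilon>) * real n ^ 2 / (2 * card J0) \<le> card BB"
      "\<forall>e\<in>BB. \<forall>f\<in>BB. e \<noteq> f \<longrightarrow> (\<forall>q\<in>Jl e. \<not> q \<subseteq> set f)"
      "\<forall>S\<subseteq>BB. 2 \<le> card S \<longrightarrow> card S \<le> 8 \<longrightarrow> M * card S + 2 \<le> card (\<Union>(set ` S))"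
      "\<forall>c\<subseteq>BB. 3 \<le> card c \<longrightarrow> card c \<le> 8 \<longrightarrow> card (\<Union>(set ` c)) = M * card c + 2 \<longrightarrow>
         (\<exists>d\<subset>c. 2 \<le> card d \<and> card (\<Union>(set ` d)) < M * card d + 3)"
      using n0[THEN spec, THEN mp, OF n] by (elim exE conjE)
    define ed where "ed = (\<lambda>e :: nat list. (`) ((!) e) ` F0)"
    have finBB: "finite BB" using BB(1) finite_inj_lists finite_subset by blast
    have e: "length e = M + 2" "distinct e" "set e \<subseteq> {..<n}" if "e \<in> BB" for e
      using that BB(1) by (auto simp: inj_lists_def)
    have inj: "inj_on ((!) e) (\<Union>F0)" if "e \<in> BB" for e
      using e[OF that] F0(2) by (intro inj_on_nth) auto
    have g: "gadget (ed e) (Jl e)" "card (ed e) = card F0" if "e \<in> BB" for e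
      unfolding ed_def Jl_def using gadget_image[OF F0(1) inj[OF that]] by blast+
    have sub: "\<Union>(ed e) \<subseteq> set e" if "e \<in> BB" for e
      unfolding ed_def using F0(2) e(1)[OF that] by (auto intro!: nth_mem)
    have cV: "finite (set e) \<and> card (set e) = M + 2" if "e \<in> BB" for e
      using e[OF that] by (simp add: distinct_card)
    have sep: "\<not> q \<subseteq> set f" if "e \<in> BB" "f \<in> BB" "e \<noteq> f" "q \<in> Jl e" for e f q
      using BB(3) that by blast
    have lower: "M * card S + 2 \<le> card (\<Union>(set ` S))" if "S \<subseteq> BB" "2 \<le> card S" "card S \<le> 8" for S
      by (rule BB(4)[THEN spec, THEN mp, THEN mp, THEN mp, OF that])
    have descent: "\<exists>d\<subset>c. 2 \<le> card d \<and> card (\<Union>(set ` d)) < M * card d + 3"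
      if "c \<subseteq> BB" "3 \<le> card c" "card c \<le> 8" "card (\<Union>(set ` c)) = M * card c + 2" for c
      by (rule BB(5)[THEN spec, THEN mp, THEN mp, THEN mp, THEN mp, OF that])
    have nc: "\<not> contains_config (\<Union>(ed ` BB)) 10 8"
      by (rule no_config(1)[of BB set M ed Jl]; fact finBB cV g(1) sub sep lower descent)
    have disj: "ed e \<inter> ed f = {}" if "e \<in> BB" "f \<in> BB" "e \<noteq> f" for e f
      by (rule no_config(2)[of BB set M ed Jl, OF _ _ _ _ _ _ _ that]; fact finBB cV g(1) sub sep lower descent)
    have "\<Union>(ed ` BB) \<subseteq> nsets {..<n} 3"
    proof
      fix x assume "x \<in> \<Union>(ed ` BB)"
      then obtain b where b: "b \<in> BB" "x \<in> ed b" by blast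
      have "card x = 3" using gadgetD(2)[OF g(1)[OF b(1)] b(2)] .
      moreover have "x \<subseteq> {..<n}" using sub[OF b(1)] b(2) e(3)[OF b(1)] by blast
      moreover have "finite x" using calculation(2) finite_subset by blast
      ultimately show "x \<in> nsets {..<n} 3" by (simp add: nsets_def)
    qed
    then have "card (\<Union>(ed ` BB)) \<le> bes 3 n 10 8" by (intro card_le_bes[of "{..<n}"] nc) auto
    moreover have "card (\<Union>(ed ` BB)) = (\<Sum>e\<in>BB. card (ed e))"
      using finBB disj gadgetD(1)[OF g(1)] by (intro card_UN_disjoint) auto
    ultimately have "card BB * card F0 \<le> bes 3 n 10 8" using g(2) by simp
    then have "real (card BB) * card F0 \<le> bes 3 n 10 8" by (metis of_nat_le_iff of_nat_mult)
    moreover have "(1 - 9 * \<epsilon>) * real n ^ 2 / (2 * card J0) * card F0 \<le> real (card BB) * card F0"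
      by (intro mult_right_mono BB(2)) simp
    ultimately show "(1 - 9 * \<epsilon>) * real n ^ 2 / (2 * card J0) * card F0 \<le> bes 3 n 10 8" by linarith
  qed
qed

section \<open>The concrete gadget\<close>

datatype gvertex = GHub | GLeft nat | GRight nat | GUp "nat \<times> nat" | GDown "nat \<times> nat"

text \<open>For \<open>p = (i, j)\<close> the vertices \<open>GUp p\<close>, \<open>GDown p\<close> are \<open>x i j\<close> and \<open>y i j\<close>.\<close>

definition sq :: "nat \<Rightarrow> (nat \<times> nat) set" where
  "sq d = {..<d} \<times> {..<d}"

definition eU :: "nat \<times> nat \<Rightarrow> gvertex set" where
  "eU p = {GLeft (fst p), GRight (snd p), GUp p}"

definition eD :: "nat \<times> nat \<Rightarrow> gvertex set" where
  "eD p = {GLeft (fst p), GRight (snd p), GDown p}"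

definition eH :: "nat \<times> nat \<Rightarrow> gvertex set" where
  "eH p = {GUp p, GDown p, GHub}"

definition cell :: "nat \<times> nat \<Rightarrow> gvertex set" where
  "cell p = {GLeft (fst p), GRight (snd p), GUp p, GDown p, GHub}"

definition gverts :: "nat \<Rightarrow> gvertex set" where
  "gverts d = {GHub} \<union> GLeft ` {..<d} \<union> GRight ` {..<d} \<union> GUp ` sq d \<union> GDown ` sq d"

definition gedges :: "nat \<Rightarrow> gvertex set set" where
  "gedges d = eU ` sq d \<union> eD ` sq d \<union> eH ` sq d"

definition gpairs :: "nat \<Rightarrow> gvertex set set" where
  "gpairs d = (\<Union>p\<in>sq d. nsets (cell p) 2)"

lemma finite_sq: "finite (sq d)" and card_sq: "card (sq d) = d ^ 2"
  by (simp_all add: sq_def power2_eq_square)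

lemma inj_gedge: "inj_on eU A" "inj_on eD A" "inj_on eH A"
  by (auto simp: inj_on_def eU_def eD_def eH_def)

lemma gedge_neq: "eU p \<noteq> eD q" "eU p \<noteq> eH q" "eD p \<noteq> eH q"
  by (auto simp: eU_def eD_def eH_def)

lemma card_gedge_union:
  assumes "finite P" "finite Q" "finite R"
  shows "card (eU ` P \<union> eD ` Q \<union> eH ` R) = card P + card Q + card R"
proof -
  have "card (eU ` P \<union> eD ` Q \<union> eH ` R) = card (eU ` P \<union> eD ` Q) + card (eH ` R)"
    using assms gedge_neq gedge_neq[symmetric] by (intro card_Un_disjoint) auto
  also have "card (eU ` P \<union> eD ` Q) = card (eU ` P) + card (eD ` Q)"
    using assms gedge_neq gedge_neq[symmetric] by (intro card_Un_disjoint) auto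
  finally show ?thesis using inj_gedge by (simp add: card_image)
qed

lemma card_gedges: "card (gedges d) = 3 * d ^ 2"
  unfolding gedges_def using card_gedge_union[OF finite_sq finite_sq finite_sq] by (simp add: card_sq)

lemma card_gverts_union:
  assumes "finite A" "finite B" "finite U" "finite D"
  shows "card (GLeft ` A \<union> GRight ` B \<union> GUp ` U \<union> GDown ` D) = card A + card B + card U + card D"
proof -
  have "card (GLeft ` A \<union> GRight ` B \<union> GUp ` U \<union> GDown ` D) = card (GLeft ` A \<union> GRight ` B \<union> GUp ` U) + card (GDown ` D)"
    using assms by (intro card_Un_disjoint) auto
  also have "card (GLeft ` A \<union> GRight ` B \<union> GUp ` U) = card (GLeft ` A \<union> GRight ` B) + card (GUp ` U)"
    using assms by (intro card_Un_disjoint) auto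
  also have "card (GLeft ` A \<union> GRight ` B) = card (GLeft ` A) + card (GRight ` B)"
    using assms by (intro card_Un_disjoint) auto
  finally show ?thesis by (simp add: card_image inj_on_def)
qed

lemma card_gverts: "finite (gverts d)" "card (gverts d) = 2 * d ^ 2 + 2 * d + 1"
proof -
  show fin: "finite (gverts d)" by (simp add: gverts_def finite_sq)
  have "gverts d = insert GHub (GLeft ` {..<d} \<union> GRight ` {..<d} \<union> GUp ` sq d \<union> GDown ` sq d)"
    by (auto simp: gverts_def)
  moreover have "GHub \<notin> GLeft ` {..<d} \<union> GRight ` {..<d} \<union> GUp ` sq d \<union> GDown ` sq d" by auto
  ultimately have "card (gverts d) = Suc (card (GLeft ` {..<d} \<union> GRight ` {..<d} \<union> GUp ` sq d \<union> GDown ` sq d))"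
    by (simp add: finite_sq)
  also have "\<dots> = 2 * d ^ 2 + 2 * d + 1" by (subst card_gverts_union) (auto simp: finite_sq card_sq)
  finally show "card (gverts d) = 2 * d ^ 2 + 2 * d + 1" .
qed

lemma gedges_subset: "\<Union>(gedges d) \<subseteq> gverts d"
  by (auto simp: gedges_def gverts_def eU_def eD_def eH_def sq_def)

lemma gpairs_subset: "gpairs d \<subseteq> {q. q \<subseteq> gverts d \<and> card q = 2}"
proof -
  have "cell p \<subseteq> gverts d" if "p \<in> sq d" for p using that by (auto simp: cell_def gverts_def sq_def)
  then show ?thesis by (auto simp: gpairs_def nsets_def)
qed

text \<open>Of the ten pairs of a cell, those of the hub with \<open>GLeft i\<close> and
  \<open>GRight j\<close> are shared along rows and columns and are therefore counted only
  \<open>2 * d\<close> times altogether; the other eight are counted once per cell.\<close>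

lemma card_gpairs: "card (gpairs d) \<le> 8 * d ^ 2 + 2 * d"
proof -
  define C where "C = (\<lambda>p. set [{GLeft (fst p), GRight (snd p)}, {GLeft (fst p), GUp p}, {GRight (snd p), GUp p},
    {GLeft (fst p), GDown p}, {GRight (snd p), GDown p}, {GUp p, GDown p}, {GUp p, GHub}, {GDown p, GHub}])"
  have "gpairs d \<subseteq> (\<Union>p\<in>sq d. C p) \<union> (\<lambda>i. {GHub, GLeft i}) ` {..<d} \<union> (\<lambda>i. {GHub, GRight i}) ` {..<d}"
  proof
    fix q assume "q \<in> gpairs d"
    then obtain p where p: "p \<in> sq d" and q: "q \<subseteq> cell p" "card q = 2" by (auto simp: gpairs_def nsets_def)
    have p': "fst p < d" "snd p < d" using p by (auto simp: sq_def)
    obtain x y where xy: "q = {x, y}" "x \<noteq> y" using q(2) by (meson card_2_iff)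
    have "q \<in> C p \<or> q = {GHub, GLeft (fst p)} \<or> q = {GHub, GRight (snd p)}"
      using q(1) xy(2) unfolding xy(1) cell_def C_def
      by (simp add: doubleton_eq_iff) (elim conjE disjE; simp)
    then show "q \<in> (\<Union>p\<in>sq d. C p) \<union> (\<lambda>i. {GHub, GLeft i}) ` {..<d} \<union> (\<lambda>i. {GHub, GRight i}) ` {..<d}"
      using p p' by blast
  qed
  then have "card (gpairs d) \<le> card ((\<Union>p\<in>sq d. C p) \<union> (\<lambda>i. {GHub, GLeft i}) ` {..<d} \<union> (\<lambda>i. {GHub, GRight i}) ` {..<d})"
    by (intro card_mono) (auto simp: C_def finite_sq)
  also have "\<dots> \<le> card (\<Union>p\<in>sq d. C p) + card ((\<lambda>i. {GHub, GLeft i}) ` {..<d}) + card ((\<lambda>i. {GHub, GRight i}) ` {..<d})"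
    by (meson add_right_mono card_Un_le le_trans)
  also have "card (\<Union>p\<in>sq d. C p) \<le> (\<Sum>p\<in>sq d. card (C p))" by (rule card_UN_le[OF finite_sq])
  also have "\<dots> \<le> (\<Sum>p\<in>sq d. 8)"
  proof (rule sum_mono)
    fix p
    show "card (C p) \<le> 8" unfolding C_def by (rule le_trans[OF card_length]) simp
  qed
  also have "card ((\<lambda>i. {GHub, GLeft i}) ` {..<d}) \<le> d" using card_image_le[of "{..<d}"] by simp
  also have "card ((\<lambda>i. {GHub, GRight i}) ` {..<d}) \<le> d" using card_image_le[of "{..<d}"] by simp
  finally show ?thesis by (simp add: card_sq)
qed

text \<open>Let \<open>W\<close> be the index pairs used by triples \<open>eU\<close> or
  \<open>eD\<close>, lying in \<open>a\<close> rows and \<open>b\<close> columns. The identity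
  \<open>euler\<close> reduces all claims to lower bounds for \<open>a + b\<close>, which follow
  from \<open>w \<le> a * b\<close>. With at most four triples, equality forces all of them into a
  single cell.\<close>

lemma gadget_gedges: "gadget (gedges d) (gpairs d)"
proof -
  have key: "(1 \<le> card E \<longrightarrow> card E \<le> 8 \<longrightarrow> card E + 2 \<le> card (\<Union>E)) \<and> (card E = 8 \<longrightarrow> 11 \<le> card (\<Union>E))
    \<and> (1 \<le> card E \<longrightarrow> card E \<le> 4 \<longrightarrow> card (\<Union>E) = card E + 2 \<longrightarrow> (\<exists>p\<in>sq d. \<Union>E \<subseteq> cell p))"
    if E: "E \<subseteq> gedges d" for E
  proof -
    define P Q R where "P = {p \<in> sq d. eU p \<in> E}" and "Q = {p \<in> sq d. eD p \<in> E}" and "R = {p \<in> sq d. eH p \<in> E}"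
    have fin: "finite P" "finite Q" "finite R" by (simp_all add: P_def Q_def R_def finite_sq)
    have EPQR: "E = eU ` P \<union> eD ` Q \<union> eH ` R"
      using E by (auto simp: P_def Q_def R_def gedges_def)
    have cE: "card E = card P + card Q + card R" unfolding EPQR by (rule card_gedge_union[OF fin])
    define W where "W = P \<union> Q"
    have finW: "finite W" using fin by (simp add: W_def)
    define a b r t \<delta> where "a = card (fst ` W)" and "b = card (snd ` W)" and "r = card (R - W)"
      and "t = card (P \<inter> Q \<inter> R)" and "\<delta> = (if R = {} then 0 else 1 :: nat)"
    have UE: "\<Union>E = GLeft ` fst ` W \<union> GRight ` snd ` W \<union> GUp ` (P \<union> R) \<union> GDown ` (Q \<union> R) \<union> (if R = {} then {} else {GHub})"
      unfolding EPQR W_def by (auto simp: eU_def eD_def eH_def)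
    have cU: "card (\<Union>E) = a + b + card (P \<union> R) + card (Q \<union> R) + \<delta>"
    proof -
      have "card (\<Union>E) = card (GLeft ` fst ` W \<union> GRight ` snd ` W \<union> GUp ` (P \<union> R) \<union> GDown ` (Q \<union> R)) + card (if R = {} then {} else {GHub})"
        unfolding UE using fin finW by (intro card_Un_disjoint) auto
      then show ?thesis using fin finW by (subst (asm) card_gverts_union) (auto simp: a_def b_def \<delta>_def)
    qed
    \<comment> \<open>\<open>r\<close> and \<open>t\<close> count the index pairs whose only edge in \<open>E\<close> is \<open>xyz\<close>, and those with all three edges.\<close>
    have euler: "card (\<Union>E) + t = card E + a + b + r + \<delta>"
    proof -
      have 1: "card (P \<union> R) + card (P \<inter> R) = card P + card R" "card (Q \<union> R) + card (Q \<inter> R) = card Q + card R"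
        using card_Un_Int fin by metis+
      have "P \<inter> R \<union> Q \<inter> R = R \<inter> W" "P \<inter> R \<inter> (Q \<inter> R) = P \<inter> Q \<inter> R" by (auto simp: W_def)
      then have 2: "card (P \<inter> R) + card (Q \<inter> R) = card (R \<inter> W) + t"
        using card_Un_Int[of "P \<inter> R" "Q \<inter> R"] fin by (simp add: t_def)
      have 3: "card R = card (R \<inter> W) + r"
        unfolding r_def using card_Un_disjoint[of "R \<inter> W" "R - W"] fin by (simp add: Int_Diff_Un Int_Diff_disjoint)
      show ?thesis using cU cE 1 2 3 by linarith
    qed
    define w where "w = card W"
    have wab: "w \<le> a * b"
    proof -
      have "W \<subseteq> fst ` W \<times> snd ` W" by force
      then have "card W \<le> card (fst ` W \<times> snd ` W)" using finW by (intro card_mono) auto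
      then show ?thesis by (simp add: card_cartesian_product a_def b_def w_def)
    qed
    have s: "1 \<le> w \<Longrightarrow> 2 \<le> a + b" "2 \<le> w \<Longrightarrow> 3 \<le> a + b" "3 \<le> w \<Longrightarrow> 4 \<le> a + b"
    proof -
      have small: "a * b = 0 \<or> a + b = 2 \<and> a * b = 1 \<or> a + b = 3 \<and> a * b = 2 \<or> 4 \<le> a + b"
      proof (cases "a = 0 \<or> b = 0 \<or> 4 \<le> a + b")
        case False
        then have "a \<in> {1, 2}" "b \<in> {1, 2}" "a + b \<le> 3" by auto
        then show ?thesis by auto
      qed auto
      show "1 \<le> w \<Longrightarrow> 2 \<le> a + b" "2 \<le> w \<Longrightarrow> 3 \<le> a + b" "3 \<le> w \<Longrightarrow> 4 \<le> a + b"
        using small wab by linarith+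
    qed
    have pw: "card P \<le> w" "card Q \<le> w" unfolding w_def W_def using fin by (auto intro: card_mono)
    have Rw: "card R \<le> r + w"
    proof -
      have "card R \<le> card ((R - W) \<union> W)" using fin finW by (intro card_mono) auto
      also have "\<dots> \<le> r + w" unfolding r_def w_def by (rule card_Un_le)
      finally show ?thesis .
    qed
    have t: "t \<le> card P" "t \<le> card Q" "t \<le> card R" unfolding t_def using fin by (auto intro: card_mono)
    have \<delta>: "\<delta> = 1 \<or> \<delta> = 0 \<and> card R = 0" using fin by (simp add: \<delta>_def)
    \<comment> \<open>For \<open>3 \<le> w\<close> the bound \<open>3 * t \<le> card E\<close>
      limits \<open>t\<close>. For smaller \<open>w\<close> one has \<open>t \<le> w\<close>, and
      triples beyond three per index pair of \<open>W\<close> are of type \<open>eH\<close> outside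
      \<open>W\<close> and raise \<open>r\<close>. A positive \<open>t\<close> forces
      \<open>\<delta> = 1\<close>.\<close>
    have w_cases: "w = 0 \<or> w = 1 \<or> w = 2 \<or> 3 \<le> w" by linarith
    show ?thesis
    proof (intro conjI impI)
      assume e: "1 \<le> card E" "card E \<le> 8"
      have "t + 2 \<le> a + b + r + \<delta>"
        using w_cases \<delta> cE pw Rw t s e by linarith
      then show "card E + 2 \<le> card (\<Union>E)" using euler by linarith
    next
      assume e: "card E = 8"
      have "t + 3 \<le> a + b + r + \<delta>"
        using w_cases \<delta> cE pw Rw t s e by linarith
      then show "11 \<le> card (\<Union>E)" using euler e by linarith
    next
      assume e: "1 \<le> card E" "card E \<le> 4" "card (\<Union>E) = card E + 2"
      have sum: "a + b + r + \<delta> = t + 2" using euler e(3) by linarith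
      have "w = 0 \<and> card R = 1 \<or> w = 1 \<and> (card R = 0 \<or> r = 0)"
      proof (cases "w = 0")
        case True
        then have "a = 0" "b = 0" "card P = 0" "card Q = 0" using finW pw by (auto simp: w_def a_def b_def)
        moreover have "r = card R" using True finW by (simp add: r_def w_def)
        ultimately show ?thesis using True sum t \<delta> e(1) cE by linarith
      next
        case False
        then show ?thesis using w_cases \<delta> cE pw Rw t s e sum by linarith
      qed
      then show "\<exists>p\<in>sq d. \<Union>E \<subseteq> cell p"
      proof
        assume wR: "w = 0 \<and> card R = 1"
        then obtain p where p: "R = {p}" by (auto simp: card_1_singleton_iff)
        have "W = {}" using wR finW by (simp add: w_def)
        then have "\<Union>E \<subseteq> cell p" unfolding UE p using p by (auto simp: W_def cell_def)
        moreover have "p \<in> sq d" using p by (auto simp: R_def)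
        ultimately show ?thesis by blast
      next
        assume wR: "w = 1 \<and> (card R = 0 \<or> r = 0)"
        then obtain p where p: "W = {p}" unfolding w_def by (auto simp: card_1_singleton_iff)
        have "R \<subseteq> {p}" using wR fin p by (auto simp: r_def)
        moreover have "P \<subseteq> {p}" "Q \<subseteq> {p}" using p by (auto simp: W_def)
        ultimately have "\<Union>E \<subseteq> cell p" unfolding UE p by (auto simp: cell_def split: if_splits)
        moreover have "p \<in> sq d" using p by (auto simp: W_def P_def Q_def)
        ultimately show ?thesis by blast
      qed
    qed
  qed
  show ?thesis
    unfolding gadget_def
  proof (intro conjI ballI allI impI)
    show "finite (gedges d)" by (simp add: gedges_def finite_sq)
  next
    fix g assume "g \<in> gedges d"
    then show "card g = 3" by (auto simp: gedges_def eU_def eD_def eH_def)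
  next
    fix E assume "E \<subseteq> gedges d" "1 \<le> card E" "card E \<le> 8"
    then show "card E + 2 \<le> card (\<Union>E)" using key by blast
  next
    fix E assume "E \<subseteq> gedges d" "card E = 8"
    then show "11 \<le> card (\<Union>E)" using key by blast
  next
    fix E assume "E \<subseteq> gedges d" "1 \<le> card E" "card E \<le> 4" "card (\<Union>E) = card E + 2"
    then obtain p where p: "p \<in> sq d" "\<Union>E \<subseteq> cell p" using key by blast
    then show "nsets (\<Union>E) 2 \<subseteq> gpairs d" unfolding gpairs_def using nsets_mono[OF p(2)] by blast
  qed
qed

lemma bes_lower:
  assumes eps: "0 < \<epsilon>" "\<epsilon> < 1 / 9" and d: "0 < d"
  shows "\<exists>n0. \<forall>n\<ge>n0. (1 - 9 * \<epsilon>) * real n ^ 2 / (2 * (8 * real d ^ 2 + 2 * real d)) * (3 * real d ^ 2) \<le> bes 3 n 10 8"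
proof -
  define M where "M = 2 * d ^ 2 + 2 * d - 1"
  have M: "0 < M" "M + 2 = 2 * d ^ 2 + 2 * d + 1" using d by (auto simp: M_def)
  obtain h where h: "bij_betw h (gverts d) {..<M + 2}"
    using ex_bij_betw_finite_nat[OF card_gverts(1)[of d]] card_gverts(2)[of d] M(2) by (auto simp: lessThan_atLeast0)
  have inj: "inj_on h (gverts d)" and im: "h ` gverts d = {..<M + 2}" using h by (auto simp: bij_betw_def)
  define F0 where "F0 = (`) h ` gedges d"
  define J0 where "J0 = (`) h ` gpairs d"
  have F0: "gadget F0 J0" "card F0 = 3 * d ^ 2"
    using gadget_image[OF gadget_gedges inj_on_subset[OF inj gedges_subset]] card_gedges[of d]
    by (simp_all add: F0_def J0_def)
  have FU: "\<Union>F0 \<subseteq> {..<M + 2}" using gedges_subset[of d] im unfolding F0_def by blast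
  have J0sub: "J0 \<subseteq> {q. q \<subseteq> {..<M + 2} \<and> card q = 2}"
  proof
    fix q assume "q \<in> J0"
    then obtain p where p: "p \<subseteq> gverts d" "card p = 2" "q = h ` p" using gpairs_subset[of d] by (auto simp: J0_def)
    have "card q = card p" unfolding p(3) by (intro card_image inj_on_subset[OF inj p(1)])
    then show "q \<in> {q. q \<subseteq> {..<M + 2} \<and> card q = 2}" using p im by auto
  qed
  have F0ne: "F0 \<noteq> {}" using F0(2) d by auto
  then obtain g where "g \<in> F0" by blast
  then have J0ne: "J0 \<noteq> {}" using gadget_edge_pair[OF F0(1)] by blast
  interpret pattern M J0 by unfold_locales (use M(1) J0sub J0ne in auto)
  have finG: "finite (gpairs d)" by (rule finite_subset[OF gpairs_subset]) (simp add: card_gverts(1))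
  then have "card J0 \<le> 8 * d ^ 2 + 2 * d"
    using card_image_le[OF finG, of "(`) h"] card_gpairs[of d] by (simp add: J0_def)
  then have cJ: "real (card J0) \<le> 8 * real d ^ 2 + 2 * real d" by (metis (mono_tags) of_nat_add of_nat_le_iff of_nat_mult of_nat_numeral of_nat_power)
  have cJ0: "0 < real (card J0)" using J0ne finG by (simp add: J0_def card_gt_0_iff)
  obtain n0 where n0: "\<forall>n\<ge>n0. (1 - 9 * \<epsilon>) * real n ^ 2 / (2 * card J0) * card F0 \<le> bes 3 n 10 8"
    using bes_ge[OF F0(1) FU eps] by (rule exE)
  show ?thesis
  proof (rule exI[of _ n0], intro allI impI)
    fix n assume n: "n0 \<le> n"
    have "(1 - 9 * \<epsilon>) * real n ^ 2 / (2 * (8 * real d ^ 2 + 2 * real d)) * (3 * real d ^ 2)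
      \<le> (1 - 9 * \<epsilon>) * real n ^ 2 / (2 * card J0) * (3 * real d ^ 2)"
      using cJ cJ0 eps by (intro mult_right_mono divide_left_mono) auto
    also have "\<dots> = (1 - 9 * \<epsilon>) * real n ^ 2 / (2 * card J0) * card F0" by (simp add: F0(2))
    also have "\<dots> \<le> bes 3 n 10 8" using n0 n by blast
    finally show "(1 - 9 * \<epsilon>) * real n ^ 2 / (2 * (8 * real d ^ 2 + 2 * real d)) * (3 * real d ^ 2) \<le> bes 3 n 10 8" .
  qed
qed

theorem theorem1p2:
  assumes "convergent (\<lambda>n. real (bes 3 n 10 8) / real n ^ 2)"
  shows "lim (\<lambda>n. real (bes 3 n 10 8) / real n ^ 2) \<ge> 3 / 16"
proof -
  let ?f = "\<lambda>n. real (bes 3 n 10 8) / real n ^ 2"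
  have lim: "?f \<longlonglongrightarrow> lim ?f" using assms by (simp add: convergent_LIMSEQ_iff)
  \<comment> \<open>One parameter drives both limits: \<epsilon> is chosen with
    \<open>1 - 9 * \<epsilon> = k / (k + 1)\<close>, and the gadget with \<open>d = k\<close> loses
    at most another factor \<open>k / (k + 1)\<close>, because
    \<open>8 + 2 / k \<le> 8 * (k + 1) / k\<close>.\<close>
  have bound: "3 / 16 * (real k / real (Suc k)) ^ 2 \<le> lim ?f" if k: "1 \<le> k" for k
  proof -
    define \<epsilon> where "\<epsilon> = 1 / (9 * real (Suc k))"
    have eps: "0 < \<epsilon>" "\<epsilon> < 1 / 9" and eps': "1 - 9 * \<epsilon> = real k / real (Suc k)"
      using k by (auto simp: \<epsilon>_def field_simps)
    define c where "c = (1 - 9 * \<epsilon>) / (2 * (8 * real k ^ 2 + 2 * real k)) * (3 * real k ^ 2)"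
    have kr: "1 \<le> real k" using k by simp
    obtain n0 where n0: "\<forall>n\<ge>n0. (1 - 9 * \<epsilon>) * real n ^ 2 / (2 * (8 * real k ^ 2 + 2 * real k)) * (3 * real k ^ 2) \<le> bes 3 n 10 8"
      using bes_lower[OF eps, of k] k by auto
    have "c \<le> ?f n" if n: "max n0 1 \<le> n" for n
    proof -
      have "c * real n ^ 2 \<le> bes 3 n 10 8" using n0[THEN spec, THEN mp, of n] n by (simp add: c_def mult_ac)
      then show ?thesis using n by (simp add: pos_le_divide_eq)
    qed
    then have "c \<le> lim ?f" by (intro LIMSEQ_le_const[OF lim]) blast
    moreover have "3 / 16 * (real k / real (Suc k)) ^ 2 \<le> c"
    proof -
      have "3 / 16 * (real k / real (Suc k)) \<le> 3 * real k ^ 2 / (2 * (8 * real k ^ 2 + 2 * real k))"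
      proof -
        have "3 / 16 * (real k / real (Suc k)) = (3 * real k) / (16 * real k + 16)" by (simp add: field_simps)
        also have "\<dots> \<le> (3 * real k) / (16 * real k + 4)" using kr by (intro divide_left_mono) auto
        also have "\<dots> = (real k * (3 * real k)) / (real k * (16 * real k + 4))" using kr by simp
        also have "\<dots> = 3 * real k ^ 2 / (2 * (8 * real k ^ 2 + 2 * real k))"
          by (simp only: power2_eq_square) (simp add: algebra_simps)
        finally show ?thesis .
      qed
      then have "(real k / real (Suc k)) * (3 / 16 * (real k / real (Suc k))) \<le> (real k / real (Suc k)) * (3 * real k ^ 2 / (2 * (8 * real k ^ 2 + 2 * real k)))"
        by (intro mult_left_mono) auto
      moreover have "3 / 16 * x ^ 2 = x * (3 / 16 * x)" "x / u * v = x * (v / u)" for x u v :: real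
        by (simp_all add: power2_eq_square)
      ultimately show ?thesis unfolding c_def eps' by (simp only:)
    qed
    ultimately show ?thesis by linarith
  qed
  have "(\<lambda>k. 3 / 16 * (real k / real (Suc k)) ^ 2) \<longlonglongrightarrow> 3 / 16 * 1 ^ 2"
    by (intro tendsto_mult_left tendsto_power LIMSEQ_n_over_Suc_n)
  then have "(\<lambda>k. 3 / 16 * (real k / real (Suc k)) ^ 2) \<longlonglongrightarrow> 3 / 16" by simp
  then show ?thesis using bound by (rule LIMSEQ_le_const2[OF _ exI[of _ 1], rule_format])
qed

end
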